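(* There are algebra isomorphisms $$X(\mathfrak{so}_4,\mathfrak{so}_4)^{tw}\cong\mathcal{SB}(2,0)\otimes\mathcal B(2,0)\qquad\text{and}\qquad X(\mathfrak{so}_4,\mathfrak{so}_4)^{tw}\cong\mathcal B(2,0)\otimes\mathcal{SB}(2,0),$$ and $$Y(\mathfrak{so}_4,\mathfrak{so}_4)^{tw}\cong\mathcal{SB}(2,0)\otimes\mathcal{SB}(2,0).$$
   Context: All algebras are unital associative over $\mathbb C$; $P=\sum E_{ij}\otimes E_{ji}$; subscripts $1,2$ on matrices denote tensor factors. $2\times2$ matrices are indexed by $\{-1,1\}$, $R^\circ(u)=I-\frac Pu$. $Y(2)$ is generated by the coefficients of $T^\circ(u)=I+O(u^{-1})$ with relation $R^\circ(u-v)T^\circ_1(u)T^\circ_2(v)=T^\circ_2(v)T^\circ_1(u)R^\circ(u-v)$. The series $\mathrm{qdet}\,T^\circ(u)=t^\circ_{-1,-1}(u-1)t^\circ_{11}(u)-t^\circ_{-1,1}(u-1)t^\circ_{1,-1}(u)$ has central coefficients; $SY(2)=Y(2)/(\mathrm{qdet}\,T^\circ(u)-1)$ with $\mathcal T^\circ(u)$ the image of $T^\circ(u)$. $\mathcal B(2,0)\subset Y(2)$ is the subalgebra generated by the coefficients of $T^\circ(u)T^\circ(-u)^{-1}$ and $\mathcal{SB}(2,0)\subset SY(2)$ the subalgebra generated by the coefficients of $\mathcal T^\circ(u)\mathcal T^\circ(-u)^{-1}$. $\mathfrak{so}_4$: $4\times4$ matrices are indexed by $\{-2,-1,1,2\}$,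 $(E_{ij})^t=E_{-j,-i}$, $Q=\sum E_{ij}\otimes E_{-i,-j}$, $R(u)=I-\frac Pu+\frac Q{u-1}$. $X(\mathfrak{so}_4)$ is generated by the coefficients of the $4\times4$ matrix $T(u)=I+O(u^{-1})$ with relation $R(u-v)T_1(u)T_2(v)=T_2(v)T_1(u)R(u-v)$; one has $T(u)T(u+1)^t=z(u)I$ with $z(u)$ having central coefficients, and $Y(\mathfrak{so}_4)=X(\mathfrak{so}_4)/(z(u)-1)$ with $\mathcal T(u)$ the image of $T(u)$. $X(\mathfrak{so}_4,\mathfrak{so}_4)^{tw}\subset X(\mathfrak{so}_4)$ is the subalgebra generated by the coefficients of $T(u-\frac12)\,T(-u+\frac12)^t$, and $Y(\mathfrak{so}_4,\mathfrak{so}_4)^{tw}\subset Y(\mathfrak{so}_4)$ the subalgebra generated by the coefficients of $\mathcal T(u-\frac12)\,\mathcal T(-u+\frac12)^t$. *)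

theory Defs
  imports
    "HOL-Algebra.Subrings"
    "HOL-Algebra.QuotRing"
    "HOL-Algebra.Module"
    "HOL-Library.Poly_Mapping"
    "HOL-Computational_Algebra.Polynomial"
begin

section \<open>Unital associative algebras over the complex numbers\<close>

text \<open>
  An algebra is given by a record of type \<open>(complex, 'a) module\<close>: the ring operations on an
  explicit carrier, together with the scalar multiplication \<open>\<odot>\<close>.  (The locale \<open>algebra\<close> of
  \<open>HOL-Algebra.Module\<close> is of no use here since it covers commutative algebras only.)
\<close>

definition alg_iso ::
    "(complex, 'a) module \<Rightarrow> (complex, 'b) module \<Rightarrow> ('a \<Rightarrow> 'b) set"
  where "alg_iso A B =
    {h \<in> ring_iso A B. \<forall>c. \<forall>x \<in> carrier A. h (c \<odot>\<^bsub>A\<^esub> x) = c \<odot>\<^bsub>B\<^esub> h x}"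

definition is_alg_iso ::
    "(complex, 'a) module \<Rightarrow> (complex, 'b) module \<Rightarrow> bool" (infixr \<open>\<cong>\<^sub>a\<^sub>l\<^sub>g\<close> 60)
  where "A \<cong>\<^sub>a\<^sub>l\<^sub>g B \<longleftrightarrow> alg_iso A B \<noteq> {}"

definition generated_subalg ::
    "(complex, 'a) module \<Rightarrow> 'a set \<Rightarrow> (complex, 'a) module"
  where "generated_subalg A G =
    A\<lparr>carrier := \<Inter>{S. subring S A \<and> (\<forall>c. \<forall>x \<in> S. c \<odot>\<^bsub>A\<^esub> x \<in> S) \<and> G \<subseteq> S}\<rparr>"

text \<open>
  Quotient by a two-sided ideal.  The library ring \<open>A Quot J\<close> consists of the cosets \<open>J +> x\<close>;
  we add the induced scalar multiplication.
\<close>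

definition quot_alg ::
    "(complex, 'a) module \<Rightarrow> 'a set \<Rightarrow> (complex, 'a set) module"
  where "quot_alg A J =
    ring.extend (A Quot J)
      (module.fields (\<lambda>c X. \<Union>x \<in> X. J +>\<^bsub>A\<^esub> (c \<odot>\<^bsub>A\<^esub> x)))"

text \<open>
  The monoid algebra of \<open>M\<close>: finite formal complex linear combinations of elements of \<open>M\<close>,
  multiplied by bilinear extension of the multiplication of \<open>M\<close>.
\<close>

definition monoid_alg :: "('m, 'r) monoid_scheme \<Rightarrow> (complex, 'm \<Rightarrow>\<^sub>0 complex) module"
  where "monoid_alg M =
    \<lparr>carrier = {p. Poly_Mapping.keys p \<subseteq> carrier M},
     monoid.mult = (\<lambda>p q. \<Sum>x \<in> Poly_Mapping.keys p. \<Sum>y \<in> Poly_Mapping.keys q.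
       Poly_Mapping.single (x \<otimes>\<^bsub>M\<^esub> y) (Poly_Mapping.lookup p x * Poly_Mapping.lookup q y)),
     monoid.one = Poly_Mapping.single \<one>\<^bsub>M\<^esub> 1,
     zero = 0,
     add = (+),
     module.smult = (\<lambda>c. Poly_Mapping.map ((*) c))\<rparr>"

definition free_monoid :: "'g set \<Rightarrow> 'g list monoid"
  where "free_monoid X = \<lparr>carrier = lists X, monoid.mult = (@), monoid.one = []\<rparr>"

definition free_alg :: "'g set \<Rightarrow> (complex, 'g list \<Rightarrow>\<^sub>0 complex) module"
  where "free_alg X = monoid_alg (free_monoid X)"

text \<open>
  The tensor product over the complex numbers, in its standard construction: the vector space
  with basis \<open>carrier A \<times> carrier B\<close> modulo the bilinearity relations, with the product
  \<open>(a \<otimes> b)(a' \<otimes> b') = aa' \<otimes> bb'\<close>.  Before taking the quotient this product is that of the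
  monoid algebra of the multiplicative monoid \<open>A \<times>\<times> B\<close>; since products of bilinearity relations
  with basis elements are again bilinearity relations, the ideal they generate is their linear
  span.
\<close>

definition bilinear_relators ::
    "(complex, 'a) module \<Rightarrow> (complex, 'b) module \<Rightarrow> ('a \<times> 'b \<Rightarrow>\<^sub>0 complex) set"
  where "bilinear_relators A B =
    (let e = (\<lambda>a b. Poly_Mapping.single (a, b) (1::complex));
         scale = (\<lambda>c::complex. Poly_Mapping.map ((*) c)) in
      {e (a \<oplus>\<^bsub>A\<^esub> a') b - e a b - e a' b | a a' b.
         a \<in> carrier A \<and> a' \<in> carrier A \<and> b \<in> carrier B} \<union>
      {e a (b \<oplus>\<^bsub>B\<^esub> b') - e a b - e a b' | a b b'.
         a \<in> carrier A \<and> b \<in> carrier B \<and> b' \<in> carrier B} \<union>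
      {e (c \<odot>\<^bsub>A\<^esub> a) b - scale c (e a b) | c a b. a \<in> carrier A \<and> b \<in> carrier B} \<union>
      {e a (c \<odot>\<^bsub>B\<^esub> b) - scale c (e a b) | c a b. a \<in> carrier A \<and> b \<in> carrier B})"

definition tensor_alg ::
    "(complex, 'a) module \<Rightarrow> (complex, 'b) module \<Rightarrow> (complex, ('a \<times> 'b \<Rightarrow>\<^sub>0 complex) set) module"
    (infixr \<open>\<otimes>\<^sub>a\<^sub>l\<^sub>g\<close> 70)
  where "A \<otimes>\<^sub>a\<^sub>l\<^sub>g B =
    (let F = monoid_alg (A \<times>\<times> B) in quot_alg F (Idl\<^bsub>F\<^esub> (bilinear_relators A B)))"


section \<open>Formal series in the inverse of u and matrices of such series\<close>

text \<open>
  A series \<open>f(u) = \<Sum>r. f\<^sub>r u\<^sup>-\<^sup>r\<close> is the sequence of its coefficients \<open>f r\<close>.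
\<close>

type_synonym 'a ser = "nat \<Rightarrow> 'a"

definition ser_mult :: "(complex, 'a) module \<Rightarrow> 'a ser \<Rightarrow> 'a ser \<Rightarrow> 'a ser"
  where "ser_mult A f g = (\<lambda>n. \<Oplus>\<^bsub>A\<^esub>k \<in> {..n}. f k \<otimes>\<^bsub>A\<^esub> g (n - k))"

definition ser_one :: "(complex, 'a) module \<Rightarrow> 'a ser"
  where "ser_one A = (\<lambda>n. if n = 0 then \<one>\<^bsub>A\<^esub> else \<zero>\<^bsub>A\<^esub>)"

text \<open>
  \<open>f(u + a)\<close>, re-expanded by
  \<open>(u + a)\<^sup>-\<^sup>r = \<Sum>k. (-r gchoose k) a\<^sup>k u\<^sup>-\<^sup>r\<^sup>-\<^sup>k\<close>, and \<open>f(-u)\<close>.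
\<close>

definition ser_shift :: "(complex, 'a) module \<Rightarrow> complex \<Rightarrow> 'a ser \<Rightarrow> 'a ser"
  where "ser_shift A a f =
    (\<lambda>n. \<Oplus>\<^bsub>A\<^esub>r \<in> {..n}. ((- of_nat r gchoose (n - r)) * a ^ (n - r)) \<odot>\<^bsub>A\<^esub> f r)"

definition ser_neg :: "(complex, 'a) module \<Rightarrow> 'a ser \<Rightarrow> 'a ser"
  where "ser_neg A f = (\<lambda>n. ((- 1) ^ n) \<odot>\<^bsub>A\<^esub> f n)"

text \<open>
  A matrix of series whose rows and columns are indexed by the finite set \<open>I\<close> is an extensional
  function on \<open>I \<times> I\<close>, so that equality in \<open>mat_ser A I\<close> is equality of matrices and
  \<open>inv\<^bsub>mat_ser A I\<^esub>\<close> is the inverse of a matrix of series.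
\<close>

type_synonym 'a mser = "int \<times> int \<Rightarrow> 'a ser"

definition mat_ser :: "(complex, 'a) module \<Rightarrow> int set \<Rightarrow> 'a mser monoid"
  where "mat_ser A I =
    \<lparr>carrier = I \<times> I \<rightarrow>\<^sub>E (UNIV \<rightarrow> carrier A),
     monoid.mult = (\<lambda>F G. \<lambda>(i, j) \<in> I \<times> I. \<lambda>n. \<Oplus>\<^bsub>A\<^esub>l \<in> I. ser_mult A (F (i, l)) (G (l, j)) n),
     monoid.one = (\<lambda>(i, j) \<in> I \<times> I. if i = j then ser_one A else (\<lambda>n. \<zero>\<^bsub>A\<^esub>))\<rparr>"

definition mat_shift :: "(complex, 'a) module \<Rightarrow> int set \<Rightarrow> complex \<Rightarrow> 'a mser \<Rightarrow> 'a mser"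
  where "mat_shift A I a F = (\<lambda>p \<in> I \<times> I. ser_shift A a (F p))"

definition mat_neg :: "(complex, 'a) module \<Rightarrow> int set \<Rightarrow> 'a mser \<Rightarrow> 'a mser"
  where "mat_neg A I F = (\<lambda>p \<in> I \<times> I. ser_neg A (F p))"

text \<open>The transposition with \<open>E\<^sub>i\<^sub>j \<mapsto> E\<^sub>-\<^sub>j\<^sub>,\<^sub>-\<^sub>i\<close>.\<close>

definition mat_transp :: "int set \<Rightarrow> 'a mser \<Rightarrow> 'a mser"
  where "mat_transp I F = (\<lambda>(i, j) \<in> I \<times> I. F (- j, - i))"

definition mat_coeffs :: "int set \<Rightarrow> 'a mser \<Rightarrow> 'a set"
  where "mat_coeffs I F = {F (i, j) r | i j r. i \<in> I \<and> j \<in> I}"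

definition mat_image :: "(complex, 'a) module \<Rightarrow> 'a set \<Rightarrow> int set \<Rightarrow> 'a mser \<Rightarrow> 'a set mser"
  where "mat_image A J I F = (\<lambda>p \<in> I \<times> I. \<lambda>r. J +>\<^bsub>A\<^esub> F p r)"


section \<open>Algebras defined by an RTT relation\<close>

text \<open>
  An operator on the tensor square of the space with basis \<open>I\<close> is given by its entries:
  \<open>R (i, k) (j, l)\<close> is the coefficient of \<open>E\<^sub>i\<^sub>j \<otimes> E\<^sub>k\<^sub>l\<close>.
\<close>

type_synonym 'c op2 = "int \<times> int \<Rightarrow> int \<times> int \<Rightarrow> 'c"

definition op_I :: "complex poly op2"
  where "op_I = (\<lambda>(i, k) (j, l). if i = j \<and> k = l then 1 else 0)"

definition op_P :: "complex poly op2"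
  where "op_P = (\<lambda>(i, k) (j, l). if k = j \<and> l = i then 1 else 0)"

definition op_Q :: "complex poly op2"
  where "op_Q = (\<lambda>(i, k) (j, l). if k = - i \<and> l = - j then 1 else 0)"

text \<open>
  The R-matrices with their denominators cleared, as matrices of polynomials in \<open>x\<close>:
  \<open>R2 = x (I - P/x)\<close> and \<open>R4 = x (x - 1) (I - P/x + Q/(x - 1))\<close>.
  In the RTT relation \<open>x = u - v\<close>.  Multiplying the relation by the scalar \<open>x\<close> (respectively,
  \<open>x (x - 1)\<close>) does not change its content: this scalar is invertible in the formal Laurent series in
  \<open>u\<^sup>-\<^sup>1\<close> over the polynomials in \<open>v\<close>.
\<close>

definition R2 :: "complex poly op2"
  where "R2 = (\<lambda>p q. [:0, 1:] * op_I p q - op_P p q)"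

definition R4 :: "complex poly op2"
  where "R4 = (\<lambda>p q. [:0, 1:] * [:-1, 1:] * op_I p q - [:-1, 1:] * op_P p q + [:0, 1:] * op_Q p q)"

text \<open>
  A series in two variables is the family of its coefficients, \<open>H m n\<close> being the one of
  \<open>u\<^sup>-\<^sup>m v\<^sup>-\<^sup>n\<close>; here \<open>m\<close> and \<open>n\<close> are integers, as multiplication by \<open>u - v\<close> creates positive powers.
\<close>

definition mult_diff ::
    "(complex, 'a) module \<Rightarrow> (int \<Rightarrow> int \<Rightarrow> 'a) \<Rightarrow> int \<Rightarrow> int \<Rightarrow> 'a"
  where "mult_diff A H = (\<lambda>m n. H (m + 1) n \<ominus>\<^bsub>A\<^esub> H m (n + 1))"

text \<open>The product \<open>p(u - v) H(u, v)\<close> for a polynomial \<open>p\<close>.\<close>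

definition mult_poly_diff ::
    "(complex, 'a) module \<Rightarrow> complex poly \<Rightarrow> (int \<Rightarrow> int \<Rightarrow> 'a) \<Rightarrow> int \<Rightarrow> int \<Rightarrow> 'a"
  where "mult_poly_diff A p H =
    (\<lambda>m n. \<Oplus>\<^bsub>A\<^esub>d \<in> {..Polynomial.degree p}.
      Polynomial.coeff p d \<odot>\<^bsub>A\<^esub> ((mult_diff A ^^ d) H) m n)"

definition int_coeff :: "(complex, 'a) module \<Rightarrow> 'a ser \<Rightarrow> int \<Rightarrow> 'a"
  where "int_coeff A f m = (if m < 0 then \<zero>\<^bsub>A\<^esub> else f (nat m))"

text \<open>
  All coefficients of all entries of
  \<open>R(u - v) T\<^sub>1(u) T\<^sub>2(v) - T\<^sub>2(v) T\<^sub>1(u) R(u - v)\<close>.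
\<close>

definition rtt_relators ::
    "(complex, 'a) module \<Rightarrow> int set \<Rightarrow> complex poly op2 \<Rightarrow> 'a mser \<Rightarrow> 'a set"
  where "rtt_relators A I R T =
    (let t = (\<lambda>i j. int_coeff A (T (i, j))) in
      {(\<Oplus>\<^bsub>A\<^esub>a \<in> I. \<Oplus>\<^bsub>A\<^esub>b \<in> I.
          mult_poly_diff A (R (i, k) (a, b)) (\<lambda>r s. t a j r \<otimes>\<^bsub>A\<^esub> t b l s) m n) \<ominus>\<^bsub>A\<^esub>
       (\<Oplus>\<^bsub>A\<^esub>a \<in> I. \<Oplus>\<^bsub>A\<^esub>b \<in> I.
          mult_poly_diff A (R (a, b) (j, l)) (\<lambda>r s. t k b s \<otimes>\<^bsub>A\<^esub> t i a r) m n)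
       | i k j l m n. i \<in> I \<and> k \<in> I \<and> j \<in> I \<and> l \<in> I})"

text \<open>\<open>(i, j, r)\<close> stands for the generator \<open>t\<^sub>i\<^sub>j\<^sup>(\<^sup>r\<^sup>)\<close>, the coefficient of \<open>u\<^sup>-\<^sup>r\<close> in \<open>t\<^sub>i\<^sub>j(u)\<close>.\<close>

type_synonym gen = "int \<times> int \<times> nat"
type_synonym free = "gen list \<Rightarrow>\<^sub>0 complex"

definition rtt_free :: "int set \<Rightarrow> (complex, free) module"
  where "rtt_free I = free_alg {(i, j, r). i \<in> I \<and> j \<in> I \<and> r \<ge> 1}"

definition rtt_free_T :: "int set \<Rightarrow> free mser"
  where "rtt_free_T I = (\<lambda>(i, j) \<in> I \<times> I. \<lambda>r.
    if r = 0 then (if i = j then \<one>\<^bsub>rtt_free I\<^esub> else \<zero>\<^bsub>rtt_free I\<^esub>)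
    else Poly_Mapping.single [(i, j, r)] 1)"

definition rtt_ideal :: "int set \<Rightarrow> complex poly op2 \<Rightarrow> free set"
  where "rtt_ideal I R = Idl\<^bsub>rtt_free I\<^esub> (rtt_relators (rtt_free I) I R (rtt_free_T I))"

definition rtt_alg :: "int set \<Rightarrow> complex poly op2 \<Rightarrow> (complex, free set) module"
  where "rtt_alg I R = quot_alg (rtt_free I) (rtt_ideal I R)"

definition rtt_T :: "int set \<Rightarrow> complex poly op2 \<Rightarrow> free set mser"
  where "rtt_T I R = mat_image (rtt_free I) (rtt_ideal I R) I (rtt_free_T I)"


section \<open>The Yangians \<open>Y(2)\<close>, \<open>SY(2)\<close> and the algebras \<open>B(2,0)\<close>, \<open>SB(2,0)\<close>\<close>

definition I2 :: "int set"
  where "I2 = {-1, 1}"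

definition Y2 :: "(complex, free set) module"
  where "Y2 = rtt_alg I2 R2"

definition T2 :: "free set mser"
  where "T2 = rtt_T I2 R2"

definition qdet_T2 :: "free set ser"
  where "qdet_T2 = (\<lambda>n.
    ser_mult Y2 (ser_shift Y2 (- 1) (T2 (-1, -1))) (T2 (1, 1)) n \<ominus>\<^bsub>Y2\<^esub>
    ser_mult Y2 (ser_shift Y2 (- 1) (T2 (-1, 1))) (T2 (1, -1)) n)"

definition SY2_ideal :: "free set set"
  where "SY2_ideal = Idl\<^bsub>Y2\<^esub> {qdet_T2 n \<ominus>\<^bsub>Y2\<^esub> ser_one Y2 n | n. True}"

definition SY2 :: "(complex, free set set) module"
  where "SY2 = quot_alg Y2 SY2_ideal"

definition ST2 :: "free set set mser"
  where "ST2 = mat_image Y2 SY2_ideal I2 T2"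

definition B20 :: "(complex, free set) module"
  where "B20 = generated_subalg Y2
    (mat_coeffs I2 (T2 \<otimes>\<^bsub>mat_ser Y2 I2\<^esub> (inv\<^bsub>mat_ser Y2 I2\<^esub> (mat_neg Y2 I2 T2))))"

definition SB20 :: "(complex, free set set) module"
  where "SB20 = generated_subalg SY2
    (mat_coeffs I2 (ST2 \<otimes>\<^bsub>mat_ser SY2 I2\<^esub> (inv\<^bsub>mat_ser SY2 I2\<^esub> (mat_neg SY2 I2 ST2))))"


section \<open>The Yangians of \<open>so\<^sub>4\<close> and their twisted subalgebras\<close>

definition I4 :: "int set"
  where "I4 = {-2, -1, 1, 2}"

definition X4 :: "(complex, free set) module"
  where "X4 = rtt_alg I4 R4"

definition T4 :: "free set mser"
  where "T4 = rtt_T I4 R4"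

text \<open>The series \<open>z(u)\<close> with \<open>T(u) T(u + 1)\<^sup>t = z(u) I\<close>.\<close>

definition z4 :: "free set ser"
  where "z4 = (THE z. \<forall>i \<in> I4. \<forall>j \<in> I4.
    (T4 \<otimes>\<^bsub>mat_ser X4 I4\<^esub> mat_transp I4 (mat_shift X4 I4 1 T4)) (i, j) =
      (if i = j then z else (\<lambda>n. \<zero>\<^bsub>X4\<^esub>)))"

definition Y4_ideal :: "free set set"
  where "Y4_ideal = Idl\<^bsub>X4\<^esub> {z4 n \<ominus>\<^bsub>X4\<^esub> ser_one X4 n | n. True}"

definition Y4 :: "(complex, free set set) module"
  where "Y4 = quot_alg X4 Y4_ideal"

definition ST4 :: "free set set mser"
  where "ST4 = mat_image X4 Y4_ideal I4 T4"

text \<open>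
  \<open>T(u - 1/2) T(-u + 1/2)\<^sup>t\<close>; the second factor is obtained from \<open>T(u + 1/2)\<close> by \<open>u \<mapsto> -u\<close>.
\<close>

definition twisted_mat :: "(complex, 'a) module \<Rightarrow> 'a mser \<Rightarrow> 'a mser"
  where "twisted_mat A T =
    mat_shift A I4 (- 1 / 2) T \<otimes>\<^bsub>mat_ser A I4\<^esub>
    mat_transp I4 (mat_neg A I4 (mat_shift A I4 (1 / 2) T))"

definition X4_tw :: "(complex, free set) module"
  where "X4_tw = generated_subalg X4 (mat_coeffs I4 (twisted_mat X4 T4))"

definition Y4_tw :: "(complex, free set set) module"
  where "Y4_tw = generated_subalg Y4 (mat_coeffs I4 (twisted_mat Y4 ST4))"

end

(*
  Since I - P/u + Q/(u-1) is the tensor square of the R-matrix of Y(2) under C^4 = C^2 (x) C^2, and every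
  series in u^-1 with constant term 1 has shifted square roots, one gets Y(so_4) = SY(2) (x) SY(2),
  with T(u - 1/2) corresponding to T'(u) (x) T''(u). Hence
  T(u - 1/2) T(-u + 1/2)^t becomes s'(u) (x) s''(u) with s(u) = T(u) T(1 - u)^t = T(u) T(-u)^-1 in SY(2).
  The factors s' and s'' are recovered from the product by the unitarity s(u) s(-u) = 1 and
  the symmetry tr s(u) = tr s(1 - u), which proves the third isomorphism. In X(so_4) there is an additional
  central series W(u - 1/2) in front of s' (x) s'', with W even; it carries the same information as the
  central series d(u)/d(-u), where d(u) d(u - 1) = qdet T(u), that distinguishes B(2,0) from SB(2,0), whence the other two.
*)

theory Submission
  imports Defs "HOL-Computational_Algebra.Formal_Power_Series"
begin

unbundle fps_syntax

section \<open>Complex algebras as a type class\<close>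

text \<open>No basis theorem of Poincare-Birkhoff-Witt type enters, so injectivity needs another
  source. The map out of the tensor product is composed with a homomorphism into an algebra of
  operators on bilinear forms, on which the two factors act by commuting translations and in which
  only the zero tensor acts as zero. That homomorphism exists by the universal property of Y(so_4)
  or X(so_4). Universal properties are quantified over target types; hence the presented algebras
  are also made into types of class \<open>calg\<close>, linked to the records of the statement by
  \<open>rhom\<close>. Surjectivity is phrased as: every subalgebra containing the twisted
  subalgebra contains both images, and conversely. The asymmetry between W, which is even, and v(u)
  = d(u)/d(-u), which satisfies v(u) v(-u) = 1, is bridged by a chain of invertible operations on
  central series: among the solutions of d(u)/d(-u) = v(u) take the one with d - 1 odd, pass to the
  even series 1 + u^-1 (d - 1), and identify the latter with the square root of W. The commutation
  of s' with s'' is checked on three generators of each factor; the only new input is one commutator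
  of two coefficients of level 2.\<close>

class calg = ring_1 +
  fixes cs :: "complex \<Rightarrow> 'a \<Rightarrow> 'a" (infixr \<open>\<star>\<close> 73)
  assumes cs_add_right: "c \<star> (x + y) = c \<star> x + c \<star> y"
    and cs_add_left: "(b + c) \<star> x = b \<star> x + c \<star> x"
    and cs_assoc: "b \<star> c \<star> x = (b * c) \<star> x"
    and cs_one [simp]: "1 \<star> x = x"
    and cs_mult_left: "(c \<star> x) * y = c \<star> (x * y)"
    and cs_mult_right: "x * (c \<star> y) = c \<star> (x * y)"
begin

lemma cs_zero_right [simp]: "c \<star> 0 = 0"
  using cs_add_right[of c 0 0] by simp

lemma cs_zero_left [simp]: "0 \<star> x = 0"
  using cs_add_left[of 0 0 x] by simp

lemma cs_minus_right [simp]: "c \<star> (- x) = - (c \<star> x)"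
proof -
  have "c \<star> x + c \<star> (- x) = 0" by (simp flip: cs_add_right)
  then show ?thesis by (rule minus_unique[symmetric])
qed

lemma cs_minus_left [simp]: "(- c) \<star> x = - (c \<star> x)"
proof -
  have "c \<star> x + (- c) \<star> x = 0" by (simp flip: cs_add_left)
  then show ?thesis by (rule minus_unique[symmetric])
qed

lemma cs_diff_right: "c \<star> (x - y) = c \<star> x - c \<star> y"
  using cs_add_right[of c x "- y"] by simp

lemma cs_diff_left: "(b - c) \<star> x = b \<star> x - c \<star> x"
  using cs_add_left[of b "- c" x] by simp

lemma cs_sum_right: "c \<star> sum f A = (\<Sum>x\<in>A. c \<star> f x)"
  by (induction A rule: infinite_finite_induct) (simp_all add: cs_add_right)

lemma cs_sum_left: "sum f A \<star> x = (\<Sum>a\<in>A. f a \<star> x)"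
  by (induction A rule: infinite_finite_induct) (simp_all add: cs_add_left)

lemma cs_two: "2 \<star> x = x + x"
  using cs_add_left[of 1 1 x] by simp

lemma half_cs_double: "(1/2) \<star> (x + x) = x"
  unfolding cs_two[symmetric] by (simp add: cs_assoc)

lemma double_eq_zero_iff: "x + x = 0 \<longleftrightarrow> x = 0"
proof
  assume "x + x = 0"
  then show "x = 0" by (subst half_cs_double[symmetric]) (simp only: cs_zero_right)
qed simp

end

instantiation complex :: calg
begin
definition cs_complex :: "complex \<Rightarrow> complex \<Rightarrow> complex" where "cs_complex = (*)"
instance by standard (simp_all add: cs_complex_def algebra_simps)
end

instantiation fps :: (calg) calg
begin
definition cs_fps :: "complex \<Rightarrow> 'a fps \<Rightarrow> 'a fps" where "c \<star> f = Abs_fps (\<lambda>n. c \<star> f $ n)"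
instance
  by standard (simp_all add: cs_fps_def fps_eq_iff fps_mult_nth cs_add_right cs_add_left cs_assoc
      cs_sum_right cs_mult_left cs_mult_right)
end

lemma cs_nth [simp]: "(c \<star> f) $ n = c \<star> f $ n"
  by (simp add: cs_fps_def)

section \<open>Homomorphisms and subalgebras\<close>

definition alg_hom :: "('a::calg \<Rightarrow> 'b::calg) \<Rightarrow> bool" where
  "alg_hom h \<longleftrightarrow> (\<forall>x y. h (x + y) = h x + h y) \<and> (\<forall>x y. h (x * y) = h x * h y) \<and> h 1 = 1 \<and>
     (\<forall>c x. h (c \<star> x) = c \<star> h x)"

lemma alg_homD:
  assumes "alg_hom h"
  shows "h (x + y) = h x + h y" "h (x * y) = h x * h y" "h 1 = 1" "h (c \<star> x) = c \<star> h x"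
    "h 0 = 0" "h (- x) = - h x" "h (x - y) = h x - h y" "h (sum f A) = (\<Sum>a\<in>A. h (f a))"
proof -
  note h = assms[unfolded alg_hom_def]
  show "h (x + y) = h x + h y" "h (x * y) = h x * h y" "h 1 = 1" "h (c \<star> x) = c \<star> h x"
    using h by auto
  show 0: "h 0 = 0" using h by (metis add_cancel_right_right)
  show m: "h (- x) = - h x" for x using h 0 by (metis add.right_inverse add_eq_0_iff)
  show "h (x - y) = h x - h y" using h m by (metis diff_conv_add_uminus)
  show "h (sum f A) = (\<Sum>a\<in>A. h (f a))"
    by (induction A rule: infinite_finite_induct) (use h 0 in auto)
qed

lemma alg_hom_comp: "alg_hom g \<Longrightarrow> alg_hom h \<Longrightarrow> alg_hom (\<lambda>x. g (h x))"
  by (simp add: alg_hom_def)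

definition subalg :: "'a::calg set \<Rightarrow> bool" where
  "subalg S \<longleftrightarrow> 1 \<in> S \<and> (\<forall>x\<in>S. \<forall>y\<in>S. x + y \<in> S) \<and> (\<forall>x\<in>S. \<forall>y\<in>S. x * y \<in> S) \<and>
     (\<forall>c. \<forall>x\<in>S. c \<star> x \<in> S)"

lemma subalgD:
  assumes "subalg S"
  shows "1 \<in> S" "0 \<in> S" "x \<in> S \<Longrightarrow> y \<in> S \<Longrightarrow> x + y \<in> S" "x \<in> S \<Longrightarrow> y \<in> S \<Longrightarrow> x * y \<in> S"
    "x \<in> S \<Longrightarrow> c \<star> x \<in> S" "x \<in> S \<Longrightarrow> - x \<in> S" "x \<in> S \<Longrightarrow> y \<in> S \<Longrightarrow> x - y \<in> S"
    "(\<And>a. a \<in> A \<Longrightarrow> f a \<in> S) \<Longrightarrow> sum f A \<in> S"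
proof -
  note s = assms[unfolded subalg_def]
  show "1 \<in> S" "x \<in> S \<Longrightarrow> y \<in> S \<Longrightarrow> x + y \<in> S" "x \<in> S \<Longrightarrow> y \<in> S \<Longrightarrow> x * y \<in> S"
    "x \<in> S \<Longrightarrow> c \<star> x \<in> S"
    using s by auto
  show 0: "0 \<in> S" using s by (metis cs_zero_left)
  show m: "x \<in> S \<Longrightarrow> - x \<in> S" for x using s by (metis cs_minus_left cs_one)
  show "x \<in> S \<Longrightarrow> y \<in> S \<Longrightarrow> x - y \<in> S" using s m by (metis diff_conv_add_uminus)
  show "(\<And>a. a \<in> A \<Longrightarrow> f a \<in> S) \<Longrightarrow> sum f A \<in> S"
    by (induction A rule: infinite_finite_induct) (use s 0 in auto)
qed

lemma subalg_double: "subalg S \<Longrightarrow> x + x \<in> S \<Longrightarrow> x \<in> S"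
  using subalgD(5)[of S "x + x" "1/2"] by (simp add: half_cs_double)

definition gsub :: "'a::calg set \<Rightarrow> 'a set" where
  "gsub G = \<Inter>{S. subalg S \<and> G \<subseteq> S}"

lemma subalg_gsub: "subalg (gsub G)"
  unfolding gsub_def subalg_def by blast

lemma gsub_incl: "G \<subseteq> gsub G"
  unfolding gsub_def by blast

lemma gsub_min: "subalg S \<Longrightarrow> G \<subseteq> S \<Longrightarrow> gsub G \<subseteq> S"
  unfolding gsub_def by blast

lemma subalg_vimage: "alg_hom h \<Longrightarrow> subalg S \<Longrightarrow> subalg (h -` S)"
  unfolding subalg_def by (simp add: alg_homD)

lemma subalg_equalizer: "alg_hom g \<Longrightarrow> alg_hom h \<Longrightarrow> subalg {x. g x = h x}"
  unfolding subalg_def by (simp add: alg_homD)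

lemma subalg_centralizer: "subalg {x. \<forall>y\<in>Y. x * y = y * x}"
  unfolding subalg_def
  by (auto simp: algebra_simps cs_mult_left cs_mult_right) (metis mult.assoc)

section \<open>Series\<close>

text \<open>The series variable is u^-1, so this is f(u + a) expanded by the binomial series; it is
  the counterpart of \<open>ser_shift\<close> for types of class \<open>calg\<close>.\<close>

definition fshift :: "complex \<Rightarrow> 'a::calg fps \<Rightarrow> 'a fps" where
  "fshift a f = Abs_fps (\<lambda>n. \<Sum>r\<le>n. ((- of_nat r gchoose (n - r)) * a ^ (n - r)) \<star> f $ r)"

definition fneg :: "'a::calg fps \<Rightarrow> 'a fps" where
  "fneg f = Abs_fps (\<lambda>n. (- 1) ^ n \<star> f $ n)"

lemma fneg_nth: "fneg f $ n = (- 1) ^ n \<star> f $ n"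
  by (simp add: fneg_def)

lemma fshift_nth:
  "fshift a f $ n = (\<Sum>r\<le>n. ((- of_nat r gchoose (n - r)) * a ^ (n - r)) \<star> f $ r)"
  by (simp add: fshift_def)

lemma fshift_nth_0 [simp]: "fshift a f $ 0 = f $ 0"
  by (simp add: fshift_nth)

lemma fneg_nth_0 [simp]: "fneg f $ 0 = f $ 0"
  by (simp add: fneg_nth)

lemma fneg_hom: "alg_hom fneg"
  unfolding alg_hom_def
proof (intro conjI allI)
  fix x y :: "'a fps" and c
  show "fneg (x + y) = fneg x + fneg y" by (simp add: fps_eq_iff fneg_nth cs_add_right)
  show "fneg (c \<star> x) = c \<star> fneg x" by (simp add: fps_eq_iff fneg_nth cs_assoc mult.commute)
  show "fneg (1::'a fps) = 1" by (simp add: fps_eq_iff fneg_nth)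
  have "(- 1) ^ n \<star> (\<Sum>i=0..n. x $ i * y $ (n - i)) =
      (\<Sum>i=0..n. ((- 1) ^ i \<star> x $ i) * ((- 1) ^ (n - i) \<star> y $ (n - i)))" for n
    unfolding cs_sum_right
    by (intro sum.cong) (auto simp: cs_mult_left cs_mult_right cs_assoc simp flip: power_add)
  then show "fneg (x * y) = fneg x * fneg y" by (simp add: fps_eq_iff fneg_nth fps_mult_nth)
qed

lemma fneg_fneg [simp]: "fneg (fneg f) = f"
  by (simp add: fps_eq_iff fneg_nth cs_assoc flip: power_mult_distrib)

lemma fshift_0 [simp]: "fshift 0 f = f"
proof -
  have "(\<Sum>r\<le>n. ((- of_nat r gchoose (n - r)) * 0 ^ (n - r)) \<star> f $ r) = f $ n" for n
  proof -
    have "(\<Sum>r\<le>n. ((- of_nat r gchoose (n - r)) * 0 ^ (n - r)) \<star> f $ r) =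
      (\<Sum>r\<le>n. if r = n then f $ n else 0)"
      by (intro sum.cong) (auto simp: zero_power)
    then show ?thesis by simp
  qed
  then show ?thesis by (simp add: fps_eq_iff fshift_nth)
qed

lemma sum_triangle_swap:
  fixes g :: "nat \<Rightarrow> nat \<Rightarrow> 'a::comm_monoid_add"
  shows "(\<Sum>s\<le>n. \<Sum>r\<le>s. g s r) = (\<Sum>r\<le>n. \<Sum>s\<in>{r..n}. g s r)"
proof -
  have "(\<Sum>s\<le>n. \<Sum>r\<le>s. g s r) = (\<Sum>(s, r)\<in>Sigma {..n} (\<lambda>s. {..s}). g s r)"
    by (subst sum.Sigma) auto
  also have "\<dots> = (\<Sum>(r, s)\<in>Sigma {..n} (\<lambda>r. {r..n}). g s r)"
    by (rule sum.reindex_bij_witness[where i = "\<lambda>(x, y). (y, x)" and j = "\<lambda>(x, y). (y, x)"]) auto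
  also have "\<dots> = (\<Sum>r\<le>n. \<Sum>s\<in>{r..n}. g s r)"
    by (subst sum.Sigma) auto
  finally show ?thesis .
qed

text \<open>Trinomial revision pulls the factor indexed by n - r out of the sum; what remains is the
  binomial expansion of (a + b)^(n - r).\<close>

lemma fshift_coeff_compose:
  fixes a b :: complex
  assumes "r \<le> n"
  shows "(\<Sum>s\<in>{r..n}. ((- of_nat s gchoose (n - s)) * a ^ (n - s)) *
      ((- of_nat r gchoose (s - r)) * b ^ (s - r))) =
    (- of_nat r gchoose (n - r)) * (a + b) ^ (n - r)"
proof -
  define m where "m = n - r"
  have "(\<Sum>s\<in>{r..n}. ((- of_nat s gchoose (n - s)) * a ^ (n - s)) *
      ((- of_nat r gchoose (s - r)) * b ^ (s - r))) =
    (\<Sum>k\<le>m. ((- of_nat (r + k) gchoose (m - k)) * a ^ (m - k)) *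
      ((- of_nat r gchoose k) * b ^ k))"
    by (rule sum.reindex_bij_witness[where i = "\<lambda>k. r + k" and j = "\<lambda>s. s - r"])
      (use assms in \<open>auto simp: m_def\<close>)
  also have "\<dots> = (\<Sum>k\<le>m. (- of_nat r gchoose m) * (of_nat (m choose k) * b ^ k * a ^ (m - k)))"
  proof (intro sum.cong refl)
    fix k assume "k \<in> {..m}"
    then have k: "k \<le> m" by simp
    have "(- of_nat r gchoose m) * (of_nat m gchoose k) =
        (- of_nat r gchoose k) * ((- of_nat r - of_nat k :: complex) gchoose (m - k))"
      by (rule gbinomial_trinomial_revision[OF k])
    moreover have "- of_nat r - of_nat k = (- of_nat (r + k) :: complex)" by simp
    ultimately have "(- of_nat r gchoose m) * of_nat (m choose k) =
        (- of_nat r gchoose k) * ((- of_nat (r + k) :: complex) gchoose (m - k))"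
      by (simp only: binomial_gbinomial)
    then have "((- of_nat r gchoose m) * of_nat (m choose k)) * (b ^ k * a ^ (m - k)) =
        ((- of_nat r gchoose k) * ((- of_nat (r + k)) gchoose (m - k))) * (b ^ k * a ^ (m - k))"
      by (simp only:)
    then show "((- of_nat (r + k) gchoose (m - k)) * a ^ (m - k)) * ((- of_nat r gchoose k) * b ^ k)
      = (- of_nat r gchoose m) * (of_nat (m choose k) * b ^ k * a ^ (m - k))"
      by (simp only: mult_ac)
  qed
  also have "\<dots> = (- of_nat r gchoose m) * (a + b) ^ m"
    unfolding sum_distrib_left[symmetric] binomial_ring[symmetric] by (simp add: add.commute)
  finally show ?thesis by (simp add: m_def)
qed

lemma fshift_fshift [simp]: "fshift a (fshift b f) = fshift (a + b) f"
proof (rule fps_ext)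
  fix n
  have "fshift a (fshift b f) $ n = (\<Sum>s\<le>n. \<Sum>r\<le>s.
      (((- of_nat s gchoose (n - s)) * a ^ (n - s)) * ((- of_nat r gchoose (s - r)) * b ^ (s - r))) \<star> f $ r)"
    by (simp add: fshift_nth cs_sum_right cs_assoc)
  also have "\<dots> = (\<Sum>r\<le>n. \<Sum>s\<in>{r..n}.
      (((- of_nat s gchoose (n - s)) * a ^ (n - s)) * ((- of_nat r gchoose (s - r)) * b ^ (s - r))) \<star> f $ r)"
    by (rule sum_triangle_swap)
  also have "\<dots> = (\<Sum>r\<le>n. ((- of_nat r gchoose (n - r)) * (a + b) ^ (n - r)) \<star> f $ r)"
    by (intro sum.cong) (simp_all add: fshift_coeff_compose flip: cs_sum_left)
  finally show "fshift a (fshift b f) $ n = fshift (a + b) f $ n"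
    by (simp add: fshift_nth)
qed

text \<open>The terms are regrouped by the pair of coefficients f_r, g_s. Vandermonde convolution
  then expresses that the expansions of (u + a)^-r and (u + a)^-s multiply to that of (u +
  a)^-(r+s).\<close>

lemma fshift_mult: "fshift a (f * g) = fshift a f * fshift a g"
proof (rule fps_ext)
  fix n
  let ?c = "\<lambda>r k. (- of_nat r gchoose k) * a ^ k :: complex"
  have "(fshift a f * fshift a g) $ n =
      (\<Sum>m\<le>n. \<Sum>r\<le>m. \<Sum>s\<le>n - m. (?c r (m - r) * ?c s (n - m - s)) \<star> (f $ r * g $ s))"
    by (simp add: fps_mult_nth fshift_nth sum_product cs_mult_left cs_mult_right cs_assoc
        mult_ac atMost_atLeast0)
  also have "\<dots> = (\<Sum>r\<le>n. \<Sum>m\<in>{r..n}. \<Sum>s\<le>n - m. (?c r (m - r) * ?c s (n - m - s)) \<star> (f $ r * g $ s))"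
    by (rule sum_triangle_swap)
  also have "\<dots> = (\<Sum>r\<le>n. \<Sum>s\<le>n - r. \<Sum>k\<le>n - r - s. (?c r k * ?c s (n - r - s - k)) \<star> (f $ r * g $ s))"
  proof (rule sum.cong[OF refl])
    fix r assume "r \<in> {..n}"
    then have r: "r \<le> n" by simp
    have "(\<Sum>m\<in>{r..n}. \<Sum>s\<le>n - m. (?c r (m - r) * ?c s (n - m - s)) \<star> (f $ r * g $ s)) =
      (\<Sum>(m, s)\<in>Sigma {r..n} (\<lambda>m. {..n - m}). (?c r (m - r) * ?c s (n - m - s)) \<star> (f $ r * g $ s))"
      by (subst sum.Sigma) auto
    also have "\<dots> = (\<Sum>(s, k)\<in>Sigma {..n - r} (\<lambda>s. {..n - r - s}).
        (?c r k * ?c s (n - r - s - k)) \<star> (f $ r * g $ s))"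
      by (rule sum.reindex_bij_witness[where i = "\<lambda>(s, k). (r + k, s)" and j = "\<lambda>(m, s). (s, m - r)"])
        (use r in \<open>auto simp: algebra_simps\<close>)
    also have "\<dots> = (\<Sum>s\<le>n - r. \<Sum>k\<le>n - r - s. (?c r k * ?c s (n - r - s - k)) \<star> (f $ r * g $ s))"
      by (subst sum.Sigma) auto
    finally show "(\<Sum>m\<in>{r..n}. \<Sum>s\<le>n - m. (?c r (m - r) * ?c s (n - m - s)) \<star> (f $ r * g $ s)) =
      (\<Sum>s\<le>n - r. \<Sum>k\<le>n - r - s. (?c r k * ?c s (n - r - s - k)) \<star> (f $ r * g $ s))" .
  qed
  also have "\<dots> = (\<Sum>r\<le>n. \<Sum>s\<le>n - r. ?c (r + s) (n - r - s) \<star> (f $ r * g $ s))"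
  proof (intro sum.cong refl)
    fix r s
    let ?N = "n - r - s"
    have "(\<Sum>k\<le>?N. ?c r k * ?c s (?N - k)) =
        (\<Sum>k\<le>?N. (- of_nat r gchoose k) * (- of_nat s gchoose (?N - k))) * a ^ ?N"
      unfolding sum_distrib_right
    proof (intro sum.cong refl)
      fix k assume "k \<in> {..?N}"
      then have "a ^ ?N = a ^ k * a ^ (?N - k)" by (metis atMost_iff le_add_diff_inverse power_add)
      then show "?c r k * ?c s (?N - k) = (- of_nat r gchoose k) * (- of_nat s gchoose (?N - k)) * a ^ ?N"
        by simp
    qed
    also have "\<dots> = ?c (r + s) ?N"
      unfolding atMost_atLeast0 gbinomial_Vandermonde by simp
    finally show "(\<Sum>k\<le>?N. (?c r k * ?c s (?N - k)) \<star> (f $ r * g $ s)) =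
        ?c (r + s) ?N \<star> (f $ r * g $ s)"
      by (simp flip: cs_sum_left)
  qed
  also have "\<dots> = (\<Sum>r\<le>n. \<Sum>m\<in>{r..n}. ?c m (n - m) \<star> (f $ r * g $ (m - r)))"
  proof (rule sum.cong[OF refl])
    fix r assume "r \<in> {..n}"
    then show "(\<Sum>s\<le>n - r. ?c (r + s) (n - r - s) \<star> (f $ r * g $ s)) =
        (\<Sum>m\<in>{r..n}. ?c m (n - m) \<star> (f $ r * g $ (m - r)))"
      by (intro sum.reindex_bij_witness[where i = "\<lambda>m. m - r" and j = "\<lambda>s. r + s"]) auto
  qed
  also have "\<dots> = (\<Sum>m\<le>n. \<Sum>r\<le>m. ?c m (n - m) \<star> (f $ r * g $ (m - r)))"
    by (rule sum_triangle_swap[symmetric])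
  also have "\<dots> = fshift a (f * g) $ n"
    by (simp add: fshift_nth fps_mult_nth cs_sum_right atMost_atLeast0)
  finally show "fshift a (f * g) $ n = (fshift a f * fshift a g) $ n" by simp
qed

lemma gbinomial_0_left: "(0 :: 'a :: field_char_0) gchoose k = (if k = 0 then 1 else 0)"
  by (cases k) simp_all

lemma fshift_hom: "alg_hom (fshift a)"
  unfolding alg_hom_def
proof (intro conjI allI)
  fix x y :: "'a fps" and c
  show "fshift a (x + y) = fshift a x + fshift a y"
    by (simp add: fps_eq_iff fshift_nth cs_add_right sum.distrib)
  show "fshift a (c \<star> x) = c \<star> fshift a x"
    by (simp add: fps_eq_iff fshift_nth cs_assoc cs_sum_right mult_ac)
  have "(\<Sum>r\<le>n. ((- of_nat r gchoose (n - r)) * a ^ (n - r)) \<star> (1::'a fps) $ r) =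
    (\<Sum>r\<le>n. if r = 0 then (if n = 0 then 1 else 0) else 0)" for n
    by (intro sum.cong) (auto simp: gbinomial_0_left)
  then show "fshift a (1::'a fps) = 1" by (simp add: fps_eq_iff fshift_nth)
qed (rule fshift_mult)

lemma fneg_fshift: "fneg (fshift a f) = fshift (- a) (fneg f)"
proof (rule fps_ext)
  fix n
  have "(- 1) ^ n * (c * a ^ (n - r)) = c * (- a) ^ (n - r) * (- 1) ^ r" if "r \<le> n" for r and c :: complex
  proof -
    have "(- 1 :: complex) ^ n = (- 1) ^ (n - r) * (- 1) ^ r" using that by (simp flip: power_add)
    then show ?thesis by (simp add: power_minus[of a])
  qed
  then show "fneg (fshift a f) $ n = fshift (- a) (fneg f) $ n"
    unfolding fneg_nth fshift_nth cs_sum_right cs_assoc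
    by (intro sum.cong refl arg_cong2[where f = cs]) (simp only: atMost_iff)
qed

subsection \<open>Homomorphisms and subalgebras acting on series\<close>

definition fmap :: "('a::calg \<Rightarrow> 'b::calg) \<Rightarrow> 'a fps \<Rightarrow> 'b fps" where
  "fmap h f = Abs_fps (\<lambda>n. h (f $ n))"

lemma fmap_nth [simp]: "fmap h f $ n = h (f $ n)"
  by (simp add: fmap_def)

lemma fmap_hom:
  assumes "alg_hom h" shows "alg_hom (fmap h)"
  by (simp add: alg_hom_def[of "fmap h"] fps_eq_iff alg_homD[OF assms] fps_mult_nth)

lemma fmap_fshift:
  assumes "alg_hom h" shows "fmap h (fshift a f) = fshift a (fmap h f)"
  by (simp add: fps_eq_iff fshift_nth alg_homD[OF assms])

lemma fmap_fneg:
  assumes "alg_hom h" shows "fmap h (fneg f) = fneg (fmap h f)"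
  by (simp add: fps_eq_iff fneg_nth alg_homD[OF assms])

lemma fmap_fmap: "fmap g (fmap h f) = fmap (\<lambda>x. g (h x)) f"
  by (simp add: fps_eq_iff)

definition serin :: "'a::calg set \<Rightarrow> 'a fps set" where
  "serin S = {f. \<forall>n. f $ n \<in> S}"

lemma serinI: "(\<And>n. f $ n \<in> S) \<Longrightarrow> f \<in> serin S"
  by (simp add: serin_def)

lemma serinD: "f \<in> serin S \<Longrightarrow> f $ n \<in> S"
  by (simp add: serin_def)

lemma subalg_serin: "subalg S \<Longrightarrow> subalg (serin S)"
  by (simp add: subalg_def[of "serin S"])
    (auto simp: serin_def fps_mult_nth subalgD intro!: subalgD(8))

lemma serin_fshift: "subalg S \<Longrightarrow> f \<in> serin S \<Longrightarrow> fshift a f \<in> serin S"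
  by (auto simp: serin_def fshift_nth intro!: subalgD(5,8))

lemma serin_fneg: "subalg S \<Longrightarrow> f \<in> serin S \<Longrightarrow> fneg f \<in> serin S"
  by (auto simp: serin_def fneg_nth intro!: subalgD(5))

lemma serin_const: "x \<in> S \<Longrightarrow> subalg S \<Longrightarrow> fps_const x \<in> serin S"
  by (auto simp: serin_def subalgD)

lemma serin_X: "subalg S \<Longrightarrow> fps_X \<in> serin S"
  by (auto simp: serin_def fps_X_def subalgD)

lemma serin_X_power: "subalg S \<Longrightarrow> fps_X ^ n \<in> serin S"
  by (induction n) (auto intro!: serin_X subalgD(1,4) dest: subalg_serin)

section \<open>Leading coefficients modulo lower ones\<close>

lemma mult_nth_split:
  fixes f g :: "'a::calg fps"
  assumes "n \<ge> 1"
  shows "(f * g) $ n = f $ 0 * g $ n + f $ n * g $ 0 + (\<Sum>i=1..<n. f $ i * g $ (n - i))"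
proof -
  have "{0..n} = insert 0 (insert n {1..<n})" using assms by auto
  then show ?thesis using assms by (simp add: fps_mult_nth)
qed

text \<open>Basis of all inductions on the coefficient index below: once the lower coefficients lie
  in S, a product is, modulo S, linear in the n-th coefficients of its factors. By
  \<open>fshift_nth_mod\<close>, shifts are invisible at this level.\<close>

lemma mult_nth_mod:
  assumes "subalg S" "n \<ge> 1" "\<And>k. k < n \<Longrightarrow> f $ k \<in> S" "\<And>k. k < n \<Longrightarrow> g $ k \<in> S"
  shows "(f * g) $ n - (f $ 0 * g $ n + f $ n * g $ 0) \<in> S"
  unfolding mult_nth_split[OF assms(2)] using assms
  by (auto intro!: subalgD(8)[OF assms(1)] subalgD(4)[OF assms(1)])

lemma fshift_nth_split:
  "fshift a f $ n = f $ n + (\<Sum>r<n. ((- of_nat r gchoose (n - r)) * a ^ (n - r)) \<star> f $ r)"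
  by (simp add: fshift_nth lessThan_Suc_atMost[symmetric] del: lessThan_Suc_atMost)

lemma fshift_nth_mod:
  assumes "subalg S" "\<And>k. k < n \<Longrightarrow> f $ k \<in> S"
  shows "fshift a f $ n - f $ n \<in> S"
  unfolding fshift_nth_split using assms
  by (auto intro!: subalgD(8)[OF assms(1)] subalgD(5)[OF assms(1)])

section \<open>Inverses of series with constant term 1\<close>

definition finv :: "'a::calg fps \<Rightarrow> 'a fps" where
  "finv f = fps_right_inverse f 1"

lemma finv_nth_0 [simp]: "finv f $ 0 = 1"
  by (simp add: finv_def)

lemma finv_right: "f $ 0 = 1 \<Longrightarrow> f * finv f = 1"
  unfolding finv_def by (rule fps_right_inverse) simp

text \<open>The coefficients need not commute, so only a right inverse is given. It has constant
  term 1 itself and thus has a right inverse too; associativity identifies that one with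
  \<open>f\<close>.\<close>

lemma finv_left: 
  assumes "f $ 0 = 1"
  shows "finv f * f = 1"
proof -
  have "f = f * (finv f * finv (finv f))" by (simp add: finv_right)
  also have "\<dots> = finv (finv f)" by (simp only: mult.assoc[symmetric] finv_right[OF assms] mult_1_left)
  finally have "finv f * f = finv f * finv (finv f)" by simp
  then show ?thesis by (simp add: finv_right)
qed

lemma finv_unique:
  assumes "f $ 0 = 1" "f * g = 1"
  shows "g = finv f"
proof -
  have "g = finv f * f * g" by (simp add: assms finv_left)
  then show ?thesis by (simp add: assms mult.assoc)
qed

lemma fmap_finv:
  assumes "alg_hom h" "f $ 0 = 1"
  shows "fmap h (finv f) = finv (fmap h f)"
proof (rule finv_unique)
  show "fmap h f $ 0 = 1" using assms by (simp add: alg_homD[OF assms(1)])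
  show "fmap h f * fmap h (finv f) = 1"
    using assms by (metis alg_homD(2,3) finv_right fmap_hom)
qed

lemma fshift_finv: "f $ 0 = 1 \<Longrightarrow> fshift a (finv f) = finv (fshift a f)"
  by (rule finv_unique) (simp, metis alg_homD(3) finv_right fshift_hom fshift_mult)

lemma fneg_finv: "f $ 0 = 1 \<Longrightarrow> fneg (finv f) = finv (fneg f)"
  by (rule finv_unique) (simp, metis alg_homD(2,3) finv_right fneg_hom)

lemma finv_mult:
  assumes "f $ 0 = 1" "g $ 0 = 1"
  shows "finv (f * g) = finv g * finv f"
proof (rule finv_unique[symmetric])
  have "f * g * (finv g * finv f) = f * (g * finv g) * finv f" by (simp only: mult.assoc)
  then show "f * g * (finv g * finv f) = 1" using assms by (simp add: finv_right)
qed (use assms in simp)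

lemma serin_finv:
  assumes "subalg S" "f \<in> serin S"
  shows "finv f \<in> serin S"
proof (rule serinI)
  fix n show "finv f $ n \<in> S"
  proof (induction n rule: less_induct)
    case (less n)
    then show ?case using assms
      by (cases n) (auto simp: finv_def serin_def intro!: subalgD)
  qed
qed

lemma finv_commute:
  assumes "f $ 0 = 1" "f * g = g * f"
  shows "finv f * g = g * finv f"
proof -
  have "finv f * g = finv f * (g * f) * finv f" by (simp add: mult.assoc assms finv_right)
  also have "\<dots> = (finv f * f) * g * finv f" by (simp add: mult.assoc flip: assms(2))
  finally show ?thesis by (simp add: assms finv_left)
qed

text \<open>\<open>sqs a g\<close> is the solution \<open>f\<close> of \<open>f(u) f(u + a) = g(u)\<close> with constant term 1.\<close>

primrec sqs_approx :: "complex \<Rightarrow> 'a::calg fps \<Rightarrow> nat \<Rightarrow> 'a fps" where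
  "sqs_approx a g 0 = 1"
| "sqs_approx a g (Suc n) = sqs_approx a g n +
     fps_const ((1/2) \<star> (g - sqs_approx a g n * fshift a (sqs_approx a g n)) $ Suc n) * fps_X ^ Suc n"

definition sqs :: "complex \<Rightarrow> 'a::calg fps \<Rightarrow> 'a fps" where
  "sqs a g = Abs_fps (\<lambda>n. sqs_approx a g n $ n)"

lemma sqs_approx_nth_Suc: "k \<noteq> Suc n \<Longrightarrow> sqs_approx a g (Suc n) $ k = sqs_approx a g n $ k"
  by (cases k) auto

lemma sqs_approx_nth: "k \<le> n \<Longrightarrow> sqs_approx a g n $ k = sqs a g $ k"
proof (induction n)
  case (Suc n)
  then show ?case
    by (cases "k = Suc n") (auto simp: sqs_def simp del: sqs_approx.simps simp: sqs_approx_nth_Suc)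
qed (simp add: sqs_def)

lemma sqs_nth_0 [simp]: "sqs a g $ 0 = 1"
  by (simp add: sqs_def)

text \<open>For constant term 1 the n-th coefficient of f(u) f(u + a) is 2 f_n plus terms in lower
  coefficients. This explains the correction by half the defect in \<open>sqs_approx\<close>, and it
  yields uniqueness as well, since 2 is invertible.\<close>

lemma mult_fshift_nth_diff:
  fixes f g :: "'a::calg fps"
  assumes "n \<ge> 1" "f $ 0 = 1" "\<And>k. k < n \<Longrightarrow> f $ k = g $ k"
  shows "(f * fshift a f) $ n - (g * fshift a g) $ n = (f $ n - g $ n) + (f $ n - g $ n)"
proof -
  have "fshift a f $ k = fshift a g $ k" if "k < n" for k
    unfolding fshift_nth using that assms(3) by (intro sum.cong) auto
  moreover have "fshift a f $ n - fshift a g $ n = f $ n - g $ n"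
    unfolding fshift_nth_split using assms(3) by simp
  ultimately have "(f * fshift a f) $ n - (g * fshift a g) $ n =
      f $ 0 * (f $ n - g $ n) + (f $ n - g $ n) * f $ 0"
    unfolding mult_nth_split[OF assms(1)] using assms
    by (simp add: algebra_simps)
  then show ?thesis using assms by simp
qed

lemma fshift_mult_nth_cong:
  fixes f g :: "'a::calg fps"
  assumes "\<And>k. k \<le> n \<Longrightarrow> f $ k = g $ k"
  shows "(f * fshift a f) $ n = (g * fshift a g) $ n"
  unfolding fps_mult_nth fshift_nth using assms by (intro sum.cong arg_cong2[where f = "(*)"]) auto

lemma sqs_eq:
  assumes "g $ 0 = 1"
  shows "sqs a g * fshift a (sqs a g) = g"
proof (rule fps_ext)
  fix n
  have "(sqs a g * fshift a (sqs a g)) $ n = (sqs_approx a g n * fshift a (sqs_approx a g n)) $ n"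
    by (rule fshift_mult_nth_cong) (simp add: sqs_approx_nth)
  also have "\<dots> = g $ n"
  proof (cases n)
    case 0
    then show ?thesis by (simp add: assms)
  next
    case (Suc m)
    let ?h = "sqs_approx a g m" and ?k = "sqs_approx a g (Suc m)"
    let ?c = "(1/2) \<star> (g - ?h * fshift a ?h) $ Suc m"
    have "(?k * fshift a ?k) $ Suc m - (?h * fshift a ?h) $ Suc m =
        (?k $ Suc m - ?h $ Suc m) + (?k $ Suc m - ?h $ Suc m)"
      by (rule mult_fshift_nth_diff) (auto simp del: sqs_approx.simps simp: sqs_approx_nth)
    also have "?k $ Suc m - ?h $ Suc m = ?c" by simp
    also have "?c + ?c = g $ Suc m - (?h * fshift a ?h) $ Suc m"
      by (simp add: cs_add_right[symmetric] half_cs_double del: cs_diff_right)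
    finally show ?thesis using Suc by (simp del: sqs_approx.simps)
  qed
  finally show "(sqs a g * fshift a (sqs a g)) $ n = g $ n" .
qed

lemma sqs_unique:
  assumes "f $ 0 = 1" "g $ 0 = 1" "f * fshift a f = g * fshift a g"
  shows "f = g"
proof (rule fps_ext)
  fix n show "f $ n = g $ n"
  proof (induction n rule: less_induct)
    case (less n)
    show ?case
    proof (cases "n = 0")
      case False
      then have "(f $ n - g $ n) + (f $ n - g $ n) = 0"
        using mult_fshift_nth_diff[of n f g a] less assms by simp
      then show ?thesis by (simp only: double_eq_zero_iff) simp
    qed (simp add: assms)
  qed
qed

lemma sqs_eqI:
  assumes "f $ 0 = 1" "f * fshift a f = g"
  shows "sqs a g = f"
proof (rule sqs_unique[of _ _ a])
  have "g $ 0 = 1" using assms by (auto simp: fps_mult_nth)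
  then show "sqs a g * fshift a (sqs a g) = f * fshift a f" by (simp add: sqs_eq assms)
qed (use assms in auto)

lemma serin_sqs:
  assumes "subalg S" "g \<in> serin S"
  shows "sqs a g \<in> serin S"
proof -
  note s = subalgD[OF subalg_serin[OF assms(1)]]
  have "sqs_approx a g n \<in> serin S" for n
  proof (induction n)
    case (Suc n)
    then have "g - sqs_approx a g n * fshift a (sqs_approx a g n) \<in> serin S"
      using assms by (intro s serin_fshift)
    then have "(1/2) \<star> (g - sqs_approx a g n * fshift a (sqs_approx a g n)) $ Suc n \<in> S"
      by (intro subalgD(5)[OF assms(1)] serinD)
    then show ?case
      unfolding sqs_approx.simps using Suc assms
      by (intro s serin_const serin_X_power)
  qed (simp add: s)
  then show ?thesis by (auto simp: sqs_def serin_def)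
qed

lemma fmap_sqs:
  assumes "alg_hom h" "g $ 0 = 1"
  shows "fmap h (sqs a g) = sqs a (fmap h g)"
  by (rule sqs_eqI[symmetric])
    (simp_all add: assms(2) alg_homD[OF assms(1)] sqs_eq
      flip: fmap_fshift[OF assms(1)] alg_homD(2)[OF fmap_hom[OF assms(1)]])

subsection \<open>Series in two variables\<close>

text \<open>Series in \<open>X = u\<^sup>-\<^sup>1\<close> and \<open>Y = v\<^sup>-\<^sup>1\<close> are series in \<open>Y\<close> with coefficients series in \<open>X\<close>; so
  \<open>u - v\<close> is \<open>DD / XY\<close>.\<close>

definition U :: "'a::calg fps \<Rightarrow> 'a fps fps" where "U = fps_const"
definition V :: "'a::calg fps \<Rightarrow> 'a fps fps" where "V = fmap fps_const"
definition XY :: "'a::calg fps fps" where "XY = fps_const fps_X * fps_X"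
definition DD :: "'a::calg fps fps" where "DD = fps_X - fps_const fps_X"

lemma fps_const_hom: "alg_hom fps_const"
  by (auto simp: alg_hom_def fps_eq_iff)

lemma U_hom: "alg_hom U"
  unfolding U_def by (rule fps_const_hom)

lemma V_hom: "alg_hom V"
  unfolding V_def by (rule fmap_hom[OF fps_const_hom])

lemma U_V_nth: "(U f * V g) $ n $ m = f $ m * g $ n"
  by (simp add: U_def V_def)

lemma V_U_nth: "(V g * U f) $ n $ m = g $ n * f $ m"
  by (simp add: U_def V_def)

lemma fps_const_X_commute: "fps_const fps_X * F = F * (fps_const fps_X :: 'a::calg fps fps)"
  by (simp add: fps_eq_iff fps_mult_fps_X_commute)

lemma DD_commute: "DD * F = F * DD"
  by (simp add: DD_def algebra_simps fps_mult_fps_X_commute fps_const_X_commute)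

lemma XY_commute: "XY * F = F * XY"
  unfolding XY_def by (metis fps_const_X_commute fps_mult_fps_X_commute mult.assoc)

lemma DD_mult_nth: "(DD * F) $ n $ m =
    (if n = 0 then 0 else F $ (n - 1) $ m) - (if m = 0 then 0 else F $ n $ (m - 1))"
  by (simp add: DD_def left_diff_distrib)

lemma XY_mult_nth: "(XY * F) $ n $ m = (if n = 0 \<or> m = 0 then 0 else F $ (n - 1) $ (m - 1))"
  by (simp add: XY_def mult.assoc)

lemma XY_cancel: "XY * F = XY * G \<Longrightarrow> F = G"
proof (intro fps_ext)
  fix n m assume "XY * F = XY * G"
  then have "(XY * F) $ Suc n $ Suc m = (XY * G) $ Suc n $ Suc m" by simp
  then show "F $ n $ m = G $ n $ m" by (simp add: XY_mult_nth)
qed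

text \<open>Multiplication by u - v - c is injective. In the coefficient at (n, m + 1) the product
  contains - F(n, m) and otherwise only row n - 1 of F, so the rows vanish one after the
  other.\<close>

lemma DD_XY_cancel:
  assumes "(DD - c \<star> XY) * F = 0"
  shows "F = (0 :: 'a::calg fps fps)"
proof -
  have "F $ n = 0" for n
  proof (induction n rule: less_induct)
    case (less n)
    have "((DD - c \<star> XY) * F) $ n $ Suc m = 0" for m by (simp add: assms)
    then have "F $ n $ m = 0" for m
      using less by (cases n) (simp_all add: left_diff_distrib DD_mult_nth cs_mult_left XY_mult_nth
        del: fps_mult_nth_0)
    then show ?case by (simp add: fps_eq_iff)
  qed
  then show ?thesis by (simp add: fps_eq_iff)
qed

lemma fshift_const [simp]: "fshift c (fps_const x) = fps_const x"
proof (rule fps_ext)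
  fix n
  have "fshift c (fps_const x) $ n = (\<Sum>r\<le>n. if r = 0 then (if n = 0 then x else 0) else 0)"
    unfolding fshift_nth by (intro sum.cong) (auto simp: gbinomial_0_left)
  then show "fshift c (fps_const x) $ n = fps_const x $ n" by simp
qed

text \<open>This is (u + c)^-1 = u^-1 / (1 + c u^-1) with the denominator cleared; the factors 1 + c
  u^-1 and 1 + c v^-1 in the shift rules below originate here.\<close>

lemma fshift_X: "(1 + c \<star> fps_X) * fshift c fps_X = (fps_X :: 'a::calg fps)"
proof (rule fps_ext)
  fix n
  have *: "fshift c fps_X $ n = (if n = 0 then 0 else (- c) ^ (n - 1) \<star> (1::'a))" for n
  proof -
    have "fshift c fps_X $ n = (\<Sum>r\<le>n. if r = 1 then (- c) ^ (n - 1) \<star> (1::'a) else 0)"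
      unfolding fshift_nth
    proof (intro sum.cong refl)
      fix r assume "r \<in> {..n}"
      have "(- 1 :: complex) gchoose k = (- 1) ^ k" for k
        using gbinomial_minus[of 1 k] by (cases "k = 0") (simp_all add: binomial_gbinomial[symmetric])
      then show "((- of_nat r gchoose (n - r)) * c ^ (n - r)) \<star> fps_X $ r =
          (if r = 1 then (- c) ^ (n - 1) \<star> (1::'a) else 0)"
        by (auto simp: power_minus[of c])
    qed
    then show ?thesis by simp
  qed
  show "((1 + c \<star> fps_X) * fshift c fps_X) $ n = (fps_X :: 'a fps) $ n"
  proof (cases n)
    case (Suc m)
    then show ?thesis
      by (cases m) (simp_all add: distrib_right cs_mult_left * cs_assoc)
  qed (simp add: distrib_right *)
qed

definition shV :: "complex \<Rightarrow> 'a::calg fps fps \<Rightarrow> 'a fps fps" where "shV = fshift"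
definition shU :: "complex \<Rightarrow> 'a::calg fps fps \<Rightarrow> 'a fps fps" where "shU c = fmap (fshift c)"

lemma shV_hom: "alg_hom (shV c)" unfolding shV_def by (rule fshift_hom)
lemma shU_hom: "alg_hom (shU c)" unfolding shU_def by (rule fmap_hom[OF fshift_hom])

lemma shift_U_V [simp]:
  "shV c (U f) = U f" "shV c (V f) = V (fshift c f)"
  "shU c (V f) = V f" "shU c (U f) = U (fshift c f)"
  by (simp_all add: shV_def shU_def U_def V_def fmap_fshift[OF fps_const_hom] fmap_fmap)
    (simp_all add: fps_eq_iff alg_homD[OF fshift_hom])

text \<open>Under v -> v + c the quotient \<open>DD\<close> / \<open>XY\<close> = u - v becomes u -
  v - c; numerator and denominator share the factor 1 + c v^-1, which is cleared.\<close>

lemma shV_DD_XY: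
  "(1 + c \<star> fps_X) * shV c XY = (XY :: 'a::calg fps fps)"
  "(1 + c \<star> fps_X) * shV c DD = (DD - c \<star> XY :: 'a fps fps)"
proof -
  have c: "fps_const fps_X * (1 + c \<star> fps_X) = (1 + c \<star> fps_X) * (fps_const fps_X :: 'a fps fps)"
    by (rule fps_const_X_commute)
  have "(1 + c \<star> fps_X) * shV c XY = fps_const fps_X * ((1 + c \<star> fps_X) * fshift c (fps_X :: 'a fps fps))"
    by (simp only: shV_def XY_def fshift_mult fshift_const c mult.assoc[symmetric])
  then show "(1 + c \<star> fps_X) * shV c XY = (XY :: 'a fps fps)" by (simp only: fshift_X XY_def)
  have "(1 + c \<star> fps_X) * shV c DD = (1 + c \<star> fps_X) * fshift c fps_X - (1 + c \<star> fps_X) * fps_const (fps_X :: 'a fps)"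
    by (simp add: shV_def DD_def alg_homD[OF fshift_hom] algebra_simps)
  then show "(1 + c \<star> fps_X) * shV c DD = (DD - c \<star> XY :: 'a fps fps)"
    unfolding fshift_X by (simp add: DD_def XY_def c[symmetric] distrib_left cs_mult_right)
qed

lemma shU_DD_XY:
  "(1 + c \<star> fps_const fps_X) * shU c XY = (XY :: 'a::calg fps fps)"
  "(1 + c \<star> fps_const fps_X) * shU c DD = (DD + c \<star> XY :: 'a fps fps)"
proof -
  have s: "shU c fps_X = fps_X" "shU c (fps_const fps_X) = fps_const (fshift c (fps_X :: 'a fps))"
    by (auto simp: shU_def fps_eq_iff fps_X_def alg_homD[OF fshift_hom])
  have k: "1 + c \<star> fps_const fps_X = fps_const (1 + c \<star> fps_X :: 'a fps)"
    by (simp add: fps_eq_iff)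
  have m: "(1 + c \<star> fps_const fps_X) * fps_const (fshift c fps_X) = fps_const (fps_X :: 'a fps)"
    unfolding k by (simp only: fps_const_mult fshift_X)
  show "(1 + c \<star> fps_const fps_X) * shU c XY = (XY :: 'a fps fps)"
    by (simp add: XY_def alg_homD[OF shU_hom] s m flip: mult.assoc)
  show "(1 + c \<star> fps_const fps_X) * shU c DD = (DD + c \<star> XY :: 'a fps fps)"
    unfolding DD_def alg_homD[OF shU_hom] s
    by (simp add: right_diff_distrib m) (simp add: algebra_simps XY_def cs_mult_left)
qed

text \<open>The specialization v = u. It annihilates multiples of u - v and keeps the order of the
  coefficients in \<open>U f * V g\<close> and \<open>V g * U f\<close>.\<close>

definition diag :: "'a::calg fps fps \<Rightarrow> 'a fps" where
  "diag F = Abs_fps (\<lambda>n. \<Sum>k\<le>n. F $ k $ (n - k))"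

lemma diag_nth: "diag F $ n = (\<Sum>k\<le>n. F $ k $ (n - k))"
  by (simp add: diag_def)

lemma diag_add: "diag (F + G) = diag F + diag G"
  by (simp add: fps_eq_iff diag_nth sum.distrib)

lemma diag_cs: "diag (c \<star> F) = c \<star> diag F"
  by (simp add: fps_eq_iff diag_nth cs_sum_right)

lemma diag_minus: "diag (- F) = - diag F"
  using diag_cs[of "- 1" F] by simp

lemma diag_diff: "diag (F - G) = diag F - diag G"
  using diag_add[of F "- G"] by (simp add: diag_minus)

lemma diag_0 [simp]: "diag 0 = 0"
  by (simp add: fps_eq_iff diag_nth)

lemma diag_U_V: "diag (U f * V g) = f * g"
proof (rule fps_ext)
  fix n
  have "(\<Sum>k\<le>n. f $ (n - k) * g $ k) = (\<Sum>k\<le>n. f $ k * g $ (n - k))"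
    by (rule sum.reindex_bij_witness[of _ "\<lambda>k. n - k" "\<lambda>k. n - k"]) auto
  then show "diag (U f * V g) $ n = (f * g) $ n"
    unfolding diag_nth U_V_nth by (simp add: fps_mult_nth atMost_atLeast0)
qed

lemma diag_V_U: "diag (V g * U f) = g * f"
  unfolding fps_eq_iff diag_nth V_U_nth by (simp add: fps_mult_nth atMost_atLeast0)

lemma diag_X:
  "diag (fps_X * F) = fps_X * diag F" "diag (fps_const fps_X * F) = fps_X * diag F"
proof -
  show "diag (fps_X * F) = fps_X * diag F"
  proof (rule fps_ext)
    fix n show "diag (fps_X * F) $ n = (fps_X * diag F) $ n"
      by (cases n) (simp_all add: diag_nth sum.atMost_Suc_shift del: sum.atMost_Suc)
  qed
  show "diag (fps_const fps_X * F) = fps_X * diag F"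
  proof (rule fps_ext)
    fix n show "diag (fps_const fps_X * F) $ n = (fps_X * diag F) $ n"
    proof (cases n)
      case (Suc m)
      have "(\<Sum>k\<le>m. F $ k $ (Suc m - k - 1)) = (\<Sum>k\<le>m. F $ k $ (m - k))"
        by (intro sum.cong) auto
      then show ?thesis using Suc by (simp add: diag_nth)
    qed (simp add: diag_nth)
  qed
qed

lemma diag_DD: "diag (DD * F) = 0"
  by (simp add: DD_def left_diff_distrib diag_diff diag_X)

lemma diag_XY: "diag (XY * F) = fps_X * (fps_X * diag F)"
  by (simp add: XY_def mult.assoc diag_X)

text \<open>Interchanges the variables u and v, not the order in which coefficients are multiplied:
  f(u) g(v) becomes f(v) g(u).\<close>

definition swp :: "'a::calg fps fps \<Rightarrow> 'a fps fps" where
  "swp F = Abs_fps (\<lambda>n. Abs_fps (\<lambda>m. F $ m $ n))"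

lemma swp_nth: "swp F $ n $ m = F $ m $ n"
  by (simp add: swp_def)

lemma swp_simps: "swp (F + G) = swp F + swp G" "swp (F - G) = swp F - swp G" "swp (- F) = - swp F"
  "swp (c \<star> F) = c \<star> swp F" "swp 0 = 0" "swp (DD * F) = - (DD * swp F)" "swp (XY * F) = XY * swp F"
  "swp (U f * V g) = V f * U g" "swp (V f * U g) = U f * V g"
  by (simp_all add: fps_eq_iff swp_nth DD_mult_nth XY_mult_nth U_V_nth V_U_nth)

lemma swp_sum: "swp (sum f A) = (\<Sum>a\<in>A. swp (f a))"
  by (induction A rule: infinite_finite_induct) (simp_all add: swp_simps)

section \<open>RTT relations\<close>

text \<open>This is f(u) g(v) = g(v) f(u) with independent variables, which is stronger than
  commutation of the two series. Even \<open>cm f f\<close> is a condition on f.\<close>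

definition cm :: "'a::calg fps \<Rightarrow> 'a fps \<Rightarrow> bool" where
  "cm f g \<longleftrightarrow> (\<forall>m n. f $ m * g $ n = g $ n * f $ m)"

lemma cm_sym: "cm f g \<Longrightarrow> cm g f"
  by (simp add: cm_def)

lemma cm_iff_serin: "cm f g \<longleftrightarrow> g \<in> serin {x. \<forall>y\<in>range (($) f). x * y = y * x}"
  by (auto simp: cm_def serin_def)

lemma cm_iff_UV: "cm f g \<longleftrightarrow> U f * V g = V g * U f"
  by (auto simp: cm_def fps_eq_iff U_V_nth V_U_nth)

lemma cm_subalg: "subalg {g. cm f g}"
  unfolding cm_iff_serin Collect_mem_eq by (rule subalg_serin[OF subalg_centralizer])

lemma cm_closed:
  assumes "cm f g"
  shows "cm f (fshift a g)" "cm f (fneg g)" "cm f (finv g)" "cm f (sqs a g)"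
  using assms unfolding cm_iff_serin
  by (fact serin_fshift[OF subalg_centralizer] serin_fneg[OF subalg_centralizer]
      serin_finv[OF subalg_centralizer] serin_sqs[OF subalg_centralizer])+

lemma cm_arith:
  assumes "cm f g" "cm f h"
  shows "cm f (g * h)" "cm f (g + h)" "cm f (g - h)" "cm f (c \<star> g)"
  using assms subalgD[OF cm_subalg[of f]] by auto

lemma cm_mult_commute: "cm f g \<Longrightarrow> f * g = g * f"
proof -
  assume "cm f g"
  then have "diag (U f * V g) = diag (V g * U f)" by (simp add: cm_iff_UV)
  then show ?thesis by (simp add: diag_U_V diag_V_U)
qed

lemma cm_1: "cm f 1"
  by (simp add: cm_def)

lemma cm_fmap: "alg_hom h \<Longrightarrow> cm f g \<Longrightarrow> cm (fmap h f) (fmap h g)"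
proof -
  assume h: "alg_hom h" and "cm f g"
  then show ?thesis unfolding cm_def fmap_nth by (metis alg_homD(2)[OF h])
qed

text \<open>A polynomial \<open>p\<close> of degree at most two, evaluated at \<open>u - v\<close> and multiplied by
  \<open>u\<^sup>-\<^sup>2 v\<^sup>-\<^sup>2\<close>.\<close>

definition pk :: "complex poly \<Rightarrow> 'a::calg fps fps" where
  "pk p = coeff p 2 \<star> (DD * DD) + coeff p 1 \<star> (DD * XY) + coeff p 0 \<star> (XY * XY)"

lemma pk_commute: "pk p * F = F * pk p"
proof -
  have c: "A * B * F = F * (A * B)" if "A * F = F * A" "B * F = F * B" for A B :: "'a fps fps"
    by (metis mult.assoc that)
  show ?thesis
    unfolding pk_def distrib_left distrib_right cs_mult_left cs_mult_right
    by (simp only: c[OF DD_commute DD_commute] c[OF DD_commute XY_commute] c[OF XY_commute XY_commute])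
qed

lemma pk_add: "pk (p + q) = pk p + pk q"
  by (simp add: pk_def cs_add_left algebra_simps)

lemma pk_0 [simp]: "pk 0 = 0"
  by (simp add: pk_def)

lemma pk_smult: "pk (smult c p) = c \<star> pk p"
  by (simp add: pk_def cs_add_right cs_assoc)

text \<open>The polynomial p(1 - x), for p of degree at most 2; x -> 1 - x is the crossing
  substitution of the R-matrices.\<close>

definition prefl :: "complex poly \<Rightarrow> complex poly" where
  "prefl p = [:coeff p 0 + coeff p 1 + coeff p 2, - coeff p 1 - 2 * coeff p 2, coeff p 2:]"

text \<open>The polynomial p(x + 1), for p of degree at most 2; it arises when v is replaced by v -
  1.\<close>

definition psucc :: "complex poly \<Rightarrow> complex poly" where
  "psucc p = [:coeff p 0 + coeff p 1 + coeff p 2, coeff p 1 + 2 * coeff p 2, coeff p 2:]"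

lemma coeff_quadratic [simp]:
  "coeff [:a, b, c:] 2 = c" "coeff [:a, b, c:] (Suc 0) = b" "coeff [:a, b:] 2 = 0" 
  "coeff [:a, b:] (Suc 0) = b" "coeff [:a:] 2 = 0" "coeff [:a:] (Suc 0) = 0"
  by (simp_all add: numeral_2_eq_2)

lemma shV_pk:
  fixes F :: "'a::calg fps fps"
  shows "(1 + c \<star> fps_X) * ((1 + c \<star> fps_X) * shV c (pk p * F)) =
    (coeff p 2 \<star> ((DD - c \<star> XY) * (DD - c \<star> XY)) + coeff p 1 \<star> ((DD - c \<star> XY) * XY)
      + coeff p 0 \<star> (XY * XY)) * shV c F"
proof -
  define w where "w = (1 + c \<star> fps_X :: 'a fps fps)"
  have w: "w * G = G * w" for G :: "'a fps fps"
    by (simp add: w_def distrib_left distrib_right cs_mult_left cs_mult_right fps_mult_fps_X_commute)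
  have dx: "w * shV c XY = XY" "w * shV c DD = DD - c \<star> XY"
    unfolding w_def by (rule shV_DD_XY)+
  have ab: "w * (w * (A * B * G)) = (w * A) * (w * B) * G" for A B G :: "'a fps fps"
  proof -
    have "w * (w * (A * B * G)) = w * ((w * A) * B * G)" by (simp only: mult.assoc)
    also have "\<dots> = w * (w * A) * B * G" by (simp only: mult.assoc)
    also have "\<dots> = (w * A) * w * B * G" by (simp only: w[of "w * A"])
    finally show ?thesis by (simp only: mult.assoc)
  qed
  show ?thesis
    unfolding w_def[symmetric] pk_def distrib_right cs_mult_left alg_homD[OF shV_hom] distrib_left[of w] cs_mult_right
      ab dx ..
qed

lemma diag_pk: "diag (pk p * F) = coeff p 0 \<star> (fps_X ^ 4 * diag F)"
proof -
  have "diag (pk p * F) = coeff p 0 \<star> (fps_X * (fps_X * (fps_X * (fps_X * diag F))))"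
    by (simp add: pk_def distrib_right cs_mult_left diag_add diag_cs mult.assoc diag_DD diag_XY)
  then show ?thesis by (simp add: mult.assoc power4_eq_xxxx)
qed

lemma pk_shV_minus_one:
  fixes F :: "'a::calg fps fps"
  shows "(1 - fps_X) * ((1 - fps_X) * shV (- 1) (pk p * F)) = pk (psucc p) * shV (- 1) F"
proof -
  have c: "(DD * XY :: 'a fps fps) = XY * DD" by (rule DD_commute)
  have "(coeff p 2 \<star> ((DD + XY) * (DD + XY)) + coeff p 1 \<star> ((DD + XY) * XY) + coeff p 0 \<star> (XY * XY))
      = (pk (psucc p) :: 'a fps fps)"
    by (simp add: pk_def psucc_def distrib_left distrib_right cs_add_left cs_add_right c
        cs_two[symmetric] cs_assoc mult.commute add_ac)
  then show ?thesis using shV_pk[of "-1" p F] by simp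
qed

text \<open>Specialization at v = u - 1. There u - v = 1, so each polynomial contributes its value
  at 1, written as the sum of its coefficients.\<close>

lemma pk_specialize:
  fixes A B C :: "'a::calg fps fps"
  assumes "pk a * A + pk b * B + pk c * C = 0"
  shows "(coeff a 0 + coeff a 1 + coeff a 2) \<star> diag (shV (- 1) A)
    + (coeff b 0 + coeff b 1 + coeff b 2) \<star> diag (shV (- 1) B)
    + (coeff c 0 + coeff c 1 + coeff c 2) \<star> diag (shV (- 1) C) = 0"
proof -
  have "(1 - fps_X) * ((1 - fps_X) * shV (- 1) (pk a * A + pk b * B + pk c * C)) = 0"
    by (simp add: assms alg_homD[OF shV_hom])
  then have "pk (psucc a) * shV (- 1) A + pk (psucc b) * shV (- 1) B + pk (psucc c) * shV (- 1) C = 0"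
    by (simp only: alg_homD[OF shV_hom] distrib_left pk_shV_minus_one[symmetric])
  then have "diag (pk (psucc a) * shV (- 1) A + pk (psucc b) * shV (- 1) B + pk (psucc c) * shV (- 1) C) = 0"
    by simp
  then have "fps_X ^ 4 * ((coeff a 0 + coeff a 1 + coeff a 2) \<star> diag (shV (- 1) A)
    + (coeff b 0 + coeff b 1 + coeff b 2) \<star> diag (shV (- 1) B)
    + (coeff c 0 + coeff c 1 + coeff c 2) \<star> diag (shV (- 1) C)) = 0"
    by (simp add: diag_add diag_pk psucc_def distrib_left cs_mult_right)
  then have "(fps_X ^ 4 * ((coeff a 0 + coeff a 1 + coeff a 2) \<star> diag (shV (- 1) A)
    + (coeff b 0 + coeff b 1 + coeff b 2) \<star> diag (shV (- 1) B)
    + (coeff c 0 + coeff c 1 + coeff c 2) \<star> diag (shV (- 1) C))) $ (n + 4) = 0" for n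
    by simp
  then show ?thesis by (simp add: fps_eq_iff fps_X_power_mult_nth)
qed

lemma swp_pk:
  "swp (pk p * F) = (coeff p 2 \<star> (DD * DD) - coeff p 1 \<star> (DD * XY) + coeff p 0 \<star> (XY * XY)) * swp F"
  by (simp add: pk_def distrib_right left_diff_distrib swp_simps cs_mult_left mult.assoc)

text \<open>Interchanging u and v and then replacing v by v + 1 turns u - v into 1 - (u -
  v).\<close>

lemma pk_reflect:
  fixes F :: "'a::calg fps fps"
  shows "(1 + fps_X) * ((1 + fps_X) * shV 1 (swp (pk p * F))) = pk (prefl p) * shV 1 (swp F)"
proof -
  have c: "(DD * XY :: 'a fps fps) = XY * DD" by (rule DD_commute)
  let ?p = "[:coeff p 0, - coeff p 1, coeff p 2:]"
  have "swp (pk p * F) = pk ?p * swp F"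
    unfolding swp_pk by (simp add: pk_def)
  then have "(1 + fps_X) * ((1 + fps_X) * shV 1 (swp (pk p * F))) =
    (coeff p 2 \<star> ((DD - XY) * (DD - XY)) - coeff p 1 \<star> ((DD - XY) * XY) + coeff p 0 \<star> (XY * XY))
      * shV 1 (swp F)"
    using shV_pk[of 1 ?p "swp F"] by simp
  also have "(coeff p 2 \<star> ((DD - XY) * (DD - XY)) - coeff p 1 \<star> ((DD - XY) * XY) + coeff p 0 \<star> (XY * XY))
      = (pk (prefl p) :: 'a fps fps)"
  proof -
    have "(2 * coeff p 2) \<star> (XY * DD) = coeff p 2 \<star> (XY * DD) + coeff p 2 \<star> (XY * DD :: 'a fps fps)"
      by (simp add: cs_two[symmetric] cs_assoc)
    then show ?thesis
    by (simp add: pk_def prefl_def left_diff_distrib right_diff_distrib cs_add_left cs_add_right 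
        cs_diff_left cs_diff_right c algebra_simps)
  qed
  finally show ?thesis .
qed

abbreviation uv :: "(int \<Rightarrow> int \<Rightarrow> 'a::calg fps) \<Rightarrow> int \<Rightarrow> int \<Rightarrow> int \<Rightarrow> int \<Rightarrow> 'a fps fps" where
  "uv T i j k l \<equiv> U (T i j) * V (T k l)"

abbreviation vu :: "(int \<Rightarrow> int \<Rightarrow> 'a::calg fps) \<Rightarrow> int \<Rightarrow> int \<Rightarrow> int \<Rightarrow> int \<Rightarrow> 'a fps fps" where
  "vu T k l i j \<equiv> V (T k l) * U (T i j)"

text \<open>The RTT relation for \<open>R(u - v) = a I + b P + c Q\<close>, where
  \<open>Q = \<Sum> e\<^sub>i e\<^sub>j E\<^sub>i\<^sub>j \<otimes> E\<^sub>-\<^sub>i\<^sub>,\<^sub>-\<^sub>j\<close>.\<close>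

definition rtt :: "int set \<Rightarrow> (int \<Rightarrow> complex) \<Rightarrow> complex poly \<Rightarrow> complex poly \<Rightarrow> complex poly \<Rightarrow>
    (int \<Rightarrow> int \<Rightarrow> 'a::calg fps) \<Rightarrow> bool" where
  "rtt I e a b c T \<longleftrightarrow> (\<forall>i\<in>I. \<forall>j\<in>I. \<forall>k\<in>I. \<forall>l\<in>I.
     pk a * (uv T i j k l - vu T k l i j) + pk b * (uv T k j i l - vu T k j i l) +
     pk c * ((if k = - i then e i \<star> (\<Sum>p\<in>I. e p \<star> uv T p j (- p) l) else 0) -
             (if l = - j then e j \<star> (\<Sum>p\<in>I. e p \<star> vu T k (- p) i p) else 0)) = 0)"

lemma rttD:
  assumes "rtt I e a b c T" "i \<in> I" "j \<in> I" "k \<in> I" "l \<in> I"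
  shows "pk a * (uv T i j k l - vu T k l i j) + pk b * (uv T k j i l - vu T k j i l) +
     pk c * ((if k = - i then e i \<star> (\<Sum>p\<in>I. e p \<star> uv T p j (- p) l) else 0) -
             (if l = - j then e j \<star> (\<Sum>p\<in>I. e p \<star> vu T k (- p) i p) else 0)) = 0"
  using assms unfolding rtt_def by blast

text \<open>Covers the alternating form on C^2 (\<open>e2\<close>) and the symmetric form on C^4
  (\<open>e4\<close>) at once. The last condition says that e(i) e(-i) is the same sign for all
  i.\<close>

definition sign_set :: "int set \<Rightarrow> (int \<Rightarrow> complex) \<Rightarrow> bool" where
  "sign_set I e \<longleftrightarrow> finite I \<and> (\<forall>i\<in>I. - i \<in> I \<and> i \<noteq> - i \<and> e i * e i = 1) \<and>
     (\<forall>i\<in>I. \<forall>j\<in>I. e (- i) * e (- j) = e i * e j)"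

lemma sum_uminus:
  assumes "sign_set I e"
  shows "(\<Sum>p\<in>I. f (- p)) = (\<Sum>p\<in>I. f p)"
  by (rule sum.reindex_bij_witness[of _ uminus uminus]) (use assms in \<open>auto simp: sign_set_def\<close>)

text \<open>The relation with u and v interchanged and v raised by 1, so that W(v) = T(v + 1). When
  W is rewritten through its transpose in \<open>rtt_central\<close>, the terms of P take the shape
  of those of Q and conversely; this is why crossing symmetry exchanges b and c there.\<close>

lemma rtt_reflect:
  assumes I: "sign_set I e" and r: "rtt I e a b c T" and ijkl: "i \<in> I" "j \<in> I" "k \<in> I" "l \<in> I"
  defines "W \<equiv> \<lambda>p q. V (fshift 1 (T p q))"
  shows "pk (prefl a) * (W k l * U (T i j) - U (T i j) * W k l) +
    pk (prefl b) * (W i l * U (T k j) - U (T i l) * W k j) +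
    pk (prefl c) * ((if k = - i then e i \<star> (\<Sum>p\<in>I. e p \<star> (W (- p) l * U (T p j))) else 0) -
             (if l = - j then e j \<star> (\<Sum>p\<in>I. e p \<star> (U (T i p) * W k (- p))) else 0)) = 0"
proof -
  let ?G = "(if i = - k then e k \<star> (\<Sum>p\<in>I. e p \<star> uv T p l (- p) j) else 0) -
             (if j = - l then e l \<star> (\<Sum>p\<in>I. e p \<star> vu T i (- p) k p) else 0)"
  have "pk a * (uv T k l i j - vu T i j k l) + pk b * (uv T i l k j - vu T i l k j) + pk c * ?G = 0"
    by (rule rttD[OF r]) (use ijkl in auto)
  then have "(1 + fps_X) * ((1 + fps_X) * shV 1 (swp (pk a * (uv T k l i j - vu T i j k l) +
       pk b * (uv T i l k j - vu T i l k j) + pk c * ?G))) = 0"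
    by (simp add: swp_simps alg_homD[OF shV_hom])
  then have *: "pk (prefl a) * shV 1 (swp (uv T k l i j - vu T i j k l)) +
    pk (prefl b) * shV 1 (swp (uv T i l k j - vu T i l k j)) + pk (prefl c) * shV 1 (swp ?G) = 0"
    unfolding pk_reflect[symmetric]
    by (simp only: swp_simps(1) alg_homD[OF shV_hom] distrib_left)
  have S1: "e k \<star> (\<Sum>p\<in>I. e p \<star> (W p l * U (T (- p) j))) = e i \<star> (\<Sum>p\<in>I. e p \<star> (W (- p) l * U (T p j)))"
    if "i = - k"
  proof -
    have "(\<Sum>p\<in>I. e p \<star> (W p l * U (T (- p) j))) = (\<Sum>p\<in>I. e (- p) \<star> (W (- p) l * U (T p j)))"
      using sum_uminus[OF I, of "\<lambda>p. e (- p) \<star> (W (- p) l * U (T p j))"] by simp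
    moreover have "e k * e (- p) = e i * e p" if "p \<in> I" for p
      using I \<open>i = - k\<close> that ijkl(1) unfolding sign_set_def by (metis minus_minus)
    ultimately show ?thesis by (simp add: cs_sum_right cs_assoc)
  qed
  have S2: "e l \<star> (\<Sum>p\<in>I. e p \<star> (U (T i (- p)) * W k p)) = e j \<star> (\<Sum>p\<in>I. e p \<star> (U (T i p) * W k (- p)))"
    if "j = - l"
  proof -
    have "(\<Sum>p\<in>I. e p \<star> (U (T i (- p)) * W k p)) = (\<Sum>p\<in>I. e (- p) \<star> (U (T i p) * W k (- p)))"
      using sum_uminus[OF I, of "\<lambda>p. e (- p) \<star> (U (T i p) * W k (- p))"] by simp
    moreover have "e l * e (- p) = e j * e p" if "p \<in> I" for p
      using I \<open>j = - l\<close> that ijkl(2) unfolding sign_set_def by (metis minus_minus)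
    ultimately show ?thesis by (simp add: cs_sum_right cs_assoc)
  qed
  have "shV 1 (swp ?G) = (if k = - i then e i \<star> (\<Sum>p\<in>I. e p \<star> (W (- p) l * U (T p j))) else 0) -
             (if l = - j then e j \<star> (\<Sum>p\<in>I. e p \<star> (U (T i p) * W k (- p))) else 0)"
    using S1 S2
    by (auto simp: swp_simps swp_sum alg_homD[OF shV_hom] W_def)
  then show ?thesis using *
    by (simp add: swp_simps alg_homD[OF shV_hom] W_def)
qed

definition tr_mat :: "(int \<Rightarrow> complex) \<Rightarrow> (int \<Rightarrow> int \<Rightarrow> 'a::calg fps) \<Rightarrow> int \<Rightarrow> int \<Rightarrow> 'a fps" where
  "tr_mat e T i j = (e i * e j) \<star> T (- j) (- i)"

text \<open>The argument: \<open>T*(v) = T\<^sup>t(v + 1)\<close> satisfies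
  \<open>T*\<^sub>2(v) R(u - v) T\<^sub>1(u) = T\<^sub>1(u) R(u - v) T*\<^sub>2(v)\<close>, so that
  \<open>R T\<^sub>1(u) z(v) = R T\<^sub>1(u) T\<^sub>2(v) T*\<^sub>2(v) = T\<^sub>2(v) T\<^sub>1(u) R T*\<^sub>2(v) = z(v) R T\<^sub>1(u)\<close>.\<close>

lemma rtt_central:
  fixes T :: "int \<Rightarrow> int \<Rightarrow> 'a::calg fps"
  assumes I: "sign_set I e" and r: "rtt I e a b c T"
    and refl: "prefl a = smult s a" "prefl b = smult s c" "prefl c = smult s b" "s \<noteq> 0"
    and z: "\<And>k m. k \<in> I \<Longrightarrow> m \<in> I \<Longrightarrow>
      (\<Sum>l\<in>I. T k l * fshift 1 (tr_mat e T l m)) = (if k = m then z else 0)"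
    and reg: "\<And>F. pk (a + b) * F = 0 \<Longrightarrow> F = (0::'a fps fps)"
    and i: "i \<in> I" and j: "j \<in> I"
  shows "cm (T i j) z"
proof -
  have fin: "finite I" using I by (simp add: sign_set_def)
  have neg: "- p \<in> I" "p \<noteq> - p" "e p * e p = 1" if "p \<in> I" for p
    using I that by (auto simp: sign_set_def)
  have ee: "e (- p) * e (- q) = e p * e q" if "p \<in> I" "q \<in> I" for p q
    using I that by (auto simp: sign_set_def)
  define t where "t = (\<lambda>p q. U (T p q))"
  define w where "w = (\<lambda>p q. V (T p q))"
  define W where "W = (\<lambda>p q. V (fshift 1 (T p q)))"
  \<comment> \<open>The transpose of T(v + 1). The hypothesis on z says that \<open>w\<close> times
    \<open>S\<close> is the scalar matrix z(v).\<close>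
  define S where "S = (\<lambda>p q. (e p * e q) \<star> W (- q) (- p))"
  have zz: "(\<Sum>l\<in>I. w k l * S l m) = (if k = m then V z else 0)" if "k \<in> I" "m \<in> I" for k m
  proof -
    have "(\<Sum>l\<in>I. w k l * S l m) = V (\<Sum>l\<in>I. T k l * fshift 1 (tr_mat e T l m))"
      by (simp add: w_def S_def W_def tr_mat_def alg_homD[OF V_hom] alg_homD[OF fshift_hom])
    then show ?thesis using z[OF that] by (simp add: alg_homD[OF V_hom])
  qed
  \<comment> \<open>The crossed relation between T(u) and the transpose of T(v + 1), at entry (i, j)
    of the first tensor factor and (q, i) of the second, with the signs absorbed into
    \<open>S\<close>.\<close>
  have B: "pk a * (t i j * S q i) + (if q = j then pk b * (\<Sum>p\<in>I. t i p * S p i) else 0)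
        + pk c * ((e (- q) * e j) \<star> (t i (- q) * S (- j) i)) =
      pk a * (S q i * t i j) + pk b * (\<Sum>p\<in>I. S q p * t p j)
        + pk c * ((e i * e (- i)) \<star> (S q (- i) * t (- i) j))" if q: "q \<in> I" for q
  proof -
    have eq: "pk (prefl a) * (W (- i) (- q) * t i j - t i j * W (- i) (- q)) +
      pk (prefl b) * (W i (- q) * t (- i) j - t i (- q) * W (- i) j) +
      pk (prefl c) * ((if - i = - i then e i \<star> (\<Sum>p\<in>I. e p \<star> (W (- p) (- q) * t p j)) else 0) -
             (if - q = - j then e j \<star> (\<Sum>p\<in>I. e p \<star> (t i p * W (- i) (- p))) else 0)) = 0"
      unfolding t_def W_def by (rule rtt_reflect[OF I r]) (use i j q neg in auto)
    have s0: "s \<star> G = 0 \<Longrightarrow> G = 0" for G :: "'a fps fps"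
      using refl(4) by (metis cs_assoc cs_one cs_zero_right left_inverse)
    have "pk a * (W (- i) (- q) * t i j - t i j * W (- i) (- q)) +
      pk c * (W i (- q) * t (- i) j - t i (- q) * W (- i) j) +
      pk b * (e i \<star> (\<Sum>p\<in>I. e p \<star> (W (- p) (- q) * t p j)) -
             (if q = j then e j \<star> (\<Sum>p\<in>I. e p \<star> (t i p * W (- i) (- p))) else 0)) = 0"
      by (rule s0) (use eq in \<open>simp add: refl pk_smult cs_add_right cs_mult_left\<close>)
    then have "(e q * e i) \<star> (pk a * (W (- i) (- q) * t i j - t i j * W (- i) (- q)) +
      pk c * (W i (- q) * t (- i) j - t i (- q) * W (- i) j) +
      pk b * (e i \<star> (\<Sum>p\<in>I. e p \<star> (W (- p) (- q) * t p j)) -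
             (if q = j then e j \<star> (\<Sum>p\<in>I. e p \<star> (t i p * W (- i) (- p))) else 0))) = 0"
      by simp
    moreover have "(e q * e i) \<star> (W (- i) (- q) * t i j) = S q i * t i j"
      "(e q * e i) \<star> (t i j * W (- i) (- q)) = t i j * S q i"
      by (simp_all add: S_def cs_mult_left cs_mult_right)
    moreover have "(e q * e i) \<star> (W i (- q) * t (- i) j) = (e i * e (- i)) \<star> (S q (- i) * t (- i) j)"
    proof -
      have "e i * e (- i) * (e q * e (- i)) = e q * e i * (e (- i) * e (- i))" by simp
      also have "\<dots> = e q * e i" using neg[OF neg(1)[OF i]] by simp
      finally show ?thesis by (simp only: S_def cs_mult_left cs_assoc minus_minus)
    qed
    moreover have "(e q * e i) \<star> (t i (- q) * W (- i) j) = (e (- q) * e j) \<star> (t i (- q) * S (- j) i)"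
    proof -
      have "e (- q) * e j * (e (- j) * e i) = (e (- q) * e (- j)) * (e j * e i)"
        by (simp only: mult_ac)
      also have "\<dots> = (e j * e j) * (e q * e i)" unfolding ee[OF q j] by (simp only: mult_ac)
      also have "\<dots> = e q * e i" using neg[OF j] by simp
      finally show ?thesis by (simp only: S_def cs_mult_right cs_assoc minus_minus)
    qed
    moreover have "(e q * e i) \<star> (e i \<star> (\<Sum>p\<in>I. e p \<star> (W (- p) (- q) * t p j))) = (\<Sum>p\<in>I. S q p * t p j)"
    proof -
      have ei: "e q * (e i * (e i * e p)) = e q * e p" for p
        using neg[OF i] by (metis mult.assoc mult_1_left)
      show ?thesis by (simp only: S_def cs_mult_left cs_assoc cs_sum_right mult.assoc ei)
    qed
    moreover have "(e q * e i) \<star> (e j \<star> (\<Sum>p\<in>I. e p \<star> (t i p * W (- i) (- p)))) = (\<Sum>p\<in>I. t i p * S p i)"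
      if "q = j"
    proof -
      have ej: "e j * (e i * (e j * e p)) = e p * e i" for p
        using neg[OF j] by (metis mult.assoc mult.commute mult_1_left)
      show ?thesis by (simp only: S_def cs_mult_right cs_assoc cs_sum_right mult.assoc ej that)
    qed
    ultimately show ?thesis
      by (cases "q = j") (simp_all add: cs_add_right cs_diff_right cs_mult_right[symmetric] right_diff_distrib
          algebra_simps)
  qed
  \<comment> \<open>Both row indices are taken equal to i: on such rows P acts as the identity, and
    Q vanishes because i and - i differ. This produces the polynomial a + b at the end.\<close>
  have A: "pk a * (t i j * w i l - w i l * t i j) + pk b * (t i j * w i l - w i j * t i l) -
     (if l = - j then pk c * (e j \<star> (\<Sum>p\<in>I. e p \<star> (w i (- p) * t i p))) else 0) = 0" if "l \<in> I" for l
    using rttD[OF r i j i that] neg(2)[OF i] by (auto simp: t_def w_def)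
  have "0 = (\<Sum>l\<in>I. (pk a * (t i j * w i l - w i l * t i j) + pk b * (t i j * w i l - w i j * t i l) -
     (if l = - j then pk c * (e j \<star> (\<Sum>p\<in>I. e p \<star> (w i (- p) * t i p))) else 0)) * S l i)"
    using A by simp
  also have "\<dots> = pk a * (t i j * (\<Sum>l\<in>I. w i l * S l i)) - pk a * (\<Sum>l\<in>I. w i l * t i j * S l i)
     + pk b * (t i j * (\<Sum>l\<in>I. w i l * S l i)) - pk b * (w i j * (\<Sum>l\<in>I. t i l * S l i))
     - (\<Sum>l\<in>I. if l = - j then pk c * (e j \<star> (\<Sum>p\<in>I. e p \<star> (w i (- p) * t i p))) * S l i else 0)"
    by (simp add: sum_distrib_left sum_distrib_right sum.distrib sum_subtractf left_diff_distrib right_diff_distrib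
        distrib_left distrib_right mult.assoc if_distrib[of "\<lambda>x. x * _"] cong: if_cong)
  also have "(\<Sum>l\<in>I. if l = - j then pk c * (e j \<star> (\<Sum>p\<in>I. e p \<star> (w i (- p) * t i p))) * S l i else 0)
     = pk c * (e j \<star> (\<Sum>p\<in>I. e p \<star> (w i (- p) * t i p))) * S (- j) i"
    using neg[OF j] fin by (simp add: sum.delta)
  also have "\<dots> = pk c * (\<Sum>q\<in>I. (e (- q) * e j) \<star> (w i q * t i (- q) * S (- j) i))"
  proof -
    have "(\<Sum>p\<in>I. e p \<star> (w i (- p) * t i p)) = (\<Sum>q\<in>I. e (- q) \<star> (w i q * t i (- q)))"
      using sum_uminus[OF I, of "\<lambda>q. e (- q) \<star> (w i q * t i (- q))"] by simp
    then show ?thesis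
      by (simp add: mult.assoc cs_sum_right cs_assoc sum_distrib_right cs_mult_left mult.commute)
  qed
  finally have 1: "pk a * (\<Sum>l\<in>I. w i l * t i j * S l i) + pk b * (w i j * (\<Sum>l\<in>I. t i l * S l i))
      + pk c * (\<Sum>q\<in>I. (e (- q) * e j) \<star> (w i q * t i (- q) * S (- j) i))
      = pk a * (t i j * V z) + pk b * (t i j * V z)"
    by (simp add: zz i algebra_simps)
  have m: "w i q * (pk p * F) = pk p * (w i q * F)" for q p F
    using pk_commute[of p "w i q"] by (metis mult.assoc)
  \<comment> \<open>The crossed relation is multiplied by T(v) from the left; its left side is the
    expression found in \<open>1\<close>, its right side collapses by \<open>zz\<close>.\<close>
  have "(\<Sum>q\<in>I. w i q * (pk a * (t i j * S q i) + (if q = j then pk b * (\<Sum>p\<in>I. t i p * S p i) else 0)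
        + pk c * ((e (- q) * e j) \<star> (t i (- q) * S (- j) i)))) =
     (\<Sum>q\<in>I. w i q * (pk a * (S q i * t i j) + pk b * (\<Sum>p\<in>I. S q p * t p j)
        + pk c * ((e i * e (- i)) \<star> (S q (- i) * t (- i) j))))"
    using B by simp
  moreover have "(\<Sum>q\<in>I. w i q * (pk a * (t i j * S q i) + (if q = j then pk b * (\<Sum>p\<in>I. t i p * S p i) else 0)
        + pk c * ((e (- q) * e j) \<star> (t i (- q) * S (- j) i)))) =
      pk a * (\<Sum>q\<in>I. w i q * t i j * S q i) + pk b * (w i j * (\<Sum>l\<in>I. t i l * S l i))
      + pk c * (\<Sum>q\<in>I. (e (- q) * e j) \<star> (w i q * t i (- q) * S (- j) i))"
  proof -
    have "(\<Sum>q\<in>I. w i q * (if q = j then pk b * (\<Sum>p\<in>I. t i p * S p i) else 0)) =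
       (\<Sum>q\<in>I. if q = j then pk b * (w i j * (\<Sum>p\<in>I. t i p * S p i)) else 0)"
      by (intro sum.cong) (auto simp: m)
    also have "\<dots> = pk b * (w i j * (\<Sum>l\<in>I. t i l * S l i))" using j fin by simp
    finally show ?thesis
      by (simp add: distrib_left sum.distrib m sum_distrib_left cs_mult_right mult.assoc)
  qed
  moreover have "(\<Sum>q\<in>I. w i q * (pk a * (S q i * t i j) + pk b * (\<Sum>p\<in>I. S q p * t p j)
        + pk c * ((e i * e (- i)) \<star> (S q (- i) * t (- i) j)))) =
      pk a * (V z * t i j) + pk b * (V z * t i j)"
  proof -
    have "(\<Sum>q\<in>I. w i q * (\<Sum>p\<in>I. S q p * t p j)) = (\<Sum>p\<in>I. (\<Sum>q\<in>I. w i q * S q p) * t p j)"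
      unfolding sum_distrib_left sum_distrib_right by (subst sum.swap) (simp add: mult.assoc)
    also have "\<dots> = (\<Sum>p\<in>I. if i = p then V z * t p j else 0)"
      by (intro sum.cong) (auto simp: zz i)
    also have "\<dots> = V z * t i j" using i fin by simp
    finally have b: "(\<Sum>q\<in>I. w i q * (\<Sum>p\<in>I. S q p * t p j)) = V z * t i j" .
    have "(\<Sum>q\<in>I. w i q * S q i) = V z" "(\<Sum>q\<in>I. w i q * S q (- i)) = 0"
      using neg[OF i] by (simp_all add: zz i)
    then have ac: "(\<Sum>q\<in>I. w i q * (S q i * t i j)) = V z * t i j"
      "(\<Sum>q\<in>I. w i q * (S q (- i) * t (- i) j)) = 0"
      by (simp_all flip: mult.assoc sum_distrib_right)
    show ?thesis
      by (simp add: distrib_left sum.distrib m b ac cs_mult_right flip: sum_distrib_left cs_sum_right)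
  qed
  ultimately have "pk (a + b) * (t i j * V z - V z * t i j) = 0"
    using 1 by (simp add: pk_add algebra_simps)
  then have "t i j * V z - V z * t i j = 0" by (rule reg)
  then show ?thesis by (simp add: cm_iff_UV t_def)
qed

lemma commute_left: "a * b = b * a \<Longrightarrow> a * (b * c) = b * (a * c :: 'a::semigroup_mult)"
  by (metis mult.assoc)

section \<open>Operations that preserve the RTT relation: scaling, shifts, homomorphisms\<close>

lemma rtt_scale:
  fixes T :: "int \<Rightarrow> int \<Rightarrow> 'a::calg fps"
  assumes r: "rtt I e a b c T" and f: "cm f f" "\<And>i j. i \<in> I \<Longrightarrow> j \<in> I \<Longrightarrow> cm f (T i j)"
    and I: "sign_set I e"
  shows "rtt I e a b c (\<lambda>i j. f * T i j)"
  unfolding rtt_def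
proof (intro ballI)
  fix i j k l assume ijkl: "i \<in> I" "j \<in> I" "k \<in> I" "l \<in> I"
  define g where "g = U f * V f"
  have c: "U (T i j) * V f = V f * U (T i j)" "V (T i j) * U f = U f * V (T i j)" 
    if "i \<in> I" "j \<in> I" for i j
    using f(2)[OF that] by (simp_all add: cm_iff_UV[symmetric] cm_sym) (simp add: cm_iff_UV)
  have ff: "V f * U f = U f * V f" using f(1) by (simp add: cm_iff_UV)
  have uv: "uv (\<lambda>i j. f * T i j) i j k l = g * uv T i j k l" 
    if "i \<in> I" "j \<in> I" "k \<in> I" "l \<in> I" for i j k l
  proof -
    have "uv (\<lambda>i j. f * T i j) i j k l = U f * (U (T i j) * V f) * V (T k l)"
      by (simp add: alg_homD[OF U_hom] alg_homD[OF V_hom] mult.assoc)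
    then show ?thesis by (simp add: g_def c that mult.assoc)
  qed
  have vu: "vu (\<lambda>i j. f * T i j) k l i j = g * vu T k l i j" 
    if "i \<in> I" "j \<in> I" "k \<in> I" "l \<in> I" for i j k l
  proof -
    have "vu (\<lambda>i j. f * T i j) k l i j = V f * (V (T k l) * U f) * U (T i j)"
      by (simp add: alg_homD[OF U_hom] alg_homD[OF V_hom] mult.assoc)
    also have "\<dots> = (V f * U f) * vu T k l i j" by (simp add: c that mult.assoc)
    finally show ?thesis by (simp add: g_def ff)
  qed
  have n: "- p \<in> I" if "p \<in> I" for p using I that by (auto simp: sign_set_def)
  have s: "(\<Sum>p\<in>I. e p \<star> uv (\<lambda>i j. f * T i j) p j (- p) l) = g * (\<Sum>p\<in>I. e p \<star> uv T p j (- p) l)"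
    "(\<Sum>p\<in>I. e p \<star> vu (\<lambda>i j. f * T i j) k (- p) i p) = g * (\<Sum>p\<in>I. e p \<star> vu T k (- p) i p)"
    unfolding sum_distrib_left cs_mult_right by (intro sum.cong refl; simp only: uv vu n ijkl)+
  have m: "pk p * (g * F) = g * (pk p * F)" for p F
    by (rule commute_left[OF pk_commute])
  let ?uv = "uv (\<lambda>i j. f * T i j)" and ?vu = "vu (\<lambda>i j. f * T i j)"
  have "pk a * (?uv i j k l - ?vu k l i j) + pk b * (?uv k j i l - ?vu k j i l) +
     pk c * ((if k = - i then e i \<star> (\<Sum>p\<in>I. e p \<star> ?uv p j (- p) l) else 0) -
             (if l = - j then e j \<star> (\<Sum>p\<in>I. e p \<star> ?vu k (- p) i p) else 0)) =
     g * (pk a * (uv T i j k l - vu T k l i j) + pk b * (uv T k j i l - vu T k j i l) +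
     pk c * ((if k = - i then e i \<star> (\<Sum>p\<in>I. e p \<star> uv T p j (- p) l) else 0) -
             (if l = - j then e j \<star> (\<Sum>p\<in>I. e p \<star> vu T k (- p) i p) else 0)))"
    unfolding s uv[OF ijkl] vu[OF ijkl] uv[OF ijkl(3,2,1,4)] vu[OF ijkl(1,4,3,2)]
    by (cases "k = - i"; cases "l = - j") (simp_all add: distrib_left right_diff_distrib m cs_mult_right)
  then show "pk a * (?uv i j k l - ?vu k l i j) + pk b * (?uv k j i l - ?vu k j i l) +
     pk c * ((if k = - i then e i \<star> (\<Sum>p\<in>I. e p \<star> ?uv p j (- p) l) else 0) -
             (if l = - j then e j \<star> (\<Sum>p\<in>I. e p \<star> ?vu k (- p) i p) else 0)) = 0"
    unfolding rttD[OF r ijkl] by simp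
qed

definition sh2 :: "complex \<Rightarrow> 'a::calg fps fps \<Rightarrow> 'a fps fps" where
  "sh2 c F = shU c (shV c F)"

lemma sh2_hom: "alg_hom (sh2 c)"
  unfolding sh2_def by (rule alg_hom_comp[OF shU_hom shV_hom])

lemma sh2_UV [simp]: "sh2 c (U f) = U (fshift c f)" "sh2 c (V f) = V (fshift c f)"
  by (simp_all add: sh2_def)

text \<open>A simultaneous shift keeps u - v. Hence \<open>DD\<close> and \<open>XY\<close> acquire
  the same central factor, whose inverse is (1 + c u^-1)(1 + c v^-1).\<close>

lemma sh2_pk:
  fixes F :: "'a::calg fps fps"
  obtains w where "\<And>F p. w * (w * sh2 c (pk p * F)) = (pk p * sh2 c F :: 'a fps fps)"
proof -
  define wX where "wX = (1 + c \<star> fps_const fps_X :: 'a fps fps)"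
  define wY where "wY = (1 + c \<star> fps_X :: 'a fps fps)"
  define w where "w = wX * wY"
  have cX: "wX * G = G * wX" for G
    by (simp add: wX_def distrib_left distrib_right cs_mult_left cs_mult_right fps_const_X_commute)
  have cY: "wY * G = G * wY" for G
    by (simp add: wY_def distrib_left distrib_right cs_mult_left cs_mult_right fps_mult_fps_X_commute)
  have w: "w * G = G * w" for G
    unfolding w_def by (metis cX cY mult.assoc)
  have Y: "shU c wY = wY"
    by (auto simp: wY_def shU_def fps_eq_iff fps_X_def alg_homD[OF fshift_hom])
  have dY: "wY * shV c XY = XY" "wY * shV c DD = DD - c \<star> XY"
    unfolding wY_def by (rule shV_DD_XY)+
  have dX: "wX * shU c XY = XY" "wX * shU c DD = DD + c \<star> XY"
    unfolding wX_def by (rule shU_DD_XY)+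
  have "wY * sh2 c XY = shU c XY" "wY * sh2 c DD = shU c DD - c \<star> shU c XY"
    using dY[THEN arg_cong, of "shU c"] by (simp_all add: alg_homD[OF shU_hom] Y sh2_def)
  then have d: "w * sh2 c XY = XY" "w * sh2 c DD = DD"
    unfolding w_def mult.assoc by (simp_all add: dX right_diff_distrib cs_mult_right)
  have ab: "w * (w * (A * B * G)) = (w * A) * (w * B) * G" for A B G :: "'a fps fps"
  proof -
    have "w * (w * (A * B * G)) = w * ((w * A) * B * G)" by (simp only: mult.assoc)
    also have "\<dots> = w * (w * A) * B * G" by (simp only: mult.assoc)
    also have "\<dots> = (w * A) * w * B * G" by (simp only: w[of "w * A"])
    finally show ?thesis by (simp only: mult.assoc)
  qed
  have "w * (w * sh2 c (pk p * F)) = (pk p * sh2 c F :: 'a fps fps)" for F p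
    unfolding pk_def distrib_right cs_mult_left alg_homD[OF sh2_hom] distrib_left[of w] cs_mult_right
      ab d ..
  then show ?thesis by (rule that)
qed

lemma rtt_shift:
  fixes T :: "int \<Rightarrow> int \<Rightarrow> 'a::calg fps"
  assumes r: "rtt I e a b c T"
  shows "rtt I e a b c (\<lambda>i j. fshift h (T i j))"
  unfolding rtt_def
proof (intro ballI)
  fix i j k l assume ijkl: "i \<in> I" "j \<in> I" "k \<in> I" "l \<in> I"
  obtain w where w: "\<And>F p. w * (w * sh2 h (pk p * F)) = (pk p * sh2 h F :: 'a fps fps)"
    using sh2_pk by blast
  let ?C = "(if k = - i then e i \<star> (\<Sum>p\<in>I. e p \<star> uv T p j (- p) l) else 0) -
             (if l = - j then e j \<star> (\<Sum>p\<in>I. e p \<star> vu T k (- p) i p) else 0)"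
  let ?uv = "uv (\<lambda>i j. fshift h (T i j))" and ?vu = "vu (\<lambda>i j. fshift h (T i j))"
  have "w * (w * sh2 h (pk a * (uv T i j k l - vu T k l i j) + pk b * (uv T k j i l - vu T k j i l) +
     pk c * ?C)) = 0"
    unfolding rttD[OF r ijkl] by (simp add: alg_homD[OF sh2_hom])
  then have "pk a * sh2 h (uv T i j k l - vu T k l i j) + pk b * sh2 h (uv T k j i l - vu T k j i l) +
     pk c * sh2 h ?C = 0"
    by (simp only: alg_homD(1)[OF sh2_hom] distrib_left w)
  moreover have "sh2 h ?C = (if k = - i then e i \<star> (\<Sum>p\<in>I. e p \<star> ?uv p j (- p) l) else 0) -
             (if l = - j then e j \<star> (\<Sum>p\<in>I. e p \<star> ?vu k (- p) i p) else 0)"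
    by (simp add: alg_homD[OF sh2_hom])
  ultimately show "pk a * (?uv i j k l - ?vu k l i j) + pk b * (?uv k j i l - ?vu k j i l) +
     pk c * ((if k = - i then e i \<star> (\<Sum>p\<in>I. e p \<star> ?uv p j (- p) l) else 0) -
             (if l = - j then e j \<star> (\<Sum>p\<in>I. e p \<star> ?vu k (- p) i p) else 0)) = 0"
    by (simp add: alg_homD[OF sh2_hom])
qed

lemma rtt_fmap:
  fixes T :: "int \<Rightarrow> int \<Rightarrow> 'a::calg fps"
  assumes r: "rtt I e a b c T" and h: "alg_hom h"
  shows "rtt I e a b c (\<lambda>i j. fmap h (T i j))"
  unfolding rtt_def
proof (intro ballI)
  fix i j k l assume ijkl: "i \<in> I" "j \<in> I" "k \<in> I" "l \<in> I"
  let ?h = "fmap (fmap h)"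
  note H = fmap_hom[OF fmap_hom[OF h]]
  have X: "?h fps_X = fps_X" "?h (fps_const fps_X) = fps_const fps_X"
    by (auto simp: fps_eq_iff fps_X_def alg_homD[OF h])
  then have "?h DD = DD" "?h XY = XY"
    by (simp_all add: DD_def XY_def alg_homD[OF H])
  then have P: "?h (pk p) = pk p" for p
    by (simp add: pk_def alg_homD[OF H])
  have UV: "?h (U f) = U (fmap h f)" "?h (V f) = V (fmap h f)" for f
    by (auto simp: U_def V_def fps_eq_iff alg_homD[OF h])
  show "pk a * (uv (\<lambda>i j. fmap h (T i j)) i j k l - vu (\<lambda>i j. fmap h (T i j)) k l i j)
      + pk b * (uv (\<lambda>i j. fmap h (T i j)) k j i l - vu (\<lambda>i j. fmap h (T i j)) k j i l) +
     pk c * ((if k = - i then e i \<star> (\<Sum>p\<in>I. e p \<star> uv (\<lambda>i j. fmap h (T i j)) p j (- p) l) else 0) -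
             (if l = - j then e j \<star> (\<Sum>p\<in>I. e p \<star> vu (\<lambda>i j. fmap h (T i j)) k (- p) i p) else 0)) = 0"
    using rttD[OF r ijkl, THEN arg_cong, of ?h]
    by (simp add: alg_homD[OF H] P UV if_distrib[of ?h] cong: if_cong)
qed

definition unital :: "int set \<Rightarrow> (int \<Rightarrow> int \<Rightarrow> 'a::calg fps) \<Rightarrow> bool" where
  "unital I T \<longleftrightarrow> (\<forall>i\<in>I. \<forall>j\<in>I. T i j $ 0 = (if i = j then 1 else 0))"

section \<open>The Yangian of \<open>gl\<^sub>2\<close>\<close>

lemma I2_simps [simp]: "1 \<in> I2" "- 1 \<in> I2" "p \<in> I2 \<Longrightarrow> - p \<in> I2"
  "(\<Sum>p\<in>I2. f p) = f (- 1) + f 1"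
  by (auto simp: I2_def)

lemma I2E: "i \<in> I2 \<Longrightarrow> (i = - 1 \<Longrightarrow> P) \<Longrightarrow> (i = 1 \<Longrightarrow> P) \<Longrightarrow> P"
  by (auto simp: I2_def)

definition e2 :: "int \<Rightarrow> complex" where "e2 = of_int"

lemma e2_simps [simp]: "e2 1 = 1" "e2 (- 1) = - 1"
  by (simp_all add: e2_def)

lemma sign_set_I2: "sign_set I2 e2"
  by (auto simp: sign_set_def I2_def e2_def)

definition rtt2 :: "(int \<Rightarrow> int \<Rightarrow> 'a::calg fps) \<Rightarrow> bool" where
  "rtt2 T \<longleftrightarrow> rtt I2 e2 [:0, 1:] [:-1:] 0 T"

lemma rtt2_iff:
  "rtt2 T \<longleftrightarrow> (\<forall>i\<in>I2. \<forall>j\<in>I2. \<forall>k\<in>I2. \<forall>l\<in>I2.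
     DD * (uv T i j k l - vu T k l i j) = XY * (uv T k j i l - vu T k j i l))"
proof -
  have "pk [:0, 1:] * A + pk [:-1:] * B + pk 0 * C = 0 \<longleftrightarrow> DD * A = XY * B"
    for A B C :: "'a fps fps"
  proof -
    have "pk [:0, 1:] * A + pk [:-1:] * B + pk 0 * C = XY * (DD * A) - XY * (XY * B)"
      by (simp add: pk_def DD_commute[of XY] mult.assoc)
    also have "\<dots> = 0 \<longleftrightarrow> DD * A = XY * B" using XY_cancel by auto
    finally show ?thesis .
  qed
  then show ?thesis unfolding rtt2_def rtt_def by blast
qed

text \<open>For the alternating form on C^2 one has Q = I - P, so 2(x - P) = (2x - 1) I - P + Q. In
  this presentation x -> 1 - x multiplies 2x - 1 by -1 and exchanges the coefficients of P and Q up
  to the same sign, as \<open>rtt_central\<close> requires.\<close>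

lemma rtt2_rtt:
  assumes "rtt2 T"
  shows "rtt I2 e2 [:-1, 2:] [:-1:] [:1:] T"
  unfolding rtt_def
proof (intro ballI)
  fix i j k l assume ijkl: "i \<in> I2" "j \<in> I2" "k \<in> I2" "l \<in> I2"
  let ?A = "uv T i j k l - vu T k l i j" and ?B = "uv T k j i l - vu T k j i l"
  let ?C = "(if k = - i then e2 i \<star> (\<Sum>p\<in>I2. e2 p \<star> uv T p j (- p) l) else 0) -
             (if l = - j then e2 j \<star> (\<Sum>p\<in>I2. e2 p \<star> vu T k (- p) i p) else 0)"
  have C: "?C = ?A - ?B"
    using ijkl by (elim I2E) simp_all
  have "DD * ?A = XY * ?B" using assms ijkl unfolding rtt2_iff by blast
  then have D: "XY * (DD * ?A) = XY * (XY * ?B)" by simp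
  have "pk [:-1, 2:] * ?A + pk [:-1:] * ?B + pk [:1:] * (?A - ?B)
      = (XY * (DD * ?A) - XY * (XY * ?B)) + (XY * (DD * ?A) - XY * (XY * ?B))"
    by (simp only: pk_def coeff_quadratic coeff_pCons_0 One_nat_def DD_commute[of XY] mult.assoc
        distrib_right left_diff_distrib right_diff_distrib distrib_left cs_mult_left cs_two
        cs_minus_left cs_one cs_zero_left add_0_left add_0_right minus_mult_left[symmetric])
      (simp add: algebra_simps)
  then show "pk [:-1, 2:] * ?A + pk [:-1:] * ?B + pk [:1:] * ?C = 0"
    unfolding C D by simp
qed

text \<open>The relation at v = u - 1, where the R-matrix degenerates to I - P.\<close>

lemma rtt2_minus_one:
  assumes r: "rtt2 T" and "i \<in> I2" "j \<in> I2" "k \<in> I2" "l \<in> I2"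
  shows "T i j * fshift (- 1) (T k l) - fshift (- 1) (T k l) * T i j =
    T k j * fshift (- 1) (T i l) - fshift (- 1) (T k j) * T i l"
  using pk_specialize[OF rttD[OF r[unfolded rtt2_def] assms(2-5)]]
  by (simp add: alg_homD[OF shV_hom] diag_diff diag_U_V diag_V_U flip: eq_neg_iff_add_eq_0)

section \<open>The quantum determinant and normalization by it\<close>

definition qd :: "(int \<Rightarrow> int \<Rightarrow> 'a::calg fps) \<Rightarrow> 'a fps" where
  "qd T = fshift (- 1) (T (- 1) (- 1)) * T 1 1 - fshift (- 1) (T (- 1) 1) * T 1 (- 1)"

text \<open>On C^2 tensor C^2 the image of I - P is a line. The relation at v = u - 1 therefore
  makes the products of T(u - 1) with the transpose of T(u), in either order, the same
  scalar.\<close>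

lemma qd_left_right:
  assumes r: "rtt2 T" and i: "i \<in> I2" "j \<in> I2"
  shows "(\<Sum>p\<in>I2. fshift (- 1) (T i p) * tr_mat e2 T p j) = (if i = j then qd T else 0)"
    and "(\<Sum>p\<in>I2. tr_mat e2 T i p * fshift (- 1) (T p j)) = (if i = j then qd T else 0)"
proof -
  note E = rtt2_minus_one[OF r]
  have 1: "fshift (- 1) (T 1 1) * T (- 1) (- 1) - fshift (- 1) (T 1 (- 1)) * T (- 1) 1 = qd T"
  proof -
    let ?s = "\<lambda>i j. fshift (- 1) (T i j)"
    have "?s 1 1 * T (- 1) (- 1) - ?s 1 (- 1) * T (- 1) 1 =
        T (- 1) (- 1) * ?s 1 1 - T 1 (- 1) * ?s (- 1) 1"
      using E[of "- 1" "-1" 1 1] by (simp add: algebra_simps)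
    also have "\<dots> = qd T"
      using E[of 1 "- 1" "- 1" 1] unfolding qd_def by (simp add: algebra_simps)
    finally show ?thesis .
  qed
  have 2: "fshift (- 1) (T k i) * T k j - fshift (- 1) (T k j) * T k i = 0" if "k \<in> I2" for k
    using E[of k i k j] E[of k j k i] i that by (simp add: algebra_simps)
  show "(\<Sum>p\<in>I2. fshift (- 1) (T i p) * tr_mat e2 T p j) = (if i = j then qd T else 0)"
    using i 1 E[of 1 1 1 "- 1"] E[of "-1" 1 "-1" "-1"] E[of 1 "-1" 1 1] E[of "-1" "-1" "-1" 1]
    by (elim I2E) (simp_all add: tr_mat_def qd_def)
  have 3: "T i k * fshift (- 1) (T j k) - T j k * fshift (- 1) (T i k) = 0" if "k \<in> I2" for k
    using E[of i k j k] i that by (simp add: algebra_simps)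
  have 4: "T 1 1 * fshift (- 1) (T (- 1) (- 1)) - T (- 1) 1 * fshift (- 1) (T 1 (- 1)) = qd T"
    using E[of 1 1 "- 1" "- 1"] unfolding qd_def by (simp add: algebra_simps)
  have 5: "T (- 1) (- 1) * fshift (- 1) (T 1 1) - T 1 (- 1) * fshift (- 1) (T (- 1) 1) = qd T"
    using E[of "- 1" "- 1" 1 1] 1 by (simp add: algebra_simps)
  show "(\<Sum>p\<in>I2. tr_mat e2 T i p * fshift (- 1) (T p j)) = (if i = j then qd T else 0)"
    using i 4 5 E[of 1 1 "-1" 1] E[of "-1" "-1" 1 "-1"]
    by (elim I2E) (simp_all add: tr_mat_def)
qed

lemma pk_reg2: "pk [:-2, 2:] * F = 0 \<Longrightarrow> F = (0 :: 'a::calg fps fps)"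
proof -
  assume "pk [:-2, 2:] * F = 0"
  moreover have "pk [:-2, 2:] * F = XY * ((DD - 1 \<star> XY) * F + (DD - 1 \<star> XY) * F)"
    by (simp add: pk_def cs_two DD_commute[of XY] algebra_simps)
  ultimately have "XY * ((DD - 1 \<star> XY) * F + (DD - 1 \<star> XY) * F) = XY * 0" by simp
  then have "(DD - 1 \<star> XY) * F + (DD - 1 \<star> XY) * F = 0" by (rule XY_cancel)
  then have "(DD - 1 \<star> XY) * F = 0" by (simp only: double_eq_zero_iff)
  then show "F = 0" by (rule DD_XY_cancel)
qed

lemma qd_central:
  assumes r: "rtt2 T" and "i \<in> I2" "j \<in> I2"
  shows "cm (T i j) (qd T)"
proof -
  have "cm (T i j) (fshift 1 (qd T))"
  \<comment> \<open>The scalar in T(u) T^t(u + 1) is qdet T(u + 1), so centrality is proved for the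
    shifted series and then shifted back. The value of s is the sign of 2x - 1 under x -> 1 -
    x.\<close>
  proof (rule rtt_central[OF sign_set_I2 rtt2_rtt[OF r], where s = "-1"])
    show "(\<Sum>l\<in>I2. T k l * fshift 1 (tr_mat e2 T l m)) = (if k = m then fshift 1 (qd T) else 0)"
      if "k \<in> I2" "m \<in> I2" for k m
      using arg_cong[OF qd_left_right(1)[OF r that], of "fshift 1"]
      by (simp add: alg_homD[OF fshift_hom] split: if_splits)
  qed (use assms pk_reg2 in \<open>simp_all add: prefl_def\<close>)
  from cm_closed(1)[OF this, of "- 1"] show ?thesis by simp
qed

text \<open>Only one of the two determinants is expanded; its entries commute with the other by
  centrality.\<close>

lemma qd_self_commute:
  assumes r: "rtt2 T"
  shows "cm (qd T) (qd T)"
  unfolding qd_def[of T]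
  by (intro cm_arith cm_closed(1) qd_central[OF r, unfolded qd_def, THEN cm_sym]) simp_all

lemma unital_qd: "unital I2 T \<Longrightarrow> qd T $ 0 = 1"
  by (simp add: unital_def qd_def)

text \<open>With d(u) d(u - 1) = qdet T(u), the matrix T(u) / d(u) has quantum determinant 1. So
  every solution of the relations of Y(2) yields one of the relations of SY(2).\<close>

definition nrm :: "(int \<Rightarrow> int \<Rightarrow> 'a::calg fps) \<Rightarrow> int \<Rightarrow> int \<Rightarrow> 'a fps" where
  "nrm T i j = finv (sqs (- 1) (qd T)) * T i j"

lemma qd_scale:
  assumes f: "\<And>i j. i \<in> I2 \<Longrightarrow> j \<in> I2 \<Longrightarrow> cm (T i j) f" "cm f f"
  shows "qd (\<lambda>i j. f * T i j) = f * fshift (- 1) f * qd T"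
proof -
  have c: "fshift (- 1) (f * T i j) * (f * T k l) = f * fshift (- 1) f * (fshift (- 1) (T i j) * T k l)"
    if "i \<in> I2" "j \<in> I2" "k \<in> I2" "l \<in> I2" for i j k l
  proof -
    have "fshift (- 1) f * fshift (- 1) (T i j) * (f * T k l)
        = fshift (- 1) f * (fshift (- 1) (T i j) * f) * T k l" by (simp only: mult.assoc)
    also have "fshift (- 1) (T i j) * f = f * fshift (- 1) (T i j)"
      by (rule cm_mult_commute, rule cm_sym, rule cm_closed, rule cm_sym, rule f) (use that in auto)
    also have "fshift (- 1) f * (f * fshift (- 1) (T i j)) * T k l = fshift (- 1) f * f * (fshift (- 1) (T i j) * T k l)"
      by (simp only: mult.assoc)
    also have "fshift (- 1) f * f = f * fshift (- 1) f"
      by (rule cm_mult_commute[OF cm_closed(1)[OF f(2)], symmetric])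
    finally show ?thesis by (simp only: fshift_mult)
  qed
  show ?thesis by (simp add: qd_def c right_diff_distrib)
qed

lemma nrm_props:
  assumes r: "rtt2 T" and u: "unital I2 T"
  shows "rtt2 (nrm T)" "unital I2 (nrm T)" "qd (nrm T) = 1"
proof -
  let ?f = "finv (sqs (- 1) (qd T))"
  have c: "cm (T i j) ?f" if "i \<in> I2" "j \<in> I2" for i j
    by (intro cm_closed qd_central r that)
  have qf: "cm (qd T) ?f" by (intro cm_closed qd_self_commute r)
  then have ff: "cm ?f ?f" by (rule cm_closed(3)[OF cm_closed(4)[OF cm_sym]])
  show "rtt2 (nrm T)"
    unfolding rtt2_def nrm_def by (rule rtt_scale[OF r[unfolded rtt2_def] ff cm_sym[OF c] sign_set_I2])
  show "unital I2 (nrm T)"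
    using u by (simp add: unital_def nrm_def)
  have q: "sqs (- 1) (qd T) * fshift (- 1) (sqs (- 1) (qd T)) = qd T"
    by (rule sqs_eq) (rule unital_qd[OF u])
  have "qd (nrm T) = ?f * fshift (- 1) ?f * qd T"
    unfolding nrm_def by (rule qd_scale[OF c ff])
  also have "fshift (- 1) ?f = finv (fshift (- 1) (sqs (- 1) (qd T)))"
    by (rule fshift_finv) simp
  also have "?f * \<dots> = finv (fshift (- 1) (sqs (- 1) (qd T)) * sqs (- 1) (qd T))"
    by (rule finv_mult[symmetric]) simp_all
  also have "fshift (- 1) (sqs (- 1) (qd T)) * sqs (- 1) (qd T) = qd T"
    using cm_mult_commute[OF cm_closed(1)[OF cm_closed(4)[OF cm_sym[OF cm_closed(4)[OF qd_self_commute[OF r]]]]]] q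
    by metis
  finally show "qd (nrm T) = 1" by (simp add: finv_left unital_qd[OF u])
qed

text \<open>The substitution u -> 1 - u.\<close>

definition rho :: "'a::calg fps \<Rightarrow> 'a fps" where
  "rho f = fneg (fshift 1 f)"

lemma rho_hom: "alg_hom rho"
  unfolding rho_def by (rule alg_hom_comp[OF fneg_hom fshift_hom])

lemma rho_rho [simp]: "rho (rho f) = f"
  by (simp add: rho_def fneg_fshift)

lemma rho_nth_0 [simp]: "rho f $ 0 = f $ 0"
  by (simp add: rho_def)

text \<open>The series \<open>T(u) T\<^sup>t(1 - u)\<close>, which is \<open>T(u) T(-u)\<^sup>-\<^sup>1\<close> if the quantum determinant is 1.\<close>

definition twm :: "(int \<Rightarrow> int \<Rightarrow> 'a::calg fps) \<Rightarrow> int \<Rightarrow> int \<Rightarrow> 'a fps" where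
  "twm T i j = (\<Sum>p\<in>I2. T i p * rho (tr_mat e2 T p j))"

lemma fneg_X: "fneg fps_X = - fps_X"
  by (auto simp: fps_eq_iff fneg_nth fps_X_def)

lemma fneg_const: "fneg (fps_const x) = fps_const x"
  by (auto simp: fps_eq_iff fneg_nth)

text \<open>The RTT relation at v = 1 - u, reached by v -> 1 - v followed by v = u. There u - v = 2u
  - 1; the factor 2 - u^-1 is this number times u^-1.\<close>

lemma rtt2_rho:
  fixes T :: "int \<Rightarrow> int \<Rightarrow> 'a::calg fps"
  assumes r: "rtt2 T" and ijkl: "i \<in> I2" "j \<in> I2" "k \<in> I2" "l \<in> I2"
  shows "(2 \<star> 1 - fps_X) * (T i j * rho (T k l) - rho (T k l) * T i j) =
    fps_X * (T k j * rho (T i l) - rho (T k j) * T i l)"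
proof -
  let ?A = "uv T i j k l - vu T k l i j" and ?B = "uv T k j i l - vu T k j i l"
  let ?h = "\<lambda>F :: 'a fps fps. fneg (shV 1 F)"
  note h = alg_homD[OF alg_hom_comp[OF fneg_hom shV_hom]]
  have "DD * ?A = XY * ?B" using r ijkl unfolding rtt2_iff by blast
  then have "((1 + 1 \<star> fps_X) * shV 1 DD) * shV 1 ?A = ((1 + 1 \<star> fps_X) * shV 1 XY) * shV 1 ?B"
    unfolding mult.assoc by (metis alg_homD(2)[OF shV_hom])
  then have "(DD - XY) * shV 1 ?A = XY * shV 1 ?B"
    unfolding shV_DD_XY by simp
  then have "fneg (DD - XY) * ?h ?A = fneg XY * ?h ?B"
    by (metis alg_homD(2)[OF fneg_hom])
  moreover have "fneg XY = (- XY :: 'a fps fps)"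
    by (simp add: XY_def alg_homD[OF fneg_hom] fneg_X fneg_const)
  moreover have "fneg DD = (- fps_X - fps_const fps_X :: 'a fps fps)"
    by (simp add: DD_def alg_homD[OF fneg_hom] fneg_X fneg_const)
  ultimately have "(fps_X + fps_const fps_X - XY) * ?h ?A = XY * ?h ?B"
    unfolding alg_homD[OF fneg_hom] by (simp add: algebra_simps)
  then have "diag ((fps_X + fps_const fps_X - XY) * ?h ?A) = diag (XY * ?h ?B)" by simp
  then have "fps_X * ((2 \<star> 1 - fps_X) * diag (?h ?A)) = fps_X * (fps_X * diag (?h ?B))"
    by (simp add: distrib_right left_diff_distrib diag_add diag_diff diag_X diag_XY cs_two cs_mult_left
      right_diff_distrib distrib_left mult_2)
  moreover have "fneg (U f) = U f" "fneg (V f) = V (fneg f)" for f :: "'a fps"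
    by (auto simp: U_def V_def fneg_const fmap_fneg[OF fps_const_hom])
  then have "diag (?h ?A) = T i j * rho (T k l) - rho (T k l) * T i j"
    "diag (?h ?B) = T k j * rho (T i l) - rho (T k j) * T i l"
    by (simp_all add: alg_homD[OF shV_hom] alg_homD[OF fneg_hom] diag_diff diag_U_V diag_V_U rho_def)
  ultimately have "fps_X * ((2 \<star> 1 - fps_X) * (T i j * rho (T k l) - rho (T k l) * T i j)) =
    fps_X * (fps_X * (T k j * rho (T i l) - rho (T k j) * T i l))"
    by (simp only:)
  then have "(fps_X * ((2 \<star> 1 - fps_X) * (T i j * rho (T k l) - rho (T k l) * T i j))) $ Suc n =
    (fps_X * (fps_X * (T k j * rho (T i l) - rho (T k j) * T i l))) $ Suc n" for n by simp
  then show ?thesis by (simp add: fps_eq_iff)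
qed

text \<open>The difference of the two traces is a signed sum of commutators, and by regrouping it is
  also minus the same sum of the right-hand sides of the relation at v = 1 - u. Hence 2u - 1 times
  the difference is minus the difference, and the difference vanishes.\<close>

lemma trace_twm_symmetric:
  assumes r: "rtt2 T"
  shows "rho (twm T 1 1 + twm T (- 1) (- 1)) = twm T 1 1 + twm T (- 1) (- 1)"
proof -
  let ?t = "twm T 1 1 + twm T (- 1) (- 1)"
  define c where "c = (\<lambda>i j k l. T i j * rho (T k l) - rho (T k l) * T i j)"
  define d where "d = (\<lambda>i j k l. T k j * rho (T i l) - rho (T k j) * T i l)"
  have cd: "(2 \<star> 1 - fps_X) * c i j k l = fps_X * d i j k l"
    if "i \<in> I2" "j \<in> I2" "k \<in> I2" "l \<in> I2" for i j k l
    unfolding c_def d_def by (rule rtt2_rho[OF r that])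
  note s = alg_homD[OF rho_hom] tr_mat_def twm_def
  have 1: "?t - rho ?t = c 1 1 (- 1) (- 1) + c (- 1) (- 1) 1 1 - c 1 (- 1) (- 1) 1 - c (- 1) 1 1 (- 1)"
    by (simp add: s c_def)
  have 2: "?t - rho ?t = - (d 1 1 (- 1) (- 1) + d (- 1) (- 1) 1 1 - d 1 (- 1) (- 1) 1 - d (- 1) 1 1 (- 1))"
    by (simp add: s d_def)
  have "(2 \<star> 1 - fps_X) * (?t - rho ?t) = fps_X * (d 1 1 (- 1) (- 1) + d (- 1) (- 1) 1 1 - d 1 (- 1) (- 1) 1 - d (- 1) 1 1 (- 1))"
    unfolding 1 distrib_left right_diff_distrib by (simp add: cd)
  also have "\<dots> = - (fps_X * (?t - rho ?t))" unfolding 2 by (simp only: mult_minus_right minus_minus)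
  finally have "2 \<star> (?t - rho ?t) = 0" by (simp add: left_diff_distrib cs_mult_left)
  then have "?t - rho ?t = 0" unfolding cs_two double_eq_zero_iff .
  then show ?thesis by simp
qed

lemma rtt2_nth:
  assumes r: "rtt2 T" and ijkl: "i \<in> I2" "j \<in> I2" "k \<in> I2" "l \<in> I2" and u: "unital I2 T"
  shows "T i j $ 1 * T k l $ n - T k l $ n * T i j $ 1 =
      (if k = j then T i l $ n else 0) - (if i = l then T k j $ n else 0)"
    and "T i j $ 2 * T k l $ n - T k l $ n * T i j $ 2 =
      (T i j $ 1 * T k l $ Suc n - T k l $ Suc n * T i j $ 1) + (T k j $ 1 * T i l $ n - T k j $ n * T i l $ 1)"
proof -
  have e: "DD * (uv T i j k l - vu T k l i j) = XY * (uv T k j i l - vu T k j i l)"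
    using r ijkl unfolding rtt2_iff by blast
  have u: "T i j $ 0 = (if i = j then 1 else 0)" if "i \<in> I2" "j \<in> I2" for i j
    using u that by (simp add: unital_def)
  have "(DD * (uv T i j k l - vu T k l i j)) $ Suc n $ 1 = (XY * (uv T k j i l - vu T k j i l)) $ Suc n $ 1"
    unfolding e ..
  then show "T i j $ 1 * T k l $ n - T k l $ n * T i j $ 1 =
      (if k = j then T i l $ n else 0) - (if i = l then T k j $ n else 0)"
    unfolding DD_mult_nth XY_mult_nth fps_sub_nth U_V_nth V_U_nth by (auto simp: u ijkl split: if_splits)
  have "(DD * (uv T i j k l - vu T k l i j)) $ Suc n $ 2 = (XY * (uv T k j i l - vu T k j i l)) $ Suc n $ 2"
    unfolding e ..
  then show "T i j $ 2 * T k l $ n - T k l $ n * T i j $ 2 =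
      (T i j $ 1 * T k l $ Suc n - T k l $ Suc n * T i j $ 1) + (T k j $ 1 * T i l $ n - T k j $ n * T i l $ 1)"
    unfolding DD_mult_nth XY_mult_nth fps_sub_nth U_V_nth V_U_nth by (simp add: algebra_simps)
qed

text \<open>In terms of currents, e_0, f_0 and e_1 generate SY(2). Commutators of e_0 or e_1 with f
  give the differences of diagonal coefficients, bracketing these with e_0 and f_0 gives the
  off-diagonal coefficients of the same level, and quantum determinant 1 supplies the sums of
  diagonal coefficients.\<close>

lemma rtt2_generated:
  assumes r: "rtt2 T" and u: "unital I2 T" and q: "qd T = 1" and S: "subalg S"
    and gens: "T 1 (- 1) $ 1 \<in> S" "T (- 1) 1 $ 1 \<in> S" "T 1 (- 1) $ 2 \<in> S"
    and ij: "i \<in> I2" "j \<in> I2"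
  shows "T i j $ n \<in> S"
proof -
  note s = subalgD[OF S]
  have u0: "T i j $ 0 = (if i = j then 1 else 0)" if "i \<in> I2" "j \<in> I2" for i j
    using u that by (simp add: unital_def)
  \<comment> \<open>Modulo lower coefficients the n-th coefficient of the quantum determinant is the
    sum of the two diagonal ones; with their difference known, both follow.\<close>
  have level: "\<forall>i\<in>I2. \<forall>j\<in>I2. T i j $ n \<in> S"
    if n: "n \<ge> 1" and lower: "\<And>k i j. k < n \<Longrightarrow> i \<in> I2 \<Longrightarrow> j \<in> I2 \<Longrightarrow> T i j $ k \<in> S"
      and off: "T 1 (- 1) $ n \<in> S" "T (- 1) 1 $ n \<in> S" "T 1 1 $ n - T (- 1) (- 1) $ n \<in> S" for n
  proof -
    let ?A = "fshift (- 1) (T (- 1) (- 1)) * T 1 1" and ?B = "fshift (- 1) (T (- 1) 1) * T 1 (- 1)"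
    have sl: "fshift (- 1) (T i j) $ k \<in> S" if "k < n" "i \<in> I2" "j \<in> I2" for i j k
      unfolding fshift_nth using that by (intro s lower) auto
    have a: "?A $ n - (T 1 1 $ n + fshift (- 1) (T (- 1) (- 1)) $ n) \<in> S"
      using mult_nth_mod[OF S n, of "fshift (- 1) (T (- 1) (- 1))" "T 1 1"] sl lower by (simp add: u0)
    have b: "fshift (- 1) (T (- 1) (- 1)) $ n - T (- 1) (- 1) $ n \<in> S"
      by (rule fshift_nth_mod[OF S]) (simp add: lower)
    have c: "?B $ n \<in> S"
      using mult_nth_mod[OF S n, of "fshift (- 1) (T (- 1) 1)" "T 1 (- 1)"] sl lower by (simp add: u0)
    have d: "?A $ n - ?B $ n = 0"
      using n q[THEN arg_cong, of "\<lambda>f. f $ n"] by (simp add: qd_def)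
    have "0 - ((?A $ n - (T 1 1 $ n + fshift (- 1) (T (- 1) (- 1)) $ n)) +
        (fshift (- 1) (T (- 1) (- 1)) $ n - T (- 1) (- 1) $ n) - ?B $ n) \<in> S"
      by (rule s(7)[OF s(2) s(7)[OF s(3)[OF a b] c]])
    also have "0 - ((?A $ n - (T 1 1 $ n + fshift (- 1) (T (- 1) (- 1)) $ n)) +
        (fshift (- 1) (T (- 1) (- 1)) $ n - T (- 1) (- 1) $ n) - ?B $ n) = T 1 1 $ n + T (- 1) (- 1) $ n"
      using d by (simp add: algebra_simps)
    finally have sum: "T 1 1 $ n + T (- 1) (- 1) $ n \<in> S" .
    have "T 1 1 $ n + T 1 1 $ n \<in> S" using s(3)[OF sum off(3)] by simp
    then have "T 1 1 $ n \<in> S" by (rule subalg_double[OF S])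
    moreover from this have "T (- 1) (- 1) $ n \<in> S" using s(7)[OF sum] by force
    ultimately show ?thesis using off by (auto simp: I2_def)
  qed
  note c = rtt2_nth[OF r _ _ _ _ u]
  have "\<forall>k\<le>n. \<forall>i\<in>I2. \<forall>j\<in>I2. T i j $ k \<in> S"
  proof (induction n)
    case 0
    then show ?case using s by (auto simp: u0)
  next
    case (Suc n)
    then have lower: "T i j $ k \<in> S" if "k < Suc n" "i \<in> I2" "j \<in> I2" for k i j
      using that by auto
    have h: "T 1 1 $ Suc n - T (- 1) (- 1) $ Suc n \<in> S"
    proof (cases "n = 0")
      case True
      have "T 1 (- 1) $ 1 * T (- 1) 1 $ 1 - T (- 1) 1 $ 1 * T 1 (- 1) $ 1 \<in> S" by (intro s gens)
      then show ?thesis using c(1)[of 1 "-1" "-1" 1 1] True by simp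
    next
      case False
      have "(T 1 (- 1) $ 2 * T (- 1) 1 $ n - T (- 1) 1 $ n * T 1 (- 1) $ 2)
         - (T (- 1) (- 1) $ 1 * T 1 1 $ n - T (- 1) (- 1) $ n * T 1 1 $ 1) \<in> S"
        using False by (intro s gens lower) auto
      then show ?thesis using c(2)[of 1 "-1" "-1" 1 n] c(1)[of 1 "-1" "-1" 1 "Suc n"] by simp
    qed
    have e: "T 1 (- 1) $ Suc n \<in> S"
    proof -
      have "(T 1 1 $ Suc n - T (- 1) (- 1) $ Suc n) * T 1 (- 1) $ 1 -
          T 1 (- 1) $ 1 * (T 1 1 $ Suc n - T (- 1) (- 1) $ Suc n) \<in> S"
        by (intro s gens h) 
      also have "(T 1 1 $ Suc n - T (- 1) (- 1) $ Suc n) * T 1 (- 1) $ 1 -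
          T 1 (- 1) $ 1 * (T 1 1 $ Suc n - T (- 1) (- 1) $ Suc n) =
          (T 1 (- 1) $ 1 * T (- 1) (- 1) $ Suc n - T (- 1) (- 1) $ Suc n * T 1 (- 1) $ 1) -
          (T 1 (- 1) $ 1 * T 1 1 $ Suc n - T 1 1 $ Suc n * T 1 (- 1) $ 1)"
        by (simp add: algebra_simps)
      also have "\<dots> = T 1 (- 1) $ Suc n + T 1 (- 1) $ Suc n"
        using c(1)[of 1 "-1" "-1" "-1" "Suc n"] c(1)[of 1 "-1" 1 1 "Suc n"] by simp
      finally show ?thesis by (rule subalg_double[OF S])
    qed
    have f: "T (- 1) 1 $ Suc n \<in> S"
    proof -
      have "T (- 1) 1 $ 1 * (T 1 1 $ Suc n - T (- 1) (- 1) $ Suc n) -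
          (T 1 1 $ Suc n - T (- 1) (- 1) $ Suc n) * T (- 1) 1 $ 1 \<in> S"
        by (intro s gens h) 
      also have "T (- 1) 1 $ 1 * (T 1 1 $ Suc n - T (- 1) (- 1) $ Suc n) -
          (T 1 1 $ Suc n - T (- 1) (- 1) $ Suc n) * T (- 1) 1 $ 1 =
          (T (- 1) 1 $ 1 * T 1 1 $ Suc n - T 1 1 $ Suc n * T (- 1) 1 $ 1) -
          (T (- 1) 1 $ 1 * T (- 1) (- 1) $ Suc n - T (- 1) (- 1) $ Suc n * T (- 1) 1 $ 1)"
        by (simp add: algebra_simps)
      also have "\<dots> = T (- 1) 1 $ Suc n + T (- 1) 1 $ Suc n"
        using c(1)[of "-1" 1 "-1" "-1" "Suc n"] c(1)[of "-1" 1 1 1 "Suc n"] by simp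
      finally show ?thesis by (rule subalg_double[OF S])
    qed
    have "\<forall>i\<in>I2. \<forall>j\<in>I2. T i j $ Suc n \<in> S"
      by (rule level) (use lower e f h in auto)
    then show ?case using Suc by (auto simp: le_Suc_eq)
  qed
  then show ?thesis using ij by auto
qed

section \<open>The extended Yangian of \<open>so\<^sub>4\<close>\<close>

lemma I4_simps [simp]: "1 \<in> I4" "2 \<in> I4" "- 1 \<in> I4" "- 2 \<in> I4" "p \<in> I4 \<Longrightarrow> - p \<in> I4"
  "(\<Sum>p\<in>I4. f p) = f (- 2) + f (- 1) + f 1 + f 2"
  by (auto simp: I4_def add.assoc)

lemma I4E: "i \<in> I4 \<Longrightarrow> (i = - 2 \<Longrightarrow> P) \<Longrightarrow> (i = - 1 \<Longrightarrow> P) \<Longrightarrow> (i = 1 \<Longrightarrow> P) \<Longrightarrow> (i = 2 \<Longrightarrow> P) \<Longrightarrow> P"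
  by (auto simp: I4_def)

definition e4 :: "int \<Rightarrow> complex" where "e4 = (\<lambda>_. 1)"

lemma e4_simps [simp]: "e4 i = 1"
  by (simp add: e4_def)

lemma sign_set_I4: "sign_set I4 e4"
  by (auto simp: sign_set_def I4_def)

definition rtt4 :: "(int \<Rightarrow> int \<Rightarrow> 'a::calg fps) \<Rightarrow> bool" where
  "rtt4 T \<longleftrightarrow> rtt I4 e4 [:0, -1, 1:] [:1, -1:] [:0, 1:] T"

definition zz :: "(int \<Rightarrow> int \<Rightarrow> 'a::calg fps) \<Rightarrow> 'a fps" where
  "zz T = (\<Sum>p\<in>I4. fshift 1 (T p 2) * T (- p) (- 2))"

text \<open>At u - v = 1 the coefficients of I and P in the cleared R-matrix vanish and only Q is
  left. As Q has rank one, the relation forces both products to be scalar, with the same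
  scalar.\<close>

lemma zz_left_right:
  assumes r: "rtt4 T" and ij: "i \<in> I4" "j \<in> I4"
  shows "(\<Sum>p\<in>I4. T i p * fshift 1 (tr_mat e4 T p j)) = (if i = j then zz T else 0)"
    and "(\<Sum>p\<in>I4. fshift 1 (tr_mat e4 T i p) * T p j) = (if i = j then zz T else 0)"
proof -
  have E: "(if k = - i then \<Sum>p\<in>I4. T p j * fshift (- 1) (T (- p) l) else 0) =
      (if l = - j then \<Sum>p\<in>I4. fshift (- 1) (T k (- p)) * T i p else 0)"
    if "i \<in> I4" "j \<in> I4" "k \<in> I4" "l \<in> I4" for i j k l
    using pk_specialize[OF rttD[OF r[unfolded rtt4_def] that]]
    by (simp add: if_distrib[of "shV _"] if_distrib[of diag] diag_diff diag_add diag_U_V diag_V_U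
        alg_homD[OF shV_hom] del: I4_simps(6) cong: if_cong)
      (simp add: alg_homD[OF shV_hom] diag_add diag_U_V diag_V_U split: if_splits)
  have F: "(if k = - i then \<Sum>p\<in>I4. fshift 1 (T p j) * T (- p) l else 0) =
      (if l = - j then \<Sum>p\<in>I4. T k (- p) * fshift 1 (T i p) else 0)"
    if "i \<in> I4" "j \<in> I4" "k \<in> I4" "l \<in> I4" for i j k l
    using E[OF that, THEN arg_cong, of "fshift 1"]
    by (simp add: if_distrib[of "fshift 1"] alg_homD[OF fshift_hom] cong: if_cong)
  have "(\<Sum>p\<in>I4. T i p * fshift 1 (tr_mat e4 T p j)) = (\<Sum>p\<in>I4. T i (- p) * fshift 1 (T (- j) p))"
    by (simp add: tr_mat_def algebra_simps)
  also have "\<dots> = (if i = j then zz T else 0)"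
    using F[of "- j" 2 i "- 2"] F[of 2 2 "- 2" "- 2"] ij by (auto simp: zz_def simp del: I4_simps(6))
  finally show "(\<Sum>p\<in>I4. T i p * fshift 1 (tr_mat e4 T p j)) = (if i = j then zz T else 0)" .
  have "(\<Sum>p\<in>I4. fshift 1 (tr_mat e4 T i p) * T p j) = (\<Sum>p\<in>I4. fshift 1 (T p (- i)) * T (- p) j)"
    by (simp add: tr_mat_def algebra_simps)
  also have "\<dots> = (if i = j then zz T else 0)"
    using F[of 2 "- i" "- 2" j] F[of 2 2 "- 2" "- 2"] ij by (auto simp add: zz_def simp del: I4_simps(6))
  finally show "(\<Sum>p\<in>I4. fshift 1 (tr_mat e4 T i p) * T p j) = (if i = j then zz T else 0)" .
qed

lemma pk_square: "pk [:1, -2, 1:] = (DD - XY) * (DD - XY)"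
  by (simp add: pk_def DD_commute[of XY] cs_two left_diff_distrib right_diff_distrib)

lemma zz_central:
  assumes r: "rtt4 T" and ij: "i \<in> I4" "j \<in> I4"
  shows "cm (T i j) (zz T)"
proof (rule rtt_central[OF sign_set_I4 r[unfolded rtt4_def], where s = 1])
  show "(\<Sum>l\<in>I4. T k l * fshift 1 (tr_mat e4 T l m)) = (if k = m then zz T else 0)"
    if "k \<in> I4" "m \<in> I4" for k m
    by (rule zz_left_right[OF r that])
next
  fix F assume "pk ([:0, -1, 1:] + [:1, -1:]) * F = (0 :: 'a fps fps)"
  then have "(DD - 1 \<star> XY) * ((DD - 1 \<star> XY) * F) = 0"
    by (simp add: pk_square mult.assoc)
  then show "F = 0" using DD_XY_cancel by blast
qed (use ij in \<open>simp_all add: prefl_def\<close>)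

lemma zz_self_commute:
  assumes r: "rtt4 T"
  shows "cm (zz T) (zz T)"
  unfolding zz_def[of T] I4_simps(6)
  by (intro cm_arith cm_closed(1) zz_central[OF r, unfolded zz_def I4_simps(6), THEN cm_sym]) simp_all

lemma unital_zz: "unital I4 T \<Longrightarrow> zz T $ 0 = 1"
  by (simp add: unital_def zz_def)

definition nrm4 :: "(int \<Rightarrow> int \<Rightarrow> 'a::calg fps) \<Rightarrow> int \<Rightarrow> int \<Rightarrow> 'a fps" where
  "nrm4 T i j = finv (sqs 1 (zz T)) * T i j"

lemma zz_scale:
  assumes f: "\<And>i j. i \<in> I4 \<Longrightarrow> j \<in> I4 \<Longrightarrow> cm (T i j) f" "cm f f"
  shows "zz (\<lambda>i j. f * T i j) = f * fshift 1 f * zz T"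
proof -
  have c: "fshift 1 (f * T i j) * (f * T k l) = f * fshift 1 f * (fshift 1 (T i j) * T k l)"
    if "i \<in> I4" "j \<in> I4" "k \<in> I4" "l \<in> I4" for i j k l
  proof -
    have "fshift 1 f * fshift 1 (T i j) * (f * T k l)
        = fshift 1 f * (fshift 1 (T i j) * f) * T k l" by (simp only: mult.assoc)
    also have "fshift 1 (T i j) * f = f * fshift 1 (T i j)"
      by (rule cm_mult_commute, rule cm_sym, rule cm_closed, rule cm_sym, rule f) (use that in auto)
    also have "fshift 1 f * (f * fshift 1 (T i j)) * T k l = fshift 1 f * f * (fshift 1 (T i j) * T k l)"
      by (simp only: mult.assoc)
    also have "fshift 1 f * f = f * fshift 1 f"
      by (rule cm_mult_commute[OF cm_closed(1)[OF f(2)], symmetric])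
    finally show ?thesis by (simp only: fshift_mult)
  qed
  show ?thesis by (simp add: zz_def c distrib_left)
qed

lemma nrm4_props:
  assumes r: "rtt4 T" and u: "unital I4 T"
  shows "rtt4 (nrm4 T)" "unital I4 (nrm4 T)" "zz (nrm4 T) = 1"
proof -
  let ?f = "finv (sqs 1 (zz T))"
  have c: "cm (T i j) ?f" if "i \<in> I4" "j \<in> I4" for i j
    by (intro cm_closed zz_central r that)
  have qf: "cm (zz T) ?f" by (intro cm_closed zz_self_commute r)
  then have ff: "cm ?f ?f" by (rule cm_closed(3)[OF cm_closed(4)[OF cm_sym]])
  show "rtt4 (nrm4 T)"
    unfolding rtt4_def nrm4_def by (rule rtt_scale[OF r[unfolded rtt4_def] ff cm_sym[OF c] sign_set_I4])
  show "unital I4 (nrm4 T)"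
    using u by (simp add: unital_def nrm4_def)
  have q: "sqs 1 (zz T) * fshift 1 (sqs 1 (zz T)) = zz T"
    by (rule sqs_eq) (rule unital_zz[OF u])
  have "zz (nrm4 T) = ?f * fshift 1 ?f * zz T"
    unfolding nrm4_def by (rule zz_scale[OF c ff])
  also have "fshift 1 ?f = finv (fshift 1 (sqs 1 (zz T)))"
    by (rule fshift_finv) simp
  also have "?f * \<dots> = finv (fshift 1 (sqs 1 (zz T)) * sqs 1 (zz T))"
    by (rule finv_mult[symmetric]) simp_all
  also have "fshift 1 (sqs 1 (zz T)) * sqs 1 (zz T) = zz T"
    using cm_mult_commute[OF cm_closed(1)[OF cm_closed(4)[OF cm_sym[OF cm_closed(4)[OF zz_self_commute[OF r]]]]]] q
    by metis
  finally show "zz (nrm4 T) = 1" by (simp add: finv_left unital_zz[OF u])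
qed

text \<open>\<open>\<complex>\<^sup>4 = \<complex>\<^sup>2 \<otimes> \<complex>\<^sup>2\<close> with basis vectors
  \<open>w\<^sub>2 = v\<^sub>1 \<otimes> v\<^sub>1\<close>, \<open>w\<^sub>1 = v\<^sub>1 \<otimes> v\<^sub>-\<^sub>1\<close>, \<open>w\<^sub>-\<^sub>1 = - v\<^sub>-\<^sub>1 \<otimes> v\<^sub>1\<close>,
  \<open>w\<^sub>-\<^sub>2 = v\<^sub>-\<^sub>1 \<otimes> v\<^sub>-\<^sub>1\<close>; then \<open>R4(x) = R2(x) \<otimes> R2(x)\<close>, since
  \<open>P \<otimes> I + I \<otimes> P = I + P - Q\<close>.\<close>

definition ix1 :: "int \<Rightarrow> int" where "ix1 i = (if i = 2 \<or> i = 1 then 1 else - 1)"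
definition ix2 :: "int \<Rightarrow> int" where "ix2 i = (if i = 2 \<or> i = - 1 then 1 else - 1)"
definition sg :: "int \<Rightarrow> complex" where "sg i = (if i = - 1 then - 1 else 1)"

lemma ix_simps [simp]: "ix1 2 = 1" "ix1 1 = 1" "ix1 (- 1) = - 1" "ix1 (- 2) = - 1"
  "ix2 2 = 1" "ix2 1 = - 1" "ix2 (- 1) = 1" "ix2 (- 2) = - 1"
  "sg 2 = 1" "sg 1 = 1" "sg (- 1) = - 1" "sg (- 2) = 1"
  by (auto simp: ix1_def ix2_def sg_def)

lemma ix_I2 [simp]: "ix1 i \<in> I2" "ix2 i \<in> I2"
  by (auto simp: ix1_def ix2_def)

definition prod4 :: "(int \<Rightarrow> int \<Rightarrow> 'a::calg fps) \<Rightarrow> (int \<Rightarrow> int \<Rightarrow> 'a fps) \<Rightarrow> int \<Rightarrow> int \<Rightarrow> 'a fps" where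
  "prod4 A B i j = (sg i * sg j) \<star> (A (ix1 i) (ix1 j) * B (ix2 i) (ix2 j))"

text \<open>The identity P tensor I + I tensor P = I + P - Q in coordinates. Written for an
  arbitrary function N of the four indices, it serves the row indices as well as the column
  indices.\<close>

lemma P_Q_rows:
  fixes N :: "int \<Rightarrow> int \<Rightarrow> int \<Rightarrow> int \<Rightarrow> 'a::calg"
  assumes "i \<in> I4" "k \<in> I4"
  shows "(sg i * sg k) \<star> (N (ix1 k) (ix1 i) (ix2 i) (ix2 k) + N (ix1 i) (ix1 k) (ix2 k) (ix2 i)) =
    (sg i * sg k) \<star> (N (ix1 i) (ix1 k) (ix2 i) (ix2 k) + N (ix1 k) (ix1 i) (ix2 k) (ix2 i)) -
    (if k = - i then \<Sum>p\<in>I4. (sg p * sg (- p)) \<star> N (ix1 p) (ix1 (- p)) (ix2 p) (ix2 (- p)) else 0)"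
  using assms by (elim I4E) (simp_all add: algebra_simps)

lemma unital_prod4: "unital I2 A \<Longrightarrow> unital I2 B \<Longrightarrow> unital I4 (prod4 A B)"
  unfolding unital_def prod4_def
  by (intro ballI, elim I4E) simp_all

text \<open>The relations of A and B may be multiplied because their coefficients commute. The mixed
  terms with a single permutation are rewritten by \<open>P_Q_rows\<close>, which is where Q
  enters.\<close>

lemma rtt4_prod:
  fixes A B :: "int \<Rightarrow> int \<Rightarrow> 'a::calg fps"
  assumes A: "rtt2 A" and B: "rtt2 B"
    and c: "\<And>i j k l. i \<in> I2 \<Longrightarrow> j \<in> I2 \<Longrightarrow> k \<in> I2 \<Longrightarrow> l \<in> I2 \<Longrightarrow> cm (A i j) (B k l)"
  shows "rtt4 (prod4 A B)"
  unfolding rtt4_def rtt_def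
proof (intro ballI)
  fix i j k l assume ijkl: "i \<in> I4" "j \<in> I4" "k \<in> I4" "l \<in> I4"
  let ?T = "prod4 A B"
  define N where "N = (\<lambda>j l j' l' i k i' k'. uv A i j k l * uv B i' j' k' l')"
  define M where "M = (\<lambda>i k i' k' j l j' l'. vu A k l i j * vu B k' l' i' j')"
  have c1: "U (A i j) * U (B k l) = U (B k l) * U (A i j)" "V (A i j) * U (B k l) = U (B k l) * V (A i j)"
     "U (A i j) * V (B k l) = V (B k l) * U (A i j)" "V (A i j) * V (B k l) = V (B k l) * V (A i j)"
    if "i \<in> I2" "j \<in> I2" "k \<in> I2" "l \<in> I2" for i j k l
  proof -
    note cc = c[OF that]
    show "U (A i j) * V (B k l) = V (B k l) * U (A i j)" using cc by (simp add: cm_iff_UV)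
    show "V (A i j) * U (B k l) = U (B k l) * V (A i j)" using cm_sym[OF cc] by (simp add: cm_iff_UV)
    show "U (A i j) * U (B k l) = U (B k l) * U (A i j)" "V (A i j) * V (B k l) = V (B k l) * V (A i j)"
      using cm_mult_commute[OF cc] by (simp_all flip: alg_homD(2)[OF U_hom] alg_homD(2)[OF V_hom])
  qed
  have uvT: "uv ?T i j k l = (sg i * sg j * (sg k * sg l)) \<star>
      N (ix1 j) (ix1 l) (ix2 j) (ix2 l) (ix1 i) (ix1 k) (ix2 i) (ix2 k)" for i j k l
  proof -
    have "U (A (ix1 i) (ix1 j)) * U (B (ix2 i) (ix2 j)) * (V (A (ix1 k) (ix1 l)) * V (B (ix2 k) (ix2 l)))
      = U (A (ix1 i) (ix1 j)) * (U (B (ix2 i) (ix2 j)) * V (A (ix1 k) (ix1 l))) * V (B (ix2 k) (ix2 l))"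
      by (simp only: mult.assoc)
    also have "\<dots> = uv A (ix1 i) (ix1 j) (ix1 k) (ix1 l) * uv B (ix2 i) (ix2 j) (ix2 k) (ix2 l)"
      by (subst c1(2)[symmetric]) (simp_all only: mult.assoc ix_I2)
    finally show ?thesis
      by (simp add: N_def prod4_def alg_homD[OF U_hom] alg_homD[OF V_hom] cs_mult_left cs_mult_right cs_assoc mult_ac)
  qed
  have vuT: "vu ?T k l i j = (sg i * sg j * (sg k * sg l)) \<star>
      M (ix1 i) (ix1 k) (ix2 i) (ix2 k) (ix1 j) (ix1 l) (ix2 j) (ix2 l)" for i j k l
  proof -
    have "V (A (ix1 k) (ix1 l)) * V (B (ix2 k) (ix2 l)) * (U (A (ix1 i) (ix1 j)) * U (B (ix2 i) (ix2 j)))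
      = V (A (ix1 k) (ix1 l)) * (V (B (ix2 k) (ix2 l)) * U (A (ix1 i) (ix1 j))) * U (B (ix2 i) (ix2 j))"
      by (simp only: mult.assoc)
    also have "\<dots> = vu A (ix1 k) (ix1 l) (ix1 i) (ix1 j) * vu B (ix2 k) (ix2 l) (ix2 i) (ix2 j)"
      by (subst c1(3)[symmetric]) (simp_all only: mult.assoc ix_I2)
    finally show ?thesis
      by (simp add: M_def prod4_def alg_homD[OF U_hom] alg_homD[OF V_hom] cs_mult_left cs_mult_right cs_assoc mult_ac)
  qed
  let ?i1 = "ix1 i" and ?j1 = "ix1 j" and ?k1 = "ix1 k" and ?l1 = "ix1 l"
  let ?i2 = "ix2 i" and ?j2 = "ix2 j" and ?k2 = "ix2 k" and ?l2 = "ix2 l"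
  have rA: "DD * uv A ?i1 ?j1 ?k1 ?l1 - XY * uv A ?k1 ?j1 ?i1 ?l1 =
      DD * vu A ?k1 ?l1 ?i1 ?j1 - XY * vu A ?k1 ?j1 ?i1 ?l1"
    using A unfolding rtt2_iff by (simp add: algebra_simps)
  have rB: "DD * uv B ?i2 ?j2 ?k2 ?l2 - XY * uv B ?k2 ?j2 ?i2 ?l2 =
      DD * vu B ?k2 ?l2 ?i2 ?j2 - XY * vu B ?k2 ?j2 ?i2 ?l2"
    using B unfolding rtt2_iff by (simp add: algebra_simps)
  have exp: "(DD * a - XY * b) * (DD * a' - XY * b') =
      DD * DD * (a * a') - DD * XY * (b * a' + a * b') + XY * XY * (b * b')" for a b a' b' :: "'a fps fps"
  proof -
    have 1: "a * (DD * a') = DD * (a * a')" "a * (XY * b') = XY * (a * b')" 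
      "b * (DD * a') = DD * (b * a')" "b * (XY * b') = XY * (b * b')"
      by (rule commute_left; simp only: DD_commute XY_commute)+
    have 2: "XY * (DD * F) = DD * (XY * F)" for F :: "'a fps fps"
      by (rule commute_left) (rule XY_commute)
    show ?thesis
      by (simp add: left_diff_distrib right_diff_distrib mult.assoc 1 2 distrib_left)
  qed
  \<comment> \<open>On the side where R stands on the left the columns are fixed and R acts on the
    rows; for \<open>cM\<close> it is the other way round.\<close>
  define rN where "rN = N ?j1 ?l1 ?j2 ?l2"
  define cM where "cM = M ?i1 ?k1 ?i2 ?k2"
  have eq: "DD * DD * rN ?i1 ?k1 ?i2 ?k2 - DD * XY * (rN ?k1 ?i1 ?i2 ?k2 + rN ?i1 ?k1 ?k2 ?i2) + XY * XY * rN ?k1 ?i1 ?k2 ?i2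
    = DD * DD * cM ?j1 ?l1 ?j2 ?l2 - DD * XY * (cM ?l1 ?j1 ?j2 ?l2 + cM ?j1 ?l1 ?l2 ?j2) + XY * XY * cM ?l1 ?j1 ?l2 ?j2"
    unfolding rN_def cM_def N_def M_def
    unfolding exp[symmetric] rA rB ..
  let ?s = "sg i * sg j * (sg k * sg l)"
  define qN where "qN = (if k = - i then (sg j * sg l) \<star> (\<Sum>p\<in>I4. (sg p * sg (- p)) \<star> rN (ix1 p) (ix1 (- p)) (ix2 p) (ix2 (- p))) else 0)"
  define qM where "qM = (if l = - j then (sg i * sg k) \<star> (\<Sum>p\<in>I4. (sg p * sg (- p)) \<star> cM (ix1 p) (ix1 (- p)) (ix2 p) (ix2 (- p))) else 0)"
  have rows: "?s \<star> (rN ?k1 ?i1 ?i2 ?k2 + rN ?i1 ?k1 ?k2 ?i2) = ?s \<star> rN ?i1 ?k1 ?i2 ?k2 + ?s \<star> rN ?k1 ?i1 ?k2 ?i2 - qN"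
  proof -
    have "?s = (sg j * sg l) * (sg i * sg k)" by simp
    then have s: "?s \<star> F = (sg j * sg l) \<star> ((sg i * sg k) \<star> F)" for F :: "'a fps fps" by (simp add: cs_assoc mult_ac)
    show ?thesis unfolding s P_Q_rows[OF ijkl(1,3), of rN] qN_def
      by (simp only: cs_diff_right cs_add_right if_distrib[of "\<lambda>x. _ \<star> x"] cs_zero_right)
  qed
  have cols: "?s \<star> (cM ?l1 ?j1 ?j2 ?l2 + cM ?j1 ?l1 ?l2 ?j2) = ?s \<star> cM ?j1 ?l1 ?j2 ?l2 + ?s \<star> cM ?l1 ?j1 ?l2 ?j2 - qM"
  proof -
    have "?s = (sg i * sg k) * (sg j * sg l)" by simp
    then have s: "?s \<star> F = (sg i * sg k) \<star> ((sg j * sg l) \<star> F)" for F :: "'a fps fps" by (simp add: cs_assoc mult_ac)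
    show ?thesis unfolding s P_Q_rows[OF ijkl(2,4), of cM] qM_def
      by (simp only: cs_diff_right cs_add_right if_distrib[of "\<lambda>x. _ \<star> x"] cs_zero_right)
  qed
  have t: "uv ?T i j k l = ?s \<star> rN ?i1 ?k1 ?i2 ?k2" "vu ?T k l i j = ?s \<star> cM ?j1 ?l1 ?j2 ?l2"
    "uv ?T k j i l = ?s \<star> rN ?k1 ?i1 ?k2 ?i2" "vu ?T k j i l = ?s \<star> cM ?l1 ?j1 ?l2 ?j2"
    by (simp_all add: uvT vuT rN_def cM_def mult_ac)
  have tN: "(if k = - i then e4 i \<star> (\<Sum>p\<in>I4. e4 p \<star> uv ?T p j (- p) l) else 0) = qN"
    unfolding qN_def uvT rN_def by (simp add: cs_add_right cs_diff_right cs_assoc mult_ac)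
  have tM: "(if l = - j then e4 j \<star> (\<Sum>p\<in>I4. e4 p \<star> vu ?T k (- p) i p) else 0) = qM"
    unfolding qM_def vuT cM_def by (simp add: cs_add_right cs_diff_right cs_assoc mult_ac)
  have pks: "pk [:0, -1, 1:] = DD * DD - DD * XY" "pk [:1, -1:] = XY * XY - DD * XY" "pk [:0, 1:] = (DD * XY :: 'a fps fps)"
    by (simp_all add: pk_def)
  have "DD * DD * (?s \<star> rN ?i1 ?k1 ?i2 ?k2) - DD * XY * (?s \<star> rN ?i1 ?k1 ?i2 ?k2 + ?s \<star> rN ?k1 ?i1 ?k2 ?i2 - qN) + XY * XY * (?s \<star> rN ?k1 ?i1 ?k2 ?i2)
    = DD * DD * (?s \<star> cM ?j1 ?l1 ?j2 ?l2) - DD * XY * (?s \<star> cM ?j1 ?l1 ?j2 ?l2 + ?s \<star> cM ?l1 ?j1 ?l2 ?j2 - qM) + XY * XY * (?s \<star> cM ?l1 ?j1 ?l2 ?j2)"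
    unfolding rows[symmetric] cols[symmetric] cs_mult_right
    using eq[THEN arg_cong, of "\<lambda>F. ?s \<star> F"] by (simp only: cs_add_right cs_diff_right)
  then show "pk [:0, -1, 1:] * (uv ?T i j k l - vu ?T k l i j) + pk [:1, -1:] * (uv ?T k j i l - vu ?T k j i l) +
     pk [:0, 1:] * ((if k = - i then e4 i \<star> (\<Sum>p\<in>I4. e4 p \<star> uv ?T p j (- p) l) else 0) -
             (if l = - j then e4 j \<star> (\<Sum>p\<in>I4. e4 p \<star> vu ?T k (- p) i p) else 0)) = 0"
    unfolding tN tM t pks
    by (simp only: left_diff_distrib right_diff_distrib distrib_left) (simp add: algebra_simps)
qed

text \<open>The symmetric form on C^4 is the product of the alternating forms on the two factors;
  the sign \<open>sg\<close> of one basis vector is chosen for this.\<close>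

lemma tr_prod4: "i \<in> I4 \<Longrightarrow> j \<in> I4 \<Longrightarrow>
  tr_mat e4 (prod4 A B) i j = prod4 (tr_mat e2 A) (tr_mat e2 B) i j"
  by (elim I4E) (simp_all add: tr_mat_def prod4_def)

lemma prod4_mult:
  assumes ij: "i \<in> I4" "j \<in> I4"
    and c: "\<And>i j k l. i \<in> I2 \<Longrightarrow> j \<in> I2 \<Longrightarrow> k \<in> I2 \<Longrightarrow> l \<in> I2 \<Longrightarrow> B i j * C k l = C k l * B i j"
  shows "(\<Sum>p\<in>I4. prod4 A B i p * prod4 C D p j) =
    prod4 (\<lambda>i j. \<Sum>p\<in>I2. A i p * C p j) (\<lambda>i j. \<Sum>p\<in>I2. B i p * D p j) i j"
proof -
  have m: "A a b * B k l * (C a' b' * D k' l') = A a b * C a' b' * (B k l * D k' l')"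
    if "k \<in> I2" "l \<in> I2" "a' \<in> I2" "b' \<in> I2" for a b k l a' b' k' l'
  proof -
    have "A a b * B k l * (C a' b' * D k' l') = A a b * (B k l * C a' b') * D k' l'" by (simp only: mult.assoc)
    then show ?thesis unfolding c[OF that] by (simp only: mult.assoc)
  qed
  have "(\<Sum>p\<in>I4. prod4 A B i p * prod4 C D p j) = (sg i * sg j) \<star> (\<Sum>p\<in>I4. 
      (A (ix1 i) (ix1 p) * C (ix1 p) (ix1 j)) * (B (ix2 i) (ix2 p) * D (ix2 p) (ix2 j)))"
  proof -
    have s: "sg p * sg j * (sg i * sg p) = sg i * sg j" for p
      by (simp add: sg_def)
    show ?thesis unfolding cs_sum_right
      by (intro sum.cong refl) (simp only: prod4_def cs_mult_left cs_mult_right cs_assoc m ix_I2 s)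
  qed
  also have "\<dots> = prod4 (\<lambda>i j. \<Sum>p\<in>I2. A i p * C p j) (\<lambda>i j. \<Sum>p\<in>I2. B i p * D p j) i j"
    by (simp add: prod4_def distrib_left distrib_right algebra_simps)
  finally show ?thesis .
qed

lemma rtt2_diag_commute:
  assumes "rtt2 T" "i \<in> I2"
  shows "cm (T i i) (T i i)"
proof -
  have "DD * (uv T i i i i - vu T i i i i) = XY * (uv T i i i i - vu T i i i i)"
    using assms unfolding rtt2_iff by blast
  then have "(DD - 1 \<star> XY) * (uv T i i i i - vu T i i i i) = 0"
    by (simp add: left_diff_distrib)
  then have "uv T i i i i - vu T i i i i = 0" by (rule DD_XY_cancel)
  then show ?thesis by (simp add: cm_iff_UV)
qed

text \<open>The two Yangians of \<open>gl\<^sub>2\<close> inside \<open>X(so\<^sub>4)\<close>: if \<open>T = A \<otimes> B\<close> then they are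
  \<open>A b\<^sub>1\<^sub>1\<close> and \<open>a\<^sub>1\<^sub>1 B\<close>.\<close>

definition subL :: "(int \<Rightarrow> int \<Rightarrow> 'a::calg fps) \<Rightarrow> int \<Rightarrow> int \<Rightarrow> 'a fps" where
  "subL T a c = (e2 a * e2 c) \<star> T (if a = 1 then 2 else - 1) (if c = 1 then 2 else - 1)"

definition subR :: "(int \<Rightarrow> int \<Rightarrow> 'a::calg fps) \<Rightarrow> int \<Rightarrow> int \<Rightarrow> 'a fps" where
  "subR T b d = T (if b = 1 then 2 else 1) (if d = 1 then 2 else 1)"

lemma sub_simps [simp]:
  "subL T 1 1 = T 2 2" "subL T 1 (- 1) = - T 2 (- 1)" "subL T (- 1) 1 = - T (- 1) 2"
  "subL T (- 1) (- 1) = T (- 1) (- 1)"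
  "subR T 1 1 = T 2 2" "subR T 1 (- 1) = T 2 1" "subR T (- 1) 1 = T 1 2" "subR T (- 1) (- 1) = T 1 1"
  by (simp_all add: subL_def subR_def)

lemma unital_sub: "unital I4 T \<Longrightarrow> unital I2 (subL T)" "unital I4 T \<Longrightarrow> unital I2 (subR T)"
  unfolding unital_def by (intro ballI; elim I2E; simp)+

text \<open>Without opposite indices the relation is that of Y(2) multiplied by u - v - 1, which can
  be cancelled. The index sets {2, -1} and {2, 1} of \<open>subL\<close> and \<open>subR\<close>
  contain no opposite pair, so both submatrices satisfy the relation of Y(2).\<close>

lemma rtt4_no_Q:
  fixes T :: "int \<Rightarrow> int \<Rightarrow> 'a::calg fps"
  assumes r: "rtt4 T" and ijkl: "i \<in> I4" "j \<in> I4" "k \<in> I4" "l \<in> I4" and n: "k \<noteq> - i" "l \<noteq> - j"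
  shows "DD * (uv T i j k l - vu T k l i j) = XY * (uv T k j i l - vu T k j i l)"
proof -
  let ?A = "uv T i j k l - vu T k l i j" and ?B = "uv T k j i l - vu T k j i l"
  have "pk [:0, -1, 1:] * ?A + pk [:1, -1:] * ?B = 0"
    using rttD[OF r[unfolded rtt4_def] ijkl] n by simp
  moreover have "pk [:0, -1, 1:] * ?A + pk [:1, -1:] * ?B = (DD - 1 \<star> XY) * (DD * ?A - XY * ?B)"
  proof -
    have "pk [:0, -1, 1:] = ((DD - XY) * DD :: 'a fps fps)" "pk [:1, -1:] = (- ((DD - XY) * XY) :: 'a fps fps)"
      by (simp_all add: pk_def DD_commute[of XY] left_diff_distrib)
    then show ?thesis
      by (simp only: cs_one right_diff_distrib[of "DD - XY"] mult.assoc minus_mult_left[symmetric]) simp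
  qed
  ultimately have "DD * ?A - XY * ?B = 0" using DD_XY_cancel by metis
  then show ?thesis by simp
qed

lemma rtt2_sub:
  assumes r: "rtt4 T"
  shows "rtt2 (subL T)" "rtt2 (subR T)"
proof -
  let ?q = "\<lambda>a :: int. if a = 1 then 2 else - 1 :: int"
  have q: "DD * (uv T (?q i) (?q j) (?q k) (?q l) - vu T (?q k) (?q l) (?q i) (?q j)) =
    XY * (uv T (?q k) (?q j) (?q i) (?q l) - vu T (?q k) (?q j) (?q i) (?q l))"
    for i j k l by (rule rtt4_no_Q[OF r]) simp_all
  show "rtt2 (subL T)" unfolding rtt2_iff
  proof (intro ballI)
    fix i j k l
    let ?s = "e2 i * e2 j * (e2 k * e2 l)"
    have "uv (subL T) i j k l = ?s \<star> uv T (?q i) (?q j) (?q k) (?q l)"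
      "vu (subL T) k l i j = ?s \<star> vu T (?q k) (?q l) (?q i) (?q j)"
      "uv (subL T) k j i l = ?s \<star> uv T (?q k) (?q j) (?q i) (?q l)"
      "vu (subL T) k j i l = ?s \<star> vu T (?q k) (?q j) (?q i) (?q l)"
      unfolding subL_def alg_homD(4)[OF U_hom] alg_homD(4)[OF V_hom] cs_mult_left cs_mult_right cs_assoc
      by (simp_all only: mult_ac)
    then show "DD * (uv (subL T) i j k l - vu (subL T) k l i j) = XY * (uv (subL T) k j i l - vu (subL T) k j i l)"
      by (simp only: cs_diff_right[symmetric] cs_mult_right q)
  qed
  show "rtt2 (subR T)" unfolding rtt2_iff subR_def
    by (intro ballI rtt4_no_Q[OF r]) simp_all
qed

section \<open>Coefficients of low level and the commutation of the two factors\<close>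

lemma pk4_nth:
  fixes A B C :: "'a::calg fps fps"
  shows "(pk [:0, -1, 1:] * A + pk [:1, -1:] * B + pk [:0, 1:] * C) $ Suc (Suc n) $ 1 =
    A $ n $ 1 - B $ n $ 0 + C $ n $ 0 - A $ n $ 0 - A $ Suc n $ 0 - A $ Suc n $ 0"
proof -
  have pks: "pk [:0, -1, 1:] = DD * DD - DD * XY" "pk [:1, -1:] = XY * XY - DD * XY" "pk [:0, 1:] = (DD * XY :: 'a fps fps)"
    by (simp_all add: pk_def)
  show ?thesis
    unfolding pks left_diff_distrib mult.assoc fps_add_nth fps_sub_nth DD_mult_nth XY_mult_nth
    by (simp add: algebra_simps)
qed

lemma rtt4_nth:
  assumes r: "rtt4 T" and ijkl: "i \<in> I4" "j \<in> I4" "k \<in> I4" "l \<in> I4" and u: "unital I4 T"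
  shows "T i j $ 1 * T k l $ n - T k l $ n * T i j $ 1 =
      (if k = j then T i l $ n else 0) - (if i = l then T k j $ n else 0)
      - (if k = - i then T (- j) l $ n else 0) + (if l = - j then T k (- i) $ n else 0)"
proof -
  have u: "T i j $ 0 = (if i = j then 1 else 0)" if "i \<in> I4" "j \<in> I4" for i j
    using u that by (simp add: unital_def)
  let ?A = "uv T i j k l - vu T k l i j" and ?B = "uv T k j i l - vu T k j i l"
  let ?C = "(if k = - i then e4 i \<star> (\<Sum>p\<in>I4. e4 p \<star> uv T p j (- p) l) else 0) -
             (if l = - j then e4 j \<star> (\<Sum>p\<in>I4. e4 p \<star> vu T k (- p) i p) else 0)"
  have "(pk [:0, -1, 1:] * ?A + pk [:1, -1:] * ?B + pk [:0, 1:] * ?C) $ Suc (Suc n) $ 1 = 0"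
    unfolding rttD[OF r[unfolded rtt4_def] ijkl] by simp
  then have "?A $ n $ 1 - ?B $ n $ 0 + ?C $ n $ 0 - ?A $ n $ 0 - ?A $ Suc n $ 0 - ?A $ Suc n $ 0 = 0"
    unfolding pk4_nth .
  moreover have "?A $ m $ 0 = 0" for m
    unfolding fps_sub_nth U_V_nth V_U_nth by (simp add: u ijkl)
  moreover have "?B $ n $ 0 = (if k = j then T i l $ n else 0) - (if i = l then T k j $ n else 0)"
    unfolding fps_sub_nth U_V_nth V_U_nth by (simp add: u ijkl)
  moreover have "?C $ n $ 0 = (if k = - i then T (- j) l $ n else 0) - (if l = - j then T k (- i) $ n else 0)"
  proof -
    have "(\<Sum>p\<in>I4. T p j $ 0 * T (- p) l $ n) = T (- j) l $ n"
      using ijkl(2) by (elim I4E) (simp_all add: u)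
    moreover have "(\<Sum>p\<in>I4. T k (- p) $ n * T i p $ 0) = T k (- i) $ n"
      using ijkl(1) by (elim I4E) (simp_all add: u)
    ultimately show ?thesis
      by (simp add: fps_sum_nth U_V_nth V_U_nth del: I4_simps(6))
  qed
  ultimately have "?A $ n $ 1 = ((if k = j then T i l $ n else 0) - (if i = l then T k j $ n else 0))
      - ((if k = - i then T (- j) l $ n else 0) - (if l = - j then T k (- i) $ n else 0))"
    by (simp only: diff_0_right) (simp add: algebra_simps)
  then show ?thesis unfolding fps_sub_nth U_V_nth V_U_nth by (simp only: diff_diff_eq2 diff_add_eq)
qed

lemma fshift_nth_small: "fshift a f $ Suc 0 = f $ Suc 0" "fshift 1 f $ 2 = f $ 2 - f $ Suc 0"
proof -
  show "fshift a f $ Suc 0 = f $ Suc 0" by (simp add: fshift_nth gbinomial_0_left)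
  have "{..2::nat} = {0, 1, 2}" by auto
  then show "fshift 1 f $ 2 = f $ 2 - f $ Suc 0" by (simp add: fshift_nth gbinomial_0_left)
qed

text \<open>The relations for rows 2, 2 and columns -1, 1 or 1, -1 contain the same term in Q. Their
  difference is free of Q and divisible by u - v - 1. In the coefficient taken from the quotient,
  the two commutators between levels 1 and 3 cancel by \<open>rtt4_nth\<close>.\<close>

lemma rtt4_level2:
  fixes T :: "int \<Rightarrow> int \<Rightarrow> 'a::calg fps"
  assumes r: "rtt4 T" and u: "unital I4 T"
  shows "T 2 (- 1) $ 2 * T 2 1 $ 2 - T 2 1 $ 2 * T 2 (- 1) $ 2 =
    (1/2) \<star> (T 2 (- 1) $ 1 * T 2 1 $ 2 - T 2 1 $ 1 * T 2 (- 1) $ 2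
      - T 2 (- 1) $ 2 * T 2 1 $ 1 + T 2 1 $ 2 * T 2 (- 1) $ 1)"
proof -
  let ?A = "uv T 2 (- 1) 2 1" and ?B = "vu T 2 1 2 (- 1)" and ?C = "uv T 2 1 2 (- 1)" and ?D = "vu T 2 (- 1) 2 1"
  let ?Q = "\<Sum>p\<in>I4. vu T 2 (- p) 2 p"
  have 1: "pk [:0, -1, 1:] * (?A - ?B) + pk [:1, -1:] * (?A - ?D) - pk [:0, 1:] * ?Q = 0"
    using rttD[OF r[unfolded rtt4_def], of 2 "- 1" 2 1] by (simp del: I4_simps(6))
  have 2: "pk [:0, -1, 1:] * (?C - ?D) + pk [:1, -1:] * (?C - ?B) - pk [:0, 1:] * ?Q = 0"
    using rttD[OF r[unfolded rtt4_def], of 2 1 2 "- 1"] by (simp del: I4_simps(6))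
  let ?N = "?A - ?C" and ?M = "?D - ?B"
  have pks: "pk [:0, -1, 1:] = ((DD - XY) * DD :: 'a fps fps)" "pk [:1, -1:] = (- ((DD - XY) * XY) :: 'a fps fps)"
    by (simp_all add: pk_def DD_commute[of XY] left_diff_distrib)
  have "(DD - 1 \<star> XY) * (DD * (?N + ?M) - XY * (?N - ?M)) =
      (pk [:0, -1, 1:] * (?A - ?B) + pk [:1, -1:] * (?A - ?D) - pk [:0, 1:] * ?Q) -
      (pk [:0, -1, 1:] * (?C - ?D) + pk [:1, -1:] * (?C - ?B) - pk [:0, 1:] * ?Q)"
    unfolding pks by (simp add: algebra_simps del: I4_simps(6))
  also have "\<dots> = 0" unfolding 1 2 by simp
  finally have "DD * (?N + ?M) - XY * (?N - ?M) = 0" by (rule DD_XY_cancel)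
  then have "(DD * (?N + ?M) - XY * (?N - ?M)) $ 3 $ 2 = 0" by simp
  moreover have "(DD * A - XY * B) $ 3 $ 2 = A $ 2 $ 2 - A $ 3 $ 1 - B $ 2 $ 1" for A B :: "'a fps fps"
    by (simp add: DD_mult_nth XY_mult_nth)
  ultimately have "(?N + ?M) $ 2 $ 2 - (?N + ?M) $ 3 $ 1 - (?N - ?M) $ 2 $ 1 = 0" by metis
  then have "(?N + ?M) $ 2 $ 2 = (?N + ?M) $ 3 $ 1 + (?N - ?M) $ 2 $ 1"
    by (simp only: diff_diff_eq right_minus_eq)
  moreover have "(?N + ?M) $ 3 $ 1 = (T 2 (- 1) $ 1 * T 2 1 $ 3 - T 2 1 $ 3 * T 2 (- 1) $ 1)
      - (T 2 1 $ 1 * T 2 (- 1) $ 3 - T 2 (- 1) $ 3 * T 2 1 $ 1)"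
    unfolding fps_add_nth fps_sub_nth U_V_nth V_U_nth by (simp add: algebra_simps)
  moreover have "\<dots> = 0"
    using rtt4_nth[OF r _ _ _ _ u, of 2 "- 1" 2 1 3] rtt4_nth[OF r _ _ _ _ u, of 2 1 2 "- 1" 3] by simp
  moreover have "(?N + ?M) $ 2 $ 2 = (T 2 (- 1) $ 2 * T 2 1 $ 2 - T 2 1 $ 2 * T 2 (- 1) $ 2) +
      (T 2 (- 1) $ 2 * T 2 1 $ 2 - T 2 1 $ 2 * T 2 (- 1) $ 2)"
    unfolding fps_add_nth fps_sub_nth U_V_nth V_U_nth by (simp add: algebra_simps)
  moreover have "(?N - ?M) $ 2 $ 1 = T 2 (- 1) $ 1 * T 2 1 $ 2 - T 2 1 $ 1 * T 2 (- 1) $ 2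
      - T 2 (- 1) $ 2 * T 2 1 $ 1 + T 2 1 $ 2 * T 2 (- 1) $ 1"
    unfolding fps_add_nth fps_sub_nth U_V_nth V_U_nth by (simp add: algebra_simps)
  ultimately have e: "(T 2 (- 1) $ 2 * T 2 1 $ 2 - T 2 1 $ 2 * T 2 (- 1) $ 2) +
      (T 2 (- 1) $ 2 * T 2 1 $ 2 - T 2 1 $ 2 * T 2 (- 1) $ 2) = T 2 (- 1) $ 1 * T 2 1 $ 2 - T 2 1 $ 1 * T 2 (- 1) $ 2
      - T 2 (- 1) $ 2 * T 2 1 $ 1 + T 2 1 $ 2 * T 2 (- 1) $ 1"
    by simp
  show ?thesis unfolding e[symmetric] half_cs_double ..
qed

lemma zz_nth:
  assumes r: "rtt4 T" and u: "unital I4 T" and z: "zz T = 1" and ij: "i \<in> I4" "j \<in> I4"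
  shows "T i j $ 1 + T (- j) (- i) $ 1 = 0"
    and "T i j $ 2 + T (- j) (- i) $ 2 + (\<Sum>p\<in>I4. T i p $ 1 * T (- j) (- p) $ 1) = T (- j) (- i) $ 1"
proof -
  have u: "T i j $ 0 = (if i = j then 1 else 0)" if "i \<in> I4" "j \<in> I4" for i j
    using u that by (simp add: unital_def)
  have e: "(\<Sum>p\<in>I4. T i p * fshift 1 (T (- j) (- p))) = (if i = j then 1 else 0)"
    using zz_left_right(1)[OF r ij] z by (simp add: tr_mat_def del: I4_simps(6))
  have "(\<Sum>p\<in>I4. T i p * fshift 1 (T (- j) (- p))) $ 1 = 0" unfolding e by simp
  then show "T i j $ 1 + T (- j) (- i) $ 1 = 0"
    unfolding fps_sum_nth fps_mult_nth
    using ij by (elim I4E) (simp_all add: u fshift_nth_small algebra_simps)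
  have s: "{0..2::nat} = {0, 1, 2}" by auto
  have "(\<Sum>p\<in>I4. T i p * fshift 1 (T (- j) (- p))) $ 2 = 0" unfolding e by simp
  then have "T i j $ 2 + (T (- j) (- i) $ 2 - T (- j) (- i) $ 1) + (\<Sum>p\<in>I4. T i p $ 1 * T (- j) (- p) $ 1) = 0"
    unfolding fps_sum_nth fps_mult_nth s
    using ij by (elim I4E) (simp_all add: u fshift_nth_small algebra_simps)
  then show "T i j $ 2 + T (- j) (- i) $ 2 + (\<Sum>p\<in>I4. T i p $ 1 * T (- j) (- p) $ 1) = T (- j) (- i) $ 1"
    by (simp add: algebra_simps del: I4_simps(6))
qed

lemma sqs_nth_1:
  assumes "g $ 0 = 1"
  shows "sqs a g $ 1 = (1/2) \<star> g $ 1"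
proof -
  have "g $ 1 = (sqs a g * fshift a (sqs a g)) $ 1" by (simp only: sqs_eq[OF assms])
  also have "\<dots> = sqs a g $ 1 + sqs a g $ 1"
    by (simp add: fps_mult_nth fshift_nth gbinomial_0_left)
  finally show ?thesis by (simp add: half_cs_double)
qed

lemma nrm_nth:
  assumes u: "unital I2 T" and ij: "i \<in> I2" "j \<in> I2" "i \<noteq> j"
  shows "nrm T i j $ 1 = T i j $ 1"
    and "nrm T i j $ 2 = T i j $ 2 - ((1/2) \<star> (T 1 1 $ 1 + T (- 1) (- 1) $ 1)) * T i j $ 1"
proof -
  have u0: "T i j $ 0 = (if i = j then 1 else 0)" if "i \<in> I2" "j \<in> I2" for i j
    using u that by (simp add: unital_def)
  have s: "{0..2::nat} = {0, 1, 2}" by auto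
  let ?d = "sqs (- 1) (qd T)"
  have "(?d * finv ?d) $ 1 = 0" by (simp add: finv_right)
  then have 1: "finv ?d $ Suc 0 = - (?d $ Suc 0)"
    by (simp add: fps_mult_nth eq_neg_iff_add_eq_0)
  have "?d $ 1 = (1/2) \<star> qd T $ 1" by (rule sqs_nth_1[OF unital_qd[OF u]])
  also have "qd T $ 1 = T 1 1 $ 1 + T (- 1) (- 1) $ 1"
    by (simp add: qd_def fps_mult_nth fshift_nth gbinomial_0_left u0)
  finally have 2: "?d $ Suc 0 = (1/2) \<star> (T 1 1 $ 1 + T (- 1) (- 1) $ 1)" by simp
  show "nrm T i j $ 1 = T i j $ 1"
    using ij by (simp add: nrm_def fps_mult_nth u0)
  show "nrm T i j $ 2 = T i j $ 2 - ((1/2) \<star> (T 1 1 $ 1 + T (- 1) (- 1) $ 1)) * T i j $ 1"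
    using ij by (simp add: nrm_def fps_mult_nth u0 s 1 2)
qed

text \<open>The relations are oriented so that rewriting brings both sides to the same normal form.
  In the application F', F'' and G', G'' are the entries (2, -1), (2, 1) at levels 1 and 2, while
  \<open>\<alpha>\<close> and \<open>\<beta>\<close> are half the level-one traces of
  \<open>subR\<close> and \<open>subL\<close>, which enter through the division by d.\<close>

lemma so4_commute_level2:
  fixes F' F'' G' G'' H \<alpha> \<beta> :: "'a::ring_1"
  assumes FF: "F'' * F' = F' * F''"
    and a: "F' * \<alpha> = \<alpha> * F' - F'" "F'' * \<alpha> = \<alpha> * F''" "G' * \<alpha> = \<alpha> * G' - G'" "G'' * \<alpha> = \<alpha> * G''"
    and b: "F'' * \<beta> = \<beta> * F'' - F''" "F' * \<beta> = \<beta> * F'" "G'' * \<beta> = \<beta> * G'' - G''" "G' * \<beta> = \<beta> * G'"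
    and ab: "\<beta> * \<alpha> = \<alpha> * \<beta>"
    and G: "G'' * F' = F' * G'' + F' * F''" "G' * F'' = F'' * G' + F' * F''"
      "G' * G'' = G'' * G' + F' * G'' - F'' * G'"
  shows "(G' - \<beta> * F') * (G'' - \<alpha> * F'') = (G'' - \<alpha> * F'') * (G' - \<beta> * F')"
proof -
  have l: "x * (y * z) = w * z" if "x * y = w" for x y z w :: 'a
    using that by (metis mult.assoc)
  show ?thesis
    by (simp add: left_diff_distrib right_diff_distrib distrib_left distrib_right mult.assoc
        FF a b ab G FF[THEN l] a[THEN l] b[THEN l] ab[THEN l] G[THEN l])
qed

text \<open>It suffices to commute \<open>e\<^sub>0, f\<^sub>0, e\<^sub>1\<close> of one factor with
  those of the other.\<close>

lemma nrm_sub_commute: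
  assumes r: "rtt4 T" and u: "unital I4 T" and z: "zz T = 1"
    and ijkl: "i \<in> I2" "j \<in> I2" "k \<in> I2" "l \<in> I2"
  shows "cm (nrm (subL T) i j) (nrm (subR T) k l)"
proof -
  note c = rtt4_nth[OF r _ _ _ _ u]
  note z1 = zz_nth(1)[OF r u z]
  note z2 = zz_nth(2)[OF r u z]
  let ?F = "\<lambda>i j. T i j $ 1" and ?G = "\<lambda>i j. T i j $ 2"
  let ?L = "nrm (subL T)" and ?R = "nrm (subR T)"
  \<comment> \<open>At level 1 the antidiagonal entries equal their own negatives.\<close>
  have F0: "?F 2 (- 2) = 0" "?F (- 2) 2 = 0" "?F 1 (- 1) = 0" "?F (- 1) 1 = 0"
    using z1[of 2 "-2"] z1[of "-2" 2] z1[of 1 "-1"] z1[of "-1" 1] by (simp_all add: double_eq_zero_iff)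
  have F1: "?F (- 1) (- 1) = - ?F 1 1" "?F 1 (- 2) = - ?F 2 (- 1)" "?F (- 1) (- 2) = - ?F 2 1"
    "?F (- 2) 1 = - ?F (- 1) 2" "?F (- 2) (- 1) = - ?F 1 2"
    using z1[of "-1" "-1"] z1[of 1 "-2"] z1[of "-1" "-2"] z1[of "-2" 1] z1[of "-2" "-1"]
    by (simp_all add: eq_neg_iff_add_eq_0)
  define \<alpha> where "\<alpha> = (1/2) \<star> (?F 2 2 + ?F 1 1)"
  define \<beta> where "\<beta> = (1/2) \<star> (?F 2 2 - ?F 1 1)"
  have h: "(1/2) \<star> (x + x) = x" "(1/2) \<star> (- x - x) = - x" for x :: 'a
  proof -
    show "(1/2) \<star> (x + x) = x" by (rule half_cs_double)
    have "(1/2) \<star> (- x - x) = - ((1/2) \<star> (x + x))" by (simp add: cs_diff_right cs_add_right)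
    then show "(1/2) \<star> (- x - x) = - x" by (simp only: half_cs_double)
  qed
  have Le: "?L 1 (- 1) $ 1 = - ?F 2 (- 1)" "?L (- 1) 1 $ 1 = - ?F (- 1) 2" 
    "?L 1 (- 1) $ 2 = - (?G 2 (- 1) - \<beta> * ?F 2 (- 1))"
    using nrm_nth[OF unital_sub(1)[OF u], of 1 "-1"] nrm_nth[OF unital_sub(1)[OF u], of "-1" 1] F1
    by (simp_all add: \<beta>_def)
  have Re: "?R 1 (- 1) $ 1 = ?F 2 1" "?R (- 1) 1 $ 1 = ?F 1 2" 
    "?R 1 (- 1) $ 2 = ?G 2 1 - \<alpha> * ?F 2 1"
    using nrm_nth[OF unital_sub(2)[OF u], of 1 "-1"] nrm_nth[OF unital_sub(2)[OF u], of "-1" 1] F1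
    by (simp_all add: \<alpha>_def)
  have FF: "?F 2 1 * ?F 2 (- 1) = ?F 2 (- 1) * ?F 2 1" "?F 1 2 * ?F 2 (- 1) = ?F 2 (- 1) * ?F 1 2"
    "?F 2 1 * ?F (- 1) 2 = ?F (- 1) 2 * ?F 2 1" "?F 1 2 * ?F (- 1) 2 = ?F (- 1) 2 * ?F 1 2"
    using c[of 2 "-1" 2 1 1] c[of 2 "-1" 1 2 1] c[of "-1" 2 2 1 1] c[of "-1" 2 1 2 1] F0 by simp_all
  have half: "X * \<alpha> - \<alpha> * X = (1/2) \<star> ((X * ?F 2 2 - ?F 2 2 * X) + (X * ?F 1 1 - ?F 1 1 * X))"
    "X * \<beta> - \<beta> * X = (1/2) \<star> ((X * ?F 2 2 - ?F 2 2 * X) - (X * ?F 1 1 - ?F 1 1 * X))" for X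
    by (simp_all add: \<alpha>_def \<beta>_def cs_mult_left cs_mult_right algebra_simps cs_add_right cs_diff_right)
  have ca: "?F 2 (- 1) * \<alpha> - \<alpha> * ?F 2 (- 1) = - ?F 2 (- 1)" "?F 2 1 * \<alpha> - \<alpha> * ?F 2 1 = 0"
    "?F (- 1) 2 * \<alpha> - \<alpha> * ?F (- 1) 2 = ?F (- 1) 2"
    unfolding half
    using c[of 2 "-1" 2 2 1] c[of 2 "-1" 1 1 1] c[of 2 1 2 2 1] c[of 2 1 1 1 1] c[of "-1" 2 2 2 1] c[of "-1" 2 1 1 1]
    by (simp_all add: F0 F1[simplified] h)
  have cb: "?F 2 1 * \<beta> - \<beta> * ?F 2 1 = - ?F 2 1" "?F 2 (- 1) * \<beta> - \<beta> * ?F 2 (- 1) = 0"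
    "?F 1 2 * \<beta> - \<beta> * ?F 1 2 = ?F 1 2"
    unfolding half
    using c[of 2 "-1" 2 2 1] c[of 2 "-1" 1 1 1] c[of 2 1 2 2 1] c[of 2 1 1 1 1] c[of 1 2 2 2 1] c[of 1 2 1 1 1]
    by (simp_all add: F0 F1[simplified] h)
  \<comment> \<open>At level 2 the condition z = 1 expresses antidiagonal entries through products
    of level-one entries. These antidiagonal entries are the values of the commutators in
    \<open>FG\<close>.\<close>
  have G2: "?G 2 (- 2) = - (?F 2 (- 1) * ?F 2 1)"
  proof -
    have "(?G 2 (- 2) + ?F 2 (- 1) * ?F 2 1) + (?G 2 (- 2) + ?F 2 (- 1) * ?F 2 1) = 0"
      using z2[of 2 "-2"] F0 FF(1) by (simp add: algebra_simps)
    then have "?G 2 (- 2) + ?F 2 (- 1) * ?F 2 1 = 0" by (simp only: double_eq_zero_iff)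
    then show ?thesis by (simp add: eq_neg_iff_add_eq_0)
  qed
  have G1: "?G (- 1) 1 = ?F (- 1) 2 * ?F 2 1"
  proof -
    have "(?G (- 1) 1 - ?F (- 1) 2 * ?F 2 1) + (?G (- 1) 1 - ?F (- 1) 2 * ?F 2 1) = 0"
      using z2[of "-1" 1] F0 F1 FF(3) by (simp add: algebra_simps)
    then have "?G (- 1) 1 - ?F (- 1) 2 * ?F 2 1 = 0" by (simp only: double_eq_zero_iff)
    then show ?thesis by simp
  qed
  have G3: "?G 1 (- 1) = ?F 2 (- 1) * ?F 1 2"
  proof -
    have "(?G 1 (- 1) - ?F 2 (- 1) * ?F 1 2) + (?G 1 (- 1) - ?F 2 (- 1) * ?F 1 2) = 0"
      using z2[of 1 "-1"] F0 F1 FF(2) by (simp add: algebra_simps)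
    then have "?G 1 (- 1) - ?F 2 (- 1) * ?F 1 2 = 0" by (simp only: double_eq_zero_iff)
    then show ?thesis by simp
  qed
  have FG: "?F 2 (- 1) * ?G 2 1 - ?G 2 1 * ?F 2 (- 1) = ?G 2 (- 2)"
    "?F 2 1 * ?G 2 (- 1) - ?G 2 (- 1) * ?F 2 1 = ?G 2 (- 2)"
    "?F (- 1) 2 * ?G 2 1 - ?G 2 1 * ?F (- 1) 2 = ?G (- 1) 1"
    "?F 1 2 * ?G 2 (- 1) - ?G 2 (- 1) * ?F 1 2 = ?G 1 (- 1)"
    using c[of 2 "-1" 2 1 2] c[of 2 1 2 "-1" 2] c[of "-1" 2 2 1 2] c[of 1 2 2 "-1" 2] by simp_all
  have half': "\<alpha> * X - X * \<alpha> = (1/2) \<star> ((?F 2 2 * X - X * ?F 2 2) + (?F 1 1 * X - X * ?F 1 1))"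
    "\<beta> * X - X * \<beta> = (1/2) \<star> ((?F 2 2 * X - X * ?F 2 2) - (?F 1 1 * X - X * ?F 1 1))" for X
    by (simp_all add: \<alpha>_def \<beta>_def cs_mult_left cs_mult_right algebra_simps cs_add_right cs_diff_right)
  have cG: "\<alpha> * ?G 2 (- 1) - ?G 2 (- 1) * \<alpha> = ?G 2 (- 1)" "\<alpha> * ?G 2 1 - ?G 2 1 * \<alpha> = 0"
    "\<beta> * ?G 2 1 - ?G 2 1 * \<beta> = ?G 2 1" "\<beta> * ?G 2 (- 1) - ?G 2 (- 1) * \<beta> = 0"
    unfolding half'
    using c[of 2 2 2 "-1" 2] c[of 1 1 2 "-1" 2] c[of 2 2 2 1 2] c[of 1 1 2 1 2] by (simp_all add: h)
  have ab: "\<beta> * \<alpha> = \<alpha> * \<beta>"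
    using c[of 2 2 1 1 1]
    by (simp add: \<alpha>_def \<beta>_def cs_mult_left cs_mult_right algebra_simps cs_add_right cs_diff_right)
  have sw: "x * y = z + y * x" if "x * y - y * x = z" for x y z :: 'a
    using that by (simp add: algebra_simps)
  have sw': "y * x = x * y - z" if "x * y - y * x = z" for x y z :: 'a
    using that by (simp add: algebra_simps)
  note FG' = FG[unfolded G1 G2 G3]
  have GG: "?G 2 (- 1) * ?G 2 1 = ?G 2 1 * ?G 2 (- 1) + ?F 2 (- 1) * ?G 2 1 - ?F 2 1 * ?G 2 (- 1)"
  proof -
    let ?Z = "?F 2 (- 1) * ?G 2 1 - ?F 2 1 * ?G 2 (- 1)"
    have "?F 2 (- 1) * ?G 2 1 - ?F 2 1 * ?G 2 (- 1) - ?G 2 (- 1) * ?F 2 1 + ?G 2 1 * ?F 2 (- 1) = ?Z + ?Z"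
      unfolding sw'[OF FG'(1)] sw'[OF FG'(2)] by (simp add: algebra_simps)
    then have "?G 2 (- 1) * ?G 2 1 - ?G 2 1 * ?G 2 (- 1) = ?Z"
      unfolding rtt4_level2[OF r u] by (simp only: half_cs_double)
    then show ?thesis by (simp add: algebra_simps)
  qed
  have main: "(?G 2 (- 1) - \<beta> * ?F 2 (- 1)) * (?G 2 1 - \<alpha> * ?F 2 1) =
      (?G 2 1 - \<alpha> * ?F 2 1) * (?G 2 (- 1) - \<beta> * ?F 2 (- 1))"
    by (rule so4_commute_level2)
      (use FF(1) GG ab sw[OF ca(1)] sw[OF ca(2)] sw'[OF cG(1)] sw'[OF cG(2)] sw[OF cb(1)] sw[OF cb(2)]
        sw'[OF cG(3)] sw'[OF cG(4)] sw'[OF FG'(1)] sw'[OF FG'(2)] in simp_all)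
  have FGa: "?F 2 (- 1) * (?G 2 1 - \<alpha> * ?F 2 1) = (?G 2 1 - \<alpha> * ?F 2 1) * ?F 2 (- 1)"
    "?F (- 1) 2 * (?G 2 1 - \<alpha> * ?F 2 1) = (?G 2 1 - \<alpha> * ?F 2 1) * ?F (- 1) 2"
  proof -
    have *: "X * (?G 2 1 - \<alpha> * ?F 2 1) = (?G 2 1 - \<alpha> * ?F 2 1) * X"
      if "X * ?G 2 1 - ?G 2 1 * X = (X * \<alpha> - \<alpha> * X) * ?F 2 1" "?F 2 1 * X = X * ?F 2 1" for X
    proof -
      have "X * (?G 2 1 - \<alpha> * ?F 2 1) - (?G 2 1 - \<alpha> * ?F 2 1) * X =
        (X * ?G 2 1 - ?G 2 1 * X) - (X * \<alpha> * ?F 2 1 - \<alpha> * (?F 2 1 * X))"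
        by (simp add: algebra_simps)
      also have "\<dots> = (X * ?G 2 1 - ?G 2 1 * X) - (X * \<alpha> - \<alpha> * X) * ?F 2 1"
        unfolding that(2) by (simp add: algebra_simps)
      finally show ?thesis using that(1) by simp
    qed
    show "?F 2 (- 1) * (?G 2 1 - \<alpha> * ?F 2 1) = (?G 2 1 - \<alpha> * ?F 2 1) * ?F 2 (- 1)"
      by (rule *) (simp_all only: FF FG' ca mult_minus_left)
    show "?F (- 1) 2 * (?G 2 1 - \<alpha> * ?F 2 1) = (?G 2 1 - \<alpha> * ?F 2 1) * ?F (- 1) 2"
      by (rule *) (simp_all only: FF FG' ca)
  qed
  have FGb: "?F 2 1 * (?G 2 (- 1) - \<beta> * ?F 2 (- 1)) = (?G 2 (- 1) - \<beta> * ?F 2 (- 1)) * ?F 2 1"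
    "?F 1 2 * (?G 2 (- 1) - \<beta> * ?F 2 (- 1)) = (?G 2 (- 1) - \<beta> * ?F 2 (- 1)) * ?F 1 2"
  proof -
    have *: "X * (?G 2 (- 1) - \<beta> * ?F 2 (- 1)) = (?G 2 (- 1) - \<beta> * ?F 2 (- 1)) * X"
      if "X * ?G 2 (- 1) - ?G 2 (- 1) * X = (X * \<beta> - \<beta> * X) * ?F 2 (- 1)" "X * ?F 2 (- 1) = ?F 2 (- 1) * X" for X
    proof -
      have "X * (?G 2 (- 1) - \<beta> * ?F 2 (- 1)) - (?G 2 (- 1) - \<beta> * ?F 2 (- 1)) * X =
        (X * ?G 2 (- 1) - ?G 2 (- 1) * X) - (X * \<beta> * ?F 2 (- 1) - \<beta> * (?F 2 (- 1) * X))"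
        by (simp add: algebra_simps)
      also have "\<dots> = (X * ?G 2 (- 1) - ?G 2 (- 1) * X) - (X * \<beta> - \<beta> * X) * ?F 2 (- 1)"
        unfolding that(2)[symmetric] by (simp add: algebra_simps)
      finally show ?thesis using that(1) by simp
    qed
    show "?F 2 1 * (?G 2 (- 1) - \<beta> * ?F 2 (- 1)) = (?G 2 (- 1) - \<beta> * ?F 2 (- 1)) * ?F 2 1"
      by (rule *) (simp_all only: FF FG' cb mult_minus_left)
    show "?F 1 2 * (?G 2 (- 1) - \<beta> * ?F 2 (- 1)) = (?G 2 (- 1) - \<beta> * ?F 2 (- 1)) * ?F 1 2"
      by (rule *) (simp_all only: FF FG' cb)
  qed
  define GL where "GL = {?L 1 (- 1) $ 1, ?L (- 1) 1 $ 1, ?L 1 (- 1) $ 2}"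
  define GR where "GR = {?R 1 (- 1) $ 1, ?R (- 1) 1 $ 1, ?R 1 (- 1) $ 2}"
  have gens: "x * y = y * x" if "x \<in> GL" "y \<in> GR" for x y
    using that unfolding GL_def GR_def Le Re
    by (elim insertE emptyE) (simp_all only: mult_minus_left mult_minus_right FF FGa FGb main)
  note nL = nrm_props[OF rtt2_sub(1)[OF r] unital_sub(1)[OF u]]
  note nR = nrm_props[OF rtt2_sub(2)[OF r] unital_sub(2)[OF u]]
  \<comment> \<open>Centralizers are subalgebras, so \<open>rtt2_generated\<close> applies twice:
    the left factor commutes with the three generators of the right one, and then the whole right
    factor commutes with the left one.\<close>
  have L: "?L i j $ n \<in> {x. \<forall>y\<in>GR. x * y = y * x}" for n
    by (rule rtt2_generated[OF nL subalg_centralizer]) (use gens ijkl in \<open>auto simp: GL_def\<close>)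
  let ?C = "{x. \<forall>y\<in>range (\<lambda>n. ?L i j $ n). x * y = y * x}"
  have g: "y \<in> ?C" if "y \<in> GR" for y
    using L that by auto
  have R: "?R k l $ n \<in> ?C" for n
    by (rule rtt2_generated[OF nR subalg_centralizer g g g ijkl(3,4)]) (simp_all add: GR_def)
  then show ?thesis by (auto simp: cm_def)
qed

text \<open>Modulo lower coefficients the two submatrices give their off-diagonal entries and the
  differences T_22 - T_-1,-1 and T_22 - T_11, while z = 1 gives all sums T_ij + T_-j,-i. Together
  these determine every entry. The normalizing series of the submatrices are carried along in the
  induction, since they are not known to lie in S beforehand.\<close>

lemma rtt4_generated:
  assumes r: "rtt4 T" and u: "unital I4 T" and z: "zz T = 1" and S: "subalg S"
    and gens: "\<And>i j n. i \<in> I2 \<Longrightarrow> j \<in> I2 \<Longrightarrow> nrm (subL T) i j $ n \<in> S"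
      "\<And>i j n. i \<in> I2 \<Longrightarrow> j \<in> I2 \<Longrightarrow> nrm (subR T) i j $ n \<in> S"
    and ij: "i \<in> I4" "j \<in> I4"
  shows "T i j $ n \<in> S"
proof -
  note s = subalgD[OF S]
  have u0: "T i j $ 0 = (if i = j then 1 else 0)" if "i \<in> I4" "j \<in> I4" for i j
    using u that by (simp add: unital_def)
  let ?dL = "sqs (- 1) (qd (subL T))" and ?dR = "sqs (- 1) (qd (subR T))"
  have eq: "subL T i j = ?dL * nrm (subL T) i j" "subR T i j = ?dR * nrm (subR T) i j" for i j
    by (simp_all add: nrm_def finv_right flip: mult.assoc)
  have n0: "nrm (subL T) i j $ 0 = (if i = j then 1 else 0)" "nrm (subR T) i j $ 0 = (if i = j then 1 else 0)"
    if "i \<in> I2" "j \<in> I2" for i j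
    using nrm_props(2)[OF rtt2_sub(1)[OF r] unital_sub(1)[OF u]]
      nrm_props(2)[OF rtt2_sub(2)[OF r] unital_sub(2)[OF u]] that by (auto simp: unital_def)
  have dbl: "x \<in> S" if "x + x \<in> S" for x using subalg_double[OF S that] .
  have "\<forall>k\<le>n. ?dL $ k \<in> S \<and> ?dR $ k \<in> S \<and> (\<forall>i\<in>I4. \<forall>j\<in>I4. T i j $ k \<in> S)"
  proof (induction n)
    case 0
    then show ?case using s by (auto simp: u0)
  next
    case (Suc m)
    define n where "n = Suc m"
    have n: "n \<ge> 1" by (simp add: n_def)
    have lower: "?dL $ k \<in> S" "?dR $ k \<in> S" "\<And>i j. i \<in> I4 \<Longrightarrow> j \<in> I4 \<Longrightarrow> T i j $ k \<in> S" if "k < n" for k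
      using Suc that by (auto simp: n_def)
    have L: "subL T i j $ n - (if i = j then ?dL $ n else 0) \<in> S" if "i \<in> I2" "j \<in> I2" for i j
    proof -
      have "subL T i j $ n - (?dL $ 0 * nrm (subL T) i j $ n + ?dL $ n * nrm (subL T) i j $ 0) \<in> S"
        by (subst eq(1)) (rule mult_nth_mod[OF S n], use lower gens that in auto)
      from s(3)[OF this gens(1)[OF that, of n]] show ?thesis by (simp add: n0 that algebra_simps split: if_splits)
    qed
    have R: "subR T i j $ n - (if i = j then ?dR $ n else 0) \<in> S" if "i \<in> I2" "j \<in> I2" for i j
    proof -
      have "subR T i j $ n - (?dR $ 0 * nrm (subR T) i j $ n + ?dR $ n * nrm (subR T) i j $ 0) \<in> S"
        by (subst eq(2)) (rule mult_nth_mod[OF S n], use lower gens that in auto)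
      from s(3)[OF this gens(2)[OF that, of n]] show ?thesis by (simp add: n0 that algebra_simps split: if_splits)
    qed
    have Z: "T i j $ n + T (- j) (- i) $ n \<in> S" if ij: "i \<in> I4" "j \<in> I4" for i j
    proof -
      have e: "(\<Sum>p\<in>I4. T i p * fshift 1 (T (- j) (- p))) = (if i = j then 1 else 0)"
        using zz_left_right(1)[OF r ij] z by (simp add: tr_mat_def del: I4_simps(6))
      have "(T i p * fshift 1 (T (- j) (- p))) $ n -
          ((if i = p then T (- j) (- p) $ n else 0) + (if j = p then T i p $ n else 0)) \<in> S" if p: "p \<in> I4" for p
      proof -
        have a: "(T i p * fshift 1 (T (- j) (- p))) $ n - (T i p $ 0 * fshift 1 (T (- j) (- p)) $ n
            + T i p $ n * fshift 1 (T (- j) (- p)) $ 0) \<in> S"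
          by (rule mult_nth_mod[OF S n]) (use lower ij p in \<open>auto simp: fshift_nth intro!: s\<close>)
        have b: "fshift 1 (T (- j) (- p)) $ n - T (- j) (- p) $ n \<in> S"
          by (rule fshift_nth_mod[OF S]) (use lower ij p in auto)
        show ?thesis
        proof (cases "i = p")
          case True
          show ?thesis using s(3)[OF a b] True ij p by (simp add: u0 algebra_simps split: if_splits)
        next
          case False
          show ?thesis using a False ij p by (simp add: u0 algebra_simps split: if_splits)
        qed
      qed
      then have "(\<Sum>p\<in>I4. (T i p * fshift 1 (T (- j) (- p))) $ n -
          ((if i = p then T (- j) (- p) $ n else 0) + (if j = p then T i p $ n else 0))) \<in> S"
        by (rule s(8))
      also have "(\<Sum>p\<in>I4. (T i p * fshift 1 (T (- j) (- p))) $ n -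
          ((if i = p then T (- j) (- p) $ n else 0) + (if j = p then T i p $ n else 0))) =
          (\<Sum>p\<in>I4. T i p * fshift 1 (T (- j) (- p))) $ n - (T (- j) (- i) $ n + T i j $ n)"
        using ij by (simp add: sum_subtractf sum.distrib fps_sum_nth sum.delta' I4_def del: I4_simps(6))
      also have "\<dots> = - (T i j $ n + T (- j) (- i) $ n)"
        using n unfolding e by simp
      finally have m: "- (T i j $ n + T (- j) (- i) $ n) \<in> S" .
      show ?thesis using s(6)[OF m] by (simp only: minus_minus)
    qed
    have off: "T 2 (- 1) $ n \<in> S" "T (- 1) 2 $ n \<in> S" "T 2 1 $ n \<in> S" "T 1 2 $ n \<in> S"
      using L[of 1 "-1"] L[of "-1" 1] R[of 1 "-1"] R[of "-1" 1] s(6)[of "- T 2 (- 1) $ n"] s(6)[of "- T (- 1) 2 $ n"] by simp_all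
    have d1: "T 2 2 $ n - T (- 1) (- 1) $ n \<in> S" "T 2 2 $ n - T 1 1 $ n \<in> S"
      using s(7)[OF L[of 1 1] L[of "-1" "-1"]] s(7)[OF R[of 1 1] R[of "-1" "-1"]] by simp_all
    have "(T 2 2 $ n - T (- 1) (- 1) $ n) + (T 2 2 $ n - T 1 1 $ n) + (T 1 1 $ n + T (- 1) (- 1) $ n) \<in> S"
      by (rule s(3)[OF s(3)[OF d1]]) (use Z[of 1 1] in simp)
    then have "T 2 2 $ n + T 2 2 $ n \<in> S" by (simp add: algebra_simps)
    then have t22: "T 2 2 $ n \<in> S" by (rule dbl)
    have off': "T i j $ n \<in> S" if "T (- j) (- i) $ n \<in> S" "i \<in> I4" "j \<in> I4" for i j
      using s(7)[OF Z[OF that(2,3)] that(1)] by simp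
    have t11: "T 1 1 $ n \<in> S" "T (- 1) (- 1) $ n \<in> S"
      using s(7)[OF t22 d1(2)] s(7)[OF t22 d1(1)] by simp_all
    have "T 2 (- 2) $ n + T 2 (- 2) $ n \<in> S" "T (- 2) 2 $ n + T (- 2) 2 $ n \<in> S"
      "T 1 (- 1) $ n + T 1 (- 1) $ n \<in> S" "T (- 1) 1 $ n + T (- 1) 1 $ n \<in> S"
      using Z[of 2 "-2"] Z[of "-2" 2] Z[of 1 "-1"] Z[of "-1" 1] by simp_all
    note sd = this[THEN dbl]
    have o2: "T 1 (- 2) $ n \<in> S" "T (- 2) 1 $ n \<in> S" "T (- 1) (- 2) $ n \<in> S" "T (- 2) (- 1) $ n \<in> S" "T (- 2) (- 2) $ n \<in> S"
      using off'[of 1 "-2"] off'[of "-2" 1] off'[of "-1" "-2"] off'[of "-2" "-1"] off'[of "-2" "-2"] off t22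
      by simp_all
    have all: "\<forall>i\<in>I4. \<forall>j\<in>I4. T i j $ n \<in> S"
      using off t11 t22 sd o2 by (auto simp: I4_def)
    moreover have "?dL $ n \<in> S" "?dR $ n \<in> S"
      using s(7)[OF t22 L[of 1 1]] s(7)[OF t22 R[of 1 1]] by simp_all
    ultimately show ?case using Suc by (auto simp: le_Suc_eq n_def)
  qed
  then show ?thesis using ij by auto
qed

lemma sub_prod4:
  assumes "i \<in> I2" "j \<in> I2"
  shows "subL (prod4 A B) i j = A i j * B 1 1" "subR (prod4 A B) i j = A 1 1 * B i j"
  using assms by (elim I2E; simp add: subL_def prod4_def)+

lemma qd_cong: "(\<And>i j. i \<in> I2 \<Longrightarrow> j \<in> I2 \<Longrightarrow> A i j = B i j) \<Longrightarrow> qd A = qd B"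
  by (simp add: qd_def)

text \<open>In the product of A and B the submatrices are b_11 A and a_11 B. Their determinants are
  b_11(u) b_11(u - 1) and a_11(u) a_11(u - 1), so normalization removes exactly the scalar factor.
  That b_11 and a_11 commute with themselves comes from \<open>rtt2_diag_commute\<close>.\<close>

lemma nrm_sub_prod4:
  assumes A: "rtt2 A" "unital I2 A" "qd A = 1" and B: "rtt2 B" "unital I2 B" "qd B = 1"
    and c: "\<And>i j k l. i \<in> I2 \<Longrightarrow> j \<in> I2 \<Longrightarrow> k \<in> I2 \<Longrightarrow> l \<in> I2 \<Longrightarrow> cm (A i j) (B k l)"
    and ij: "i \<in> I2" "j \<in> I2"
  shows "nrm (subL (prod4 A B)) i j = A i j" "nrm (subR (prod4 A B)) i j = B i j"
proof -
  have main: "finv (sqs (- 1) (qd (\<lambda>i j. f * C i j))) * (f * C i j) = C i j"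
    if C: "rtt2 C" "unital I2 C" "qd C = 1" and f: "cm f f" "f $ 0 = 1" "\<And>i j. i \<in> I2 \<Longrightarrow> j \<in> I2 \<Longrightarrow> cm (C i j) f"
    for f and C :: "int \<Rightarrow> int \<Rightarrow> 'a fps"
  proof -
    have "qd (\<lambda>i j. f * C i j) = f * fshift (- 1) f"
      using qd_scale[OF f(3,1)] C(3) by simp
    then have "sqs (- 1) (qd (\<lambda>i j. f * C i j)) = f" by (intro sqs_eqI f) simp
    then show ?thesis by (simp add: finv_left f flip: mult.assoc)
  qed
  have "A 1 1 $ 0 = 1" "B 1 1 $ 0 = 1" using A B by (auto simp: unital_def)
  note d = rtt2_diag_commute[OF A(1), of 1] rtt2_diag_commute[OF B(1), of 1]
  have L: "subL (prod4 A B) i j = B 1 1 * A i j" if "i \<in> I2" "j \<in> I2" for i j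
    using cm_mult_commute[OF c[OF that, of 1 1]] by (simp add: sub_prod4 that)
  have R: "subR (prod4 A B) i j = A 1 1 * B i j" if "i \<in> I2" "j \<in> I2" for i j
    by (simp add: sub_prod4 that)
  have "qd (subL (prod4 A B)) = qd (\<lambda>i j. B 1 1 * A i j)" "qd (subR (prod4 A B)) = qd (\<lambda>i j. A 1 1 * B i j)"
    by (rule qd_cong; simp add: L R)+
  then show "nrm (subL (prod4 A B)) i j = A i j" "nrm (subR (prod4 A B)) i j = B i j"
    unfolding nrm_def L[OF ij] R[OF ij]
    using main[OF A, of "B 1 1"] main[OF B, of "A 1 1"] \<open>A 1 1 $ 0 = 1\<close> \<open>B 1 1 $ 0 = 1\<close> d c cm_sym[OF c]
    by simp_all
qed

lemma zz_prod4:
  assumes A: "rtt2 A" "unital I2 A" and B: "rtt2 B" "unital I2 B"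
    and c: "\<And>i j k l. i \<in> I2 \<Longrightarrow> j \<in> I2 \<Longrightarrow> k \<in> I2 \<Longrightarrow> l \<in> I2 \<Longrightarrow> cm (A i j) (B k l)"
  shows "zz (prod4 A B) = fshift 1 (qd A) * fshift 1 (qd B)"
proof -
  have q: "(\<Sum>p\<in>I2. T i p * fshift 1 (tr_mat e2 T p j)) = (if i = j then fshift 1 (qd T) else 0)"
    if "rtt2 T" "i \<in> I2" "j \<in> I2" for T :: "int \<Rightarrow> int \<Rightarrow> 'a fps" and i j
    using arg_cong[OF qd_left_right(1)[OF that], of "fshift 1"]
    by (simp add: alg_homD[OF fshift_hom] split: if_splits)
  have sh: "fshift 1 (prod4 C D i j) = prod4 (\<lambda>i j. fshift 1 (C i j)) (\<lambda>i j. fshift 1 (D i j)) i j" for C D :: "int \<Rightarrow> int \<Rightarrow> 'a fps" and i j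
    by (simp add: prod4_def alg_homD[OF fshift_hom])
  have cc: "B i j * fshift 1 (tr_mat e2 A k l) = fshift 1 (tr_mat e2 A k l) * B i j"
    if "i \<in> I2" "j \<in> I2" "k \<in> I2" "l \<in> I2" for i j k l
    unfolding tr_mat_def by (rule cm_mult_commute, rule cm_closed, rule cm_arith; rule cm_sym, rule c) (use that in auto)
  have "zz (prod4 A B) = (\<Sum>p\<in>I4. prod4 A B 2 p * fshift 1 (tr_mat e4 (prod4 A B) p 2))"
    using zz_left_right(1)[OF rtt4_prod[OF A(1) B(1) c], of 2 2] by (simp del: I4_simps(6))
  also have "\<dots> = (\<Sum>p\<in>I4. prod4 A B 2 p *
      prod4 (\<lambda>i j. fshift 1 (tr_mat e2 A i j)) (\<lambda>i j. fshift 1 (tr_mat e2 B i j)) p 2)"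
    by (intro sum.cong refl) (simp add: tr_prod4 sh)
  also have "\<dots> = prod4 (\<lambda>i j. \<Sum>p\<in>I2. A i p * fshift 1 (tr_mat e2 A p j))
      (\<lambda>i j. \<Sum>p\<in>I2. B i p * fshift 1 (tr_mat e2 B p j)) 2 2"
    by (rule prod4_mult) (use cc in auto)
  also have "\<dots> = fshift 1 (qd A) * fshift 1 (qd B)"
    by (simp add: prod4_def q[OF A(1)] q[OF B(1)] del: I2_simps(4))
  finally show ?thesis .
qed

section \<open>Algebras given by records\<close>

definition calg_rec :: "(complex, 'a) module \<Rightarrow> bool" where
  "calg_rec A \<longleftrightarrow> ring A \<and>
     (\<forall>c. \<forall>x\<in>carrier A. c \<odot>\<^bsub>A\<^esub> x \<in> carrier A \<and> 1 \<odot>\<^bsub>A\<^esub> x = x \<and>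
       (\<forall>b. b \<odot>\<^bsub>A\<^esub> (c \<odot>\<^bsub>A\<^esub> x) = (b * c) \<odot>\<^bsub>A\<^esub> x \<and>
          (b + c) \<odot>\<^bsub>A\<^esub> x = b \<odot>\<^bsub>A\<^esub> x \<oplus>\<^bsub>A\<^esub> c \<odot>\<^bsub>A\<^esub> x) \<and>
       (\<forall>y\<in>carrier A. c \<odot>\<^bsub>A\<^esub> (x \<oplus>\<^bsub>A\<^esub> y) = c \<odot>\<^bsub>A\<^esub> x \<oplus>\<^bsub>A\<^esub> c \<odot>\<^bsub>A\<^esub> y \<and>
          (c \<odot>\<^bsub>A\<^esub> x) \<otimes>\<^bsub>A\<^esub> y = c \<odot>\<^bsub>A\<^esub> (x \<otimes>\<^bsub>A\<^esub> y) \<and>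
          x \<otimes>\<^bsub>A\<^esub> (c \<odot>\<^bsub>A\<^esub> y) = c \<odot>\<^bsub>A\<^esub> (x \<otimes>\<^bsub>A\<^esub> y)))"

lemma calg_recD:
  assumes "calg_rec A"
  shows "ring A" "x \<in> carrier A \<Longrightarrow> c \<odot>\<^bsub>A\<^esub> x \<in> carrier A" "x \<in> carrier A \<Longrightarrow> 1 \<odot>\<^bsub>A\<^esub> x = x"
    "x \<in> carrier A \<Longrightarrow> b \<odot>\<^bsub>A\<^esub> (c \<odot>\<^bsub>A\<^esub> x) = (b * c) \<odot>\<^bsub>A\<^esub> x"
    "x \<in> carrier A \<Longrightarrow> (b + c) \<odot>\<^bsub>A\<^esub> x = b \<odot>\<^bsub>A\<^esub> x \<oplus>\<^bsub>A\<^esub> c \<odot>\<^bsub>A\<^esub> x"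
    "x \<in> carrier A \<Longrightarrow> y \<in> carrier A \<Longrightarrow> c \<odot>\<^bsub>A\<^esub> (x \<oplus>\<^bsub>A\<^esub> y) = c \<odot>\<^bsub>A\<^esub> x \<oplus>\<^bsub>A\<^esub> c \<odot>\<^bsub>A\<^esub> y"
    "x \<in> carrier A \<Longrightarrow> y \<in> carrier A \<Longrightarrow> (c \<odot>\<^bsub>A\<^esub> x) \<otimes>\<^bsub>A\<^esub> y = c \<odot>\<^bsub>A\<^esub> (x \<otimes>\<^bsub>A\<^esub> y)"
    "x \<in> carrier A \<Longrightarrow> y \<in> carrier A \<Longrightarrow> x \<otimes>\<^bsub>A\<^esub> (c \<odot>\<^bsub>A\<^esub> y) = c \<odot>\<^bsub>A\<^esub> (x \<otimes>\<^bsub>A\<^esub> y)"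
  using assms unfolding calg_rec_def by blast+

text \<open>Sources are records and targets are types: presentations live on records, whereas the
  computations with series live in types.\<close>

definition rhom :: "(complex, 'a) module \<Rightarrow> ('a \<Rightarrow> 'b::calg) \<Rightarrow> bool" where
  "rhom A f \<longleftrightarrow> f \<one>\<^bsub>A\<^esub> = 1 \<and> (\<forall>x\<in>carrier A. \<forall>y\<in>carrier A.
     f (x \<oplus>\<^bsub>A\<^esub> y) = f x + f y \<and> f (x \<otimes>\<^bsub>A\<^esub> y) = f x * f y) \<and>
     (\<forall>c. \<forall>x\<in>carrier A. f (c \<odot>\<^bsub>A\<^esub> x) = c \<star> f x)"

lemma rhomD:
  assumes f: "rhom A f" and A: "calg_rec A"
  shows "f \<one>\<^bsub>A\<^esub> = 1" "f \<zero>\<^bsub>A\<^esub> = 0"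
    "x \<in> carrier A \<Longrightarrow> y \<in> carrier A \<Longrightarrow> f (x \<oplus>\<^bsub>A\<^esub> y) = f x + f y"
    "x \<in> carrier A \<Longrightarrow> y \<in> carrier A \<Longrightarrow> f (x \<otimes>\<^bsub>A\<^esub> y) = f x * f y"
    "x \<in> carrier A \<Longrightarrow> f (c \<odot>\<^bsub>A\<^esub> x) = c \<star> f x"
    "x \<in> carrier A \<Longrightarrow> f (\<ominus>\<^bsub>A\<^esub> x) = - f x"
    "x \<in> carrier A \<Longrightarrow> y \<in> carrier A \<Longrightarrow> f (x \<ominus>\<^bsub>A\<^esub> y) = f x - f y"
    "(\<And>i. i \<in> I \<Longrightarrow> g i \<in> carrier A) \<Longrightarrow> f (\<Oplus>\<^bsub>A\<^esub>i\<in>I. g i) = (\<Sum>i\<in>I. f (g i))"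
proof -
  interpret ring A using A by (simp add: calg_rec_def)
  note h = f[unfolded rhom_def]
  show "f \<one>\<^bsub>A\<^esub> = 1" "x \<in> carrier A \<Longrightarrow> f (c \<odot>\<^bsub>A\<^esub> x) = c \<star> f x" using h by auto
  show a: "f (x \<oplus>\<^bsub>A\<^esub> y) = f x + f y" if "x \<in> carrier A" "y \<in> carrier A" for x y
    using h that by auto
  show "x \<in> carrier A \<Longrightarrow> y \<in> carrier A \<Longrightarrow> f (x \<otimes>\<^bsub>A\<^esub> y) = f x * f y" using h by auto
  show z: "f \<zero>\<^bsub>A\<^esub> = 0" using a[of "\<zero>\<^bsub>A\<^esub>" "\<zero>\<^bsub>A\<^esub>"] by simp
  show m: "f (\<ominus>\<^bsub>A\<^esub> x) = - f x" if "x \<in> carrier A" for x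
  proof -
    have "f x + f (\<ominus>\<^bsub>A\<^esub> x) = 0" using a[of x "\<ominus>\<^bsub>A\<^esub> x"] that z by (simp add: r_neg)
    then show ?thesis by (rule group_add_class.minus_unique[symmetric])
  qed
  show "x \<in> carrier A \<Longrightarrow> y \<in> carrier A \<Longrightarrow> f (x \<ominus>\<^bsub>A\<^esub> y) = f x - f y"
    by (simp add: a_minus_def a m)
  show "(\<And>i. i \<in> I \<Longrightarrow> g i \<in> carrier A) \<Longrightarrow> f (\<Oplus>\<^bsub>A\<^esub>i\<in>I. g i) = (\<Sum>i\<in>I. f (g i))"
  proof (induction I rule: infinite_finite_induct)
    case (insert i I)
    then show ?case by (simp add: a finsum_insert Pi_def)
  qed (simp_all add: z finsum_infinite)
qed

subsection \<open>Quotients\<close>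

lemma quot_alg_simps:
  assumes A: "calg_rec A" and J: "ideal J A"
  shows "carrier (quot_alg A J) = (\<lambda>x. J +>\<^bsub>A\<^esub> x) ` carrier A"
    and "\<one>\<^bsub>quot_alg A J\<^esub> = J +>\<^bsub>A\<^esub> \<one>\<^bsub>A\<^esub>" and "\<zero>\<^bsub>quot_alg A J\<^esub> = J"
    and "x \<in> carrier A \<Longrightarrow> y \<in> carrier A \<Longrightarrow>
      (J +>\<^bsub>A\<^esub> x) \<oplus>\<^bsub>quot_alg A J\<^esub> (J +>\<^bsub>A\<^esub> y) = J +>\<^bsub>A\<^esub> (x \<oplus>\<^bsub>A\<^esub> y)"
    and "x \<in> carrier A \<Longrightarrow> y \<in> carrier A \<Longrightarrow>
      (J +>\<^bsub>A\<^esub> x) \<otimes>\<^bsub>quot_alg A J\<^esub> (J +>\<^bsub>A\<^esub> y) = J +>\<^bsub>A\<^esub> (x \<otimes>\<^bsub>A\<^esub> y)"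
    and "x \<in> carrier A \<Longrightarrow> c \<odot>\<^bsub>quot_alg A J\<^esub> (J +>\<^bsub>A\<^esub> x) = J +>\<^bsub>A\<^esub> (c \<odot>\<^bsub>A\<^esub> x)"
proof -
  interpret ideal J A by fact
  note d = quot_alg_def ring.extend_def module.fields_def
  show "carrier (quot_alg A J) = (\<lambda>x. J +>\<^bsub>A\<^esub> x) ` carrier A"
    by (auto simp: d FactRing_simps)
  show "\<one>\<^bsub>quot_alg A J\<^esub> = J +>\<^bsub>A\<^esub> \<one>\<^bsub>A\<^esub>" "\<zero>\<^bsub>quot_alg A J\<^esub> = J"
    by (simp_all add: d FactRing_def)
  show "x \<in> carrier A \<Longrightarrow> y \<in> carrier A \<Longrightarrow>
      (J +>\<^bsub>A\<^esub> x) \<oplus>\<^bsub>quot_alg A J\<^esub> (J +>\<^bsub>A\<^esub> y) = J +>\<^bsub>A\<^esub> (x \<oplus>\<^bsub>A\<^esub> y)"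
    by (simp add: d FactRing_def a_rcos_sum)
  show "x \<in> carrier A \<Longrightarrow> y \<in> carrier A \<Longrightarrow>
      (J +>\<^bsub>A\<^esub> x) \<otimes>\<^bsub>quot_alg A J\<^esub> (J +>\<^bsub>A\<^esub> y) = J +>\<^bsub>A\<^esub> (x \<otimes>\<^bsub>A\<^esub> y)"
    by (simp add: d FactRing_def rcoset_mult_add)
  assume x: "x \<in> carrier A"
  have eq: "J +>\<^bsub>A\<^esub> (c \<odot>\<^bsub>A\<^esub> y) = J +>\<^bsub>A\<^esub> (c \<odot>\<^bsub>A\<^esub> x)" if y: "y \<in> J +>\<^bsub>A\<^esub> x" for y
  proof -
    obtain h where h: "h \<in> J" "y = h \<oplus>\<^bsub>A\<^esub> x" using y by (auto simp: a_r_coset_def r_coset_def)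
    have hc: "h \<in> carrier A" using h by (simp add: a_Hcarr)
    have "c \<odot>\<^bsub>A\<^esub> h = (c \<odot>\<^bsub>A\<^esub> \<one>\<^bsub>A\<^esub>) \<otimes>\<^bsub>A\<^esub> h"
      using hc by (simp add: calg_recD(7)[OF A])
    then have "c \<odot>\<^bsub>A\<^esub> h \<in> J" using h calg_recD(2)[OF A] by (simp add: I_l_closed)
    then have "c \<odot>\<^bsub>A\<^esub> y \<in> J +>\<^bsub>A\<^esub> (c \<odot>\<^bsub>A\<^esub> x)"
      using h(2) hc x by (auto simp: calg_recD(6)[OF A] a_r_coset_def r_coset_def)
    then show ?thesis
      using a_repr_independence'[of "c \<odot>\<^bsub>A\<^esub> y"] x calg_recD(2)[OF A] by auto
  qed
  have ne: "x \<in> J +>\<^bsub>A\<^esub> x" using x by (rule a_rcos_self)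
  have "(\<Union>y\<in>J +>\<^bsub>A\<^esub> x. J +>\<^bsub>A\<^esub> (c \<odot>\<^bsub>A\<^esub> y)) = J +>\<^bsub>A\<^esub> (c \<odot>\<^bsub>A\<^esub> x)"
  proof (rule SUP_eq_const)
    show "J +>\<^bsub>A\<^esub> x \<noteq> {}" using ne by blast
  qed (rule eq)
  then show "c \<odot>\<^bsub>quot_alg A J\<^esub> (J +>\<^bsub>A\<^esub> x) = J +>\<^bsub>A\<^esub> (c \<odot>\<^bsub>A\<^esub> x)"
    by (simp add: d)
qed

lemma calg_rec_quot:
  assumes A: "calg_rec A" and J: "ideal J A"
  shows "calg_rec (quot_alg A J)"
proof -
  interpret ideal J A by fact
  note q = quot_alg_simps[OF A J] and a = calg_recD[OF A]
  let ?Q = "quot_alg A J"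
  have z: "\<zero>\<^bsub>?Q\<^esub> = J +>\<^bsub>A\<^esub> \<zero>\<^bsub>A\<^esub>" 
    unfolding q(3) by (simp add: a_rcos_const)
  have ag: "abelian_group ?Q"
  proof (rule abelian_groupI)
    fix X assume "X \<in> carrier ?Q"
    then obtain x where x: "x \<in> carrier A" "X = J +>\<^bsub>A\<^esub> x" by (auto simp: q(1))
    have "(J +>\<^bsub>A\<^esub> (\<ominus>\<^bsub>A\<^esub> x)) \<oplus>\<^bsub>?Q\<^esub> X = \<zero>\<^bsub>?Q\<^esub>"
      unfolding x(2) z by (subst q(4)) (simp_all add: x l_neg)
    then show "\<exists>Y\<in>carrier ?Q. Y \<oplus>\<^bsub>?Q\<^esub> X = \<zero>\<^bsub>?Q\<^esub>"
      using x(1) by (auto simp: q(1))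
    show "\<zero>\<^bsub>?Q\<^esub> \<oplus>\<^bsub>?Q\<^esub> X = X"
      unfolding x(2) z by (subst q(4)) (simp_all add: x)
  next
    show "\<zero>\<^bsub>?Q\<^esub> \<in> carrier ?Q" unfolding z q(1) by simp
  qed (auto simp: q(1,4) a_ac)
  have "ring ?Q"
  proof (rule ringI[OF ag])
    show "Group.monoid ?Q"
      by (rule monoidI) (auto simp: q(1,2,5) m_assoc)
  qed (auto simp: q(1,4,5) l_distr r_distr)
  then show ?thesis
    unfolding calg_rec_def q(1)
    by (auto simp: q(4-6) a)
qed

lemma coset_eq_iff:
  assumes A: "calg_rec A" and J: "ideal J A" and "x \<in> carrier A" "y \<in> carrier A"
  shows "J +>\<^bsub>A\<^esub> x = J +>\<^bsub>A\<^esub> y \<longleftrightarrow> x \<ominus>\<^bsub>A\<^esub> y \<in> J"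
  using ring.quotient_eq_iff_same_a_r_cos[OF calg_recD(1)[OF A] J] assms by blast

lemma rhom_Idl:
  assumes A: "calg_rec A" and G: "G \<subseteq> carrier A" and f: "rhom A f" and k: "\<And>g. g \<in> G \<Longrightarrow> f g = 0"
    and x: "x \<in> Idl\<^bsub>A\<^esub> G"
  shows "f x = 0"
proof -
  interpret ring A using A by (simp add: calg_rec_def)
  note h = rhomD[OF f A]
  have "ideal {x \<in> carrier A. f x = 0} A"
  proof (rule idealI)
    show "subgroup {x \<in> carrier A. f x = 0} (add_monoid A)"
      by (rule group.subgroupI) (auto simp: h a_group simp flip: a_inv_def)
  qed (auto simp: h ring_axioms)
  then have "Idl\<^bsub>A\<^esub> G \<subseteq> {x \<in> carrier A. f x = 0}"
    by (rule genideal_minimal) (use G k in auto)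
  then show ?thesis using x by auto
qed

lemma rhom_quot:
  assumes A: "calg_rec A" and J: "ideal J A" and f: "rhom A f" and k: "\<And>x. x \<in> J \<Longrightarrow> f x = 0"
  obtains f' where "rhom (quot_alg A J) f'" "\<And>x. x \<in> carrier A \<Longrightarrow> f' (J +>\<^bsub>A\<^esub> x) = f x"
proof -
  interpret ideal J A by fact
  note h = rhomD[OF f A] and q = quot_alg_simps[OF A J]
  define f' where "f' X = f (SOME x. x \<in> carrier A \<and> J +>\<^bsub>A\<^esub> x = X)" for X
  have v: "f' (J +>\<^bsub>A\<^esub> x) = f x" if x: "x \<in> carrier A" for x
  proof -
    let ?y = "SOME y. y \<in> carrier A \<and> J +>\<^bsub>A\<^esub> y = J +>\<^bsub>A\<^esub> x"
    have y: "?y \<in> carrier A \<and> J +>\<^bsub>A\<^esub> ?y = J +>\<^bsub>A\<^esub> x" by (rule someI) (use x in simp)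
    then have "?y \<ominus>\<^bsub>A\<^esub> x \<in> J" using coset_eq_iff[OF A J] x by blast
    then have "f (?y \<ominus>\<^bsub>A\<^esub> x) = 0" by (rule k)
    then show ?thesis using y x h by (simp add: f'_def)
  qed
  have "rhom (quot_alg A J) f'"
    unfolding rhom_def q(1)
    by (auto simp: q v h calg_recD(2)[OF A])
  then show ?thesis using v by (rule that)
qed

lemma rhom_coset:
  assumes A: "calg_rec A" and J: "ideal J A" and f: "rhom (quot_alg A J) f"
  shows "rhom A (\<lambda>x. f (J +>\<^bsub>A\<^esub> x))" and "x \<in> J \<Longrightarrow> f (J +>\<^bsub>A\<^esub> x) = 0"
proof -
  interpret ideal J A by fact
  note h = rhomD[OF f calg_rec_quot[OF A J]] and q = quot_alg_simps[OF A J]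
  show "rhom A (\<lambda>x. f (J +>\<^bsub>A\<^esub> x))"
    unfolding rhom_def
    by (auto simp: h q(1) simp flip: q(2,4,5,6))
  assume "x \<in> J"
  then have "J +>\<^bsub>A\<^esub> x = J" by (rule a_rcos_const)
  then show "f (J +>\<^bsub>A\<^esub> x) = 0" using h(2) by (simp add: q)
qed

subsection \<open>Monoid algebras\<close>

definition lin :: "('m \<Rightarrow> 'b::calg) \<Rightarrow> ('m \<Rightarrow>\<^sub>0 complex) \<Rightarrow> 'b" where
  "lin f p = (\<Sum>x\<in>Poly_Mapping.keys p. Poly_Mapping.lookup p x \<star> f x)"

lemma lin_superset:
  assumes "finite S" "Poly_Mapping.keys p \<subseteq> S"
  shows "lin f p = (\<Sum>x\<in>S. Poly_Mapping.lookup p x \<star> f x)"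
  unfolding lin_def by (rule sum.mono_neutral_left) (use assms in \<open>auto simp: in_keys_iff\<close>)

lemma lin_add: "lin f (p + q) = lin f p + lin f q"
proof -
  let ?S = "Poly_Mapping.keys p \<union> Poly_Mapping.keys q"
  have "Poly_Mapping.keys (p + q) \<subseteq> ?S" by (rule Poly_Mapping.keys_add)
  then show ?thesis
    by (simp add: lin_superset[of ?S] lookup_add cs_add_left sum.distrib)
qed

lemma lin_single [simp]: "lin f (Poly_Mapping.single x c) = c \<star> f x"
  by (simp add: lin_def)

lemma lin_0 [simp]: "lin f 0 = 0"
  by (simp add: lin_def)

abbreviation psc :: "complex \<Rightarrow> ('m \<Rightarrow>\<^sub>0 complex) \<Rightarrow> ('m \<Rightarrow>\<^sub>0 complex)" where
  "psc c \<equiv> Poly_Mapping.map ((*) c)"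

lemma lookup_psc [simp]: "Poly_Mapping.lookup (psc c p) x = c * Poly_Mapping.lookup p x"
  by (simp add: Poly_Mapping.map.rep_eq when_def)

lemma keys_psc: "Poly_Mapping.keys (psc c p) \<subseteq> Poly_Mapping.keys p"
  by (auto simp: in_keys_iff)

lemma lin_psc: "lin f (psc c p) = c \<star> lin f p"
  unfolding lin_superset[OF finite_keys keys_psc] by (simp add: lin_def cs_sum_right cs_assoc)

lemma lin_minus: "lin f (- p) = - lin f p"
  using lin_add[of f p "- p"] by (simp add: minus_unique[symmetric])

lemma lin_diff: "lin f (p - q) = lin f p - lin f q"
  using lin_add[of f p "- q"] by (simp add: lin_minus)

lemma psc_single [simp]: "psc c (Poly_Mapping.single x d) = Poly_Mapping.single x (c * d)"
  by (rule poly_mapping_eqI) (simp add: lookup_single when_def)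

definition mm :: "('m \<Rightarrow> 'm \<Rightarrow> 'm) \<Rightarrow> ('m \<Rightarrow>\<^sub>0 complex) \<Rightarrow> ('m \<Rightarrow>\<^sub>0 complex) \<Rightarrow> ('m \<Rightarrow>\<^sub>0 complex)" where
  "mm g p q = (\<Sum>x\<in>Poly_Mapping.keys p. \<Sum>y\<in>Poly_Mapping.keys q.
     Poly_Mapping.single (g x y) (Poly_Mapping.lookup p x * Poly_Mapping.lookup q y))"

lemma mm_superset:
  assumes "finite S" "Poly_Mapping.keys p \<subseteq> S" "finite T" "Poly_Mapping.keys q \<subseteq> T"
  shows "mm g p q = (\<Sum>x\<in>S. \<Sum>y\<in>T. Poly_Mapping.single (g x y) (Poly_Mapping.lookup p x * Poly_Mapping.lookup q y))"
proof -
  have "mm g p q = (\<Sum>x\<in>Poly_Mapping.keys p. \<Sum>y\<in>T. Poly_Mapping.single (g x y) (Poly_Mapping.lookup p x * Poly_Mapping.lookup q y))"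
    unfolding mm_def
    by (intro sum.cong sum.mono_neutral_left refl) (use assms in \<open>auto simp: in_keys_iff\<close>)
  also have "\<dots> = (\<Sum>x\<in>S. \<Sum>y\<in>T. Poly_Mapping.single (g x y) (Poly_Mapping.lookup p x * Poly_Mapping.lookup q y))"
    by (rule sum.mono_neutral_left) (use assms in \<open>auto simp: in_keys_iff\<close>)
  finally show ?thesis .
qed

lemma mm_add_left: "mm g (p + p') q = mm g p q + mm g p' q"
proof -
  let ?S = "Poly_Mapping.keys p \<union> Poly_Mapping.keys p'"
  have "Poly_Mapping.keys (p + p') \<subseteq> ?S" by (rule Poly_Mapping.keys_add)
  then show ?thesis
    by (simp add: mm_superset[of ?S _ "Poly_Mapping.keys q"] lookup_add single_add distrib_right sum.distrib)
qed

lemma mm_add_right: "mm g q (p + p') = mm g q p + mm g q p'"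
proof -
  let ?S = "Poly_Mapping.keys p \<union> Poly_Mapping.keys p'"
  have "Poly_Mapping.keys (p + p') \<subseteq> ?S" by (rule Poly_Mapping.keys_add)
  then show ?thesis
    by (simp add: mm_superset[of "Poly_Mapping.keys q" _ ?S] lookup_add single_add distrib_left sum.distrib)
qed

lemma mm_0 [simp]: "mm g 0 q = 0" "mm g q 0 = 0"
  by (simp_all add: mm_def)

lemma mm_single [simp]: "mm g (Poly_Mapping.single x c) (Poly_Mapping.single y d) = Poly_Mapping.single (g x y) (c * d)"
  by (simp add: mm_def)

lemma mm_psc: "mm g (psc c p) q = psc c (mm g p q)" "mm g q (psc c p) = psc c (mm g q p)"
proof -
  have s: "psc c (sum f A) = (\<Sum>a\<in>A. psc c (f a))" for f :: "'x \<Rightarrow> 'y \<Rightarrow>\<^sub>0 complex" and A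
    by (rule poly_mapping_eqI) (simp add: lookup_sum sum_distrib_left)
  show "mm g (psc c p) q = psc c (mm g p q)" "mm g q (psc c p) = psc c (mm g q p)"
    unfolding mm_superset[OF finite_keys keys_psc finite_keys order_refl]
      mm_superset[OF finite_keys order_refl finite_keys keys_psc]
    by (simp_all add: mm_def s mult_ac)
qed

lemma mm_keys:
  assumes "Poly_Mapping.keys p \<subseteq> S" "Poly_Mapping.keys q \<subseteq> T" "\<And>x y. x \<in> S \<Longrightarrow> y \<in> T \<Longrightarrow> g x y \<in> W"
  shows "Poly_Mapping.keys (mm g p q) \<subseteq> W"
proof
  fix z assume "z \<in> Poly_Mapping.keys (mm g p q)"
  then obtain x where x: "x \<in> Poly_Mapping.keys p" "z \<in> Poly_Mapping.keys (\<Sum>y\<in>Poly_Mapping.keys q.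
      Poly_Mapping.single (g x y) (Poly_Mapping.lookup p x * Poly_Mapping.lookup q y))"
    unfolding mm_def using Poly_Mapping.keys_sum[of _ "Poly_Mapping.keys p"] by fast
  then obtain y where "y \<in> Poly_Mapping.keys q"
    "z \<in> Poly_Mapping.keys (Poly_Mapping.single (g x y) (Poly_Mapping.lookup p x * Poly_Mapping.lookup q y))"
    using Poly_Mapping.keys_sum[of _ "Poly_Mapping.keys q"] by fast
  then show "z \<in> W" using x assms by (auto split: if_splits)
qed

lemma pm_induct [consumes 1, case_names zero single add]:
  assumes "Poly_Mapping.keys p \<subseteq> S" and "P 0"
    and "\<And>x c. x \<in> S \<Longrightarrow> P (Poly_Mapping.single x c)"
    and "\<And>p q. Poly_Mapping.keys p \<subseteq> S \<Longrightarrow> Poly_Mapping.keys q \<subseteq> S \<Longrightarrow> P p \<Longrightarrow> P q \<Longrightarrow> P (p + q)"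
  shows "P (p :: 'm \<Rightarrow>\<^sub>0 complex)"
proof -
  have "P (\<Sum>x\<in>A. Poly_Mapping.single x (Poly_Mapping.lookup p x)) \<and>
      Poly_Mapping.keys (\<Sum>x\<in>A. Poly_Mapping.single x (Poly_Mapping.lookup p x)) \<subseteq> S"
    if "finite A" "A \<subseteq> S" for A
    using that
  proof induction
    case (insert x A)
    let ?s = "Poly_Mapping.single x (Poly_Mapping.lookup p x)"
    let ?r = "\<Sum>x\<in>A. Poly_Mapping.single x (Poly_Mapping.lookup p x)"
    have k: "Poly_Mapping.keys ?s \<subseteq> S" "Poly_Mapping.keys ?r \<subseteq> S" "P ?s" "P ?r"
      using insert assms(3) by auto
    have "Poly_Mapping.keys (?s + ?r) \<subseteq> S"
      using Poly_Mapping.keys_add[of ?s ?r] k(1,2) by blast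
    then show ?case
      using insert assms(4)[OF k] by simp
  qed (use assms in auto)
  from this[OF finite_keys assms(1)]
  have "P (\<Sum>x\<in>Poly_Mapping.keys p. Poly_Mapping.single x (Poly_Mapping.lookup p x))" by simp
  also have "(\<Sum>x\<in>Poly_Mapping.keys p. Poly_Mapping.single x (Poly_Mapping.lookup p x)) = p"
    by (rule poly_mapping_eqI)
      (auto simp: lookup_sum lookup_single when_def in_keys_iff sum.delta)
  finally show ?thesis .
qed

lemma monoid_alg_simps:
  "carrier (monoid_alg M) = {p. Poly_Mapping.keys p \<subseteq> carrier M}"
  "p \<otimes>\<^bsub>monoid_alg M\<^esub> q = mm (\<otimes>\<^bsub>M\<^esub>) p q" "\<one>\<^bsub>monoid_alg M\<^esub> = Poly_Mapping.single \<one>\<^bsub>M\<^esub> 1"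
  "\<zero>\<^bsub>monoid_alg M\<^esub> = 0" "p \<oplus>\<^bsub>monoid_alg M\<^esub> q = p + q" "c \<odot>\<^bsub>monoid_alg M\<^esub> p = psc c p"
  by (simp_all add: monoid_alg_def mm_def)

lemma monoid_alg_carrier_add:
  "Poly_Mapping.keys p \<subseteq> S \<Longrightarrow> Poly_Mapping.keys q \<subseteq> S \<Longrightarrow> Poly_Mapping.keys (p + q) \<subseteq> S"
  using Poly_Mapping.keys_add[of p q] by blast

lemma calg_rec_monoid_alg:
  assumes M: "Group.monoid M"
  shows "calg_rec (monoid_alg M)"
proof -
  interpret M: Group.monoid M by fact
  let ?A = "monoid_alg M"
  note s = monoid_alg_simps
  have ag: "abelian_group ?A"
  proof (rule abelian_groupI)
    fix x assume "x \<in> carrier ?A"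
    then show "\<exists>y\<in>carrier ?A. y \<oplus>\<^bsub>?A\<^esub> x = \<zero>\<^bsub>?A\<^esub>"
      by (intro bexI[of _ "- x"]) (auto simp: s)
  qed (simp_all add: s add_ac monoid_alg_carrier_add)
  have closed: "mm (\<otimes>\<^bsub>M\<^esub>) x y \<in> carrier ?A" if "x \<in> carrier ?A" "y \<in> carrier ?A" for x y
    using mm_keys[of x "carrier M" y "carrier M" "(\<otimes>\<^bsub>M\<^esub>)" "carrier M"] that by (simp add: s)
  have assoc: "mm (\<otimes>\<^bsub>M\<^esub>) (mm (\<otimes>\<^bsub>M\<^esub>) x y) z = mm (\<otimes>\<^bsub>M\<^esub>) x (mm (\<otimes>\<^bsub>M\<^esub>) y z)"
    if "Poly_Mapping.keys x \<subseteq> carrier M" "Poly_Mapping.keys y \<subseteq> carrier M" "Poly_Mapping.keys z \<subseteq> carrier M" for x y z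
    using that(1)
  proof (induction x rule: pm_induct)
    case (single a c)
    from that(2) show ?case
    proof (induction y rule: pm_induct)
      case (single b d)
      from that(3) show ?case
        by (induction z rule: pm_induct) (use \<open>a \<in> carrier M\<close> single in \<open>simp_all add: M.m_assoc mult.assoc mm_add_right\<close>)
    qed (simp_all add: mm_add_left mm_add_right)
  qed (simp_all add: mm_add_left)
  have unit: "mm (\<otimes>\<^bsub>M\<^esub>) (Poly_Mapping.single \<one>\<^bsub>M\<^esub> 1) x = x" "mm (\<otimes>\<^bsub>M\<^esub>) x (Poly_Mapping.single \<one>\<^bsub>M\<^esub> 1) = x"
    if "Poly_Mapping.keys x \<subseteq> carrier M" for x
    using that by (induction x rule: pm_induct) (simp_all add: mm_add_left mm_add_right)
  have "ring ?A"
  proof (rule ringI[OF ag])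
    show "Group.monoid ?A"
      by (rule monoidI) (use closed assoc unit in \<open>auto simp: s\<close>)
  qed (auto simp: s mm_add_left mm_add_right)
  moreover have "psc b (psc c x) = psc (b * c) x" "psc 1 x = x" "psc (b + c) x = psc b x + psc c x"
    "psc c (x + y) = psc c x + psc c y" for b c and x y :: "'a \<Rightarrow>\<^sub>0 complex"
    by (rule poly_mapping_eqI; simp add: lookup_add algebra_simps)+
  ultimately show ?thesis
    unfolding calg_rec_def s
    by (auto simp: mm_psc dest!: keys_psc[THEN subsetD])
qed

lemma rhom_lin:
  assumes M: "Group.monoid M" and f: "f \<one>\<^bsub>M\<^esub> = 1"
    "\<And>x y. x \<in> carrier M \<Longrightarrow> y \<in> carrier M \<Longrightarrow> f (x \<otimes>\<^bsub>M\<^esub> y) = f x * f y"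
  shows "rhom (monoid_alg M) (lin f)"
proof -
  have "lin f (mm (\<otimes>\<^bsub>M\<^esub>) p q) = lin f p * lin f q"
    if "Poly_Mapping.keys p \<subseteq> carrier M" "Poly_Mapping.keys q \<subseteq> carrier M" for p q
    using that(1)
  proof (induction p rule: pm_induct)
    case (single a c)
    from that(2) show ?case
      by (induction q rule: pm_induct)
        (use single in \<open>simp_all add: f cs_mult_left cs_mult_right cs_assoc mult.commute mm_add_right lin_add distrib_left\<close>)
  qed (simp_all add: mm_add_left lin_add distrib_right)
  then show ?thesis
    unfolding rhom_def monoid_alg_simps by (auto simp: lin_add lin_psc f)
qed

lemma rhom_monoid_alg_eq:
  assumes M: "Group.monoid M" and h: "rhom (monoid_alg M) h" and p: "p \<in> carrier (monoid_alg M)"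
  shows "h p = lin (\<lambda>x. h (Poly_Mapping.single x 1)) p"
proof -
  note hh = rhomD[OF h calg_rec_monoid_alg[OF M], unfolded monoid_alg_simps]
  have "Poly_Mapping.keys p \<subseteq> carrier M" using p by (simp add: monoid_alg_simps)
  then show ?thesis
  proof (induction p rule: pm_induct)
    case (single x c)
    then show ?case using hh(5)[of "Poly_Mapping.single x 1" c] by simp
  next
    case (add p q)
    then show ?case using hh(3)[of p q] by (simp add: lin_add)
  qed (simp add: hh)
qed

lemma monoid_free: "Group.monoid (free_monoid X)"
  by (rule monoidI) (auto simp: free_monoid_def)

lemma calg_rec_free: "calg_rec (free_alg X)"
  unfolding free_alg_def by (rule calg_rec_monoid_alg[OF monoid_free])

lemma rhom_free:
  "rhom (free_alg X) (lin (\<lambda>w. prod_list (map g w)))"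
  unfolding free_alg_def by (rule rhom_lin[OF monoid_free]) (simp_all add: free_monoid_def)

lemma rhom_free_in_subalg:
  assumes h: "rhom (free_alg X) h" and S: "subalg S"
    and g: "\<And>x. x \<in> X \<Longrightarrow> h (Poly_Mapping.single [x] 1) \<in> S" and p: "p \<in> carrier (free_alg X)"
  shows "h p \<in> S"
proof -
  note s = subalgD[OF S]
  note c = monoid_alg_simps[of "free_monoid X", folded free_alg_def]
  note hh = rhomD[OF h calg_rec_free]
  have w: "h (Poly_Mapping.single w 1) \<in> S" if "w \<in> lists X" for w
    using that
  proof induction
    case Nil
    then show ?case using hh(1) s(1) by (simp add: c free_monoid_def)
  next
    case (Cons x w)
    then have "h (Poly_Mapping.single [x] 1 \<otimes>\<^bsub>free_alg X\<^esub> Poly_Mapping.single w 1) \<in> S"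
      using g by (subst hh(4)) (auto simp: c free_monoid_def intro: s)
    then show ?case by (simp add: c free_monoid_def)
  qed
  have "h p = lin (\<lambda>x. h (Poly_Mapping.single x 1)) p"
    by (rule rhom_monoid_alg_eq[OF monoid_free]) (use h p in \<open>simp_all add: free_alg_def\<close>)
  also have "\<dots> \<in> S"
  proof -
    have "a \<in> lists X" if "a \<in> Poly_Mapping.keys p" for a
      using p that unfolding c free_monoid_def by (simp only: mem_Collect_eq partial_object.simps subset_iff)
    then show ?thesis unfolding lin_def by (intro s w)
  qed
  finally show ?thesis .
qed

section \<open>RTT relations in records\<close>

definition fser :: "('a \<Rightarrow> 'b::calg) \<Rightarrow> (nat \<Rightarrow> 'a) \<Rightarrow> 'b fps" where
  "fser f F = Abs_fps (\<lambda>n. f (F n))"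

lemma fser_nth [simp]: "fser f F $ n = f (F n)"
  by (simp add: fser_def)

lemma fser_simps:
  assumes A: "calg_rec A" and f: "rhom A f" and F: "\<And>n. F n \<in> carrier A"
  shows "(\<And>n. G n \<in> carrier A) \<Longrightarrow> fser f (ser_mult A F G) = fser f F * fser f G"
    and "fser f (ser_shift A a F) = fshift a (fser f F)" and "fser f (ser_neg A F) = fneg (fser f F)"
    and "fser f (ser_one A) = 1"
    and "(\<And>n. G n \<in> carrier A) \<Longrightarrow> ser_mult A F G n \<in> carrier A"
    and "ser_shift A a F n \<in> carrier A" and "ser_neg A F n \<in> carrier A" and "ser_one A n \<in> carrier A"
proof -
  interpret ring A using A by (simp add: calg_rec_def)
  note h = rhomD[OF f A] and c = calg_recD[OF A]
  show "fser f (ser_mult A F G) = fser f F * fser f G" if G: "\<And>n. G n \<in> carrier A"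
    by (simp add: fps_eq_iff fps_mult_nth ser_mult_def h F G atMost_atLeast0)
  show "fser f (ser_shift A a F) = fshift a (fser f F)"
    by (simp add: fps_eq_iff fshift_nth ser_shift_def h F c)
  show "fser f (ser_neg A F) = fneg (fser f F)"
    by (simp add: fps_eq_iff fneg_nth ser_neg_def h F)
  show "fser f (ser_one A) = 1"
    by (simp add: fps_eq_iff ser_one_def h)
  show "ser_mult A F G n \<in> carrier A" if G: "\<And>n. G n \<in> carrier A"
    unfolding ser_mult_def by (intro finsum_closed) (simp add: F G)
  show "ser_shift A a F n \<in> carrier A"
    unfolding ser_shift_def by (intro finsum_closed) (simp add: F c)
  show "ser_neg A F n \<in> carrier A" "ser_one A n \<in> carrier A"
    by (simp_all add: ser_neg_def ser_one_def F c)
qed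

text \<open>The coefficient of u^-m v^-n for arbitrary integers, extended by zero, to match the
  integer indices of \<open>mult_diff\<close>.\<close>

definition zc :: "'a::calg fps fps \<Rightarrow> int \<Rightarrow> int \<Rightarrow> 'a" where
  "zc G m n = (if m < 0 \<or> n < 0 then 0 else G $ nat n $ nat m)"

text \<open>\<open>DD\<close> is u - v times u^-1 v^-1, so one factor u - v costs a step in both
  indices.\<close>

lemma zc_DD: "zc (DD * G) (m + 1) (n + 1) = zc G (m + 1) n - zc G m (n + 1)"
proof -
  have 1: "nat (n + 1) - 1 = nat n" "nat (m + 1) - 1 = nat m" by auto
  have 2: "nat (n + 1) = 0 \<longleftrightarrow> n \<le> - 1" "nat (m + 1) = 0 \<longleftrightarrow> m \<le> - 1" by auto
  show ?thesis unfolding zc_def DD_mult_nth 1 2 by auto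
qed

lemma zc_XY: "zc (XY * G) (m + 1) (n + 1) = zc G m n"
proof -
  have 1: "nat (n + 1) - 1 = nat n" "nat (m + 1) - 1 = nat m" by auto
  have 2: "nat (n + 1) = 0 \<longleftrightarrow> n \<le> - 1" "nat (m + 1) = 0 \<longleftrightarrow> m \<le> - 1" by auto
  show ?thesis unfolding zc_def XY_mult_nth 1 2 by auto
qed

lemma zc_linear: "zc (F + G) m n = zc F m n + zc G m n" "zc (F - G) m n = zc F m n - zc G m n"
  "zc (c \<star> F) m n = c \<star> zc F m n" "zc 0 m n = 0"
  by (simp_all add: zc_def)

lemma zc_sum: "zc (sum f A) m n = (\<Sum>a\<in>A. zc (f a) m n)"
  by (induction A rule: infinite_finite_induct) (simp_all add: zc_linear)

text \<open>The offset 2 compensates for the factor u^-2 v^-2 in \<open>pk\<close>. Since m and n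
  run over all integers, starting at -2 they reach every coefficient.\<close>

lemma zc_eq_0_iff: "(\<forall>m n. zc G (m + 2) (n + 2) = 0) \<longleftrightarrow> G = 0"
proof
  assume a: "\<forall>m n. zc G (m + 2) (n + 2) = 0"
  have "G $ n $ m = 0" for n m
    using a[rule_format, of "int m - 2" "int n - 2"] by (simp add: zc_def)
  then show "G = 0" by (simp add: fps_eq_iff)
qed (simp add: zc_linear)

lemma mult_poly_diff_rhom:
  assumes A: "calg_rec A" and f: "rhom A f" and H: "\<And>m n. H m n \<in> carrier A"
    and G: "\<And>m n. f (H m n) = zc G m n" and p: "degree p \<le> 2"
  shows "mult_poly_diff A p H m n \<in> carrier A"
    and "f (mult_poly_diff A p H m n) = zc (pk p * G) (m + 2) (n + 2)"
proof -
  interpret ring A using A by (simp add: calg_rec_def)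
  note h = rhomD[OF f A] and c = calg_recD[OF A]
  have d: "(\<forall>m n. (mult_diff A ^^ d) H m n \<in> carrier A) \<and>
      (\<forall>m n. f ((mult_diff A ^^ d) H m n) = zc (DD ^ d * G) (m + int d) (n + int d))" for d
  proof (induction d)
    case (Suc d)
    have "f (mult_diff A ((mult_diff A ^^ d) H) m n) = zc (DD * (DD ^ d * G)) (m + int (Suc d)) (n + int (Suc d))" for m n
    proof -
      have "f (mult_diff A ((mult_diff A ^^ d) H) m n) =
          zc (DD ^ d * G) ((m + int d) + 1) (n + int d) - zc (DD ^ d * G) (m + int d) ((n + int d) + 1)"
        using Suc by (simp add: mult_diff_def[of A "(mult_diff A ^^ d) H"] h algebra_simps)
      then show ?thesis unfolding zc_DD[symmetric] by (simp add: algebra_simps)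
    qed
    moreover have "mult_diff A ((mult_diff A ^^ d) H) m n \<in> carrier A" for m n
      using Suc by (simp add: mult_diff_def[of A "(mult_diff A ^^ d) H"])
    ultimately show ?case by (simp add: mult.assoc)
  qed (simp add: H G)
  show "mult_poly_diff A p H m n \<in> carrier A"
    unfolding mult_poly_diff_def using d c by (intro finsum_closed) simp
  have "f (mult_poly_diff A p H m n) = (\<Sum>d\<le>degree p. coeff p d \<star> zc (DD ^ d * G) (m + int d) (n + int d))"
    unfolding mult_poly_diff_def using d c by (simp add: h)
  also have "\<dots> = (\<Sum>d\<le>2. coeff p d \<star> zc (DD ^ d * G) (m + int d) (n + int d))"
    by (rule sum.mono_neutral_left) (use p in \<open>auto simp: coeff_eq_0\<close>)
  also have "\<dots> = coeff p 0 \<star> zc G m n + coeff p 1 \<star> zc (DD * G) (m + 1) (n + 1)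
      + coeff p 2 \<star> zc (DD * DD * G) (m + 2) (n + 2)"
    by (simp add: numeral_2_eq_2 add_ac mult.assoc)
  also have "zc G m n = zc (XY * (XY * G)) (m + 2) (n + 2)"
    using zc_XY[of "XY * G" "m + 1" "n + 1"] zc_XY[of G m n] by (simp add: add_ac)
  also have "zc (DD * G) (m + 1) (n + 1) = zc (DD * (XY * G)) (m + 2) (n + 2)"
    using zc_XY[of "DD * G" "m + 1" "n + 1"] commute_left[OF DD_commute[of XY], of G] by (simp add: add_ac)
  finally show "f (mult_poly_diff A p H m n) = zc (pk p * G) (m + 2) (n + 2)"
    by (simp add: pk_def distrib_right cs_mult_left zc_linear mult.assoc add_ac)
qed

definition rttR :: "int set \<Rightarrow> complex poly op2 \<Rightarrow> (int \<Rightarrow> int \<Rightarrow> 'a::calg fps) \<Rightarrow> bool" where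
  "rttR I R T \<longleftrightarrow> (\<forall>i\<in>I. \<forall>k\<in>I. \<forall>j\<in>I. \<forall>l\<in>I.
     (\<Sum>a\<in>I. \<Sum>b\<in>I. pk (R (i, k) (a, b)) * uv T a j b l) =
     (\<Sum>a\<in>I. \<Sum>b\<in>I. pk (R (a, b) (j, l)) * vu T k b i a))"

definition deg2 :: "complex poly op2 \<Rightarrow> bool" where
  "deg2 R \<longleftrightarrow> (\<forall>p q. degree (R p q) \<le> 2)"

text \<open>The passage from the presentation by coefficients to identities between two-variable
  series; from here on relators no longer occur individually.\<close>

lemma rtt_relators_rhom:
  assumes A: "calg_rec A" and f: "rhom A f" and T: "\<And>i j r. i \<in> I \<Longrightarrow> j \<in> I \<Longrightarrow> T (i, j) r \<in> carrier A"
    and R: "deg2 R"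
  shows "rtt_relators A I R T \<subseteq> carrier A"
    and "(\<forall>g\<in>rtt_relators A I R T. f g = 0) \<longleftrightarrow> rttR I R (\<lambda>i j. fser f (T (i, j)))"
proof -
  interpret ring A using A by (simp add: calg_rec_def)
  note h = rhomD[OF f A] and c = calg_recD[OF A]
  let ?T = "\<lambda>i j. fser f (T (i, j))"
  define t where "t = (\<lambda>i j. int_coeff A (T (i, j)))"
  have tc: "t i j m \<in> carrier A" if "i \<in> I" "j \<in> I" for i j m
    using T that by (simp add: t_def int_coeff_def)
  have ft: "f (t i j m) = (if m < 0 then 0 else ?T i j $ nat m)" for i j m
    by (simp add: t_def int_coeff_def h)
  have 1: "f (t a j r \<otimes>\<^bsub>A\<^esub> t b l s) = zc (uv ?T a j b l) r s" if "a \<in> I" "j \<in> I" "b \<in> I" "l \<in> I" for a j b l r s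
    using that by (simp add: h(4) tc ft zc_def U_V_nth)
  have 2: "f (t k b s \<otimes>\<^bsub>A\<^esub> t i a r) = zc (vu ?T k b i a) r s" if "a \<in> I" "k \<in> I" "b \<in> I" "i \<in> I" for a k b i r s
    using that by (simp add: h(4) tc ft zc_def V_U_nth)
  define X where "X = (\<lambda>i k j l m n. (\<Oplus>\<^bsub>A\<^esub>a \<in> I. \<Oplus>\<^bsub>A\<^esub>b \<in> I.
          mult_poly_diff A (R (i, k) (a, b)) (\<lambda>r s. t a j r \<otimes>\<^bsub>A\<^esub> t b l s) m n))"
  define Z where "Z = (\<lambda>i k j l m n. (\<Oplus>\<^bsub>A\<^esub>a \<in> I. \<Oplus>\<^bsub>A\<^esub>b \<in> I.
          mult_poly_diff A (R (a, b) (j, l)) (\<lambda>r s. t k b s \<otimes>\<^bsub>A\<^esub> t i a r) m n))"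
  have G: "rtt_relators A I R T = {X i k j l m n \<ominus>\<^bsub>A\<^esub> Z i k j l m n | i k j l m n.
      i \<in> I \<and> k \<in> I \<and> j \<in> I \<and> l \<in> I}"
    unfolding rtt_relators_def X_def Z_def t_def Let_def ..
  have X: "X i k j l m n \<in> carrier A"
    "f (X i k j l m n) = zc (\<Sum>a\<in>I. \<Sum>b\<in>I. pk (R (i, k) (a, b)) * uv ?T a j b l) (m + 2) (n + 2)"
    if "i \<in> I" "k \<in> I" "j \<in> I" "l \<in> I" for i k j l m n
  proof -
    have *: "mult_poly_diff A (R (i, k) (a, b)) (\<lambda>r s. t a j r \<otimes>\<^bsub>A\<^esub> t b l s) m n \<in> carrier A"
      "f (mult_poly_diff A (R (i, k) (a, b)) (\<lambda>r s. t a j r \<otimes>\<^bsub>A\<^esub> t b l s) m n) =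
       zc (pk (R (i, k) (a, b)) * uv ?T a j b l) (m + 2) (n + 2)" if "a \<in> I" "b \<in> I" for a b
      by (rule mult_poly_diff_rhom[OF A f _ 1 R[unfolded deg2_def, rule_format]]; use that \<open>j \<in> I\<close> \<open>l \<in> I\<close> tc in simp)+
    show "X i k j l m n \<in> carrier A" unfolding X_def by (intro finsum_closed Pi_I *)
    have "f (X i k j l m n) = (\<Sum>a\<in>I. f (\<Oplus>\<^bsub>A\<^esub>b \<in> I.
          mult_poly_diff A (R (i, k) (a, b)) (\<lambda>r s. t a j r \<otimes>\<^bsub>A\<^esub> t b l s) m n))"
      unfolding X_def by (rule h(8)) (intro finsum_closed Pi_I *)
    also have "\<dots> = (\<Sum>a\<in>I. \<Sum>b\<in>I. zc (pk (R (i, k) (a, b)) * uv ?T a j b l) (m + 2) (n + 2))"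
      by (intro sum.cong refl) (subst h(8), auto simp: *)
    finally show "f (X i k j l m n) = zc (\<Sum>a\<in>I. \<Sum>b\<in>I. pk (R (i, k) (a, b)) * uv ?T a j b l) (m + 2) (n + 2)"
      by (simp add: zc_sum)
  qed
  have Z: "Z i k j l m n \<in> carrier A"
    "f (Z i k j l m n) = zc (\<Sum>a\<in>I. \<Sum>b\<in>I. pk (R (a, b) (j, l)) * vu ?T k b i a) (m + 2) (n + 2)"
    if "i \<in> I" "k \<in> I" "j \<in> I" "l \<in> I" for i k j l m n
  proof -
    have *: "mult_poly_diff A (R (a, b) (j, l)) (\<lambda>r s. t k b s \<otimes>\<^bsub>A\<^esub> t i a r) m n \<in> carrier A"
      "f (mult_poly_diff A (R (a, b) (j, l)) (\<lambda>r s. t k b s \<otimes>\<^bsub>A\<^esub> t i a r) m n) =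
       zc (pk (R (a, b) (j, l)) * vu ?T k b i a) (m + 2) (n + 2)" if "a \<in> I" "b \<in> I" for a b
      by (rule mult_poly_diff_rhom[OF A f _ 2 R[unfolded deg2_def, rule_format]]; use that \<open>i \<in> I\<close> \<open>k \<in> I\<close> tc in simp)+
    show "Z i k j l m n \<in> carrier A" unfolding Z_def by (intro finsum_closed Pi_I *)
    have "f (Z i k j l m n) = (\<Sum>a\<in>I. f (\<Oplus>\<^bsub>A\<^esub>b \<in> I.
          mult_poly_diff A (R (a, b) (j, l)) (\<lambda>r s. t k b s \<otimes>\<^bsub>A\<^esub> t i a r) m n))"
      unfolding Z_def by (rule h(8)) (intro finsum_closed Pi_I *)
    also have "\<dots> = (\<Sum>a\<in>I. \<Sum>b\<in>I. zc (pk (R (a, b) (j, l)) * vu ?T k b i a) (m + 2) (n + 2))"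
      by (intro sum.cong refl) (subst h(8), auto simp: *)
    finally show "f (Z i k j l m n) = zc (\<Sum>a\<in>I. \<Sum>b\<in>I. pk (R (a, b) (j, l)) * vu ?T k b i a) (m + 2) (n + 2)"
      by (simp add: zc_sum)
  qed
  show "rtt_relators A I R T \<subseteq> carrier A"
    unfolding G using X(1) Z(1) by auto
  define S where "S = (\<lambda>i k j l. (\<Sum>a\<in>I. \<Sum>b\<in>I. pk (R (i, k) (a, b)) * uv ?T a j b l) -
       (\<Sum>a\<in>I. \<Sum>b\<in>I. pk (R (a, b) (j, l)) * vu ?T k b i a))"
  have fg: "f (X i k j l m n \<ominus>\<^bsub>A\<^esub> Z i k j l m n) = zc (S i k j l) (m + 2) (n + 2)"
    if "i \<in> I" "k \<in> I" "j \<in> I" "l \<in> I" for i k j l m n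
    unfolding h(7)[OF X(1)[OF that] Z(1)[OF that]] X(2)[OF that] Z(2)[OF that] S_def zc_linear ..
  have "(\<forall>g\<in>rtt_relators A I R T. f g = 0) \<longleftrightarrow> (\<forall>i k j l m n. i \<in> I \<and> k \<in> I \<and> j \<in> I \<and> l \<in> I \<longrightarrow>
      f (X i k j l m n \<ominus>\<^bsub>A\<^esub> Z i k j l m n) = 0)"
    unfolding G by blast
  also have "\<dots> \<longleftrightarrow> (\<forall>i\<in>I. \<forall>k\<in>I. \<forall>j\<in>I. \<forall>l\<in>I. \<forall>m n. zc (S i k j l) (m + 2) (n + 2) = 0)"
    using fg by (simp add: Ball_def) blast
  also have "\<dots> \<longleftrightarrow> rttR I R ?T"
    unfolding zc_eq_0_iff rttR_def S_def right_minus_eq ..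
  finally show "(\<forall>g\<in>rtt_relators A I R T. f g = 0) \<longleftrightarrow> rttR I R ?T" .
qed

lemma sum_delta_pair:
  assumes "finite I" "i \<in> I" "k \<in> I" "\<And>x y. P x y \<longleftrightarrow> x = i \<and> y = k"
  shows "(\<Sum>x\<in>I. \<Sum>y\<in>I. if P x y then g x y else (0::'a::comm_monoid_add)) = g i k"
proof -
  have "(\<Sum>y\<in>I. if P x y then g x y else 0) = (if x = i then g x k else 0)" for x
    using assms by (cases "x = i") (simp_all add: sum.delta')
  then show ?thesis using assms by simp
qed

lemma sum_delta_anti:
  fixes I :: "int set"
  assumes "finite I" "\<And>i. i \<in> I \<Longrightarrow> - i \<in> I" "\<And>x y. P x y \<longleftrightarrow> Q \<and> y = - x"
  shows "(\<Sum>x\<in>I. \<Sum>y\<in>I. if P x y then g x y else (0::'a::comm_monoid_add)) =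
    (if Q then \<Sum>x\<in>I. g x (- x) else 0)"
proof -
  have "(\<Sum>y\<in>I. if P x y then g x y else 0) = (if Q then g x (- x) else 0)" if "x \<in> I" for x
    using assms that by (cases Q) (simp_all add: sum.delta')
  then show ?thesis by simp
qed

lemma rttR_iff:
  fixes T :: "int \<Rightarrow> int \<Rightarrow> 'a::calg fps"
  assumes I: "finite I" "\<And>i. i \<in> I \<Longrightarrow> - i \<in> I"
    and R: "\<And>i k j l. R (i, k) (j, l) = (if i = j \<and> k = l then a else 0) + (if k = j \<and> l = i then b else 0)
       + (if k = - i \<and> l = - j then c else 0)"
  shows "rttR I R T \<longleftrightarrow> rtt I e4 a b c T"
proof -
  have p: "pk (if Q then q else 0) * F = (if Q then pk q * F else 0)" for Q q and F :: "'a fps fps"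
    by simp
  have L: "(\<Sum>x\<in>I. \<Sum>y\<in>I. pk (R (i, k) (x, y)) * uv T x j y l) = pk a * uv T i j k l + pk b * uv T k j i l +
      (if k = - i then \<Sum>p\<in>I. pk c * uv T p j (- p) l else 0)" if ik: "i \<in> I" "k \<in> I" for i k j l
  proof -
    have "(\<Sum>x\<in>I. \<Sum>y\<in>I. if i = x \<and> k = y then pk a * uv T x j y l else 0) = pk a * uv T i j k l"
      by (rule sum_delta_pair[OF I(1) ik]) auto
    moreover have "(\<Sum>x\<in>I. \<Sum>y\<in>I. if k = x \<and> y = i then pk b * uv T x j y l else 0) = pk b * uv T k j i l"
      by (rule sum_delta_pair[OF I(1) ik(2,1)]) auto
    moreover have "(\<Sum>x\<in>I. \<Sum>y\<in>I. if k = - i \<and> y = - x then pk c * uv T x j y l else 0) =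
        (if k = - i then \<Sum>p\<in>I. pk c * uv T p j (- p) l else 0)"
      by (rule sum_delta_anti[OF I]) auto
    ultimately show ?thesis
      unfolding R pk_add distrib_right p sum.distrib by (simp only:)
  qed
  have M: "(\<Sum>x\<in>I. \<Sum>y\<in>I. pk (R (x, y) (j, l)) * vu T k y i x) = pk a * vu T k l i j + pk b * vu T k j i l +
      (if l = - j then \<Sum>p\<in>I. pk c * vu T k (- p) i p else 0)" if jl: "j \<in> I" "l \<in> I" for i k j l
  proof -
    have "(\<Sum>x\<in>I. \<Sum>y\<in>I. if x = j \<and> y = l then pk a * vu T k y i x else 0) = pk a * vu T k l i j"
      by (rule sum_delta_pair[OF I(1) jl]) auto
    moreover have "(\<Sum>x\<in>I. \<Sum>y\<in>I. if y = j \<and> l = x then pk b * vu T k y i x else 0) = pk b * vu T k j i l"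
      by (rule sum_delta_pair[OF I(1) jl(2,1)]) auto
    moreover have "(\<Sum>x\<in>I. \<Sum>y\<in>I. if y = - x \<and> l = - j then pk c * vu T k y i x else 0) =
        (if l = - j then \<Sum>p\<in>I. pk c * vu T k (- p) i p else 0)"
      by (rule sum_delta_anti[OF I]) auto
    ultimately show ?thesis
      unfolding R pk_add distrib_right p sum.distrib by (simp only:)
  qed
  have e: "(\<Sum>x\<in>I. \<Sum>y\<in>I. pk (R (i, k) (x, y)) * uv T x j y l) = (\<Sum>x\<in>I. \<Sum>y\<in>I. pk (R (x, y) (j, l)) * vu T k y i x)
    \<longleftrightarrow> pk a * (uv T i j k l - vu T k l i j) + pk b * (uv T k j i l - vu T k j i l) +
     pk c * ((if k = - i then e4 i \<star> (\<Sum>p\<in>I. e4 p \<star> uv T p j (- p) l) else 0) -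
             (if l = - j then e4 j \<star> (\<Sum>p\<in>I. e4 p \<star> vu T k (- p) i p) else 0)) = 0"
    if "i \<in> I" "j \<in> I" "k \<in> I" "l \<in> I" for i j k l
    unfolding L[OF that(1,3)] M[OF that(2,4)] e4_simps cs_one
    by (subst right_minus_eq[symmetric]) (simp add: right_diff_distrib sum_distrib_left algebra_simps)
  show ?thesis unfolding rttR_def rtt_def by (auto simp: e)
qed

lemma minus_one_poly: "(- 1 :: complex poly) = [:-1:]"
  by (rule poly_eqI) (simp add: coeff_pCons split: nat.split)

lemma rttR_R2: "rttR I2 R2 T \<longleftrightarrow> rtt2 T"
proof -
  have g: "a * (if P then 1 else 0) - (if Q then 1 else 0) =
      (if P then a else 0) + (if Q then - 1 else 0) + (if S then 0 else 0)" for a :: "complex poly" and P Q S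
    by simp
  have "rttR I2 R2 T \<longleftrightarrow> rtt I2 e4 [:0, 1:] [:-1:] 0 T"
  proof (rule rttR_iff)
    show "R2 (i, k) (j, l) = (if i = j \<and> k = l then [:0, 1:] else 0) + (if k = j \<and> l = i then [:-1:] else 0)
       + (if k = - i \<and> l = - j then 0 else 0)" for i k j l
      unfolding R2_def op_I_def op_P_def prod.case minus_one_poly[symmetric]
      by (rule g)
  qed (auto simp: I2_def)
  then show ?thesis by (simp add: rtt2_def rtt_def)
qed

lemma rttR_R4: "rttR I4 R4 T \<longleftrightarrow> rtt4 T"
proof -
  have g: "a * (if P then 1 else 0) - b * (if Q then 1 else 0) + c * (if S then 1 else 0) =
      (if P then a else 0) + (if Q then - b else 0) + (if S then c else 0)" for a b c :: "complex poly" and P Q S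
    by simp
  have "rttR I4 R4 T \<longleftrightarrow> rtt I4 e4 ([:0, 1:] * [:-1, 1:]) (- [:-1, 1:]) [:0, 1:] T"
  proof (rule rttR_iff)
    show "R4 (i, k) (j, l) = (if i = j \<and> k = l then [:0, 1:] * [:-1, 1:] else 0) + (if k = j \<and> l = i then - [:-1, 1:] else 0)
       + (if k = - i \<and> l = - j then [:0, 1:] else 0)" for i k j l
      unfolding R4_def op_I_def op_P_def op_Q_def prod.case
      by (rule g)
  qed (auto simp: I4_def)
  then show ?thesis by (simp add: rtt4_def)
qed

lemma degree_R: "deg2 R2" "deg2 R4"
proof -
  have d: "degree (x - y) \<le> 2" "degree (x + y) \<le> 2" if "degree x \<le> 2" "degree y \<le> 2" for x y :: "complex poly"
    using degree_diff_le[OF that] degree_add_le[OF that] by auto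
  have m: "degree (x * (if P then 1 else 0)) \<le> 2" if "degree x \<le> 2" for x :: "complex poly" and P
    using that by simp
  have b: "degree ([:0, 1:] :: complex poly) \<le> 2" "degree ([:- 1, 1:] :: complex poly) \<le> 2"
    "degree (if P then 1 else 0 :: complex poly) \<le> 2" for P
    by simp_all
  have q: "degree ([:0, 1:] * [:- 1, 1:] :: complex poly) \<le> 2"
    by (rule order_trans[OF degree_mult_le]) simp
  show "deg2 R2" "deg2 R4"
    unfolding R2_def R4_def op_I_def op_P_def op_Q_def deg2_def split_paired_All prod.case
    by (intro allI d m b q)+
qed

lemma calg_rec_rtt_free: "calg_rec (rtt_free I)"
  unfolding rtt_free_def by (rule calg_rec_free)

lemma rtt_free_T_carrier: "i \<in> I \<Longrightarrow> j \<in> I \<Longrightarrow> rtt_free_T I (i, j) r \<in> carrier (rtt_free I)"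
  by (auto simp: rtt_free_T_def rtt_free_def free_alg_def free_monoid_def monoid_alg_simps)

lemma rtt_ideal_ideal:
  assumes R: "deg2 R"
  shows "ideal (rtt_ideal I R) (rtt_free I)" "rtt_relators (rtt_free I) I R (rtt_free_T I) \<subseteq> carrier (rtt_free I)"
proof -
  \<comment> \<open>The carrier statement in \<open>rtt_relators_rhom\<close> is made in the
    presence of a homomorphism. The augmentation, which sends all generators to 0, supplies
    one.\<close>
  have f: "rhom (rtt_free I) (lin (\<lambda>w. prod_list (map (\<lambda>_. 0 :: complex) w)))"
    unfolding rtt_free_def by (rule rhom_free)
  show *: "rtt_relators (rtt_free I) I R (rtt_free_T I) \<subseteq> carrier (rtt_free I)"
    by (rule rtt_relators_rhom(1)[OF calg_rec_rtt_free f _ R, where T = "rtt_free_T I"])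
      (rule rtt_free_T_carrier)
  show "ideal (rtt_ideal I R) (rtt_free I)"
    unfolding rtt_ideal_def by (rule ring.genideal_ideal[OF calg_recD(1)[OF calg_rec_rtt_free] *])
qed

lemma calg_rec_rtt_alg:
  assumes "deg2 R"
  shows "calg_rec (rtt_alg I R)"
  unfolding rtt_alg_def by (rule calg_rec_quot[OF calg_rec_rtt_free rtt_ideal_ideal(1)[OF assms]])

lemma rtt_T_eq: "i \<in> I \<Longrightarrow> j \<in> I \<Longrightarrow> rtt_T I R (i, j) r = rtt_ideal I R +>\<^bsub>rtt_free I\<^esub> rtt_free_T I (i, j) r"
  by (simp add: rtt_T_def mat_image_def)

lemma rtt_T_carrier:
  assumes R: "deg2 R" and ij: "i \<in> I" "j \<in> I"
  shows "rtt_T I R (i, j) r \<in> carrier (rtt_alg I R)"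
  unfolding rtt_T_eq[OF ij] rtt_alg_def quot_alg_simps(1)[OF calg_rec_rtt_free rtt_ideal_ideal(1)[OF R]]
  using rtt_free_T_carrier[OF ij] by simp

lemma rtt_alg_universal:
  fixes T :: "int \<Rightarrow> int \<Rightarrow> 'b::calg fps"
  assumes R: "deg2 R" and r: "rttR I R T" and u: "unital I T"
  obtains f where "rhom (rtt_alg I R) f" "\<And>i j. i \<in> I \<Longrightarrow> j \<in> I \<Longrightarrow> fser f (rtt_T I R (i, j)) = T i j"
proof -
  define f where "f = lin (\<lambda>w. prod_list (map (\<lambda>(i, j, r). T i j $ r) w))"
  have f: "rhom (rtt_free I) f"
    unfolding rtt_free_def f_def by (rule rhom_free)
  have fT: "fser f (rtt_free_T I (i, j)) = T i j" if "i \<in> I" "j \<in> I" for i j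
  proof (rule fps_ext)
    fix n
    show "fser f (rtt_free_T I (i, j)) $ n = T i j $ n"
      using that u rhomD(1,2)[OF f calg_rec_rtt_free]
      by (simp add: rtt_free_T_def unital_def) (simp add: f_def)
  qed
  have "rttR I R (\<lambda>i j. fser f (rtt_free_T I (i, j)))"
    using r fT unfolding rttR_def by simp
  then have "\<forall>g\<in>rtt_relators (rtt_free I) I R (rtt_free_T I). f g = 0"
    using rtt_relators_rhom(2)[OF calg_rec_rtt_free f _ R, where T = "rtt_free_T I", OF rtt_free_T_carrier] by blast
  then have "f x = 0" if "x \<in> rtt_ideal I R" for x
    using rhom_Idl[OF calg_rec_rtt_free rtt_ideal_ideal(2)[OF R] f] that unfolding rtt_ideal_def by blast
  then obtain f' where f': "rhom (rtt_alg I R) f'"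
    "\<And>x. x \<in> carrier (rtt_free I) \<Longrightarrow> f' (rtt_ideal I R +>\<^bsub>rtt_free I\<^esub> x) = f x"
    unfolding rtt_alg_def using rhom_quot[OF calg_rec_rtt_free rtt_ideal_ideal(1)[OF R] f] by blast
  have "fser f' (rtt_T I R (i, j)) = T i j" if "i \<in> I" "j \<in> I" for i j
    using fT[OF that] by (simp add: fps_eq_iff rtt_T_eq[OF that] f'(2) rtt_free_T_carrier[OF that])
  with f'(1) show ?thesis by (rule that)
qed

lemma rtt_alg_relations:
  assumes R: "deg2 R" and f: "rhom (rtt_alg I R) f"
  shows "rttR I R (\<lambda>i j. fser f (rtt_T I R (i, j)))" "unital I (\<lambda>i j. fser f (rtt_T I R (i, j)))"
    "subalg S \<Longrightarrow> (\<And>i j r. i \<in> I \<Longrightarrow> j \<in> I \<Longrightarrow> f (rtt_T I R (i, j) r) \<in> S) \<Longrightarrow> x \<in> carrier (rtt_alg I R) \<Longrightarrow> f x \<in> S"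
proof -
  let ?J = "rtt_ideal I R" and ?F = "rtt_free I"
  let ?f = "\<lambda>x. f (?J +>\<^bsub>?F\<^esub> x)"
  note J = rtt_ideal_ideal(1)[OF R]
  have f': "rhom ?F ?f" "\<And>x. x \<in> ?J \<Longrightarrow> ?f x = 0"
    using rhom_coset[OF calg_rec_rtt_free J f[unfolded rtt_alg_def]] by blast+
  have T: "fser f (rtt_T I R (i, j)) = fser ?f (rtt_free_T I (i, j))" if "i \<in> I" "j \<in> I" for i j
    by (simp add: fps_eq_iff rtt_T_eq[OF that])
  have "rtt_relators ?F I R (rtt_free_T I) \<subseteq> ?J"
    unfolding rtt_ideal_def using ring.genideal_self[OF calg_recD(1)[OF calg_rec_rtt_free] rtt_ideal_ideal(2)[OF R]] .
  then have "\<forall>g\<in>rtt_relators ?F I R (rtt_free_T I). ?f g = 0" using f'(2) by blast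
  then have "rttR I R (\<lambda>i j. fser ?f (rtt_free_T I (i, j)))"
    using rtt_relators_rhom(2)[OF calg_rec_rtt_free f'(1) _ R, where T = "rtt_free_T I", OF rtt_free_T_carrier] by blast
  then show "rttR I R (\<lambda>i j. fser f (rtt_T I R (i, j)))"
    unfolding rttR_def by (simp add: T)
  show "unital I (\<lambda>i j. fser f (rtt_T I R (i, j)))"
    using rhomD(1,2)[OF f'(1) calg_rec_rtt_free] by (simp add: unital_def rtt_T_eq rtt_free_T_def)
  assume S: "subalg S" and g: "\<And>i j r. i \<in> I \<Longrightarrow> j \<in> I \<Longrightarrow> f (rtt_T I R (i, j) r) \<in> S" and x: "x \<in> carrier (rtt_alg I R)"
  obtain y where y: "y \<in> carrier ?F" "x = ?J +>\<^bsub>?F\<^esub> y"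
    using x unfolding rtt_alg_def quot_alg_simps(1)[OF calg_rec_rtt_free J] by blast
  have "?f y \<in> S"
  proof (rule rhom_free_in_subalg[OF f'(1)[unfolded rtt_free_def] S, folded rtt_free_def])
    fix q :: gen assume "q \<in> {(i, j, r). i \<in> I \<and> j \<in> I \<and> 1 \<le> r}"
    then obtain i j r where q: "q = (i, j, r)" "i \<in> I" "j \<in> I" "1 \<le> r" by blast
    then show "?f (Poly_Mapping.single [q] 1) \<in> S"
      using g[of i j r] by (simp add: rtt_T_eq rtt_free_T_def)
  qed (rule y(1))
  then show "f x \<in> S" using y(2) by simp
qed

section \<open>Algebra types\<close>

locale alg_type =
  fixes A :: "(complex, 'a) module" and rep :: "'t::calg \<Rightarrow> 'a" and abs :: "'a \<Rightarrow> 't"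
  assumes A: "calg_rec A" and td: "type_definition rep abs (carrier A)" and abs_hom: "rhom A abs"
begin

lemma rep_closed [simp]: "rep x \<in> carrier A"
  using type_definition.Rep[OF td] .

lemma abs_rep [simp]: "abs (rep x) = x"
  using type_definition.Rep_inverse[OF td] .

lemma rep_abs: "x \<in> carrier A \<Longrightarrow> rep (abs x) = x"
  using type_definition.Abs_inverse[OF td] .

lemma abs_inj: "x \<in> carrier A \<Longrightarrow> y \<in> carrier A \<Longrightarrow> abs x = abs y \<longleftrightarrow> x = y"
  using rep_abs by metis

lemmas hom = rhomD[OF abs_hom A]

lemma lift_hom:
  assumes f: "rhom A f"
  shows "alg_hom (\<lambda>x. f (rep x))"
proof -
  note h = rhomD[OF f A] and c = calg_recD[OF A]
  interpret ring A by (rule c(1))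
  have r: "rep (x + y) = rep x \<oplus>\<^bsub>A\<^esub> rep y" "rep (x * y) = rep x \<otimes>\<^bsub>A\<^esub> rep y" "rep (k \<star> x) = k \<odot>\<^bsub>A\<^esub> rep x"
    "rep 1 = \<one>\<^bsub>A\<^esub>" for x y k
    by (simp_all add: hom c(2) flip: abs_inj)
  show ?thesis unfolding alg_hom_def by (simp add: r h)
qed

end

text \<open>Stated for bare functions in place of the class operations, so that it can prove the
  instances themselves. The assumption that 0 and 1 differ reflects the corresponding axiom of
  \<open>ring_1\<close>.\<close>

lemma calg_transfer:
  fixes A :: "(complex, 'a) module" and rep :: "'t \<Rightarrow> 'a"
  assumes A: "calg_rec A" and td: "type_definition rep ab (carrier A)" and ne: "\<zero>\<^bsub>A\<^esub> \<noteq> \<one>\<^bsub>A\<^esub>"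
    and ops: "\<And>x y. pl x y = ab (rep x \<oplus>\<^bsub>A\<^esub> rep y)" "\<And>x y. ti x y = ab (rep x \<otimes>\<^bsub>A\<^esub> rep y)"
      "\<And>x y. mi x y = ab (rep x \<ominus>\<^bsub>A\<^esub> rep y)" "\<And>x. um x = ab (\<ominus>\<^bsub>A\<^esub> rep x)"
      "\<And>c x. sc c x = ab (c \<odot>\<^bsub>A\<^esub> rep x)" "ze = ab \<zero>\<^bsub>A\<^esub>" "on = ab \<one>\<^bsub>A\<^esub>"
  shows "ti (ti a b) c = ti a (ti b c)" "ti on a = a" "ti a on = a" "pl (pl a b) c = pl a (pl b c)"
    "pl a b = pl b a" "pl ze a = a" "pl (um a) a = ze" "mi a b = pl a (um b)"
    "ti (pl a b) c = pl (ti a c) (ti b c)" "ti a (pl b c) = pl (ti a b) (ti a c)" "ze \<noteq> on"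
    "sc k (pl a b) = pl (sc k a) (sc k b)" "sc (k + k') a = pl (sc k a) (sc k' a)"
    "sc k (sc k' a) = sc (k * k') a" "sc 1 a = a" "ti (sc k a) b = sc k (ti a b)" "ti a (sc k b) = sc k (ti a b)"
proof -
  interpret ring A using A by (simp add: calg_rec_def)
  note c = calg_recD[OF A]
  note R = type_definition.Rep[OF td] type_definition.Abs_inverse[OF td] type_definition.Rep_inverse[OF td]
  have inj: "ab x = ab y \<longleftrightarrow> x = y" if "x \<in> carrier A" "y \<in> carrier A" for x y
    using R(2) that by metis
  show "ti (ti a b) c = ti a (ti b c)" "ti on a = a" "ti a on = a" "pl (pl a b) c = pl a (pl b c)"
    "pl a b = pl b a" "pl ze a = a" "pl (um a) a = ze" "mi a b = pl a (um b)"
    "ti (pl a b) c = pl (ti a c) (ti b c)" "ti a (pl b c) = pl (ti a b) (ti a c)" "ze \<noteq> on"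
    "sc k (pl a b) = pl (sc k a) (sc k b)" "sc (k + k') a = pl (sc k a) (sc k' a)"
    "sc k (sc k' a) = sc (k * k') a" "sc 1 a = a" "ti (sc k a) b = sc k (ti a b)" "ti a (sc k b) = sc k (ti a b)"
    by (simp_all add: ops R c inj ne m_assoc a_ac l_neg r_neg a_minus_def l_distr r_distr)
qed

lemma rhom_abs:
  assumes A: "calg_rec A" and td: "type_definition rep ab (carrier A)"
    and ops: "\<And>x y. x + y = ab (rep x \<oplus>\<^bsub>A\<^esub> rep y)" "\<And>x y. x * y = ab (rep x \<otimes>\<^bsub>A\<^esub> rep y)"
      "\<And>c x. c \<star> x = ab (c \<odot>\<^bsub>A\<^esub> rep x)" "1 = ab \<one>\<^bsub>A\<^esub>"
  shows "rhom A (ab :: 'a \<Rightarrow> 't::calg)"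
  using type_definition.Abs_inverse[OF td] unfolding rhom_def by (simp add: ops)

lemma rhom_nonzero:
  assumes "calg_rec A" "rhom A (f :: 'a \<Rightarrow> 'b::calg)"
  shows "\<zero>\<^bsub>A\<^esub> \<noteq> \<one>\<^bsub>A\<^esub>"
  using rhomD(1,2)[OF assms(2,1)] by auto

lemma calg_rec_Y2: "calg_rec Y2"
  unfolding Y2_def by (rule calg_rec_rtt_alg[OF degree_R(1)])

lemma calg_rec_X4: "calg_rec X4"
  unfolding X4_def by (rule calg_rec_rtt_alg[OF degree_R(2)])

lemma Y2_universal:
  fixes T :: "int \<Rightarrow> int \<Rightarrow> 'b::calg fps"
  assumes "rtt2 T" "unital I2 T"
  obtains f where "rhom Y2 f" "\<And>i j. i \<in> I2 \<Longrightarrow> j \<in> I2 \<Longrightarrow> fser f (T2 (i, j)) = T i j"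
  using rtt_alg_universal[OF degree_R(1) _ assms(2)] assms(1) unfolding rttR_R2 Y2_def T2_def by blast

lemma X4_universal:
  fixes T :: "int \<Rightarrow> int \<Rightarrow> 'b::calg fps"
  assumes "rtt4 T" "unital I4 T"
  obtains f where "rhom X4 f" "\<And>i j. i \<in> I4 \<Longrightarrow> j \<in> I4 \<Longrightarrow> fser f (T4 (i, j)) = T i j"
  using rtt_alg_universal[OF degree_R(2) _ assms(2)] assms(1) unfolding rttR_R4 X4_def T4_def by blast

text \<open>The trivial representation T(u) = I. It shows that the presented algebras are nonzero,
  which they must be in order to become instances of \<open>calg\<close>.\<close>

definition delta_mat :: "int \<Rightarrow> int \<Rightarrow> complex fps" where
  "delta_mat i j = (if i = j then 1 else 0)"

lemma delta_mat: "rtt2 delta_mat" "unital I2 delta_mat" "qd delta_mat = 1"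
proof -
  show "unital I2 delta_mat" by (simp add: unital_def delta_mat_def)
  show "qd delta_mat = 1" by (simp add: qd_def delta_mat_def alg_homD[OF fshift_hom])
  have UV: "U (delta_mat i j) = (if i = j then 1 else 0)" "V (delta_mat i j) = (if i = j then 1 else 0)" for i j
    by (simp_all add: delta_mat_def alg_homD[OF U_hom] alg_homD[OF V_hom])
  show "rtt2 delta_mat" unfolding rtt2_iff UV by simp
qed

lemma delta_mat4: "rtt4 (prod4 delta_mat delta_mat)" "unital I4 (prod4 delta_mat delta_mat)"
  "zz (prod4 delta_mat delta_mat) = 1"
proof -
  have c: "cm (delta_mat i j) (delta_mat k l)" for i j k l by (simp add: cm_def mult.commute)
  show "rtt4 (prod4 delta_mat delta_mat)" by (rule rtt4_prod[OF delta_mat(1) delta_mat(1) c])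
  show "unital I4 (prod4 delta_mat delta_mat)" by (rule unital_prod4[OF delta_mat(2) delta_mat(2)])
  show "zz (prod4 delta_mat delta_mat) = 1"
    using zz_prod4[OF delta_mat(1,2) delta_mat(1,2) c] by (simp add: delta_mat(3) alg_homD[OF fshift_hom])
qed

lemma Y2_nonzero: "\<zero>\<^bsub>Y2\<^esub> \<noteq> \<one>\<^bsub>Y2\<^esub>"
  using Y2_universal[OF delta_mat(1,2)] rhom_nonzero[OF calg_rec_Y2] by blast

lemma X4_nonzero: "\<zero>\<^bsub>X4\<^esub> \<noteq> \<one>\<^bsub>X4\<^esub>"
  using X4_universal[OF delta_mat4(1,2)] rhom_nonzero[OF calg_rec_X4] by blast

typedef y2 = "carrier Y2"
  using ring.ring_simprules(6)[OF calg_recD(1)[OF calg_rec_Y2]] by blast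

instantiation y2 :: calg
begin
definition "0 = Abs_y2 \<zero>\<^bsub>Y2\<^esub>"
definition "1 = Abs_y2 \<one>\<^bsub>Y2\<^esub>"
definition "x + y = Abs_y2 (Rep_y2 x \<oplus>\<^bsub>Y2\<^esub> Rep_y2 y)"
definition "x * y = Abs_y2 (Rep_y2 x \<otimes>\<^bsub>Y2\<^esub> Rep_y2 y)"
definition "x - y = Abs_y2 (Rep_y2 x \<ominus>\<^bsub>Y2\<^esub> Rep_y2 y)"
definition "- x = Abs_y2 (\<ominus>\<^bsub>Y2\<^esub> Rep_y2 x)"
definition "c \<star> x = Abs_y2 (c \<odot>\<^bsub>Y2\<^esub> Rep_y2 x)"
instance
  by standard (fact calg_transfer[OF calg_rec_Y2 type_definition_y2 Y2_nonzero plus_y2_def times_y2_def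
    minus_y2_def uminus_y2_def cs_y2_def zero_y2_def one_y2_def])+
end

interpretation y2: alg_type Y2 Rep_y2 Abs_y2
  by (rule alg_type.intro) (fact calg_rec_Y2 type_definition_y2 rhom_abs[OF calg_rec_Y2 type_definition_y2
    plus_y2_def times_y2_def cs_y2_def one_y2_def])+

typedef x4 = "carrier X4"
  using ring.ring_simprules(6)[OF calg_recD(1)[OF calg_rec_X4]] by blast

instantiation x4 :: calg
begin
definition "0 = Abs_x4 \<zero>\<^bsub>X4\<^esub>"
definition "1 = Abs_x4 \<one>\<^bsub>X4\<^esub>"
definition "x + y = Abs_x4 (Rep_x4 x \<oplus>\<^bsub>X4\<^esub> Rep_x4 y)"
definition "x * y = Abs_x4 (Rep_x4 x \<otimes>\<^bsub>X4\<^esub> Rep_x4 y)"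
definition "x - y = Abs_x4 (Rep_x4 x \<ominus>\<^bsub>X4\<^esub> Rep_x4 y)"
definition "- x = Abs_x4 (\<ominus>\<^bsub>X4\<^esub> Rep_x4 x)"
definition "c \<star> x = Abs_x4 (c \<odot>\<^bsub>X4\<^esub> Rep_x4 x)"
instance
  by standard (fact calg_transfer[OF calg_rec_X4 type_definition_x4 X4_nonzero plus_x4_def times_x4_def
    minus_x4_def uminus_x4_def cs_x4_def zero_x4_def one_x4_def])+
end

interpretation x4: alg_type X4 Rep_x4 Abs_x4
  by (rule alg_type.intro) (fact calg_rec_X4 type_definition_x4 rhom_abs[OF calg_rec_X4 type_definition_x4
    plus_x4_def times_x4_def cs_x4_def one_x4_def])+

lemma T2_carrier: "i \<in> I2 \<Longrightarrow> j \<in> I2 \<Longrightarrow> T2 (i, j) r \<in> carrier Y2"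
  unfolding Y2_def T2_def by (rule rtt_T_carrier[OF degree_R(1)])

lemma T4_carrier: "i \<in> I4 \<Longrightarrow> j \<in> I4 \<Longrightarrow> T4 (i, j) r \<in> carrier X4"
  unfolding X4_def T4_def by (rule rtt_T_carrier[OF degree_R(2)])

definition Ty2 :: "int \<Rightarrow> int \<Rightarrow> y2 fps" where "Ty2 i j = fser Abs_y2 (T2 (i, j))"
definition Tx4 :: "int \<Rightarrow> int \<Rightarrow> x4 fps" where "Tx4 i j = fser Abs_x4 (T4 (i, j))"

lemma Ty2: "rtt2 Ty2" "unital I2 Ty2"
  using rtt_alg_relations(1,2)[OF degree_R(1) y2.abs_hom[unfolded Y2_def]]
  unfolding Ty2_def T2_def rttR_R2 .

lemma Tx4: "rtt4 Tx4" "unital I4 Tx4"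
  using rtt_alg_relations(1,2)[OF degree_R(2) x4.abs_hom[unfolded X4_def]]
  unfolding Tx4_def T4_def rttR_R4 .

lemma y2_generated:
  assumes S: "subalg S" and g: "\<And>i j r. i \<in> I2 \<Longrightarrow> j \<in> I2 \<Longrightarrow> Ty2 i j $ r \<in> S"
  shows "x \<in> S"
proof -
  have "Abs_y2 (Rep_y2 x) \<in> S"
    by (rule rtt_alg_relations(3)[OF degree_R(1) y2.abs_hom[unfolded Y2_def] S])
      (use g y2.rep_closed in \<open>simp_all add: Ty2_def T2_def Y2_def\<close>)
  then show ?thesis by simp
qed

lemma x4_generated:
  assumes S: "subalg S" and g: "\<And>i j r. i \<in> I4 \<Longrightarrow> j \<in> I4 \<Longrightarrow> Tx4 i j $ r \<in> S"
  shows "x \<in> S"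
proof -
  have "Abs_x4 (Rep_x4 x) \<in> S"
    by (rule rtt_alg_relations(3)[OF degree_R(2) x4.abs_hom[unfolded X4_def] S])
      (use g x4.rep_closed in \<open>simp_all add: Tx4_def T4_def X4_def\<close>)
  then show ?thesis by simp
qed

lemma y2_universal:
  fixes T :: "int \<Rightarrow> int \<Rightarrow> 'b::calg fps"
  assumes "rtt2 T" "unital I2 T"
  obtains h :: "y2 \<Rightarrow> 'b" where "alg_hom h" "\<And>i j. i \<in> I2 \<Longrightarrow> j \<in> I2 \<Longrightarrow> fmap h (Ty2 i j) = T i j"
proof -
  obtain f where f: "rhom Y2 f" "\<And>i j. i \<in> I2 \<Longrightarrow> j \<in> I2 \<Longrightarrow> fser f (T2 (i, j)) = T i j"
    using Y2_universal[OF assms] by blast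
  show ?thesis
  proof (rule that[OF y2.lift_hom[OF f(1)]])
    show "fmap (\<lambda>x. f (Rep_y2 x)) (Ty2 i j) = T i j" if "i \<in> I2" "j \<in> I2" for i j
      unfolding f(2)[OF that, symmetric]
      by (simp add: fps_eq_iff Ty2_def y2.rep_abs T2_carrier[OF that])
  qed
qed

lemma x4_universal:
  fixes T :: "int \<Rightarrow> int \<Rightarrow> 'b::calg fps"
  assumes "rtt4 T" "unital I4 T"
  obtains h :: "x4 \<Rightarrow> 'b" where "alg_hom h" "\<And>i j. i \<in> I4 \<Longrightarrow> j \<in> I4 \<Longrightarrow> fmap h (Tx4 i j) = T i j"
proof -
  obtain f where f: "rhom X4 f" "\<And>i j. i \<in> I4 \<Longrightarrow> j \<in> I4 \<Longrightarrow> fser f (T4 (i, j)) = T i j"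
    using X4_universal[OF assms] by blast
  show ?thesis
  proof (rule that[OF x4.lift_hom[OF f(1)]])
    show "fmap (\<lambda>x. f (Rep_x4 x)) (Tx4 i j) = T i j" if "i \<in> I4" "j \<in> I4" for i j
      unfolding f(2)[OF that, symmetric]
      by (simp add: fps_eq_iff Tx4_def x4.rep_abs T4_carrier[OF that])
  qed
qed

section \<open>The quotients SY(2) and Y(so_4)\<close>

definition unit_ideal :: "(complex, 'a) module \<Rightarrow> 'a ser \<Rightarrow> 'a set" where
  "unit_ideal A q = Idl\<^bsub>A\<^esub> {q n \<ominus>\<^bsub>A\<^esub> ser_one A n | n. True}"

lemma unit_quotient:
  assumes A: "calg_rec A" and q: "\<And>n. q n \<in> carrier A"
  shows "ideal (unit_ideal A q) A"
    and "rhom A f \<Longrightarrow> fser f q = 1 \<Longrightarrow> x \<in> unit_ideal A q \<Longrightarrow> f x = 0"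
    and "rhom A f \<Longrightarrow> (\<And>x. x \<in> unit_ideal A q \<Longrightarrow> f x = 0) \<Longrightarrow> fser f q = 1"
proof -
  interpret ring A using A by (simp add: calg_rec_def)
  let ?G = "{q n \<ominus>\<^bsub>A\<^esub> ser_one A n | n. True}"
  have one: "ser_one A n \<in> carrier A" for n by (simp add: ser_one_def)
  have G: "?G \<subseteq> carrier A" using q one by auto
  show "ideal (unit_ideal A q) A" unfolding unit_ideal_def by (rule genideal_ideal[OF G])
  have fone: "f (ser_one A n) = (1 :: 'c fps) $ n" if "rhom A f" for f :: "'a \<Rightarrow> 'c::calg" and n
    using rhomD(1,2)[OF that A] by (simp add: ser_one_def)
  show "f x = 0" if f: "rhom A f" and "fser f q = 1" "x \<in> unit_ideal A q"
  proof (rule rhom_Idl[OF A G f])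
    have "f (q n) = 1 $ n" for n using that(2) by (metis fser_nth)
    then show "f g = 0" if "g \<in> ?G" for g
      using that q one fone[OF f] by (auto simp: rhomD(7)[OF f A])
  qed (use that(3) in \<open>simp add: unit_ideal_def\<close>)
  show "fser f q = 1" if f: "rhom A f" and k: "\<And>x. x \<in> unit_ideal A q \<Longrightarrow> f x = 0"
  proof (rule fps_ext)
    fix n
    have "q n \<ominus>\<^bsub>A\<^esub> ser_one A n \<in> unit_ideal A q"
      unfolding unit_ideal_def using genideal_self[OF G] by blast
    then have "f (q n \<ominus>\<^bsub>A\<^esub> ser_one A n) = 0" by (rule k)
    then show "fser f q $ n = 1 $ n" using fone[OF f] q one by (simp add: rhomD(7)[OF f A])
  qed
qed

lemma qdet_rhom:
  assumes f: "rhom Y2 f"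
  shows "qdet_T2 n \<in> carrier Y2" "fser f qdet_T2 = qd (\<lambda>i j. fser f (T2 (i, j)))"
proof -
  interpret ring Y2 using calg_rec_Y2 by (simp add: calg_rec_def)
  note s = fser_simps[OF calg_rec_Y2 f]
  have c: "ser_mult Y2 (ser_shift Y2 (- 1) (T2 (i, j))) (T2 (k, l)) n \<in> carrier Y2"
    "f (ser_mult Y2 (ser_shift Y2 (- 1) (T2 (i, j))) (T2 (k, l)) n) =
      (fshift (- 1) (fser f (T2 (i, j))) * fser f (T2 (k, l))) $ n"
    if "i \<in> I2" "j \<in> I2" "k \<in> I2" "l \<in> I2" for i j k l n
  proof -
    note t = T2_carrier[OF that(1,2)] T2_carrier[OF that(3,4)]
    show "ser_mult Y2 (ser_shift Y2 (- 1) (T2 (i, j))) (T2 (k, l)) n \<in> carrier Y2"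
      by (rule s(5)[OF s(6)[OF t(1)] t(2)])
    have "fser f (ser_mult Y2 (ser_shift Y2 (- 1) (T2 (i, j))) (T2 (k, l))) =
      fshift (- 1) (fser f (T2 (i, j))) * fser f (T2 (k, l))"
      by (simp only: s(1)[OF s(6)[OF t(1)] t(2)] s(2)[OF t(1)])
    then show "f (ser_mult Y2 (ser_shift Y2 (- 1) (T2 (i, j))) (T2 (k, l)) n) =
      (fshift (- 1) (fser f (T2 (i, j))) * fser f (T2 (k, l))) $ n"
      by (metis fser_nth)
  qed
  show "qdet_T2 n \<in> carrier Y2" unfolding qdet_T2_def using c(1) by simp
  show "fser f qdet_T2 = qd (\<lambda>i j. fser f (T2 (i, j)))"
    by (simp add: fps_eq_iff qdet_T2_def qd_def rhomD(7)[OF f calg_rec_Y2] c)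
qed

lemma SY2_eq: "SY2 = quot_alg Y2 (unit_ideal Y2 qdet_T2)" "SY2_ideal = unit_ideal Y2 qdet_T2"
  by (simp_all add: SY2_def SY2_ideal_def unit_ideal_def)

lemmas SY2_quotient = unit_quotient[OF calg_rec_Y2, where q = qdet_T2, OF qdet_rhom(1)[OF y2.abs_hom]]

lemma calg_rec_SY2: "calg_rec SY2"
  unfolding SY2_eq by (rule calg_rec_quot[OF calg_rec_Y2 SY2_quotient(1)])

lemma SY2_universal:
  fixes T :: "int \<Rightarrow> int \<Rightarrow> 'b::calg fps"
  assumes T: "rtt2 T" "unital I2 T" and q: "qd T = 1"
  obtains f where "rhom SY2 f" "\<And>i j. i \<in> I2 \<Longrightarrow> j \<in> I2 \<Longrightarrow> fser f (ST2 (i, j)) = T i j"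
proof -
  obtain f where f: "rhom Y2 f" "\<And>i j. i \<in> I2 \<Longrightarrow> j \<in> I2 \<Longrightarrow> fser f (T2 (i, j)) = T i j"
    using Y2_universal[OF T] by blast
  have "fser f qdet_T2 = qd T"
    unfolding qdet_rhom(2)[OF f(1)] by (rule qd_cong) (rule f(2))
  then have "f x = 0" if "x \<in> unit_ideal Y2 qdet_T2" for x
    using SY2_quotient(2)[OF f(1)] q that by simp
  then obtain f' where f': "rhom SY2 f'" "\<And>x. x \<in> carrier Y2 \<Longrightarrow> f' (SY2_ideal +>\<^bsub>Y2\<^esub> x) = f x"
    unfolding SY2_eq using rhom_quot[OF calg_rec_Y2 SY2_quotient(1) f(1)] by blast
  have "fser f' (ST2 (i, j)) = T i j" if "i \<in> I2" "j \<in> I2" for i j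
    unfolding f(2)[OF that, symmetric] by (simp add: fps_eq_iff ST2_def mat_image_def that f'(2) T2_carrier)
  with f'(1) show ?thesis by (rule that)
qed

lemma SY2_nonzero: "\<zero>\<^bsub>SY2\<^esub> \<noteq> \<one>\<^bsub>SY2\<^esub>"
  using SY2_universal[OF delta_mat(1,2,3)] rhom_nonzero[OF calg_rec_SY2] by blast

typedef sy2 = "carrier SY2"
  using ring.ring_simprules(6)[OF calg_recD(1)[OF calg_rec_SY2]] by blast

instantiation sy2 :: calg
begin
definition "0 = Abs_sy2 \<zero>\<^bsub>SY2\<^esub>"
definition "1 = Abs_sy2 \<one>\<^bsub>SY2\<^esub>"
definition "x + y = Abs_sy2 (Rep_sy2 x \<oplus>\<^bsub>SY2\<^esub> Rep_sy2 y)"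
definition "x * y = Abs_sy2 (Rep_sy2 x \<otimes>\<^bsub>SY2\<^esub> Rep_sy2 y)"
definition "x - y = Abs_sy2 (Rep_sy2 x \<ominus>\<^bsub>SY2\<^esub> Rep_sy2 y)"
definition "- x = Abs_sy2 (\<ominus>\<^bsub>SY2\<^esub> Rep_sy2 x)"
definition "c \<star> x = Abs_sy2 (c \<odot>\<^bsub>SY2\<^esub> Rep_sy2 x)"
instance
  by standard (fact calg_transfer[OF calg_rec_SY2 type_definition_sy2 SY2_nonzero plus_sy2_def times_sy2_def
    minus_sy2_def uminus_sy2_def cs_sy2_def zero_sy2_def one_sy2_def])+
end

interpretation sy2: alg_type SY2 Rep_sy2 Abs_sy2
  by (rule alg_type.intro) (fact calg_rec_SY2 type_definition_sy2 rhom_abs[OF calg_rec_SY2 type_definition_sy2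
    plus_sy2_def times_sy2_def cs_sy2_def one_sy2_def])+

definition Tsy2 :: "int \<Rightarrow> int \<Rightarrow> sy2 fps" where "Tsy2 i j = fser Abs_sy2 (ST2 (i, j))"
definition pi2 :: "y2 \<Rightarrow> sy2" where "pi2 x = Abs_sy2 (SY2_ideal +>\<^bsub>Y2\<^esub> Rep_y2 x)"

lemma pi2_rhom: "rhom Y2 (\<lambda>x. Abs_sy2 (SY2_ideal +>\<^bsub>Y2\<^esub> x))"
  using rhom_coset(1)[OF calg_rec_Y2 SY2_quotient(1)] sy2.abs_hom unfolding SY2_eq by blast

lemma pi2_hom: "alg_hom pi2"
  unfolding pi2_def by (rule y2.lift_hom[OF pi2_rhom])

lemma fmap_pi2: "i \<in> I2 \<Longrightarrow> j \<in> I2 \<Longrightarrow> fmap pi2 (Ty2 i j) = Tsy2 i j"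
  by (simp add: fps_eq_iff pi2_def Ty2_def Tsy2_def ST2_def mat_image_def y2.rep_abs T2_carrier)

lemma pi2_surj: "\<exists>y. x = pi2 y"
proof -
  have "Rep_sy2 x \<in> carrier SY2" by (rule sy2.rep_closed)
  then obtain y where y: "y \<in> carrier Y2" "Rep_sy2 x = SY2_ideal +>\<^bsub>Y2\<^esub> y"
    unfolding SY2_eq quot_alg_simps(1)[OF calg_rec_Y2 SY2_quotient(1)] by blast
  have "x = pi2 (Abs_y2 y)"
    using sy2.abs_rep[of x] unfolding y(2) by (simp add: pi2_def y2.rep_abs y(1))
  then show ?thesis ..
qed

lemma Tsy2: "rtt2 Tsy2" "unital I2 Tsy2" "qd Tsy2 = 1"
proof -
  have "rtt2 (\<lambda>i j. fmap pi2 (Ty2 i j))"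
    using rtt_fmap[OF Ty2(1)[unfolded rtt2_def] pi2_hom] unfolding rtt2_def .
  then show "rtt2 Tsy2" unfolding rtt2_iff by (simp add: fmap_pi2)
  show "unital I2 Tsy2"
    using Ty2(2) by (auto simp: unital_def alg_homD[OF pi2_hom] simp flip: fmap_pi2)
  have "fser (\<lambda>x. Abs_sy2 (SY2_ideal +>\<^bsub>Y2\<^esub> x)) qdet_T2 = 1"
    using SY2_quotient(3)[OF pi2_rhom] rhom_coset(2)[OF calg_rec_Y2 SY2_quotient(1)] sy2.abs_hom
    unfolding SY2_eq by blast
  then have "qd (\<lambda>i j. fser (\<lambda>x. Abs_sy2 (SY2_ideal +>\<^bsub>Y2\<^esub> x)) (T2 (i, j))) = 1"
    unfolding qdet_rhom(2)[OF pi2_rhom] .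
  also have "qd (\<lambda>i j. fser (\<lambda>x. Abs_sy2 (SY2_ideal +>\<^bsub>Y2\<^esub> x)) (T2 (i, j))) = qd Tsy2"
    by (rule qd_cong) (simp add: fps_eq_iff Tsy2_def ST2_def mat_image_def)
  finally show "qd Tsy2 = 1" .
qed

lemma sy2_generated:
  assumes S: "subalg S" and g: "\<And>i j r. i \<in> I2 \<Longrightarrow> j \<in> I2 \<Longrightarrow> Tsy2 i j $ r \<in> S"
  shows "x \<in> S"
proof -
  obtain y where y: "x = pi2 y" using pi2_surj by blast
  have "y \<in> pi2 -` S"
    by (rule y2_generated[OF subalg_vimage[OF pi2_hom S]]) (use g in \<open>simp flip: fmap_pi2\<close>)
  then show ?thesis by (simp add: y)
qed

lemma sy2_universal:
  fixes T :: "int \<Rightarrow> int \<Rightarrow> 'b::calg fps"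
  assumes "rtt2 T" "unital I2 T" "qd T = 1"
  obtains h :: "sy2 \<Rightarrow> 'b" where "alg_hom h" "\<And>i j. i \<in> I2 \<Longrightarrow> j \<in> I2 \<Longrightarrow> fmap h (Tsy2 i j) = T i j"
proof -
  obtain f where f: "rhom SY2 f" "\<And>i j. i \<in> I2 \<Longrightarrow> j \<in> I2 \<Longrightarrow> fser f (ST2 (i, j)) = T i j"
    using SY2_universal[OF assms] by blast
  have c: "ST2 (i, j) r \<in> carrier SY2" if "i \<in> I2" "j \<in> I2" for i j r
    using that T2_carrier unfolding SY2_eq quot_alg_simps(1)[OF calg_rec_Y2 SY2_quotient(1)]
    by (simp add: ST2_def mat_image_def SY2_eq)
  show ?thesis
  proof (rule that[OF sy2.lift_hom[OF f(1)]])
    show "fmap (\<lambda>x. f (Rep_sy2 x)) (Tsy2 i j) = T i j" if "i \<in> I2" "j \<in> I2" for i j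
      unfolding f(2)[OF that, symmetric]
      by (simp add: fps_eq_iff Tsy2_def sy2.rep_abs c[OF that])
  qed
qed

lemma mat_mult_rhom:
  assumes A: "calg_rec A" and f: "rhom A f" and I: "i \<in> I" "j \<in> I"
    and F: "\<And>l n. l \<in> I \<Longrightarrow> F (i, l) n \<in> carrier A" and G: "\<And>l n. l \<in> I \<Longrightarrow> G (l, j) n \<in> carrier A"
  shows "(F \<otimes>\<^bsub>mat_ser A I\<^esub> G) (i, j) n \<in> carrier A"
    "fser f ((F \<otimes>\<^bsub>mat_ser A I\<^esub> G) (i, j)) = (\<Sum>l\<in>I. fser f (F (i, l)) * fser f (G (l, j)))"
proof -
  interpret ring A using A by (simp add: calg_rec_def)
  have c: "ser_mult A (F (i, l)) (G (l, j)) n \<in> carrier A" if "l \<in> I" for l n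
    by (rule fser_simps(5)[OF A f F[OF that] G[OF that]])
  have e: "(F \<otimes>\<^bsub>mat_ser A I\<^esub> G) (i, j) = (\<lambda>n. \<Oplus>\<^bsub>A\<^esub>l \<in> I. ser_mult A (F (i, l)) (G (l, j)) n)"
    using I by (simp add: mat_ser_def)
  show "(F \<otimes>\<^bsub>mat_ser A I\<^esub> G) (i, j) n \<in> carrier A"
    unfolding e by (intro finsum_closed Pi_I c)
  show "fser f ((F \<otimes>\<^bsub>mat_ser A I\<^esub> G) (i, j)) = (\<Sum>l\<in>I. fser f (F (i, l)) * fser f (G (l, j)))"
  proof (rule fps_ext)
    fix n
    have "fser f ((F \<otimes>\<^bsub>mat_ser A I\<^esub> G) (i, j)) $ n = (\<Sum>l\<in>I. f (ser_mult A (F (i, l)) (G (l, j)) n))"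
      unfolding e fser_nth by (rule rhomD(8)[OF f A]) (rule c)
    also have "\<dots> = (\<Sum>l\<in>I. fser f (ser_mult A (F (i, l)) (G (l, j))) $ n)" by simp
    also have "\<dots> = (\<Sum>l\<in>I. (fser f (F (i, l)) * fser f (G (l, j))) $ n)"
      by (intro sum.cong refl) (simp only: fser_simps(1)[OF A f F G])
    finally show "fser f ((F \<otimes>\<^bsub>mat_ser A I\<^esub> G) (i, j)) $ n = (\<Sum>l\<in>I. fser f (F (i, l)) * fser f (G (l, j))) $ n"
      by (simp only: fps_sum_nth)
  qed
qed

text \<open>The definite description has a solution because the product matrix is scalar; the entry
  (1, 1) makes it unique.\<close>

lemma z4_eq: "z4 n = Rep_x4 (zz Tx4 $ n)"
proof -
  interpret ring X4 using calg_rec_X4 by (simp add: calg_rec_def)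
  let ?z = "\<lambda>n. Rep_x4 (zz Tx4 $ n)"
  let ?M = "T4 \<otimes>\<^bsub>mat_ser X4 I4\<^esub> mat_transp I4 (mat_shift X4 I4 1 T4)"
  have G: "mat_transp I4 (mat_shift X4 I4 1 T4) (i, j) = ser_shift X4 1 (T4 (- j, - i))" if "i \<in> I4" "j \<in> I4" for i j
    using that by (simp add: mat_transp_def mat_shift_def)
  note s = fser_simps[OF calg_rec_X4 x4.abs_hom T4_carrier]
  have M: "?M (i, j) n \<in> carrier X4" "fser Abs_x4 (?M (i, j)) = (if i = j then zz Tx4 else 0)"
    if ij: "i \<in> I4" "j \<in> I4" for i j n
  proof -
    have c: "mat_transp I4 (mat_shift X4 I4 1 T4) (l, j) n \<in> carrier X4" if "l \<in> I4" for l n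
      unfolding G[OF that ij(2)] by (rule s(6)) (use that ij in simp_all)
    note m = mat_mult_rhom[OF calg_rec_X4 x4.abs_hom ij, of T4 "mat_transp I4 (mat_shift X4 I4 1 T4)", OF T4_carrier[OF ij(1)] c]
    show "?M (i, j) n \<in> carrier X4" by (rule m(1))
    have "fser Abs_x4 (?M (i, j)) = (\<Sum>l\<in>I4. fser Abs_x4 (T4 (i, l)) *
        fser Abs_x4 (mat_transp I4 (mat_shift X4 I4 1 T4) (l, j)))"
      by (rule m(2))
    also have "\<dots> = (\<Sum>l\<in>I4. Tx4 i l * fshift 1 (tr_mat e4 Tx4 l j))"
    proof (intro sum.cong refl)
      fix l assume l: "l \<in> I4"
      have "fser Abs_x4 (ser_shift X4 1 (T4 (- j, - l))) = fshift 1 (Tx4 (- j) (- l))"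
        unfolding Tx4_def by (rule s(2)) (use l ij in simp_all)
      then show "fser Abs_x4 (T4 (i, l)) * fser Abs_x4 (mat_transp I4 (mat_shift X4 I4 1 T4) (l, j)) =
          Tx4 i l * fshift 1 (tr_mat e4 Tx4 l j)"
        unfolding G[OF l ij(2)] by (simp add: Tx4_def tr_mat_def)
    qed
    also have "\<dots> = (if i = j then zz Tx4 else 0)" by (rule zz_left_right(1)[OF Tx4(1) ij])
    finally show "fser Abs_x4 (?M (i, j)) = (if i = j then zz Tx4 else 0)" .
  qed
  have main: "?M (i, j) = (if i = j then ?z else (\<lambda>n. \<zero>\<^bsub>X4\<^esub>))" if ij: "i \<in> I4" "j \<in> I4" for i j
  proof
    fix n
    have "Abs_x4 (?M (i, j) n) = (if i = j then zz Tx4 else 0) $ n"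
      unfolding M(2)[OF ij, symmetric] fser_nth ..
    then have "Rep_x4 (Abs_x4 (?M (i, j) n)) = Rep_x4 ((if i = j then zz Tx4 else 0) $ n)" by simp
    moreover have "Rep_x4 0 = \<zero>\<^bsub>X4\<^esub>" unfolding zero_x4_def by (rule x4.rep_abs) simp
    ultimately show "?M (i, j) n = (if i = j then ?z else (\<lambda>n. \<zero>\<^bsub>X4\<^esub>)) n"
      unfolding x4.rep_abs[OF M(1)[OF ij]] by simp
  qed
  have "z4 = ?z"
    unfolding z4_def
  proof (rule the_equality)
    fix z assume "\<forall>i\<in>I4. \<forall>j\<in>I4. ?M (i, j) = (if i = j then z else (\<lambda>n. \<zero>\<^bsub>X4\<^esub>))"
    then have "?M (1, 1) = z" by simp
    then show "z = ?z" using main[of 1 1] by simp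
  qed (use main in blast)
  then show ?thesis by (rule fun_cong)
qed

lemma z4_carrier: "z4 n \<in> carrier X4"
  by (simp add: z4_eq)

lemma z4_rhom:
  assumes f: "rhom X4 f"
  shows "fser f z4 = zz (\<lambda>i j. fser f (T4 (i, j)))"
proof -
  let ?h = "\<lambda>x. f (Rep_x4 x)"
  have h: "alg_hom ?h" by (rule x4.lift_hom[OF f])
  have T: "fmap ?h (Tx4 i j) = fser f (T4 (i, j))" if "i \<in> I4" "j \<in> I4" for i j
    by (simp add: fps_eq_iff Tx4_def x4.rep_abs T4_carrier[OF that])
  have "fser f z4 = fmap ?h (zz Tx4)" by (simp add: fps_eq_iff z4_eq)
  also have "\<dots> = zz (\<lambda>i j. fser f (T4 (i, j)))"
    by (simp add: zz_def alg_homD[OF fmap_hom[OF h]] fmap_fshift[OF h] T)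
  finally show ?thesis .
qed

lemma Y4_eq: "Y4 = quot_alg X4 (unit_ideal X4 z4)" "Y4_ideal = unit_ideal X4 z4"
  by (simp_all add: Y4_def Y4_ideal_def unit_ideal_def)

lemmas Y4_quotient = unit_quotient[OF calg_rec_X4, where q = z4, OF z4_carrier]

lemma calg_rec_Y4: "calg_rec Y4"
  unfolding Y4_eq by (rule calg_rec_quot[OF calg_rec_X4 Y4_quotient(1)])

lemma zz_cong: "(\<And>i j. i \<in> I4 \<Longrightarrow> j \<in> I4 \<Longrightarrow> A i j = B i j) \<Longrightarrow> zz A = zz B"
  by (simp add: zz_def)

lemma Y4_universal:
  fixes T :: "int \<Rightarrow> int \<Rightarrow> 'b::calg fps"
  assumes T: "rtt4 T" "unital I4 T" and q: "zz T = 1"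
  obtains f where "rhom Y4 f" "\<And>i j. i \<in> I4 \<Longrightarrow> j \<in> I4 \<Longrightarrow> fser f (ST4 (i, j)) = T i j"
proof -
  obtain f where f: "rhom X4 f" "\<And>i j. i \<in> I4 \<Longrightarrow> j \<in> I4 \<Longrightarrow> fser f (T4 (i, j)) = T i j"
    using X4_universal[OF T] by blast
  have "fser f z4 = zz T"
    unfolding z4_rhom[OF f(1)] by (rule zz_cong) (rule f(2))
  then have "f x = 0" if "x \<in> unit_ideal X4 z4" for x
    using Y4_quotient(2)[OF f(1)] q that by simp
  then obtain f' where f': "rhom Y4 f'" "\<And>x. x \<in> carrier X4 \<Longrightarrow> f' (Y4_ideal +>\<^bsub>X4\<^esub> x) = f x"
    unfolding Y4_eq using rhom_quot[OF calg_rec_X4 Y4_quotient(1) f(1)] by blast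
  have "fser f' (ST4 (i, j)) = T i j" if "i \<in> I4" "j \<in> I4" for i j
    unfolding f(2)[OF that, symmetric] by (simp add: fps_eq_iff ST4_def mat_image_def that f'(2) T4_carrier)
  with f'(1) show ?thesis by (rule that)
qed

lemma Y4_nonzero: "\<zero>\<^bsub>Y4\<^esub> \<noteq> \<one>\<^bsub>Y4\<^esub>"
  using Y4_universal[OF delta_mat4] rhom_nonzero[OF calg_rec_Y4] by blast

typedef y4 = "carrier Y4"
  using ring.ring_simprules(6)[OF calg_recD(1)[OF calg_rec_Y4]] by blast

instantiation y4 :: calg
begin
definition "0 = Abs_y4 \<zero>\<^bsub>Y4\<^esub>"
definition "1 = Abs_y4 \<one>\<^bsub>Y4\<^esub>"
definition "x + y = Abs_y4 (Rep_y4 x \<oplus>\<^bsub>Y4\<^esub> Rep_y4 y)"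
definition "x * y = Abs_y4 (Rep_y4 x \<otimes>\<^bsub>Y4\<^esub> Rep_y4 y)"
definition "x - y = Abs_y4 (Rep_y4 x \<ominus>\<^bsub>Y4\<^esub> Rep_y4 y)"
definition "- x = Abs_y4 (\<ominus>\<^bsub>Y4\<^esub> Rep_y4 x)"
definition "c \<star> x = Abs_y4 (c \<odot>\<^bsub>Y4\<^esub> Rep_y4 x)"
instance
  by standard (fact calg_transfer[OF calg_rec_Y4 type_definition_y4 Y4_nonzero plus_y4_def times_y4_def
    minus_y4_def uminus_y4_def cs_y4_def zero_y4_def one_y4_def])+
end

interpretation y4: alg_type Y4 Rep_y4 Abs_y4
  by (rule alg_type.intro) (fact calg_rec_Y4 type_definition_y4 rhom_abs[OF calg_rec_Y4 type_definition_y4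
    plus_y4_def times_y4_def cs_y4_def one_y4_def])+

definition pi4 :: "x4 \<Rightarrow> y4" where "pi4 x = Abs_y4 (Y4_ideal +>\<^bsub>X4\<^esub> Rep_x4 x)"

lemma pi4_rhom: "rhom X4 (\<lambda>x. Abs_y4 (Y4_ideal +>\<^bsub>X4\<^esub> x))"
  using rhom_coset(1)[OF calg_rec_X4 Y4_quotient(1)] y4.abs_hom unfolding Y4_eq by blast

lemma pi4_hom: "alg_hom pi4"
  unfolding pi4_def by (rule x4.lift_hom[OF pi4_rhom])

definition Ty4 :: "int \<Rightarrow> int \<Rightarrow> y4 fps" where "Ty4 i j = fmap pi4 (Tx4 i j)"

lemma Ty4_fser: "i \<in> I4 \<Longrightarrow> j \<in> I4 \<Longrightarrow> Ty4 i j = fser Abs_y4 (ST4 (i, j))"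
  by (simp add: fps_eq_iff pi4_def Tx4_def Ty4_def ST4_def mat_image_def x4.rep_abs T4_carrier)

lemma Ty4: "rtt4 Ty4" "unital I4 Ty4" "zz Ty4 = 1"
proof -
  show "rtt4 Ty4"
    using rtt_fmap[OF Tx4(1)[unfolded rtt4_def] pi4_hom] unfolding rtt4_def Ty4_def .
  show "unital I4 Ty4"
    using Tx4(2) by (auto simp: unital_def Ty4_def alg_homD[OF pi4_hom])
  have "fser (\<lambda>x. Abs_y4 (Y4_ideal +>\<^bsub>X4\<^esub> x)) z4 = 1"
    using Y4_quotient(3)[OF pi4_rhom] rhom_coset(2)[OF calg_rec_X4 Y4_quotient(1)] y4.abs_hom
    unfolding Y4_eq by blast
  then have "zz (\<lambda>i j. fser (\<lambda>x. Abs_y4 (Y4_ideal +>\<^bsub>X4\<^esub> x)) (T4 (i, j))) = 1"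
    unfolding z4_rhom[OF pi4_rhom] .
  also have "zz (\<lambda>i j. fser (\<lambda>x. Abs_y4 (Y4_ideal +>\<^bsub>X4\<^esub> x)) (T4 (i, j))) = zz Ty4"
    by (rule zz_cong) (simp add: fps_eq_iff Ty4_fser ST4_def mat_image_def)
  finally show "zz Ty4 = 1" .
qed

lemma ST4_carrier: "i \<in> I4 \<Longrightarrow> j \<in> I4 \<Longrightarrow> ST4 (i, j) r \<in> carrier Y4"
  using T4_carrier unfolding Y4_eq quot_alg_simps(1)[OF calg_rec_X4 Y4_quotient(1)]
  by (simp add: ST4_def mat_image_def Y4_eq)

lemma y4_universal:
  fixes T :: "int \<Rightarrow> int \<Rightarrow> 'b::calg fps"
  assumes "rtt4 T" "unital I4 T" "zz T = 1"
  obtains h :: "y4 \<Rightarrow> 'b" where "alg_hom h" "\<And>i j. i \<in> I4 \<Longrightarrow> j \<in> I4 \<Longrightarrow> fmap h (Ty4 i j) = T i j"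
proof -
  obtain f where f: "rhom Y4 f" "\<And>i j. i \<in> I4 \<Longrightarrow> j \<in> I4 \<Longrightarrow> fser f (ST4 (i, j)) = T i j"
    using Y4_universal[OF assms] by blast
  show ?thesis
  proof (rule that[OF y4.lift_hom[OF f(1)]])
    show "fmap (\<lambda>x. f (Rep_y4 x)) (Ty4 i j) = T i j" if "i \<in> I4" "j \<in> I4" for i j
      unfolding f(2)[OF that, symmetric]
      by (simp add: fps_eq_iff Ty4_fser[OF that] y4.rep_abs ST4_carrier[OF that])
  qed
qed

section \<open>Homomorphisms between the Yangians\<close>

lemma hom_prod4: "alg_hom h \<Longrightarrow> h (prod4 A B i j) = prod4 (\<lambda>i j. h (A i j)) (\<lambda>i j. h (B i j)) i j"
  unfolding prod4_def alg_hom_def by simp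

lemma rtt2_fmap: "rtt2 T \<Longrightarrow> alg_hom h \<Longrightarrow> rtt2 (\<lambda>i j. fmap h (T i j))"
  unfolding rtt2_def by (rule rtt_fmap)

lemma rtt2_fshift: "rtt2 T \<Longrightarrow> rtt2 (\<lambda>i j. fshift c (T i j))"
  unfolding rtt2_def by (rule rtt_shift)

lemma unital_fmap: "alg_hom h \<Longrightarrow> unital I T \<Longrightarrow> unital I (\<lambda>i j. fmap h (T i j))"
proof -
  assume h: "alg_hom h"
  show "unital I T \<Longrightarrow> unital I (\<lambda>i j. fmap h (T i j))"
    by (auto simp: unital_def alg_homD[OF h])
qed

lemma unital_fshift: "unital I T \<Longrightarrow> unital I (\<lambda>i j. fshift c (T i j))"
  by (simp add: unital_def)

lemma qd_fmap: "alg_hom h \<Longrightarrow> qd (\<lambda>i j. fmap h (T i j)) = fmap h (qd T)"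
proof -
  assume h: "alg_hom h"
  show ?thesis by (simp add: qd_def fmap_fshift[OF h] alg_homD[OF fmap_hom[OF h]])
qed

lemma zz_fmap: "alg_hom h \<Longrightarrow> zz (\<lambda>i j. fmap h (T i j)) = fmap h (zz T)"
proof -
  assume h: "alg_hom h"
  show ?thesis by (simp add: zz_def fmap_fshift[OF h] alg_homD[OF fmap_hom[OF h]])
qed

lemma qd_fshift: "qd (\<lambda>i j. fshift c (T i j)) = fshift c (qd T)"
  by (simp add: qd_def alg_homD[OF fshift_hom] add.commute)

lemma fmap_nrm:
  assumes h: "alg_hom h" and u: "unital I2 T"
  shows "fmap h (nrm T i j) = nrm (\<lambda>i j. fmap h (T i j)) i j"
  by (simp add: nrm_def alg_homD[OF fmap_hom[OF h]] fmap_finv[OF h] fmap_sqs[OF h unital_qd[OF u]] qd_fmap[OF h])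

lemma fmap_sub:
  assumes h: "alg_hom h"
  shows "fmap h (subL T i j) = subL (\<lambda>i j. fmap h (T i j)) i j"
    "fmap h (subR T i j) = subR (\<lambda>i j. fmap h (T i j)) i j"
  by (simp_all add: subL_def subR_def alg_homD[OF fmap_hom[OF h]])

lemma sub_cong:
  assumes "\<And>i j. i \<in> I4 \<Longrightarrow> j \<in> I4 \<Longrightarrow> A i j = B i j"
  shows "subL A = subL B" "subR A = subR B"
  using assms by (simp_all add: subL_def[abs_def] subR_def[abs_def])

lemma sy2_hom_eqI:
  assumes "alg_hom f" "alg_hom g" "\<And>i j. i \<in> I2 \<Longrightarrow> j \<in> I2 \<Longrightarrow> fmap f (Tsy2 i j) = fmap g (Tsy2 i j)"
  shows "f x = g x"
proof -
  have e: "f (Tsy2 i j $ n) = g (Tsy2 i j $ n)" if "i \<in> I2" "j \<in> I2" for i j n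
    using arg_cong[OF assms(3)[OF that], of "\<lambda>s. s $ n"] by simp
  have "x \<in> {x. f x = g x}"
    by (rule sy2_generated[OF subalg_equalizer[OF assms(1,2)]]) (use e in blast)
  then show ?thesis by (rule CollectD)
qed

lemma sy2_commute:
  assumes f: "alg_hom f" and g: "alg_hom g"
    and c: "\<And>i j k l. i \<in> I2 \<Longrightarrow> j \<in> I2 \<Longrightarrow> k \<in> I2 \<Longrightarrow> l \<in> I2 \<Longrightarrow> cm (fmap f (Tsy2 i j)) (fmap g (Tsy2 k l))"
  shows "f a * g b = g b * f a"
proof -
  have e: "g b * f (Tsy2 i j $ n) = f (Tsy2 i j $ n) * g b" if "i \<in> I2" "j \<in> I2" for i j n
  proof -
    have e: "g (Tsy2 k l $ m) * f (Tsy2 i j $ n) = f (Tsy2 i j $ n) * g (Tsy2 k l $ m)" if "k \<in> I2" "l \<in> I2" for k l m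
      using c[OF \<open>i \<in> I2\<close> \<open>j \<in> I2\<close> that] unfolding cm_def fmap_nth by metis
    have "b \<in> g -` {x. \<forall>y\<in>{f (Tsy2 i j $ n)}. x * y = y * x}"
      by (rule sy2_generated[OF subalg_vimage[OF g subalg_centralizer]]) (use e in blast)
    then show ?thesis by blast
  qed
  have "a \<in> f -` {x. \<forall>y\<in>{g b}. x * y = y * x}"
    by (rule sy2_generated[OF subalg_vimage[OF f subalg_centralizer]])
      (unfold vimage_def mem_Collect_eq, metis e singletonD)
  then show ?thesis by blast
qed

lemma cm_fmap_commute:
  assumes "\<And>a b. f a * g b = g b * f a"
  shows "cm (fmap f x) (fmap g y)"
  using assms by (simp add: cm_def)

section \<open>The homomorphisms SY(2) -> Y(2) and Y(so_4) -> X(so_4), and the two maps SY(2) ->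
  Y(so_4)\<close>

definition jj :: "sy2 \<Rightarrow> y2" where
  "jj = (SOME h. alg_hom h \<and> (\<forall>i\<in>I2. \<forall>j\<in>I2. fmap h (Tsy2 i j) = nrm Ty2 i j))"

lemma jj: "alg_hom jj" "i \<in> I2 \<Longrightarrow> j \<in> I2 \<Longrightarrow> fmap jj (Tsy2 i j) = nrm Ty2 i j"
proof -
  have "\<exists>h. alg_hom h \<and> (\<forall>i\<in>I2. \<forall>j\<in>I2. fmap h (Tsy2 i j) = nrm Ty2 i j)"
    using sy2_universal[OF nrm_props[OF Ty2]] by metis
  from someI_ex[OF this] show "alg_hom jj" "i \<in> I2 \<Longrightarrow> j \<in> I2 \<Longrightarrow> fmap jj (Tsy2 i j) = nrm Ty2 i j"
    unfolding jj_def[symmetric] by blast+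
qed

definition d2 :: "y2 fps" where "d2 = sqs (- 1) (qd Ty2)"

lemma d2_nth_0 [simp]: "d2 $ 0 = 1" by (simp add: d2_def)

lemma Ty2_eq: "i \<in> I2 \<Longrightarrow> j \<in> I2 \<Longrightarrow> Ty2 i j = d2 * fmap jj (Tsy2 i j)"
  by (simp add: jj nrm_def d2_def finv_right flip: mult.assoc)

abbreviation center :: "'a::calg set" where "center \<equiv> {x. \<forall>y\<in>UNIV. x * y = y * x}"

lemma subalg_center: "subalg center"
  by (rule subalg_centralizer)

lemma center_commute: "f \<in> serin center \<Longrightarrow> f * g = g * f"
  by (rule cm_mult_commute) (simp add: cm_def serin_def)

lemma center_cm: "f \<in> serin center \<Longrightarrow> cm f g" "f \<in> serin center \<Longrightarrow> cm g f"
  by (auto simp: cm_def serin_def)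

text \<open>Centrality passes from the determinant to its shifted square root because the latter is
  built from the coefficients of the former by algebra operations, and the center is a
  subalgebra.\<close>

lemma d2_center: "d2 \<in> serin center"
proof -
  have "qd Ty2 $ n * x = x * qd Ty2 $ n" for n x
  proof -
    have "x \<in> {x. \<forall>y\<in>{qd Ty2 $ n}. x * y = y * x}"
      by (rule y2_generated[OF subalg_centralizer]) (use qd_central[OF Ty2(1)] in \<open>simp add: cm_def\<close>)
    then show ?thesis by simp
  qed
  then have "qd Ty2 \<in> serin center" by (intro serinI) simp
  then show ?thesis unfolding d2_def by (rule serin_sqs[OF subalg_center])
qed

definition kk :: "y4 \<Rightarrow> x4" where
  "kk = (SOME h. alg_hom h \<and> (\<forall>i\<in>I4. \<forall>j\<in>I4. fmap h (Ty4 i j) = nrm4 Tx4 i j))"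

lemma kk: "alg_hom kk" "i \<in> I4 \<Longrightarrow> j \<in> I4 \<Longrightarrow> fmap kk (Ty4 i j) = nrm4 Tx4 i j"
proof -
  have "\<exists>h. alg_hom h \<and> (\<forall>i\<in>I4. \<forall>j\<in>I4. fmap h (Ty4 i j) = nrm4 Tx4 i j)"
    using y4_universal[OF nrm4_props[OF Tx4]] by metis
  from someI_ex[OF this] show "alg_hom kk" "i \<in> I4 \<Longrightarrow> j \<in> I4 \<Longrightarrow> fmap kk (Ty4 i j) = nrm4 Tx4 i j"
    unfolding kk_def[symmetric] by blast+
qed

definition yy :: "x4 fps" where "yy = sqs 1 (zz Tx4)"

lemma yy_nth_0 [simp]: "yy $ 0 = 1" by (simp add: yy_def)

lemma Tx4_eq: "i \<in> I4 \<Longrightarrow> j \<in> I4 \<Longrightarrow> Tx4 i j = yy * fmap kk (Ty4 i j)"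
  by (simp add: kk nrm4_def yy_def finv_right flip: mult.assoc)

lemma yy_center: "yy \<in> serin center"
proof -
  have "zz Tx4 $ n * x = x * zz Tx4 $ n" for n x
  proof -
    have "x \<in> {x. \<forall>y\<in>{zz Tx4 $ n}. x * y = y * x}"
      by (rule x4_generated[OF subalg_centralizer]) (use zz_central[OF Tx4(1)] in \<open>simp add: cm_def\<close>)
    then show ?thesis by simp
  qed
  then have "zz Tx4 \<in> serin center" by (intro serinI) simp
  then show ?thesis unfolding yy_def by (rule serin_sqs[OF subalg_center])
qed

text \<open>The shift by \<open>1/2\<close> turns \<open>T(u - 1/2) T(-u + 1/2)\<^sup>t\<close> into a product of two copies of
  \<open>T(u) T(1 - u)\<^sup>t = T(u) T(-u)\<^sup>-\<^sup>1\<close>.\<close>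

definition iL :: "sy2 \<Rightarrow> y4" where
  "iL = (SOME h. alg_hom h \<and> (\<forall>i\<in>I2. \<forall>j\<in>I2. fmap h (Tsy2 i j) = fshift (- 1/2) (nrm (subL Ty4) i j)))"

definition iR :: "sy2 \<Rightarrow> y4" where
  "iR = (SOME h. alg_hom h \<and> (\<forall>i\<in>I2. \<forall>j\<in>I2. fmap h (Tsy2 i j) = fshift (- 1/2) (nrm (subR Ty4) i j)))"

lemma sub_universal:
  fixes T :: "int \<Rightarrow> int \<Rightarrow> 'a::calg fps"
  assumes "rtt2 T" "unital I2 T"
  shows "\<exists>h. alg_hom h \<and> (\<forall>i\<in>I2. \<forall>j\<in>I2. fmap h (Tsy2 i j) = fshift c (nrm T i j))"
proof -
  note n = nrm_props[OF assms]
  have "qd (\<lambda>i j. fshift c (nrm T i j)) = 1"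
    unfolding qd_fshift n(3) by (rule alg_homD(3)[OF fshift_hom])
  then show ?thesis
    using sy2_universal[OF rtt2_fshift[OF n(1)] unital_fshift[OF n(2)]] by metis
qed

lemma iL: "alg_hom iL" "i \<in> I2 \<Longrightarrow> j \<in> I2 \<Longrightarrow> fmap iL (Tsy2 i j) = fshift (- 1/2) (nrm (subL Ty4) i j)"
  using someI_ex[OF sub_universal[OF rtt2_sub(1)[OF Ty4(1)] unital_sub(1)[OF Ty4(2)], of "- 1/2"]]
  unfolding iL_def[symmetric] by blast+

lemma iR: "alg_hom iR" "i \<in> I2 \<Longrightarrow> j \<in> I2 \<Longrightarrow> fmap iR (Tsy2 i j) = fshift (- 1/2) (nrm (subR Ty4) i j)"
  using someI_ex[OF sub_universal[OF rtt2_sub(2)[OF Ty4(1)] unital_sub(2)[OF Ty4(2)], of "- 1/2"]]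
  unfolding iR_def[symmetric] by blast+

lemma iL_iR_commute: "iL a * iR b = iR b * iL a"
proof (rule sy2_commute[OF iL(1) iR(1)])
  fix i j k l assume ij: "i \<in> I2" "j \<in> I2" and kl: "k \<in> I2" "l \<in> I2"
  show "cm (fmap iL (Tsy2 i j)) (fmap iR (Tsy2 k l))"
    unfolding iL(2)[OF ij] iR(2)[OF kl]
    by (rule cm_closed(1)[OF cm_sym[OF cm_closed(1)[OF cm_sym[OF nrm_sub_commute[OF Ty4 ij kl]]]]])
qed

text \<open>Homomorphisms commute with the formation of normalized submatrices, and the normalized
  submatrices of a product are its factors by \<open>nrm_sub_prod4\<close>. Thus H remembers f and
  g, whatever the algebra \<open>'c\<close> is.\<close>

lemma hom_iL_iR:
  fixes H :: "y4 \<Rightarrow> 'c::calg"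
  assumes H: "alg_hom H" and f: "alg_hom f" and g: "alg_hom g" and c: "\<And>a b. f a * g b = g b * f a"
    and HT: "\<And>i j. i \<in> I4 \<Longrightarrow> j \<in> I4 \<Longrightarrow> fmap H (Ty4 i j) =
      fshift (1/2) (prod4 (\<lambda>i j. fmap f (Tsy2 i j)) (\<lambda>i j. fmap g (Tsy2 i j)) i j)"
  shows "H (iL a) = f a" "H (iR a) = g a"
proof -
  define A where "A = (\<lambda>i j. fshift (1/2) (fmap f (Tsy2 i j)))"
  define B where "B = (\<lambda>i j. fshift (1/2) (fmap g (Tsy2 i j)))"
  have HT': "fmap H (Ty4 i j) = prod4 A B i j" if "i \<in> I4" "j \<in> I4" for i j
    unfolding HT[OF that] A_def B_def by (rule hom_prod4[OF fshift_hom])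
  have A: "rtt2 A" "unital I2 A" "qd A = 1"
    unfolding A_def using Tsy2
    by (simp_all add: rtt2_fshift rtt2_fmap unital_fshift unital_fmap f qd_fshift qd_fmap
        alg_homD[OF fshift_hom] alg_homD[OF fmap_hom[OF f]])
  have B: "rtt2 B" "unital I2 B" "qd B = 1"
    unfolding B_def using Tsy2
    by (simp_all add: rtt2_fshift rtt2_fmap unital_fshift unital_fmap g qd_fshift qd_fmap
        alg_homD[OF fshift_hom] alg_homD[OF fmap_hom[OF g]])
  have AB: "cm (A i j) (B k l)" for i j k l
    unfolding A_def B_def
    by (rule cm_closed(1)[OF cm_sym[OF cm_closed(1)[OF cm_sym[OF cm_fmap_commute[OF c]]]]])
  have "fmap H (nrm (subL Ty4) i j) = A i j" "fmap H (nrm (subR Ty4) i j) = B i j"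
    if ij: "i \<in> I2" "j \<in> I2" for i j
  proof -
    have "fmap H (nrm (subL Ty4) i j) = nrm (subL (\<lambda>i j. fmap H (Ty4 i j))) i j"
      "fmap H (nrm (subR Ty4) i j) = nrm (subR (\<lambda>i j. fmap H (Ty4 i j))) i j"
      using fmap_nrm[OF H unital_sub(1)[OF Ty4(2)]] fmap_nrm[OF H unital_sub(2)[OF Ty4(2)]]
      by (simp_all add: fmap_sub[OF H] del: sub_simps)
    moreover have "subL (\<lambda>i j. fmap H (Ty4 i j)) = subL (prod4 A B)" "subR (\<lambda>i j. fmap H (Ty4 i j)) = subR (prod4 A B)"
      by (rule sub_cong(1)[OF HT'], assumption+) (rule sub_cong(2)[OF HT'], assumption+)
    ultimately show "fmap H (nrm (subL Ty4) i j) = A i j" "fmap H (nrm (subR Ty4) i j) = B i j"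
      using nrm_sub_prod4[OF A B AB ij] by (simp_all only:)
  qed
  then have "fmap (\<lambda>x. H (iL x)) (Tsy2 i j) = fmap f (Tsy2 i j)" "fmap (\<lambda>x. H (iR x)) (Tsy2 i j) = fmap g (Tsy2 i j)"
    if "i \<in> I2" "j \<in> I2" for i j
    using that by (simp_all add: iL(2) iR(2) fmap_fshift[OF H] A_def B_def flip: fmap_fmap)
  then show "H (iL a) = f a" "H (iR a) = g a"
    using sy2_hom_eqI[OF alg_hom_comp[OF H iL(1)] f] sy2_hom_eqI[OF alg_hom_comp[OF H iR(1)] g] by blast+
qed

lemma rtt4_pair:
  fixes f g :: "sy2 \<Rightarrow> 'c::calg"
  assumes f: "alg_hom f" and g: "alg_hom g" and c: "\<And>a b. f a * g b = g b * f a"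
  defines "T \<equiv> \<lambda>i j. fshift (1/2) (prod4 (\<lambda>i j. fmap f (Tsy2 i j)) (\<lambda>i j. fmap g (Tsy2 i j)) i j)"
  shows "rtt4 T" "unital I4 T" "zz T = 1"
proof -
  define A where "A = (\<lambda>i j. fshift (1/2) (fmap f (Tsy2 i j)))"
  define B where "B = (\<lambda>i j. fshift (1/2) (fmap g (Tsy2 i j)))"
  have T: "T = prod4 A B"
    unfolding T_def A_def B_def by (intro ext hom_prod4[OF fshift_hom])
  have A: "rtt2 A" "unital I2 A" "qd A = 1"
    unfolding A_def using Tsy2
    by (simp_all add: rtt2_fshift rtt2_fmap unital_fshift unital_fmap f qd_fshift qd_fmap
        alg_homD[OF fshift_hom] alg_homD[OF fmap_hom[OF f]])
  have B: "rtt2 B" "unital I2 B" "qd B = 1"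
    unfolding B_def using Tsy2
    by (simp_all add: rtt2_fshift rtt2_fmap unital_fshift unital_fmap g qd_fshift qd_fmap
        alg_homD[OF fshift_hom] alg_homD[OF fmap_hom[OF g]])
  have AB: "cm (A i j) (B k l)" for i j k l
    unfolding A_def B_def
    by (rule cm_closed(1)[OF cm_sym[OF cm_closed(1)[OF cm_sym[OF cm_fmap_commute[OF c]]]]])
  show "rtt4 T" unfolding T by (rule rtt4_prod[OF A(1) B(1) AB])
  show "unital I4 T" unfolding T by (rule unital_prod4[OF A(2) B(2)])
  show "zz T = 1" unfolding T zz_prod4[OF A(1,2) B(1,2) AB] A(3) B(3) by (simp add: alg_homD[OF fshift_hom])
qed

text \<open>The product built from \<open>iL\<close> and \<open>iR\<close> satisfies the relations
  of Y(so_4) and so defines an endomorphism. By \<open>hom_iL_iR\<close> that endomorphism fixes the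
  images of \<open>iL\<close> and \<open>iR\<close>, and by \<open>rtt4_generated\<close> these
  generate the coefficients of T. So it fixes T, which is therefore equal to the product; no entry
  outside the two submatrices has to be computed.\<close>

theorem Ty4_factorization:
  assumes ij: "i \<in> I4" "j \<in> I4"
  shows "Ty4 i j = fshift (1/2) (prod4 (\<lambda>i j. fmap iL (Tsy2 i j)) (\<lambda>i j. fmap iR (Tsy2 i j)) i j)"
proof -
  note r = rtt4_pair[OF iL(1) iR(1) iL_iR_commute]
  obtain \<Omega> where \<Omega>: "alg_hom \<Omega>" "\<And>i j. i \<in> I4 \<Longrightarrow> j \<in> I4 \<Longrightarrow> fmap \<Omega> (Ty4 i j) =
    fshift (1/2) (prod4 (\<lambda>i j. fmap iL (Tsy2 i j)) (\<lambda>i j. fmap iR (Tsy2 i j)) i j)"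
    using y4_universal[OF r] by blast
  note o = hom_iL_iR[OF \<Omega>(1) iL(1) iR(1) iL_iR_commute \<Omega>(2)]
  let ?S = "{x. \<Omega> x = x}"
  have S: "subalg ?S" using subalg_equalizer[OF \<Omega>(1), of "\<lambda>x. x"] by (simp add: alg_hom_def)
  have "Ty4 i j $ n \<in> ?S" for n
  proof (rule rtt4_generated[OF Ty4 S _ _ ij])
    fix k l m assume kl: "k \<in> I2" "l \<in> I2"
    have "nrm (subL Ty4) k l = fshift (1/2) (fmap iL (Tsy2 k l))" "nrm (subR Ty4) k l = fshift (1/2) (fmap iR (Tsy2 k l))"
      by (simp_all add: iL(2)[OF kl] iR(2)[OF kl])
    moreover have "fmap iL (Tsy2 k l) \<in> serin ?S" "fmap iR (Tsy2 k l) \<in> serin ?S" by (simp_all add: serin_def o)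
    ultimately show "nrm (subL Ty4) k l $ m \<in> ?S" "nrm (subR Ty4) k l $ m \<in> ?S"
      using serinD[OF serin_fshift[OF S]] by metis+
  qed
  then have "fmap \<Omega> (Ty4 i j) = Ty4 i j" by (simp add: fps_eq_iff)
  then show ?thesis by (simp add: \<Omega>(2)[OF ij])
qed

section \<open>The twisted subalgebras\<close>

lemma rho_shift: "rho (fshift (- 1) f) = fneg f"
  by (simp add: rho_def)

lemma twm_fmap:
  assumes h: "alg_hom h"
  shows "fmap h (twm T i j) = twm (\<lambda>i j. fmap h (T i j)) i j"
  by (simp add: twm_def tr_mat_def rho_def fmap_fshift[OF h] fmap_fneg[OF h] alg_homD[OF fmap_hom[OF h]])

text \<open>If the quantum determinant is 1, then T^t(1 - u) is the two-sided inverse of T(-u), so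
  the inner factors in s(u) s(-u) cancel.\<close>

lemma twm_props:
  fixes T :: "int \<Rightarrow> int \<Rightarrow> 'a::calg fps"
  assumes r: "rtt2 T" and u: "unital I2 T" and q: "qd T = 1" and ij: "i \<in> I2" "j \<in> I2"
  shows "(\<Sum>p\<in>I2. twm T i p * fneg (twm T p j)) = (if i = j then 1 else 0)"
    and "twm T i j $ 0 = (if i = j then 1 else 0)"
    and "(\<Sum>p\<in>I2. rho (tr_mat e2 T i p) * fneg (T p j)) = (if i = j then 1 else 0)"
    and "(\<Sum>p\<in>I2. fneg (T i p) * rho (tr_mat e2 T p j)) = (if i = j then 1 else 0)"
proof -
  let ?t = "\<lambda>i j. rho (tr_mat e2 T i j)"
  have 1: "(\<Sum>p\<in>I2. fneg (T i p) * ?t p j) = (if i = j then 1 else 0)" if "i \<in> I2" "j \<in> I2" for i j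
  proof -
    have "rho (\<Sum>p\<in>I2. fshift (- 1) (T i p) * tr_mat e2 T p j) = (if i = j then 1 else 0)"
      using qd_left_right(1)[OF r that] q by (simp add: alg_homD[OF rho_hom])
    then show ?thesis by (simp add: alg_homD[OF rho_hom] rho_shift)
  qed
  then show "(\<Sum>p\<in>I2. fneg (T i p) * ?t p j) = (if i = j then 1 else 0)" using ij by blast
  have 2: "(\<Sum>p\<in>I2. ?t i p * fneg (T p j)) = (if i = j then 1 else 0)" if "i \<in> I2" "j \<in> I2" for i j
  proof -
    have "rho (\<Sum>p\<in>I2. tr_mat e2 T i p * fshift (- 1) (T p j)) = (if i = j then 1 else 0)"
      using qd_left_right(2)[OF r that] q by (simp add: alg_homD[OF rho_hom])
    then show ?thesis by (simp add: alg_homD[OF rho_hom] rho_shift)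
  qed
  then show "(\<Sum>p\<in>I2. ?t i p * fneg (T p j)) = (if i = j then 1 else 0)" using ij by blast
  have 3: "(\<Sum>p\<in>I2. T i p * fneg (?t p j)) = (if i = j then 1 else 0)"
    using arg_cong[OF 1[OF ij], of fneg] by (simp add: alg_homD[OF fneg_hom] split: if_splits)
  have "(\<Sum>p\<in>I2. twm T i p * fneg (twm T p j)) =
    (\<Sum>p\<in>I2. \<Sum>a\<in>I2. \<Sum>b\<in>I2. T i a * (?t a p * fneg (T p b)) * fneg (?t b j))"
    by (simp add: twm_def alg_homD[OF fneg_hom] distrib_left distrib_right mult.assoc add_ac)
  also have "\<dots> = (\<Sum>a\<in>I2. \<Sum>b\<in>I2. T i a * (\<Sum>p\<in>I2. ?t a p * fneg (T p b)) * fneg (?t b j))"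
    by (simp add: distrib_left distrib_right add_ac)
  also have "\<dots> = (\<Sum>a\<in>I2. \<Sum>b\<in>I2. T i a * (if a = b then 1 else 0) * fneg (?t b j))"
    by (intro sum.cong refl) (simp only: 2)
  also have "\<dots> = (if i = j then 1 else 0)" using 3 by simp
  finally show "(\<Sum>p\<in>I2. twm T i p * fneg (twm T p j)) = (if i = j then 1 else 0)" .
  have u0: "T i j $ 0 = (if i = j then 1 else 0)" if "i \<in> I2" "j \<in> I2" for i j
    using u that by (simp add: unital_def)
  show "twm T i j $ 0 = (if i = j then 1 else 0)"
    using ij by (elim I2E) (simp_all add: twm_def tr_mat_def alg_homD[OF rho_hom] u0)
qed

definition twm4 :: "(int \<Rightarrow> int \<Rightarrow> 'a::calg fps) \<Rightarrow> int \<Rightarrow> int \<Rightarrow> 'a fps" where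
  "twm4 T i j = (\<Sum>p\<in>I4. fshift (- 1/2) (T i p) * fneg (fshift (1/2) (T (- j) (- p))))"

text \<open>If T(u) is the product of A and B at u + 1/2, then T(u - 1/2) is that product at u and
  T(-u + 1/2) is that product at 1 - u, which explains the half shifts.\<close>

lemma twm4_prod4:
  fixes A B :: "int \<Rightarrow> int \<Rightarrow> 'a::calg fps"
  assumes ij: "i \<in> I4" "j \<in> I4"
    and T: "\<And>i j. i \<in> I4 \<Longrightarrow> j \<in> I4 \<Longrightarrow> T i j = fshift (1/2) (prod4 A B i j)"
    and c: "\<And>i j k l. i \<in> I2 \<Longrightarrow> j \<in> I2 \<Longrightarrow> k \<in> I2 \<Longrightarrow> l \<in> I2 \<Longrightarrow> cm (A i j) (B k l)"
  shows "twm4 T i j = prod4 (twm A) (twm B) i j"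
proof -
  have "twm4 T i j = (\<Sum>p\<in>I4. prod4 A B i p * rho (tr_mat e4 (prod4 A B) p j))"
    unfolding twm4_def by (intro sum.cong refl) (simp add: T ij rho_def tr_mat_def)
  also have "\<dots> = (\<Sum>p\<in>I4. prod4 A B i p * prod4 (\<lambda>i j. rho (tr_mat e2 A i j)) (\<lambda>i j. rho (tr_mat e2 B i j)) p j)"
    by (intro sum.cong refl) (simp add: tr_prod4 ij hom_prod4[OF rho_hom])
  also have "\<dots> = prod4 (\<lambda>i j. \<Sum>p\<in>I2. A i p * rho (tr_mat e2 A p j)) (\<lambda>i j. \<Sum>p\<in>I2. B i p * rho (tr_mat e2 B p j)) i j"
  proof (rule prod4_mult[OF ij])
    fix i j k l assume "i \<in> I2" "j \<in> I2" "k \<in> I2" "l \<in> I2"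
    then have "cm (B i j) (A (- l) (- k))" by (intro cm_sym[OF c]) simp_all
    then show "B i j * rho (tr_mat e2 A k l) = rho (tr_mat e2 A k l) * B i j"
      unfolding rho_def tr_mat_def by (intro cm_mult_commute cm_closed(1,2) cm_arith(4))
  qed
  finally show ?thesis by (simp add: twm_def[abs_def])
qed

abbreviation sS :: "int \<Rightarrow> int \<Rightarrow> sy2 fps" where "sS \<equiv> twm Tsy2"

definition coeffs_of :: "int set \<Rightarrow> (int \<Rightarrow> int \<Rightarrow> 'a::calg fps) \<Rightarrow> 'a set" where
  "coeffs_of I T = {T i j $ n | i j n. i \<in> I \<and> j \<in> I}"

lemma coeffs_of_serin: "coeffs_of I T \<subseteq> S \<longleftrightarrow> (\<forall>i\<in>I. \<forall>j\<in>I. T i j \<in> serin S)"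
  by (auto simp: coeffs_of_def serin_def)

lemma twm4_Ty4:
  assumes "i \<in> I4" "j \<in> I4"
  shows "twm4 Ty4 i j = prod4 (\<lambda>i j. fmap iL (sS i j)) (\<lambda>i j. fmap iR (sS i j)) i j"
  unfolding twm_fmap[OF iL(1)] twm_fmap[OF iR(1)]
  by (rule twm4_prod4[OF assms Ty4_factorization cm_fmap_commute[OF iL_iR_commute]])

definition W4 :: "x4 fps" where "W4 = yy * fneg yy"

lemma W4: "W4 \<in> serin center" "W4 $ 0 = 1" "fneg W4 = W4"
proof -
  note s = subalgD[OF subalg_serin[OF subalg_center]]
  show "W4 \<in> serin center" unfolding W4_def by (intro s(4) yy_center serin_fneg subalg_center)
  show "W4 $ 0 = 1" by (simp add: W4_def)
  show "fneg W4 = W4"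
    unfolding W4_def alg_homD[OF fneg_hom] fneg_fneg by (rule center_commute[OF yy_center, symmetric])
qed

text \<open>The central factors of T(u - 1/2) and T(-u + 1/2) combine to y(u - 1/2) y(1/2 - u) = W(u
  - 1/2).\<close>

lemma twm4_Tx4:
  assumes ij: "i \<in> I4" "j \<in> I4"
  shows "twm4 Tx4 i j = fshift (- 1/2) W4 * prod4 (\<lambda>i j. fmap kk (fmap iL (sS i j))) (\<lambda>i j. fmap kk (fmap iR (sS i j))) i j"
proof -
  let ?a = "fshift (- 1/2) yy" and ?b = "fneg (fshift (1/2) yy)"
  let ?T = "\<lambda>i j. fmap kk (Ty4 i j)"
  note s = serin_fshift[OF subalg_center yy_center]
  have ab: "?a * ?b = fshift (- 1/2) W4"
    by (simp add: W4_def fneg_fshift alg_homD[OF fshift_hom])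
  have "fshift (- 1/2) (Tx4 i p) * fneg (fshift (1/2) (Tx4 (- j) (- p))) =
     fshift (- 1/2) W4 * (fshift (- 1/2) (?T i p) * fneg (fshift (1/2) (?T (- j) (- p))))" if p: "p \<in> I4" for p
  proof -
    have "fshift (- 1/2) (Tx4 i p) * fneg (fshift (1/2) (Tx4 (- j) (- p))) =
      ?a * (fshift (- 1/2) (?T i p) * ?b) * fneg (fshift (1/2) (?T (- j) (- p)))"
      using Tx4_eq[of i p] Tx4_eq[of "- j" "- p"] p ij
      by (simp add: alg_homD[OF fshift_hom] alg_homD[OF fneg_hom] mult.assoc)
    also have "fshift (- 1/2) (?T i p) * ?b = ?b * fshift (- 1/2) (?T i p)"
      by (rule center_commute[OF serin_fneg[OF subalg_center s], symmetric])
    finally show ?thesis by (simp only: ab[symmetric] mult.assoc)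
  qed
  then have "twm4 Tx4 i j = fshift (- 1/2) W4 * twm4 ?T i j"
    unfolding twm4_def sum_distrib_left by (intro sum.cong refl)
  also have "twm4 ?T i j = fmap kk (twm4 Ty4 i j)"
    by (simp add: twm4_def alg_homD[OF fmap_hom[OF kk(1)]] fmap_fshift[OF kk(1)] fmap_fneg[OF kk(1)])
  also have "\<dots> = prod4 (\<lambda>i j. fmap kk (fmap iL (sS i j))) (\<lambda>i j. fmap kk (fmap iR (sS i j))) i j"
    unfolding twm4_Ty4[OF ij] by (rule hom_prod4[OF fmap_hom[OF kk(1)]])
  finally show ?thesis .
qed

text \<open>For odd n, comparing the n-th coefficients of f(u) and f(1 - u) gives 2 f_n = 0 modulo
  lower coefficients.\<close>

lemma symmetric_odd_nth:
  assumes S: "subalg S" and f: "rho f = f" and n: "odd n" and lower: "\<And>k. k < n \<Longrightarrow> f $ k \<in> S"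
  shows "f $ n \<in> S"
proof -
  note s = subalgD[OF S]
  have "f $ n = rho f $ n" by (simp only: f)
  also have "\<dots> = - fshift 1 f $ n" using n by (simp add: rho_def fneg_nth)
  finally have e: "fshift 1 f $ n = - f $ n" by simp
  have "fshift 1 f $ n - f $ n \<in> S" by (rule fshift_nth_mod[OF S lower])
  then have "- (f $ n + f $ n) \<in> S" unfolding e by simp
  from s(6)[OF this] have "f $ n + f $ n \<in> S" by simp
  then show ?thesis by (rule subalg_double[OF S])
qed

lemma mult_nth_in:
  assumes S: "subalg S" and fg: "(f * g) $ n \<in> S" and n: "n \<ge> 1"
    and "\<And>k. k < n \<Longrightarrow> f $ k \<in> S" "\<And>k. k < n \<Longrightarrow> g $ k \<in> S"
  shows "f $ 0 * g $ n + f $ n * g $ 0 \<in> S"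
  using subalgD(7)[OF S fg mult_nth_mod[OF S n, of f g]] assms(4,5) by (simp add: add.commute)

text \<open>In s(u) s(-u) = 1 the n-th coefficient is s_n + (-1)^n s_n modulo lower ones. For even n
  this is 2 s_n; for odd n it carries no information, and the trace symmetry has to step in.\<close>

lemma unitary_even_nth:
  assumes S: "subalg S" and s: "\<And>i j. i \<in> I2 \<Longrightarrow> j \<in> I2 \<Longrightarrow> (\<Sum>p\<in>I2. s i p * fneg (s p j)) = (if i = j then 1 else 0)"
    "\<And>i j. i \<in> I2 \<Longrightarrow> j \<in> I2 \<Longrightarrow> s i j $ 0 = (if i = j then 1 else 0)"
    and n: "even n" "n \<ge> 1" and lower: "\<And>k i j. k < n \<Longrightarrow> i \<in> I2 \<Longrightarrow> j \<in> I2 \<Longrightarrow> s i j $ k \<in> S"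
    and ij: "i \<in> I2" "j \<in> I2"
  shows "s i j $ n \<in> S"
proof -
  note c = subalgD[OF S]
  have "(s i p * fneg (s p j)) $ n - (s i p $ 0 * s p j $ n + s i p $ n * s p j $ 0) \<in> S" if "p \<in> I2" for p
    using mult_nth_mod[OF S n(2), of "s i p" "fneg (s p j)"] lower ij that n(1) by (simp add: fneg_nth c)
  then have "(\<Sum>p\<in>I2. (s i p * fneg (s p j)) $ n - (s i p $ 0 * s p j $ n + s i p $ n * s p j $ 0)) \<in> S"
    by (rule c(8))
  also have "(\<Sum>p\<in>I2. (s i p * fneg (s p j)) $ n - (s i p $ 0 * s p j $ n + s i p $ n * s p j $ 0)) =
     (\<Sum>p\<in>I2. s i p * fneg (s p j)) $ n - (\<Sum>p\<in>I2. s i p $ 0 * s p j $ n + s i p $ n * s p j $ 0)"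
    by (simp only: sum_subtractf fps_sum_nth)
  also have "(\<Sum>p\<in>I2. s i p * fneg (s p j)) $ n = 0" unfolding s(1)[OF ij] using n(2) by simp
  also have "(\<Sum>p\<in>I2. s i p $ 0 * s p j $ n + s i p $ n * s p j $ 0) = s i j $ n + s i j $ n"
    using ij by (elim I2E) (simp_all add: s(2))
  finally have "- (s i j $ n + s i j $ n) \<in> S" by simp
  from c(6)[OF this] have "s i j $ n + s i j $ n \<in> S" by simp
  then show ?thesis by (rule subalg_double[OF S])
qed

text \<open>Induction on the coefficient index: even coefficients are determined by lower ones since
  \<open>s(u) s(-u) = 1\<close>; odd coefficients of the traces are so since \<open>tr s(u) = tr s(1 - u)\<close>, and the
  other odd ones can then be read off from \<open>s \<otimes> t\<close>.\<close>

lemma separate_factors: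
  fixes s t :: "int \<Rightarrow> int \<Rightarrow> 'a::calg fps"
  assumes S: "subalg S" and W: "W \<in> serin center" "W $ 0 = 1" "rho W = W"
    and s: "\<And>i j. i \<in> I2 \<Longrightarrow> j \<in> I2 \<Longrightarrow> (\<Sum>p\<in>I2. s i p * fneg (s p j)) = (if i = j then 1 else 0)"
      "\<And>i j. i \<in> I2 \<Longrightarrow> j \<in> I2 \<Longrightarrow> s i j $ 0 = (if i = j then 1 else 0)"
      "rho (s 1 1 + s (- 1) (- 1)) = s 1 1 + s (- 1) (- 1)"
    and t: "\<And>i j. i \<in> I2 \<Longrightarrow> j \<in> I2 \<Longrightarrow> (\<Sum>p\<in>I2. t i p * fneg (t p j)) = (if i = j then 1 else 0)"
      "\<And>i j. i \<in> I2 \<Longrightarrow> j \<in> I2 \<Longrightarrow> t i j $ 0 = (if i = j then 1 else 0)"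
      "rho (t 1 1 + t (- 1) (- 1)) = t 1 1 + t (- 1) (- 1)"
    and c: "\<And>i j k l. i \<in> I2 \<Longrightarrow> j \<in> I2 \<Longrightarrow> k \<in> I2 \<Longrightarrow> l \<in> I2 \<Longrightarrow> cm (s i j) (t k l)"
    and st: "\<And>i j. i \<in> I4 \<Longrightarrow> j \<in> I4 \<Longrightarrow> W * prod4 s t i j \<in> serin S"
    and ij: "i \<in> I2" "j \<in> I2"
  shows "W \<in> serin S" "s i j \<in> serin S" "t i j \<in> serin S"
proof -
  note cS = subalgD[OF S] and cs = subalgD[OF subalg_serin[OF S]]
  have P: "W * (s a b * t k l) \<in> serin S" if abkl: "a \<in> I2" "b \<in> I2" "k \<in> I2" "l \<in> I2" for a b k l
  proof -
    \<comment> \<open>The inverse of the index map i -> (\<open>ix1 i\<close>,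
      \<open>ix2 i\<close>).\<close>
    let ?q = "\<lambda>a k. if a = 1 then if k = 1 then 2 else 1 else if k = 1 then - 1 else - 2 :: int"
    have q: "?q a k \<in> I4" "ix1 (?q a k) = a" "ix2 (?q a k) = k" "sg (?q a k) * sg (?q a k) = 1" if "a \<in> I2" "k \<in> I2" for a k
      using that by (elim I2E; simp)+
    have "sg (?q a k) * sg (?q b l) * (sg (?q a k) * sg (?q b l)) = 1"
      using q(4)[OF abkl(1,3)] q(4)[OF abkl(2,4)] by (simp only: mult_ac) (metis mult.assoc mult.commute mult_1_left)
    then have "W * (s a b * t k l) = (sg (?q a k) * sg (?q b l)) \<star> (W * prod4 s t (?q a k) (?q b l))"
      using q abkl by (simp add: prod4_def cs_mult_right cs_assoc del: ix_simps)
    moreover have "W * prod4 s t (?q a k) (?q b l) \<in> serin S" by (rule st) (use q abkl in blast)+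
    ultimately show ?thesis using cs(5) by simp
  qed
  note Wc = center_commute[OF W(1)] and Wn = center_commute[OF serin_fneg[OF subalg_center W(1)]]
  \<comment> \<open>W(u) W(-u) is extracted before anything is known about the factors: it is the
    entry at (1, 1) in both tensor factors of the product of W s t with its value at -u, by
    unitarity of s and t.\<close>
  have "W * fneg W = (\<Sum>p\<in>I2. \<Sum>q\<in>I2. (W * (s 1 p * t 1 q)) * fneg (W * (s p 1 * t q 1)))"
  proof -
    have e: "(W * (s 1 p * t 1 q)) * fneg (W * (s p 1 * t q 1)) =
      W * fneg W * ((s 1 p * fneg (s p 1)) * (t 1 q * fneg (t q 1)))" if pq: "p \<in> I2" "q \<in> I2" for p q
    proof -
      have "t 1 q * fneg (s p 1) = fneg (s p 1) * t 1 q"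
        by (rule cm_mult_commute[OF cm_closed(2)[OF cm_sym[OF c]]]) (use pq in simp_all)
      then have x: "s 1 p * t 1 q * (fneg (s p 1) * fneg (t q 1)) = (s 1 p * fneg (s p 1)) * (t 1 q * fneg (t q 1))"
        by (metis mult.assoc)
      have "(W * (s 1 p * t 1 q)) * fneg (W * (s p 1 * t q 1)) =
        W * (s 1 p * t 1 q * fneg W) * (fneg (s p 1) * fneg (t q 1))"
        by (simp only: alg_homD(2)[OF fneg_hom] mult.assoc)
      also have "s 1 p * t 1 q * fneg W = fneg W * (s 1 p * t 1 q)" by (rule Wn[symmetric])
      finally show ?thesis by (simp only: mult.assoc x[unfolded mult.assoc])
    qed
    have "(\<Sum>p\<in>I2. \<Sum>q\<in>I2. (W * (s 1 p * t 1 q)) * fneg (W * (s p 1 * t q 1))) =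
      (\<Sum>p\<in>I2. \<Sum>q\<in>I2. W * fneg W * ((s 1 p * fneg (s p 1)) * (t 1 q * fneg (t q 1))))"
      by (intro sum.cong refl e)
    also have "\<dots> = W * fneg W * ((\<Sum>p\<in>I2. s 1 p * fneg (s p 1)) * (\<Sum>q\<in>I2. t 1 q * fneg (t q 1)))"
      unfolding sum_product unfolding sum_distrib_left ..
    also have "\<dots> = W * fneg W" using s(1)[of 1 1] t(1)[of 1 1] by (simp del: I2_simps(4))
    finally show ?thesis by simp
  qed
  also have "\<dots> \<in> serin S"
    by (intro cs(8) cs(4) P serin_fneg[OF S]) simp_all
  finally have WW: "W * fneg W \<in> serin S" .
  \<comment> \<open>Odd coefficients come from the symmetry under u -> 1 - u, even ones from W(u)
    W(-u), whose n-th coefficient is then 2 W_n modulo lower ones.\<close>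
  have "W $ n \<in> S" for n
  proof (induction n rule: less_induct)
    case (less n)
    show ?case
    proof (cases "n = 0 \<or> odd n")
      case True
      then show ?thesis using cS W(2) symmetric_odd_nth[OF S W(3) _ less] by auto
    next
      case False
      have "W $ 0 * fneg W $ n + W $ n * fneg W $ 0 \<in> S"
        by (rule mult_nth_in[OF S serinD[OF WW]]) (use False less cS in \<open>auto simp: fneg_nth\<close>)
      then have "W $ n + W $ n \<in> S" using False by (simp add: W(2) fneg_nth)
      then show ?thesis by (rule subalg_double[OF S])
    qed
  qed
  then show WS: "W \<in> serin S" by (rule serinI)
  have Q: "s a b * t k l \<in> serin S" if abkl: "a \<in> I2" "b \<in> I2" "k \<in> I2" "l \<in> I2" for a b k l
  proof -
    have "finv W * (W * (s a b * t k l)) \<in> serin S"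
      by (intro cs(4) P abkl serin_finv[OF S WS])
    then show ?thesis by (simp add: finv_left[OF W(2)] flip: mult.assoc)
  qed
  have "\<forall>k\<le>n. \<forall>i\<in>I2. \<forall>j\<in>I2. s i j $ k \<in> S \<and> t i j $ k \<in> S" for n
  proof (induction n)
    case 0
    then show ?case using cS by (simp add: s(2) t(2))
  next
    case (Suc m)
    define n where "n = Suc m"
    have n: "n \<ge> 1" by (simp add: n_def)
    have ls: "s i j $ k \<in> S" and lt: "t i j $ k \<in> S" if "k < n" "i \<in> I2" "j \<in> I2" for k i j
      using Suc that by (auto simp: n_def)
    have "s i j $ n \<in> S \<and> t i j $ n \<in> S" if ij: "i \<in> I2" "j \<in> I2" for i j
    proof (cases "even n")
      case True
      then show ?thesis
        using unitary_even_nth[OF S s(1,2) True n ls ij] unitary_even_nth[OF S t(1,2) True n lt ij] by blast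
    next
      case False
      \<comment> \<open>The leading part of the n-th coefficient of s_ab t_kl, as s and t have
        constant term the identity. On diagonal entries it mixes s and t, which the traces
        resolve.\<close>
      have R: "(if a = b then t k l $ n else 0) + (if k = l then s a b $ n else 0) \<in> S"
        if abkl: "a \<in> I2" "b \<in> I2" "k \<in> I2" "l \<in> I2" for a b k l
        using mult_nth_in[OF S serinD[OF Q[OF abkl]] n ls[OF _ abkl(1,2)] lt[OF _ abkl(3,4)]]
        by (simp add: s(2) t(2) abkl split: if_splits)
      have "(s 1 1 + s (- 1) (- 1)) $ n \<in> S" "(t 1 1 + t (- 1) (- 1)) $ n \<in> S"
        by (rule symmetric_odd_nth[OF S s(3) False], simp add: cS ls)
          (rule symmetric_odd_nth[OF S t(3) False], simp add: cS lt)
      then have tr: "s 1 1 $ n + s (- 1) (- 1) $ n \<in> S" "t 1 1 $ n + t (- 1) (- 1) $ n \<in> S" by simp_all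
      have df: "s 1 1 $ n - s (- 1) (- 1) $ n \<in> S" "t 1 1 $ n - t (- 1) (- 1) $ n \<in> S"
        using cS(7)[OF R[of 1 1 1 1] R[of "-1" "-1" 1 1]] cS(7)[OF R[of 1 1 1 1] R[of 1 1 "-1" "-1"]] by simp_all
      have d1: "s 1 1 $ n \<in> S" "t 1 1 $ n \<in> S"
        using cS(3)[OF tr(1) df(1)] cS(3)[OF tr(2) df(2)] by (auto intro: subalg_double[OF S])
      have d2: "s (- 1) (- 1) $ n \<in> S" "t (- 1) (- 1) $ n \<in> S"
        using cS(7)[OF tr(1) d1(1)] cS(7)[OF tr(2) d1(2)] by simp_all
      have o: "s 1 (- 1) $ n \<in> S" "s (- 1) 1 $ n \<in> S" "t 1 (- 1) $ n \<in> S" "t (- 1) 1 $ n \<in> S"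
        using R[of 1 "-1" 1 1] R[of "-1" 1 1 1] R[of 1 1 1 "-1"] R[of 1 1 "-1" 1] by simp_all
      show ?thesis using ij d1 d2 o by (elim I2E) auto
    qed
    then show ?case using Suc by (auto simp: le_Suc_eq n_def)
  qed
  then show "s i j \<in> serin S" "t i j \<in> serin S" using ij by (auto simp: serin_def)
qed

text \<open>The analogue of \<open>separate_factors\<close> for B(2,0), with a scalar v in place of
  the second matrix. Even coefficients of v come from v(u) v(-u) = 1. For odd n the sum of the
  diagonal coefficients of v s exceeds the trace of s_n by 2 v_n, modulo lower ones, and that trace
  is already known by its symmetry.\<close>

lemma separate_scalar:
  fixes s :: "int \<Rightarrow> int \<Rightarrow> 'a::calg fps"
  assumes S: "subalg S" and v: "v * fneg v = 1" "v $ 0 = 1"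
    and s: "\<And>i j. i \<in> I2 \<Longrightarrow> j \<in> I2 \<Longrightarrow> s i j $ 0 = (if i = j then 1 else 0)"
      "rho (s 1 1 + s (- 1) (- 1)) = s 1 1 + s (- 1) (- 1)"
    and vs: "\<And>i j. i \<in> I2 \<Longrightarrow> j \<in> I2 \<Longrightarrow> v * s i j \<in> serin S"
    and ij: "i \<in> I2" "j \<in> I2"
  shows "v \<in> serin S" "s i j \<in> serin S"
proof -
  note cS = subalgD[OF S]
  have "\<forall>k\<le>n. v $ k \<in> S \<and> (\<forall>i\<in>I2. \<forall>j\<in>I2. s i j $ k \<in> S)" for n
  proof (induction n)
    case 0
    then show ?case using cS by (simp add: s(1) v(2))
  next
    case (Suc m)
    define n where "n = Suc m"
    have n: "n \<ge> 1" by (simp add: n_def)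
    have lv: "v $ k \<in> S" and ls: "\<And>i j. i \<in> I2 \<Longrightarrow> j \<in> I2 \<Longrightarrow> s i j $ k \<in> S" if "k < n" for k
      using Suc that by (auto simp: n_def)
    have R: "s i j $ n + (if i = j then v $ n else 0) \<in> S" if "i \<in> I2" "j \<in> I2" for i j
      using mult_nth_in[OF S serinD[OF vs[OF that]] n lv ls] that by (simp add: s(1) v(2) split: if_splits)
    have vn: "v $ n \<in> S"
    proof (cases "even n")
      case True
      have "(v * fneg v) $ n \<in> S" unfolding v(1) using cS by (cases n) simp_all
      then have "v $ 0 * fneg v $ n + v $ n * fneg v $ 0 \<in> S"
        by (rule mult_nth_in[OF S _ n]) (simp_all add: lv fneg_nth cS)
      then have "v $ n + v $ n \<in> S" using True by (simp add: v(2) fneg_nth)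
      then show ?thesis by (rule subalg_double[OF S])
    next
      case False
      have "(s 1 1 + s (- 1) (- 1)) $ n \<in> S"
        by (rule symmetric_odd_nth[OF S s(2) False]) (simp add: cS ls)
      then have "(s 1 1 $ n + v $ n) + (s (- 1) (- 1) $ n + v $ n) - (s 1 1 $ n + s (- 1) (- 1) $ n) \<in> S"
        using R[of 1 1] R[of "-1" "-1"] by (intro cS(7)[OF cS(3)]) simp_all
      then have "v $ n + v $ n \<in> S" by (simp add: algebra_simps)
      then show ?thesis by (rule subalg_double[OF S])
    qed
    have "s i j $ n \<in> S" if "i \<in> I2" "j \<in> I2" for i j
      using R[OF that] cS(7)[OF R[OF that] vn] by (simp split: if_splits)
    with vn show ?case using Suc by (auto simp: le_Suc_eq n_def)
  qed
  then show "v \<in> serin S" "s i j \<in> serin S" using ij by (auto simp: serin_def)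
qed

lemma fmap_sS_props:
  assumes h: "alg_hom h"
  shows "i \<in> I2 \<Longrightarrow> j \<in> I2 \<Longrightarrow> (\<Sum>p\<in>I2. fmap h (sS i p) * fneg (fmap h (sS p j))) = (if i = j then 1 else 0)"
    and "i \<in> I2 \<Longrightarrow> j \<in> I2 \<Longrightarrow> fmap h (sS i j) $ 0 = (if i = j then 1 else 0)"
    and "rho (fmap h (sS 1 1) + fmap h (sS (- 1) (- 1))) = fmap h (sS 1 1) + fmap h (sS (- 1) (- 1))"
proof -
  note H = alg_homD[OF fmap_hom[OF h]]
  show "(\<Sum>p\<in>I2. fmap h (sS i p) * fneg (fmap h (sS p j))) = (if i = j then 1 else 0)" if "i \<in> I2" "j \<in> I2"
    using twm_props(1)[OF Tsy2 that, THEN arg_cong, of "fmap h"] 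
    by (simp add: H fmap_fneg[OF h] split: if_splits)
  show "fmap h (sS i j) $ 0 = (if i = j then 1 else 0)" if "i \<in> I2" "j \<in> I2"
    using twm_props(2)[OF Tsy2 that] by (simp add: alg_homD[OF h])
  show "rho (fmap h (sS 1 1) + fmap h (sS (- 1) (- 1))) = fmap h (sS 1 1) + fmap h (sS (- 1) (- 1))"
    using trace_twm_symmetric[OF Tsy2(1), THEN arg_cong, of "fmap h"]
    by (simp add: H rho_def fmap_fneg[OF h] fmap_fshift[OF h])
qed

text \<open>For a series \<open>v\<close> with \<open>v(u) v(-u) = 1\<close>, \<open>d = half_quot v\<close> is the solution of
  \<open>d(u) / d(-u) = v(u)\<close> for which \<open>d - 1\<close> is odd, so that \<open>even_ser d = 1 + u\<^sup>-\<^sup>1 (d - 1)\<close> is even.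
  In this way the quotient \<open>d(u) / d(-u)\<close> determines an even series and conversely.\<close>

definition half_quot :: "'a::calg fps \<Rightarrow> 'a fps" where
  "half_quot v = v * finv ((1/2) \<star> (v + 1))"

lemma half_nth_0: "v $ 0 = 1 \<Longrightarrow> ((1/2) \<star> (v + 1)) $ 0 = (1::'a::calg)"
  using half_cs_double[of "1::'a"] by simp

lemma half_quot_nth_0: "v $ 0 = 1 \<Longrightarrow> half_quot v $ 0 = 1"
  by (simp add: half_quot_def)

lemma serin_half_quot: "subalg S \<Longrightarrow> v \<in> serin S \<Longrightarrow> half_quot v \<in> serin S"
proof -
  assume S: "subalg S" and v: "v \<in> serin S"
  note s = subalgD[OF subalg_serin[OF S]]
  show ?thesis unfolding half_quot_def by (rule s(4)[OF v serin_finv[OF S s(5)[OF s(3)[OF v s(1)]]]])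
qed

text \<open>Put m = (v + 1)/2. Since v(-u) is the inverse of v, m(-u) = m / v, so d = v / m
  satisfies d(-u) = 1 / m. Both claims follow: d + d(-u) = (v + 1) / m = 2 and d / d(-u) =
  v.\<close>

lemma half_quot:
  fixes v :: "'a::calg fps"
  assumes v: "v $ 0 = 1" "v * fneg v = 1"
  shows "half_quot v + fneg (half_quot v) = 1 + 1" "half_quot v * finv (fneg (half_quot v)) = v"
proof -
  let ?m = "(1/2) \<star> (v + 1)" and ?d = "half_quot v"
  note m0 = half_nth_0[OF v(1)]
  have fv: "fneg v = finv v" by (rule finv_unique[OF v])
  have fm: "fneg ?m = fneg v * ?m"
    by (simp add: alg_homD[OF fneg_hom] cs_mult_right distrib_left fv finv_left[OF v(1)] add.commute)
  have "finv (fneg ?m) = finv ?m * finv (fneg v)"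
    unfolding fm by (rule finv_mult) (use v(1) m0 in simp_all)
  also have "finv (fneg v) = v"
    by (rule finv_unique[symmetric]) (use v(1) in \<open>simp_all add: fv finv_left\<close>)
  finally have fi: "finv (fneg ?m) = finv ?m * v" .
  have "?m * v = v * ?m" by (simp add: cs_mult_right cs_mult_left distrib_left distrib_right)
  then have c: "finv ?m * v = v * finv ?m" by (rule finv_commute[OF m0])
  have "fneg ?d = fneg v * finv (fneg ?m)"
    by (simp only: half_quot_def alg_homD(2)[OF fneg_hom] fneg_finv[OF m0])
  also have "\<dots> = fneg v * v * finv ?m" unfolding fi c by (simp only: mult.assoc)
  also have "\<dots> = finv ?m" by (simp add: fv finv_left[OF v(1)])
  finally have fd: "fneg ?d = finv ?m" .
  have "?d + fneg ?d = (v + 1) * finv ?m" unfolding fd unfolding half_quot_def by (simp add: distrib_right)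
  also have "\<dots> = (?m + ?m) * finv ?m" by (simp add: cs_assoc flip: cs_two)
  also have "\<dots> = 1 + 1" by (simp only: distrib_right finv_right[OF m0])
  finally show "?d + fneg ?d = 1 + 1" .
  have "finv (finv ?m) = ?m"
    by (rule finv_unique[symmetric]) (simp_all only: finv_nth_0 finv_left[OF m0])
  then show "?d * finv (fneg ?d) = v" unfolding fd by (simp add: half_quot_def mult.assoc finv_left[OF m0] del: mult.assoc[symmetric])
qed

lemma half_quot_eqI:
  fixes d :: "'a::calg fps"
  assumes d: "d $ 0 = 1" "d + fneg d = 1 + 1"
  shows "half_quot (d * finv (fneg d)) = d"
proof -
  have f0: "fneg d $ 0 = 1" using d(1) by simp
  have "d * finv (fneg d) + 1 = (d + fneg d) * finv (fneg d)"
    by (simp add: distrib_right finv_right[OF f0])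
  also have "\<dots> = finv (fneg d) + finv (fneg d)" unfolding d(2) by (simp only: distrib_right mult_1_left)
  finally have "(1/2) \<star> (d * finv (fneg d) + 1) = finv (fneg d)" by (simp only: half_cs_double)
  moreover have "finv (finv (fneg d)) = fneg d"
    by (rule finv_unique[symmetric]) (simp_all only: finv_nth_0 finv_left[OF f0])
  ultimately show ?thesis by (simp add: half_quot_def mult.assoc finv_left[OF f0])
qed

definition even_ser :: "'a::calg fps \<Rightarrow> 'a fps" where
  "even_ser d = 1 + fps_X * (d - 1)"

lemma even_ser_inj: "even_ser d = even_ser d' \<Longrightarrow> d = d'"
proof -
  assume "even_ser d = even_ser d'"
  then have "(fps_X * (d - 1)) $ Suc n = (fps_X * (d' - 1)) $ Suc n" for n by (simp add: even_ser_def)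
  then show ?thesis by (simp add: fps_eq_iff)
qed

lemma fmap_X: "alg_hom h \<Longrightarrow> fmap h fps_X = fps_X"
proof -
  assume h: "alg_hom h"
  show ?thesis by (rule fps_ext) (simp add: alg_homD[OF h] fps_X_def)
qed

lemma fmap_even_ser: "alg_hom h \<Longrightarrow> fmap h (even_ser d) = even_ser (fmap h d)"
proof -
  assume h: "alg_hom h"
  show ?thesis by (simp add: even_ser_def alg_homD[OF fmap_hom[OF h]] fmap_X[OF h])
qed

lemma fneg_even_ser:
  assumes "d + fneg d = 1 + 1"
  shows "fneg (even_ser d) = even_ser d"
proof -
  have "fneg d - 1 = 1 - d" using assms by (simp add: algebra_simps)
  then have "fneg (even_ser d) = 1 + - fps_X * (1 - d)"
    by (simp only: even_ser_def alg_homD[OF fneg_hom] fneg_X)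
  also have "\<dots> = even_ser d" by (simp add: even_ser_def algebra_simps)
  finally show ?thesis .
qed

lemma serin_even_ser: "subalg S \<Longrightarrow> d \<in> serin S \<Longrightarrow> even_ser d \<in> serin S"
proof -
  assume S: "subalg S" and d: "d \<in> serin S"
  note s = subalgD[OF subalg_serin[OF S]]
  show ?thesis unfolding even_ser_def by (rule s(3)[OF s(1) s(4)[OF serin_X[OF S] s(7)[OF d s(1)]]])
qed

section \<open>The central series d(u)/d(-u) and its counterpart in X(so_4)\<close>

definition v2 :: "y2 fps" where "v2 = d2 * finv (fneg d2)"

lemma v2: "v2 $ 0 = 1" "v2 * fneg v2 = 1" "v2 \<in> serin center"
proof -
  note s = subalgD[OF subalg_serin[OF subalg_center]]
  have n: "finv (fneg d2) \<in> serin center"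
    by (rule serin_finv[OF subalg_center serin_fneg[OF subalg_center d2_center]])
  show "v2 $ 0 = 1" by (simp add: v2_def)
  have "v2 * fneg v2 = d2 * (finv (fneg d2) * fneg d2) * finv d2"
    by (simp add: v2_def alg_homD[OF fneg_hom] fneg_finv mult.assoc)
  also have "\<dots> = 1" by (simp add: finv_left finv_right)
  finally show "v2 * fneg v2 = 1" .
  show "v2 \<in> serin center" unfolding v2_def by (rule s(4)[OF d2_center n])
qed

text \<open>The series with \<open>even_ser d4\<close> equal to the square root of W:
  \<open>sqs 0\<close> is the ordinary square root, and \<open>fps_shift 1\<close> undoes the
  multiplication by u^-1. The root is taken because an even y gives y(u) y(-u) = y(u)^2.\<close>

definition d4 :: "x4 fps" where "d4 = 1 + fps_shift 1 (sqs 0 W4 - 1)"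

lemma d4_serinI:
  assumes S: "subalg S" and W: "W4 \<in> serin S"
  shows "d4 \<in> serin S"
proof -
  note s = subalgD[OF subalg_serin[OF S]]
  have r: "sqs 0 W4 - 1 \<in> serin S" by (rule s(7)[OF serin_sqs[OF S W] s(1)])
  have "fps_shift 1 (sqs 0 W4 - 1) \<in> serin S" by (rule serinI) (simp only: fps_shift_nth, rule serinD[OF r])
  then show ?thesis unfolding d4_def by (rule s(3)[OF s(1)])
qed

text \<open>W is even, so its square root is even by uniqueness. The vanishing of the odd
  coefficients of the root yields both the constant term 1 and the oddness of \<open>d4\<close> -
  1.\<close>

lemma d4: "even_ser d4 = sqs 0 W4" "d4 $ 0 = 1" "d4 + fneg d4 = 1 + 1" "d4 \<in> serin center"
proof -
  let ?r = "sqs 0 W4"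
  show e: "even_ser d4 = ?r"
    by (rule fps_ext) (simp add: even_ser_def d4_def)
  have r: "?r * ?r = W4" using sqs_eq[OF W4(2), of 0] by simp
  have fr: "fneg ?r * fneg ?r = W4"
    using arg_cong[OF r, of fneg] unfolding alg_homD(2)[OF fneg_hom] W4(3) .
  have "fneg ?r = ?r"
  proof (rule sqs_unique[of _ _ 0])
    show "fneg ?r * fshift 0 (fneg ?r) = ?r * fshift 0 ?r"
      by (simp add: fr r)
  qed simp_all
  then have o: "?r $ n = 0" if "odd n" for n
  proof -
    have "fneg ?r $ n = ?r $ n" by (simp only: \<open>fneg ?r = ?r\<close>)
    then have "?r $ n + ?r $ n = 0" using that by (simp add: fneg_nth eq_neg_iff_add_eq_0 neg_eq_iff_add_eq_0)
    then show ?thesis by (simp only: double_eq_zero_iff)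
  qed
  show d0: "d4 $ 0 = 1" by (simp add: d4_def o)
  show "d4 + fneg d4 = 1 + 1"
  proof (rule fps_ext)
    fix n
    show "(d4 + fneg d4) $ n = (1 + 1) $ n"
      by (cases "n = 0"; cases "even n") (simp_all add: d4_def fneg_nth o del: one_add_one)
  qed
  show "d4 \<in> serin center" by (rule d4_serinI[OF subalg_center W4(1)])
qed

lemma d4_serin:
  assumes S: "subalg S"
  shows "d4 \<in> serin S \<longleftrightarrow> W4 \<in> serin S"
proof
  assume "d4 \<in> serin S"
  then have "sqs 0 W4 \<in> serin S" using serin_even_ser[OF S] by (metis d4(1))
  then have "sqs 0 W4 * fshift 0 (sqs 0 W4) \<in> serin S" using subalgD(4)[OF subalg_serin[OF S]] by simp
  then show "W4 \<in> serin S" by (simp only: sqs_eq[OF W4(2)])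
next
  assume "W4 \<in> serin S"
  then show "d4 \<in> serin S" by (rule d4_serinI[OF S])
qed

text \<open>On \<open>B(2,0)\<close>, \<open>xi\<close> is the embedding onto the second factor of the twisted subalgebra: the even
  central series \<open>W4(u) = y(u) y(-u)\<close>, where \<open>y(u) y(u + 1) = z(u)\<close>, plays the role of
  \<open>d(u) / d(-u)\<close>, where \<open>d(u) d(u - 1)\<close> is the quantum determinant.\<close>

definition xi :: "y2 \<Rightarrow> x4" where
  "xi = (SOME h. alg_hom h \<and> (\<forall>i\<in>I2. \<forall>j\<in>I2. fmap h (Ty2 i j) = d4 * fmap kk (fmap iR (Tsy2 i j))))"

lemma central_scale:
  fixes T :: "int \<Rightarrow> int \<Rightarrow> 'a::calg fps"
  assumes "rtt2 T" "unital I2 T" "qd T = 1" "f \<in> serin center" "f $ 0 = 1"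
  shows "rtt2 (\<lambda>i j. f * T i j)" "unital I2 (\<lambda>i j. f * T i j)" "qd (\<lambda>i j. f * T i j) = f * fshift (- 1) f"
  using rtt_scale[OF assms(1)[unfolded rtt2_def] center_cm(1)[OF assms(4)] center_cm(1)[OF assms(4)] sign_set_I2]
    qd_scale[of T f, OF center_cm(2)[OF assms(4)] center_cm(1)[OF assms(4)]] assms(2,3,5)
  by (simp_all add: rtt2_def unital_def)

lemma Tx2_props:
  shows "rtt2 (\<lambda>i j. fmap kk (fmap iR (Tsy2 i j)))" "unital I2 (\<lambda>i j. fmap kk (fmap iR (Tsy2 i j)))"
    "qd (\<lambda>i j. fmap kk (fmap iR (Tsy2 i j))) = 1"
proof -
  show "rtt2 (\<lambda>i j. fmap kk (fmap iR (Tsy2 i j)))" by (rule rtt2_fmap[OF rtt2_fmap[OF Tsy2(1) iR(1)] kk(1)])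
  show "unital I2 (\<lambda>i j. fmap kk (fmap iR (Tsy2 i j)))" by (rule unital_fmap[OF kk(1) unital_fmap[OF iR(1) Tsy2(2)]])
  show "qd (\<lambda>i j. fmap kk (fmap iR (Tsy2 i j))) = 1"
    unfolding qd_fmap[OF kk(1)] qd_fmap[OF iR(1)] Tsy2(3)
    by (simp only: alg_homD(3)[OF fmap_hom[OF kk(1)]] alg_homD(3)[OF fmap_hom[OF iR(1)]])
qed

lemma xi: "alg_hom xi" "i \<in> I2 \<Longrightarrow> j \<in> I2 \<Longrightarrow> fmap xi (Ty2 i j) = d4 * fmap kk (fmap iR (Tsy2 i j))"
proof -
  note s = central_scale[OF Tx2_props d4(4,2)]
  have "\<exists>h. alg_hom h \<and> (\<forall>i\<in>I2. \<forall>j\<in>I2. fmap h (Ty2 i j) = d4 * fmap kk (fmap iR (Tsy2 i j)))"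
    using y2_universal[OF s(1,2)] by metis
  from someI_ex[OF this] show "alg_hom xi" "i \<in> I2 \<Longrightarrow> j \<in> I2 \<Longrightarrow> fmap xi (Ty2 i j) = d4 * fmap kk (fmap iR (Tsy2 i j))"
    unfolding xi_def[symmetric] by blast+
qed

lemma xi_d2: "fmap xi d2 = d4"
proof -
  have "fmap xi (qd Ty2) = qd (\<lambda>i j. fmap xi (Ty2 i j))" by (rule qd_fmap[OF xi(1), symmetric])
  also have "\<dots> = qd (\<lambda>i j. d4 * fmap kk (fmap iR (Tsy2 i j)))" by (rule qd_cong) (rule xi(2))
  also have "\<dots> = d4 * fshift (- 1) d4" by (rule central_scale(3)[OF Tx2_props d4(4,2)])
  finally show ?thesis
    unfolding d2_def fmap_sqs[OF xi(1) unital_qd[OF Ty2(2)]] by (intro sqs_eqI d4(2)) simp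
qed

lemma xi_jj: "xi (jj a) = kk (iR a)"
proof (rule sy2_hom_eqI[OF alg_hom_comp[OF xi(1) jj(1)] alg_hom_comp[OF kk(1) iR(1)]])
  fix i j assume ij: "i \<in> I2" "j \<in> I2"
  have "d4 * fmap xi (fmap jj (Tsy2 i j)) = d4 * fmap kk (fmap iR (Tsy2 i j))"
    using arg_cong[OF Ty2_eq[OF ij], of "fmap xi"] xi(2)[OF ij] by (simp add: alg_homD[OF fmap_hom[OF xi(1)]] xi_d2)
  then have "finv d4 * (d4 * fmap xi (fmap jj (Tsy2 i j))) = finv d4 * (d4 * fmap kk (fmap iR (Tsy2 i j)))" by simp
  then show "fmap (\<lambda>x. xi (jj x)) (Tsy2 i j) = fmap (\<lambda>x. kk (iR x)) (Tsy2 i j)"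
    by (simp add: finv_left[OF d4(2)] fmap_fmap flip: mult.assoc)
qed

lemma xi_v2: "fmap xi v2 = d4 * finv (fneg d4)" "half_quot (fmap xi v2) = d4"
proof -
  show e: "fmap xi v2 = d4 * finv (fneg d4)"
    by (simp add: v2_def alg_homD[OF fmap_hom[OF xi(1)]] fmap_finv[OF xi(1)] fmap_fneg[OF xi(1)] xi_d2)
  show "half_quot (fmap xi v2) = d4" unfolding e by (rule half_quot_eqI[OF d4(2,3)])
qed

text \<open>Each passage between v and W uses only operations under which series over a subalgebra
  are closed: one way \<open>half_quot\<close>, \<open>even_ser\<close> and squaring, the other way
  a square root, a change of index and a quotient.\<close>

lemma xi_v2_serin:
  assumes S: "subalg S"
  shows "fmap xi v2 \<in> serin S \<longleftrightarrow> W4 \<in> serin S"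
proof
  assume "fmap xi v2 \<in> serin S"
  then show "W4 \<in> serin S" using serin_half_quot[OF S] d4_serin[OF S] by (metis xi_v2(2))
next
  assume "W4 \<in> serin S"
  then have "d4 \<in> serin S" by (simp only: d4_serin[OF S])
  then show "fmap xi v2 \<in> serin S"
    unfolding xi_v2(1) by (intro subalgD(4)[OF subalg_serin[OF S]] serin_finv[OF S] serin_fneg[OF S])
qed

section \<open>Separation of the factors by homomorphisms, and generation of the twisted
  subalgebras\<close>

abbreviation bB :: "int \<Rightarrow> int \<Rightarrow> y2 fps" where "bB i j \<equiv> v2 * fmap jj (sS i j)"

text \<open>Commuting homomorphisms out of SY(2) and Y(2) are merged into one out of X(so_4).
  Agreement with g is claimed on B(2,0) only, since d itself is not reproduced: it is replaced by
  another series with the same quotient d(u)/d(-u).\<close>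

lemma x4_separation:
  fixes f :: "sy2 \<Rightarrow> 'c::calg" and g :: "y2 \<Rightarrow> 'c"
  assumes f: "alg_hom f" and g: "alg_hom g" and c: "\<And>a b. f a * g b = g b * f a"
  obtains \<Theta> where "alg_hom \<Theta>" "\<And>a. \<Theta> (kk (iL a)) = f a" "\<And>b. b \<in> gsub (coeffs_of I2 bB) \<Longrightarrow> \<Theta> (xi b) = g b"
proof -
  note gj = alg_hom_comp[OF g jj(1)]
  note r = rtt4_pair[OF f gj c]
  define T where "T = (\<lambda>i j. fshift (1/2) (prod4 (\<lambda>i j. fmap f (Tsy2 i j)) (\<lambda>i j. fmap (\<lambda>x. g (jj x)) (Tsy2 i j)) i j))"
  \<comment> \<open>This is the replacement for d. As e - 1 is odd, \<open>even_ser e\<close> is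
    even; with its image y as the central factor of T, the series W is sent to y^2, its root to y
    and \<open>d4\<close> to the image of e.\<close>
  define e where "e = half_quot v2"
  define y where "y = fmap g (even_ser e)"
  note e = half_quot[OF v2(1,2), folded e_def]
  have y0: "y $ 0 = 1" by (simp add: y_def alg_homD[OF g] even_ser_def)
  have ec: "even_ser e \<in> serin center"
    unfolding e_def by (intro serin_even_ser serin_half_quot subalg_center v2(3))
  have yg: "cm y (fmap g x)" for x unfolding y_def by (rule cm_fmap[OF g center_cm(1)[OF ec]])
  have yf: "cm y (fmap f x)" for x unfolding y_def cm_def by (simp add: c)
  have yT: "cm y (T i j)" for i j
    unfolding T_def prod4_def fmap_fmap[symmetric, of g jj]
    by (rule cm_closed(1)[OF cm_arith(4)[OF cm_arith(1)[OF yf yg] cm_1]])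
  have yy: "cm y y" using yg y_def by simp
  have R: "rtt4 (\<lambda>i j. y * T i j)"
    using rtt_scale[OF r(1)[folded T_def, unfolded rtt4_def] yy yT sign_set_I4] by (simp add: rtt4_def)
  have Un: "unital I4 (\<lambda>i j. y * T i j)"
    using r(2)[folded T_def] by (simp add: unital_def y0)
  have Z: "zz (\<lambda>i j. y * T i j) = y * fshift 1 y"
    using zz_scale[of T y, OF cm_sym[OF yT] yy] r(3)[folded T_def] by simp
  obtain \<Theta> where \<Theta>: "alg_hom \<Theta>" "\<And>i j. i \<in> I4 \<Longrightarrow> j \<in> I4 \<Longrightarrow> fmap \<Theta> (Tx4 i j) = y * T i j"
    using x4_universal[OF R Un] by blast
  note h = alg_homD[OF fmap_hom[OF \<Theta>(1)]] and hg = alg_homD[OF fmap_hom[OF g]]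
  have "fmap \<Theta> (zz Tx4) = y * fshift 1 y"
    unfolding zz_fmap[OF \<Theta>(1), symmetric] Z[symmetric] by (rule zz_cong) (rule \<Theta>(2))
  then have ty: "fmap \<Theta> yy = y"
    unfolding yy_def fmap_sqs[OF \<Theta>(1) unital_zz[OF Tx4(2)]] by (intro sqs_eqI y0) simp
  have T4: "fmap (\<lambda>x. \<Theta> (kk x)) (Ty4 i j) = T i j" if ij: "i \<in> I4" "j \<in> I4" for i j
  proof -
    have "y * fmap \<Theta> (fmap kk (Ty4 i j)) = y * T i j"
      using arg_cong[OF Tx4_eq[OF ij], of "fmap \<Theta>"] \<Theta>(2)[OF ij] by (simp add: h ty)
    then have "finv y * (y * fmap \<Theta> (fmap kk (Ty4 i j))) = finv y * (y * T i j)" by simp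
    then show ?thesis by (simp add: finv_left[OF y0] fmap_fmap flip: mult.assoc)
  qed
  note H = hom_iL_iR[OF alg_hom_comp[OF \<Theta>(1) kk(1)] f gj c T4[unfolded T_def]]
  have "fneg y = y" unfolding y_def fmap_fneg[OF g, symmetric] fneg_even_ser[OF e(1)] ..
  then have "fmap \<Theta> W4 = y * fshift 0 y" by (simp add: W4_def h ty fmap_fneg[OF \<Theta>(1)])
  then have "fmap \<Theta> (sqs 0 W4) = y"
    unfolding fmap_sqs[OF \<Theta>(1) W4(2)] by (intro sqs_eqI y0) simp
  then have "even_ser (fmap \<Theta> d4) = even_ser (fmap g e)"
    unfolding d4(1)[symmetric] fmap_even_ser[OF \<Theta>(1)] y_def fmap_even_ser[OF g] .
  then have d: "fmap \<Theta> d4 = fmap g e" by (rule even_ser_inj)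
  have e0: "e $ 0 = 1" unfolding e_def by (rule half_quot_nth_0[OF v2(1)])
  have "fmap \<Theta> (fmap xi v2) = fmap g (e * finv (fneg e))"
    unfolding xi_v2(1) using d4(2) e0
    by (simp add: h hg fmap_finv[OF \<Theta>(1)] fmap_finv[OF g] fmap_fneg[OF \<Theta>(1)] fmap_fneg[OF g] d)
  then have v: "fmap \<Theta> (fmap xi v2) = fmap g v2" unfolding e(2) .
  have s: "fmap \<Theta> (fmap xi (fmap jj s)) = fmap g (fmap jj s)" for s
    by (simp add: fps_eq_iff xi_jj H(2))
  have "gsub (coeffs_of I2 bB) \<subseteq> {b. \<Theta> (xi b) = g b}"
  proof (rule gsub_min[OF subalg_equalizer[OF alg_hom_comp[OF \<Theta>(1) xi(1)] g]], unfold coeffs_of_serin, intro ballI serinI CollectI)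
    fix i j n
    have "fmap \<Theta> (fmap xi (bB i j)) = fmap g (bB i j)"
      by (simp only: alg_homD(2)[OF fmap_hom[OF xi(1)]] h(2) hg(2) v s)
    from arg_cong[OF this, of "\<lambda>s. s $ n"] show "\<Theta> (xi (bB i j $ n)) = g (bB i j $ n)" by (simp only: fmap_nth)
  qed
  then show thesis using that[OF \<Theta>(1)] H(1) by blast
qed

lemma y4_separation:
  fixes f g :: "sy2 \<Rightarrow> 'c::calg"
  assumes f: "alg_hom f" and g: "alg_hom g" and c: "\<And>a b. f a * g b = g b * f a"
  obtains \<Phi> where "alg_hom \<Phi>" "\<And>a. \<Phi> (iL a) = f a" "\<And>b. \<Phi> (iR b) = g b"
proof -
  obtain \<Phi> where "alg_hom \<Phi>" and T: "\<And>i j. i \<in> I4 \<Longrightarrow> j \<in> I4 \<Longrightarrow> fmap \<Phi> (Ty4 i j) =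
    fshift (1/2) (prod4 (\<lambda>i j. fmap f (Tsy2 i j)) (\<lambda>i j. fmap g (Tsy2 i j)) i j)"
    using y4_universal[OF rtt4_pair[OF f g c]] by blast
  then show thesis using that hom_iL_iR[OF _ f g c T] by blast
qed

lemma hom_gsub_coeffs:
  assumes h: "alg_hom h" and S: "subalg S"
  shows "h ` gsub (coeffs_of I T) \<subseteq> S \<longleftrightarrow> (\<forall>i\<in>I. \<forall>j\<in>I. fmap h (T i j) \<in> serin S)"
proof
  assume "h ` gsub (coeffs_of I T) \<subseteq> S"
  then have "coeffs_of I T \<subseteq> h -` S" using gsub_incl by blast
  then show "\<forall>i\<in>I. \<forall>j\<in>I. fmap h (T i j) \<in> serin S" by (simp add: coeffs_of_serin serin_def)
next
  assume "\<forall>i\<in>I. \<forall>j\<in>I. fmap h (T i j) \<in> serin S"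
  then have "coeffs_of I T \<subseteq> h -` S" by (simp add: coeffs_of_serin serin_def)
  then show "h ` gsub (coeffs_of I T) \<subseteq> S" using gsub_min[OF subalg_vimage[OF h S]] by blast
qed

lemma gsub_coeffs:
  assumes S: "subalg S"
  shows "gsub (coeffs_of I T) \<subseteq> S \<longleftrightarrow> (\<forall>i\<in>I. \<forall>j\<in>I. T i j \<in> serin S)"
  unfolding coeffs_of_serin[symmetric] using gsub_min[OF S] gsub_incl by blast

lemma prod4_serin:
  assumes S: "subalg S" and "\<And>i j. i \<in> I2 \<Longrightarrow> j \<in> I2 \<Longrightarrow> A i j \<in> serin S" "\<And>i j. i \<in> I2 \<Longrightarrow> j \<in> I2 \<Longrightarrow> B i j \<in> serin S"
  shows "prod4 A B i j \<in> serin S"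
proof -
  note s = subalgD[OF subalg_serin[OF S]]
  show ?thesis unfolding prod4_def by (intro s(5) s(4) assms ix_I2)
qed

text \<open>Since S is arbitrary, this identifies the twisted subalgebra with the subalgebra
  generated by the two images. The hard direction is \<open>separate_factors\<close> with W =
  1.\<close>

theorem y4_twisted_generated:
  assumes S: "subalg S"
  shows "gsub (coeffs_of I4 (twm4 Ty4)) \<subseteq> S \<longleftrightarrow> iL ` gsub (coeffs_of I2 sS) \<subseteq> S \<and> iR ` gsub (coeffs_of I2 sS) \<subseteq> S"
  unfolding gsub_coeffs[OF S] hom_gsub_coeffs[OF iL(1) S] hom_gsub_coeffs[OF iR(1) S]
proof safe
  fix i j assume "\<forall>i\<in>I2. \<forall>j\<in>I2. fmap iL (sS i j) \<in> serin S" "\<forall>i\<in>I2. \<forall>j\<in>I2. fmap iR (sS i j) \<in> serin S" "i \<in> I4" "j \<in> I4"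
  then show "twm4 Ty4 i j \<in> serin S" by (simp add: twm4_Ty4 prod4_serin[OF S])
next
  fix i j assume T: "\<forall>i\<in>I4. \<forall>j\<in>I4. twm4 Ty4 i j \<in> serin S" and ij: "i \<in> I2" "j \<in> I2"
  have st: "1 * prod4 (\<lambda>i j. fmap iL (sS i j)) (\<lambda>i j. fmap iR (sS i j)) i j \<in> serin S" if "i \<in> I4" "j \<in> I4" for i j
    using T that by (simp add: twm4_Ty4)
  note s = separate_factors[OF S subalgD(1)[OF subalg_serin[OF subalg_center]] _ alg_homD(3)[OF rho_hom]
      fmap_sS_props[OF iL(1)] fmap_sS_props[OF iR(1)] cm_fmap_commute[OF iL_iR_commute] st ij]
  show "fmap iL (sS i j) \<in> serin S" "fmap iR (sS i j) \<in> serin S" using s(2,3) by simp_all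
qed

text \<open>In one direction \<open>separate_factors\<close> extracts W and both matrices, and W is
  converted into v. In the other, \<open>separate_scalar\<close> splits the generators of B(2,0)
  into v and s, and v is converted back.\<close>

theorem x4_twisted_generated:
  assumes S: "subalg S"
  shows "gsub (coeffs_of I4 (twm4 Tx4)) \<subseteq> S \<longleftrightarrow>
    (\<lambda>a. kk (iL a)) ` gsub (coeffs_of I2 sS) \<subseteq> S \<and> xi ` gsub (coeffs_of I2 bB) \<subseteq> S"
  unfolding gsub_coeffs[OF S] hom_gsub_coeffs[OF alg_hom_comp[OF kk(1) iL(1)] S] hom_gsub_coeffs[OF xi(1) S]
proof -
  let ?W = "fshift (- 1/2) W4"
  let ?L = "\<lambda>x. kk (iL x)" and ?R = "\<lambda>x. kk (iR x)"
  note L = alg_hom_comp[OF kk(1) iL(1)] and R = alg_hom_comp[OF kk(1) iR(1)]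
  note c = subalgD[OF subalg_serin[OF S]]
  have T: "twm4 Tx4 i j = ?W * prod4 (\<lambda>i j. fmap ?L (sS i j)) (\<lambda>i j. fmap ?R (sS i j)) i j" if "i \<in> I4" "j \<in> I4" for i j
    using twm4_Tx4[OF that] by (simp add: fmap_fmap)
  have B: "fmap xi (bB i j) = fmap xi v2 * fmap ?R (sS i j)" for i j
  proof -
    have "fmap xi (fmap jj (sS i j)) = fmap ?R (sS i j)" by (simp add: fps_eq_iff xi_jj)
    then show ?thesis by (simp add: alg_homD[OF fmap_hom[OF xi(1)]])
  qed
  have W: "?W \<in> serin center" by (rule serin_fshift[OF subalg_center W4(1)])
  \<comment> \<open>W(u - 1/2) is symmetric under u -> 1 - u exactly because W is even.\<close>
  have W1: "rho ?W = ?W" by (simp add: rho_def fneg_fshift W4(3))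
  show "(\<forall>i\<in>I4. \<forall>j\<in>I4. twm4 Tx4 i j \<in> serin S) \<longleftrightarrow>
    (\<forall>i\<in>I2. \<forall>j\<in>I2. fmap ?L (sS i j) \<in> serin S) \<and> (\<forall>i\<in>I2. \<forall>j\<in>I2. fmap xi (bB i j) \<in> serin S)"
  proof
    assume T': "\<forall>i\<in>I4. \<forall>j\<in>I4. twm4 Tx4 i j \<in> serin S"
    have st: "?W * prod4 (\<lambda>i j. fmap ?L (sS i j)) (\<lambda>i j. fmap ?R (sS i j)) i j \<in> serin S" if "i \<in> I4" "j \<in> I4" for i j
      using T' T that by simp
    have LR: "?L a * ?R b = ?R b * ?L a" for a b
      using arg_cong[OF iL_iR_commute, of kk a b] by (simp only: alg_homD(2)[OF kk(1)])
    note s = separate_factors[OF S W _ W1 fmap_sS_props[OF L] fmap_sS_props[OF R] cm_fmap_commute[OF LR] st]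
    have w: "?W \<in> serin S" using s(1)[of 1 1] by (simp add: W4(2))
    have "fshift (1/2) ?W \<in> serin S" by (rule serin_fshift[OF S w])
    then have "fmap xi v2 \<in> serin S" by (simp add: xi_v2_serin[OF S])
    then show "(\<forall>i\<in>I2. \<forall>j\<in>I2. fmap ?L (sS i j) \<in> serin S) \<and> (\<forall>i\<in>I2. \<forall>j\<in>I2. fmap xi (bB i j) \<in> serin S)"
      unfolding B using s(2,3) by (simp add: W4(2) c(4))
  next
    assume A: "(\<forall>i\<in>I2. \<forall>j\<in>I2. fmap ?L (sS i j) \<in> serin S) \<and> (\<forall>i\<in>I2. \<forall>j\<in>I2. fmap xi (bB i j) \<in> serin S)"
    have V: "subalg (xi -` S)" by (rule subalg_vimage[OF xi(1) S])
    have b: "bB i j \<in> serin (xi -` S)" if "i \<in> I2" "j \<in> I2" for i j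
      using A that by (simp add: serin_def)
    note s = separate_scalar[OF V v2(2,1) fmap_sS_props(2,3)[OF jj(1)] b]
    have "fmap xi v2 \<in> serin S" using s(1)[of 1 1] by (simp add: serin_def)
    then have w: "?W \<in> serin S" by (simp add: xi_v2_serin[OF S] serin_fshift[OF S])
    have "fmap ?R (sS i j) \<in> serin S" if "i \<in> I2" "j \<in> I2" for i j
      using s(2) that by (simp add: serin_def xi_jj)
    then show "\<forall>i\<in>I4. \<forall>j\<in>I4. twm4 Tx4 i j \<in> serin S"
      using A by (intro ballI) (simp only: T, rule c(4)[OF w prod4_serin[OF S]], blast+)
  qed
qed

section \<open>Tensor products\<close>

lemma separating_functional:
  fixes sc :: "complex \<Rightarrow> 'v::ab_group_add \<Rightarrow> 'v"
  assumes "vector_space sc" "module.subspace sc W" "x \<notin> W"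
  obtains l :: "'v \<Rightarrow> complex" where "\<And>a b. l (a + b) = l a + l b" "\<And>c a. l (sc c a) = c * l a"
    "\<And>w. w \<in> W \<Longrightarrow> l w = 0" "l x = 1"
proof -
  interpret v: vector_space sc by fact
  interpret vp: vector_space_pair sc "(*) :: complex \<Rightarrow> complex \<Rightarrow> complex"
    by unfold_locales (simp_all add: algebra_simps)
  obtain B where B: "B \<subseteq> W" "v.independent B" "W \<subseteq> v.span B"
    by (rule v.maximal_independent_subset)
  have x: "x \<notin> v.span B" using v.span_minimal[OF B(1) assms(2)] assms(3) by blast
  then have xB: "x \<notin> B" using v.span_base by blast
  obtain l where l: "Vector_Spaces.linear sc (*) l" "\<forall>b\<in>insert x B. l b = (if b = x then 1 else 0)"
    using vp.linear_independent_extend[OF v.independent_insertI[OF x B(2)], of "\<lambda>b. if b = x then 1 else 0"] by blast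
  show thesis
  proof (rule that)
    show "l (a + b) = l a + l b" for a b by (rule vp.linear_add[OF l(1)])
    show "l (sc c a) = c * l a" for c a by (rule vp.linear_scale[OF l(1)])
    show "l w = 0" if "w \<in> W" for w
      by (rule vp.linear_eq_0_on_span[OF l(1), of B]) (use l(2) xB that B(3) in auto)
    show "l x = 1" using l(2) by simp
  qed
qed

lemma vector_space_cs: "vector_space ((\<star>) :: complex \<Rightarrow> 'a::calg \<Rightarrow> 'a)"
  by unfold_locales (simp_all add: cs_add_right cs_add_left cs_assoc)

lemma vector_space_psc: "vector_space (psc :: complex \<Rightarrow> ('m \<Rightarrow>\<^sub>0 complex) \<Rightarrow> _)"
  by unfold_locales (simp_all add: poly_mapping_eq_iff fun_eq_iff lookup_add algebra_simps)

definition bilin :: "('a::calg \<Rightarrow> 'b::calg \<Rightarrow> complex) \<Rightarrow> bool" where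
  "bilin F \<longleftrightarrow> (\<forall>x x' y. F (x + x') y = F x y + F x' y) \<and> (\<forall>x y y'. F x (y + y') = F x y + F x y') \<and>
     (\<forall>c x y. F (c \<star> x) y = c * F x y) \<and> (\<forall>c x y. F x (c \<star> y) = c * F x y)"

lemma bilin_ops:
  "bilin F \<Longrightarrow> bilin G \<Longrightarrow> bilin (\<lambda>x y. F x y + G x y)" "bilin (\<lambda>x y. 0)"
  "bilin F \<Longrightarrow> bilin (\<lambda>x y. c * F x y)" "bilin F \<Longrightarrow> bilin (\<lambda>x y. - F x y)"
  "bilin F \<Longrightarrow> bilin G \<Longrightarrow> bilin (\<lambda>x y. F x y - G x y)"
  by (simp_all add: bilin_def algebra_simps)

lemma bilin_translate: "bilin F \<Longrightarrow> bilin (\<lambda>x y. F (x * a) y)" "bilin F \<Longrightarrow> bilin (\<lambda>x y. F x (y * b))"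
  by (simp_all add: bilin_def distrib_right cs_mult_left)

text \<open>Linear operators on the bilinear forms on \<open>'a \<times> 'b\<close> are a concrete algebra in which
  \<open>'a\<close> and \<open>'b\<close> act by translation; evaluating the translates of a form at \<open>(1, 1)\<close> detects all tensors.
  Operators are normalized to be \<open>0\<close> off the bilinear forms.\<close>

definition form_op :: "(('a::calg \<Rightarrow> 'b::calg \<Rightarrow> complex) \<Rightarrow> 'a \<Rightarrow> 'b \<Rightarrow> complex) \<Rightarrow> bool" where
  "form_op h \<longleftrightarrow> (\<forall>F. bilin (h F)) \<and> (\<forall>F. \<not> bilin F \<longrightarrow> h F = (\<lambda>x y. 0)) \<and>
     (\<forall>F G. bilin F \<longrightarrow> bilin G \<longrightarrow> h (\<lambda>x y. F x y + G x y) = (\<lambda>x y. h F x y + h G x y)) \<and>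
     (\<forall>c F. bilin F \<longrightarrow> h (\<lambda>x y. c * F x y) = (\<lambda>x y. c * h F x y))"

definition on_forms where
  "on_forms h = (\<lambda>F. if bilin F then h F else (\<lambda>x y. 0 :: complex))"

lemma form_op_on_forms:
  assumes "\<And>F. bilin F \<Longrightarrow> bilin (h F)"
    and "\<And>F G. bilin F \<Longrightarrow> bilin G \<Longrightarrow> h (\<lambda>x y. F x y + G x y) = (\<lambda>x y. h F x y + h G x y)"
    and "\<And>c F. bilin F \<Longrightarrow> h (\<lambda>x y. c * F x y) = (\<lambda>x y. c * h F x y)"
  shows "form_op (on_forms h)"
  using assms by (auto simp: form_op_def on_forms_def bilin_ops)

lemma form_opD:
  assumes "form_op h"
  shows "bilin (h F)" "\<not> bilin F \<Longrightarrow> h F = (\<lambda>x y. 0)"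
    "bilin F \<Longrightarrow> bilin G \<Longrightarrow> h (\<lambda>x y. F x y + G x y) = (\<lambda>x y. h F x y + h G x y)"
    "bilin F \<Longrightarrow> h (\<lambda>x y. c * F x y) = (\<lambda>x y. c * h F x y)" "h (\<lambda>x y. 0) = (\<lambda>x y. 0)"
proof -
  show s: "bilin F \<Longrightarrow> h (\<lambda>x y. c * F x y) = (\<lambda>x y. c * h F x y)" for c F
    using assms unfolding form_op_def by blast
  show "h (\<lambda>x y. 0) = (\<lambda>x y. 0)" using s[OF bilin_ops(2), of 0] by simp
qed (use assms in \<open>unfold form_op_def, blast+\<close>)

typedef (overloaded) ('a, 'b) form_end = "{h :: ('a::calg \<Rightarrow> 'b::calg \<Rightarrow> complex) \<Rightarrow> 'a \<Rightarrow> 'b \<Rightarrow> complex. form_op h}"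
  by (rule exI[of _ "\<lambda>F x y. 0"]) (simp add: form_op_def bilin_ops)

lemma Rep_form_op [simp]: "form_op (Rep_form_end h)"
  using Rep_form_end by blast

lemma form_op_closed:
  assumes h: "form_op h" and k: "form_op k"
  shows "form_op (\<lambda>F x y. h F x y + k F x y)" "form_op (\<lambda>F x y. h F x y - k F x y)" "form_op (\<lambda>F x y. - h F x y)"
    "form_op (\<lambda>F x y. c * h F x y)" "form_op (\<lambda>F. h (k F))"
  using form_opD[OF h] form_opD[OF k]
  by (auto simp: form_op_def bilin_ops algebra_simps)

lemma form_op_one: "form_op (on_forms (\<lambda>F. F))"
  by (rule form_op_on_forms) auto

lemma exists_nonzero_bilin: "\<exists>F :: 'a::calg \<Rightarrow> 'b::calg \<Rightarrow> complex. bilin F \<and> F 1 1 = 1"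
proof -
  have s: "module.subspace ((\<star>) :: complex \<Rightarrow> 'c::calg \<Rightarrow> 'c) {0}"
  proof -
    interpret vector_space "(\<star>) :: complex \<Rightarrow> 'c \<Rightarrow> 'c" by (rule vector_space_cs)
    show ?thesis by (rule subspace_single_0)
  qed
  obtain l :: "'a \<Rightarrow> complex" where l: "\<And>a b. l (a + b) = l a + l b" "\<And>c a. l (c \<star> a) = c * l a" "l 1 = 1"
    by (rule separating_functional[OF vector_space_cs s, of "1 :: 'a"]) auto
  obtain m :: "'b \<Rightarrow> complex" where m: "\<And>a b. m (a + b) = m a + m b" "\<And>c a. m (c \<star> a) = c * m a" "m 1 = 1"
    by (rule separating_functional[OF vector_space_cs s, of "1 :: 'b"]) auto
  show ?thesis
    by (rule exI[of _ "\<lambda>x y. l x * m y"]) (simp add: bilin_def l m algebra_simps)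
qed

instantiation form_end :: (calg, calg) calg
begin

definition "0 = Abs_form_end (\<lambda>F x y. 0)"
definition "1 = Abs_form_end (on_forms (\<lambda>F. F))"
definition "h + k = Abs_form_end (\<lambda>F x y. Rep_form_end h F x y + Rep_form_end k F x y)"
definition "h - k = Abs_form_end (\<lambda>F x y. Rep_form_end h F x y - Rep_form_end k F x y)"
definition "- h = Abs_form_end (\<lambda>F x y. - Rep_form_end h F x y)"
definition "h * k = Abs_form_end (\<lambda>F. Rep_form_end h (Rep_form_end k F))"
definition "c \<star> h = Abs_form_end (\<lambda>F x y. c * Rep_form_end h F x y)"

lemma Rep_form_end_simps:
  fixes h k :: "('a, 'b) form_end"
  shows "Rep_form_end (0 :: ('a, 'b) form_end) = (\<lambda>F x y. 0)" "Rep_form_end (1 :: ('a, 'b) form_end) = on_forms (\<lambda>F. F)"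
  "Rep_form_end (h + k) = (\<lambda>F x y. Rep_form_end h F x y + Rep_form_end k F x y)"
  "Rep_form_end (h - k) = (\<lambda>F x y. Rep_form_end h F x y - Rep_form_end k F x y)"
  "Rep_form_end (- h) = (\<lambda>F x y. - Rep_form_end h F x y)"
  "Rep_form_end (h * k) = (\<lambda>F. Rep_form_end h (Rep_form_end k F))"
  "Rep_form_end (c \<star> h) = (\<lambda>F x y. c * Rep_form_end h F x y)"
proof -
  have "form_op (\<lambda>F x y. 0)" by (simp add: form_op_def bilin_ops)
  then show "Rep_form_end (0 :: ('a, 'b) form_end) = (\<lambda>F x y. 0)"
    unfolding zero_form_end_def by (subst Abs_form_end_inverse) simp_all
qed (simp_all add: one_form_end_def plus_form_end_def minus_form_end_def uminus_form_end_def times_form_end_def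
    cs_form_end_def Abs_form_end_inverse form_op_closed[OF Rep_form_op Rep_form_op] form_op_one)

instance
proof
  fix a b c :: "('a, 'b) form_end" and s t :: complex
  note r = Rep_form_end_inject[symmetric] Rep_form_end_simps fun_eq_iff
  note d = form_opD[OF Rep_form_op]
  show "a * b * c = a * (b * c)" "a + b + c = a + (b + c)" "a + b = b + a" "0 + a = a" "- a + a = 0" "a - b = a + - b"
    "(a + b) * c = a * c + b * c" "s \<star> (a + b) = s \<star> a + s \<star> b" "(s + t) \<star> a = s \<star> a + t \<star> a" "s \<star> t \<star> a = (s * t) \<star> a"
    "1 \<star> a = a" "s \<star> a * b = s \<star> (a * b)"
    by (simp_all add: r algebra_simps)
  show "a * (b + c) = a * b + a * c" by (simp add: r d(1,3))
  show "1 * a = a" by (simp add: r on_forms_def d(1))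
  show "a * 1 = a" by (auto simp: r on_forms_def d)
  show "a * s \<star> b = s \<star> (a * b)" by (simp add: r d(1,4))
  obtain F :: "'a \<Rightarrow> 'b \<Rightarrow> complex" where "bilin F" "F 1 1 = 1" using exists_nonzero_bilin by blast
  then have "Rep_form_end (1 :: ('a, 'b) form_end) F 1 1 \<noteq> Rep_form_end (0 :: ('a, 'b) form_end) F 1 1"
    by (simp add: Rep_form_end_simps on_forms_def)
  then show "(0 :: ('a, 'b) form_end) \<noteq> 1" by metis
qed

end

text \<open>Right translation of the argument, so that the action on forms respects the order of
  products: \<open>tL (a * b) = tL a * tL b\<close>.\<close>

definition tL :: "'a::calg \<Rightarrow> ('a, 'b::calg) form_end" where
  "tL a = Abs_form_end (on_forms (\<lambda>F x y. F (x * a) y))"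

definition tR :: "'b::calg \<Rightarrow> ('a::calg, 'b) form_end" where
  "tR b = Abs_form_end (on_forms (\<lambda>F x y. F x (y * b)))"

lemma Rep_tL: "Rep_form_end (tL a) = on_forms (\<lambda>F x y. F (x * a) y)"
  unfolding tL_def
  by (rule Abs_form_end_inverse, rule CollectI, rule form_op_on_forms) (simp_all add: bilin_translate)

lemma Rep_tR: "Rep_form_end (tR b) = on_forms (\<lambda>F x y. F x (y * b))"
  unfolding tR_def
  by (rule Abs_form_end_inverse, rule CollectI, rule form_op_on_forms) (simp_all add: bilin_translate)

lemma tL_hom: "alg_hom (tL :: 'a::calg \<Rightarrow> ('a, 'b::calg) form_end)"
proof -
  have "tL (a + b) = tL a + (tL b :: ('a, 'b) form_end)" "tL (c \<star> a) = c \<star> (tL a :: ('a, 'b) form_end)"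
    "tL (a * b) = tL a * (tL b :: ('a, 'b) form_end)" "tL 1 = (1 :: ('a, 'b) form_end)" for a b :: "'a" and c
    unfolding Rep_form_end_inject[symmetric] Rep_form_end_simps Rep_tL
  proof (goal_cases)
    case 1
    show ?case by (auto simp: on_forms_def fun_eq_iff distrib_left) (simp add: bilin_def)
  next
    case 2
    show ?case by (auto simp: on_forms_def fun_eq_iff cs_mult_right) (simp add: bilin_def)
  next
    case 3
    show ?case by (auto simp: on_forms_def fun_eq_iff bilin_translate bilin_ops mult.assoc)
  next
    case 4
    show ?case by (auto simp: on_forms_def fun_eq_iff)
  qed
  then show ?thesis unfolding alg_hom_def by blast
qed

lemma tR_hom: "alg_hom (tR :: 'b::calg \<Rightarrow> ('a::calg, 'b) form_end)"
proof -
  have "tR (a + b) = tR a + (tR b :: ('a, 'b) form_end)" "tR (c \<star> a) = c \<star> (tR a :: ('a, 'b) form_end)"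
    "tR (a * b) = tR a * (tR b :: ('a, 'b) form_end)" "tR 1 = (1 :: ('a, 'b) form_end)" for a b :: "'b" and c
    unfolding Rep_form_end_inject[symmetric] Rep_form_end_simps Rep_tR
  proof (goal_cases)
    case 1
    show ?case by (auto simp: on_forms_def fun_eq_iff distrib_left) (simp add: bilin_def)
  next
    case 2
    show ?case by (auto simp: on_forms_def fun_eq_iff cs_mult_right) (simp add: bilin_def)
  next
    case 3
    show ?case by (auto simp: on_forms_def fun_eq_iff bilin_translate bilin_ops mult.assoc)
  next
    case 4
    show ?case by (auto simp: on_forms_def fun_eq_iff)
  qed
  then show ?thesis unfolding alg_hom_def by blast
qed

lemma tL_tR_commute: "tL a * tR b = tR b * tL a"
  unfolding Rep_form_end_inject[symmetric] Rep_form_end_simps Rep_tL Rep_tR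
  by (auto simp: on_forms_def fun_eq_iff bilin_translate bilin_ops)

lemma tL_tR_eval: "bilin F \<Longrightarrow> Rep_form_end (tL a * tR b) F 1 1 = F a b"
  by (simp add: Rep_form_end_simps Rep_tL Rep_tR on_forms_def bilin_translate)

lemma lin_tensor_eval:
  assumes "bilin F"
  shows "Rep_form_end (lin (\<lambda>(a, b). tL (f a) * tR (g b)) p) F 1 1 = lin (\<lambda>(a, b). F (f a) (g b)) p"
proof -
  have s: "Rep_form_end (sum h A) F 1 1 = (\<Sum>x\<in>A. Rep_form_end (h x) F 1 1)" for h :: "_ \<Rightarrow> ('a, 'b) form_end" and A
    by (induction A rule: infinite_finite_induct) (simp_all add: Rep_form_end_simps)
  show ?thesis unfolding lin_def s
    by (intro sum.cong refl) (auto simp: Rep_form_end_simps(7) tL_tR_eval[OF assms] cs_complex_def)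
qed

section \<open>Tensor products of records and homomorphisms out of them\<close>

lemma rhom_subalg:
  assumes A: "calg_rec A" and f: "rhom A f"
  shows "subalg (f ` carrier A)"
proof -
  interpret ring A by (rule calg_recD(1)[OF A])
  note h = rhomD[OF f A]
  have "1 \<in> f ` carrier A" by (metis h(1) image_eqI one_closed)
  moreover have "f x + f y \<in> f ` carrier A" "f x * f y \<in> f ` carrier A" "c \<star> f x \<in> f ` carrier A"
    if "x \<in> carrier A" "y \<in> carrier A" for x y c
    unfolding h(3)[OF that, symmetric] h(4)[OF that, symmetric] h(5)[OF that(1), symmetric]
    by (intro imageI a_closed m_closed calg_recD(2)[OF A] that)+
  ultimately show ?thesis unfolding subalg_def ball_simps by (intro conjI ballI allI; elim imageE) simp_all
qed

text \<open>A linear projection of the type onto the image of the record, followed by the inverse of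
  \<open>f\<close>. It extends linear data given on the record to the whole type.\<close>

lemma record_retraction:
  fixes f :: "'r \<Rightarrow> 'a::calg"
  assumes A: "calg_rec A" and f: "rhom A f" "inj_on f (carrier A)"
  obtains P where "\<And>x. P x \<in> carrier A" "\<And>x y. P (x + y) = P x \<oplus>\<^bsub>A\<^esub> P y" "\<And>c x. P (c \<star> x) = c \<odot>\<^bsub>A\<^esub> P x"
    "\<And>a. a \<in> carrier A \<Longrightarrow> P (f a) = a"
proof -
  interpret A: ring A by (rule calg_recD(1)[OF A])
  interpret v: vector_space "(\<star>) :: complex \<Rightarrow> 'a \<Rightarrow> 'a" by (rule vector_space_cs)
  interpret vp: vector_space_pair "(\<star>) :: complex \<Rightarrow> 'a \<Rightarrow> 'a" "(\<star>) :: complex \<Rightarrow> 'a \<Rightarrow> 'a" ..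
  note s = subalgD[OF rhom_subalg[OF A f(1)]]
  have "v.subspace (f ` carrier A)" unfolding v.subspace_def using s(2,3,5) by blast
  then obtain r where r: "range r \<subseteq> f ` carrier A" "Vector_Spaces.linear (\<star>) (\<star>) r" "\<forall>v\<in>f ` carrier A. r v = v"
    using vp.linear_exists_left_inverse_on[OF v.linear_id, of "f ` carrier A"] by auto
  define P where "P = (\<lambda>x. the_inv_into (carrier A) f (r x))"
  have P: "P x \<in> carrier A" "f (P x) = r x" for x
    using r(1) by (auto simp: P_def intro!: the_inv_into_into[OF f(2)] f_the_inv_into_f[OF f(2)])
  note h = rhomD[OF f(1) A]
  show thesis
  proof (rule that)
    show "P x \<in> carrier A" for x by (rule P)
    show "P (x + y) = P x \<oplus>\<^bsub>A\<^esub> P y" for x y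
      by (rule inj_onD[OF f(2)]) (simp_all add: P h vp.linear_add[OF r(2)])
    show "P (c \<star> x) = c \<odot>\<^bsub>A\<^esub> P x" for c x
      by (rule inj_onD[OF f(2)]) (simp_all add: P h vp.linear_scale[OF r(2)] calg_recD(2)[OF A])
    show "P (f a) = a" if "a \<in> carrier A" for a
      by (rule inj_onD[OF f(2)]) (use that in \<open>simp_all add: P r(3)\<close>)
  qed
qed

lemma ideal_smult:
  assumes A: "calg_rec A" and J: "ideal J A" and x: "x \<in> J"
  shows "c \<odot>\<^bsub>A\<^esub> x \<in> J"
proof -
  interpret ideal J A by fact
  have xc: "x \<in> carrier A" using x by (rule a_Hcarr)
  have "(c \<odot>\<^bsub>A\<^esub> \<one>\<^bsub>A\<^esub>) \<otimes>\<^bsub>A\<^esub> x \<in> J" by (rule I_l_closed[OF x calg_recD(2)[OF A one_closed]])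
  also have "(c \<odot>\<^bsub>A\<^esub> \<one>\<^bsub>A\<^esub>) \<otimes>\<^bsub>A\<^esub> x = c \<odot>\<^bsub>A\<^esub> x" using calg_recD(7)[OF A one_closed xc] xc by simp
  finally show ?thesis .
qed

lemma relators_carrier:
  assumes A: "calg_rec A" and B: "calg_rec B"
  shows "bilinear_relators A B \<subseteq> carrier (monoid_alg (A \<times>\<times> B))"
proof -
  interpret A: ring A by (rule calg_recD(1)[OF A])
  interpret B: ring B by (rule calg_recD(1)[OF B])
  have k: "Poly_Mapping.keys (p - q) \<subseteq> S" if "Poly_Mapping.keys p \<subseteq> S" "Poly_Mapping.keys q \<subseteq> S" for p q :: "'m \<Rightarrow>\<^sub>0 complex" and S
    using keys_diff[of p q] that by blast
  show ?thesis
    unfolding bilinear_relators_def Let_def monoid_alg_simps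
    by (auto intro!: k order.trans[OF keys_psc] simp: carrier_DirProd calg_recD(2)[OF A] calg_recD(2)[OF B])
      (auto simp: calg_recD(2)[OF A] calg_recD(2)[OF B] dest!: subsetD[OF keys_diff] subsetD[OF keys_psc] split: if_splits)
qed

lemma monoid_DirProd_rec:
  assumes A: "calg_rec A" and B: "calg_rec B"
  shows "Group.monoid (A \<times>\<times> B)"
proof -
  interpret A: ring A by (rule calg_recD(1)[OF A])
  interpret B: ring B by (rule calg_recD(1)[OF B])
  show ?thesis by (rule DirProd_monoid[OF A.monoid_axioms B.monoid_axioms])
qed

text \<open>Otherwise some linear functional l kills the ideal but not p. As l vanishes on the
  bilinear relators, (a, b) -> l(a tensor b) is bilinear; extended to the types by retractions it is
  a bilinear form that does not kill p.\<close>

lemma tensor_kernel: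
  fixes \<alpha> :: "'r \<Rightarrow> 'a::calg" and \<beta> :: "'s \<Rightarrow> 'b::calg"
  assumes A: "calg_rec A" and B: "calg_rec B"
    and \<alpha>: "rhom A \<alpha>" "inj_on \<alpha> (carrier A)" and \<beta>: "rhom B \<beta>" "inj_on \<beta> (carrier B)"
    and p: "p \<in> carrier (monoid_alg (A \<times>\<times> B))"
    and z: "\<And>F. bilin F \<Longrightarrow> lin (\<lambda>(a, b). F (\<alpha> a) (\<beta> b)) p = 0"
  shows "p \<in> Idl\<^bsub>monoid_alg (A \<times>\<times> B)\<^esub> (bilinear_relators A B)" (is "p \<in> ?J")
proof (rule ccontr)
  assume pJ: "p \<notin> ?J"
  let ?M = "monoid_alg (A \<times>\<times> B)"
  have F: "calg_rec ?M" by (rule calg_rec_monoid_alg[OF monoid_DirProd_rec[OF A B]])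
  interpret A: ring A by (rule calg_recD(1)[OF A])
  interpret B: ring B by (rule calg_recD(1)[OF B])
  interpret M: ring ?M by (rule calg_recD(1)[OF F])
  interpret v: vector_space "psc :: complex \<Rightarrow> ('r \<times> 's \<Rightarrow>\<^sub>0 complex) \<Rightarrow> _" by (rule vector_space_psc)
  have J: "ideal ?J ?M" by (rule M.genideal_ideal[OF relators_carrier[OF A B]])
  interpret J: ideal ?J ?M by (rule J)
  have "v.subspace ?J"
    unfolding v.subspace_def
    using J.zero_closed J.a_closed ideal_smult[OF F J] unfolding monoid_alg_simps by blast
  then obtain l :: "('r \<times> 's \<Rightarrow>\<^sub>0 complex) \<Rightarrow> complex" where l: "\<And>a b. l (a + b) = l a + l b" "\<And>c a. l (psc c a) = c * l a"
    "\<And>w. w \<in> ?J \<Longrightarrow> l w = 0" "l p = 1"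
    using separating_functional[OF vector_space_psc _ pJ] by blast
  have ld: "l (a - b) = l a - l b" for a b using l(1)[of "a - b" b] by simp
  have r: "l w = 0" if "w \<in> bilinear_relators A B" for w
    using l(3) that M.genideal_self[OF relators_carrier[OF A B]] by blast
  obtain P where P: "\<And>x. P x \<in> carrier A" "\<And>x y. P (x + y) = P x \<oplus>\<^bsub>A\<^esub> P y" "\<And>c x. P (c \<star> x) = c \<odot>\<^bsub>A\<^esub> P x"
    "\<And>a. a \<in> carrier A \<Longrightarrow> P (\<alpha> a) = a" using record_retraction[OF A \<alpha>] by metis
  obtain Q where Q: "\<And>x. Q x \<in> carrier B" "\<And>x y. Q (x + y) = Q x \<oplus>\<^bsub>B\<^esub> Q y" "\<And>c x. Q (c \<star> x) = c \<odot>\<^bsub>B\<^esub> Q x"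
    "\<And>b. b \<in> carrier B \<Longrightarrow> Q (\<beta> b) = b" using record_retraction[OF B \<beta>] by metis
  define e where "e = (\<lambda>a b. Poly_Mapping.single (a, b) (1::complex) :: 'r \<times> 's \<Rightarrow>\<^sub>0 complex)"
  have R: "e (a \<oplus>\<^bsub>A\<^esub> a') b - e a b - e a' b \<in> bilinear_relators A B"
    "e a (b \<oplus>\<^bsub>B\<^esub> b') - e a b - e a b' \<in> bilinear_relators A B"
    "e (c \<odot>\<^bsub>A\<^esub> a) b - psc c (e a b) \<in> bilinear_relators A B"
    "e a (c \<odot>\<^bsub>B\<^esub> b) - psc c (e a b) \<in> bilinear_relators A B"
    if "a \<in> carrier A" "a' \<in> carrier A" "b \<in> carrier B" "b' \<in> carrier B" for a a' b b' c
    using that unfolding bilinear_relators_def Let_def e_def by blast+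
  define G where "G = (\<lambda>x y. l (e (P x) (Q y)))"
  have G: "bilin G"
    unfolding bilin_def
  proof (intro conjI allI)
    fix x x' y y' c
    show "G (x + x') y = G x y + G x' y"
      using r[OF R(1)[OF P(1)[of x] P(1)[of x'] Q(1)[of y] Q(1)[of y]]] by (simp add: G_def P(2) ld diff_diff_eq l(1))
    show "G x (y + y') = G x y + G x y'"
      using r[OF R(2)[OF P(1)[of x] P(1)[of x'] Q(1)[of y] Q(1)[of y']]] by (simp add: G_def Q(2) ld diff_diff_eq l(1))
    show "G (c \<star> x) y = c * G x y"
      using r[OF R(3)[OF P(1)[of x] P(1)[of x'] Q(1)[of y] Q(1)[of y]], of c] by (simp add: G_def P(3) ld l(2))
    show "G x (c \<star> y) = c * G x y"
      using r[OF R(4)[OF P(1)[of x] P(1)[of x'] Q(1)[of y] Q(1)[of y]], of c] by (simp add: G_def Q(3) ld l(2))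
  qed
  have k: "Poly_Mapping.keys p \<subseteq> carrier A \<times> carrier B" using p by (simp add: monoid_alg_simps)
  have "l p = lin (\<lambda>(a, b). G (\<alpha> a) (\<beta> b)) p"
    using k
  proof (induction rule: pm_induct)
    case zero
    show ?case using l(2)[of 0 0] by simp
  next
    case (single x c)
    obtain a b where x: "x = (a, b)" "a \<in> carrier A" "b \<in> carrier B" using single by blast
    have "l (Poly_Mapping.single x c) = c * l (e a b)" unfolding l(2)[symmetric] by (simp add: e_def x)
    then show ?case by (simp add: x G_def P(4) Q(4) cs_complex_def)
  next
    case (add p q)
    then show ?case by (simp add: l(1) lin_add)
  qed
  then show False using z[OF G] l(4) by simp
qed

lemma alg_isoI:
  fixes \<gamma> :: "'r \<Rightarrow> 'c::calg"
  assumes C: "calg_rec C" and Q: "calg_rec Q" and \<gamma>: "rhom C \<gamma>" "inj_on \<gamma> (carrier C)"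
    and \<delta>: "rhom Q \<delta>" "inj_on \<delta> (carrier Q)" and im: "\<gamma> ` carrier C = \<delta> ` carrier Q"
  shows "C \<cong>\<^sub>a\<^sub>l\<^sub>g Q"
proof -
  interpret C: ring C by (rule calg_recD(1)[OF C])
  interpret Q: ring Q by (rule calg_recD(1)[OF Q])
  note g = rhomD[OF \<gamma>(1) C] and d = rhomD[OF \<delta>(1) Q]
  define h where "h = (\<lambda>x. the_inv_into (carrier Q) \<delta> (\<gamma> x))"
  have h: "h x \<in> carrier Q" "\<delta> (h x) = \<gamma> x" if "x \<in> carrier C" for x
  proof -
    have "\<gamma> x \<in> \<delta> ` carrier Q" using im that by blast
    then show "h x \<in> carrier Q" "\<delta> (h x) = \<gamma> x"
      unfolding h_def by (auto intro!: the_inv_into_into[OF \<delta>(2)] f_the_inv_into_f[OF \<delta>(2)])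
  qed
  note i = inj_onD[OF \<delta>(2)]
  have "h \<in> ring_hom C Q"
  proof (rule ring_hom_memI)
    fix x y assume xy: "x \<in> carrier C" "y \<in> carrier C"
    show "h x \<in> carrier Q" by (rule h(1)[OF xy(1)])
    show "h (x \<otimes>\<^bsub>C\<^esub> y) = h x \<otimes>\<^bsub>Q\<^esub> h y" by (rule i) (use xy in \<open>simp_all add: h g(1,3-5) d(1,3-5)\<close>)
    show "h (x \<oplus>\<^bsub>C\<^esub> y) = h x \<oplus>\<^bsub>Q\<^esub> h y" by (rule i) (use xy in \<open>simp_all add: h g(1,3-5) d(1,3-5)\<close>)
  next
    show "h \<one>\<^bsub>C\<^esub> = \<one>\<^bsub>Q\<^esub>" by (rule i) (simp_all add: h g(1,3-5) d(1,3-5))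
  qed
  moreover have "bij_betw h (carrier C) (carrier Q)"
    unfolding bij_betw_def
  proof
    show "inj_on h (carrier C)" by (rule inj_onI) (metis h(2) \<gamma>(2) inj_onD)
    show "h ` carrier C = carrier Q"
    proof
      show "carrier Q \<subseteq> h ` carrier C"
      proof
        fix q assume q: "q \<in> carrier Q"
        then have "\<delta> q \<in> \<gamma> ` carrier C" unfolding im by (rule imageI)
        then obtain x where x: "x \<in> carrier C" "\<gamma> x = \<delta> q" by auto
        have "h x = q" by (rule i) (use x q h in simp_all)
        then show "q \<in> h ` carrier C" using x by blast
      qed
    qed (use h in blast)
  qed
  moreover have "h (c \<odot>\<^bsub>C\<^esub> x) = c \<odot>\<^bsub>Q\<^esub> h x" if "x \<in> carrier C" for c x
    by (rule i) (use that in \<open>simp_all add: h g(1,3-5) d(1,3-5) calg_recD(2)[OF C] calg_recD(2)[OF Q]\<close>)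
  ultimately show ?thesis unfolding is_alg_iso_def alg_iso_def ring_iso_def by blast
qed

text \<open>The map a tensor b -> \<phi>(a) \<psi>(b) is multiplicative because the images commute,
  and its image is that of C by the generation hypothesis. For injectivity, \<Theta> carries
  \<phi>(a) \<psi>(b) to \<open>tL a * tR b\<close>, whose value on a form F at (1, 1) is F(a, b);
  hence an element of the kernel is killed by all bilinear forms, and \<open>tensor_kernel\<close>
  applies.\<close>

theorem tensor_iso:
  fixes \<alpha> :: "'r \<Rightarrow> 'a::calg" and \<beta> :: "'s \<Rightarrow> 'b::calg" and \<gamma> :: "'t \<Rightarrow> 'c::calg"
  assumes A: "calg_rec A" and B: "calg_rec B" and C: "calg_rec C"
    and \<alpha>: "rhom A \<alpha>" "inj_on \<alpha> (carrier A)" and \<beta>: "rhom B \<beta>" "inj_on \<beta> (carrier B)"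
    and \<gamma>: "rhom C \<gamma>" "inj_on \<gamma> (carrier C)"
    and \<phi>: "alg_hom \<phi>" and \<psi>: "alg_hom \<psi>" and c: "\<And>a b. \<phi> a * \<psi> b = \<psi> b * \<phi> a"
    and gen: "\<And>S. subalg S \<Longrightarrow> \<gamma> ` carrier C \<subseteq> S \<longleftrightarrow> \<phi> ` \<alpha> ` carrier A \<subseteq> S \<and> \<psi> ` \<beta> ` carrier B \<subseteq> S"
    and \<Theta>: "alg_hom \<Theta>" "\<And>a. a \<in> carrier A \<Longrightarrow> \<Theta> (\<phi> (\<alpha> a)) = (tL (\<alpha> a) :: ('a, 'b) form_end)"
      "\<And>b. b \<in> carrier B \<Longrightarrow> \<Theta> (\<psi> (\<beta> b)) = tR (\<beta> b)"
  shows "C \<cong>\<^sub>a\<^sub>l\<^sub>g A \<otimes>\<^sub>a\<^sub>l\<^sub>g B"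
proof -
  let ?M = "monoid_alg (A \<times>\<times> B)" and ?J = "Idl\<^bsub>monoid_alg (A \<times>\<times> B)\<^esub> (bilinear_relators A B)"
  note mon = monoid_DirProd_rec[OF A B]
  have M: "calg_rec ?M" by (rule calg_rec_monoid_alg[OF mon])
  interpret A: ring A by (rule calg_recD(1)[OF A])
  interpret B: ring B by (rule calg_recD(1)[OF B])
  interpret M: ring ?M by (rule calg_recD(1)[OF M])
  note rc = relators_carrier[OF A B]
  have J: "ideal ?J ?M" by (rule M.genideal_ideal[OF rc])
  define h where "h = (\<lambda>(a, b). \<phi> (\<alpha> a) * \<psi> (\<beta> b))"
  note ha = rhomD[OF \<alpha>(1) A] and hb = rhomD[OF \<beta>(1) B] and p = alg_homD[OF \<phi>] and q = alg_homD[OF \<psi>]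
  have L: "rhom ?M (lin h)"
  proof (rule rhom_lin[OF mon])
    show "h \<one>\<^bsub>A \<times>\<times> B\<^esub> = 1" by (simp add: h_def one_DirProd ha hb p q)
    fix x y assume "x \<in> carrier (A \<times>\<times> B)" "y \<in> carrier (A \<times>\<times> B)"
    then obtain a b a' b' where xy: "x = (a, b)" "y = (a', b')" "a \<in> carrier A" "a' \<in> carrier A" "b \<in> carrier B" "b' \<in> carrier B"
      by (auto simp: carrier_DirProd)
    have "\<phi> (\<alpha> a) * \<phi> (\<alpha> a') * (\<psi> (\<beta> b) * \<psi> (\<beta> b')) = \<phi> (\<alpha> a) * \<psi> (\<beta> b) * (\<phi> (\<alpha> a') * \<psi> (\<beta> b'))"
      by (metis c mult.assoc)
    then show "h (x \<otimes>\<^bsub>A \<times>\<times> B\<^esub> y) = h x * h y" using xy by (simp add: h_def ha hb p q)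
  qed
  have ker: "lin h x = 0" if "x \<in> ?J" for x
  proof (rule rhom_Idl[OF M rc L _ that])
    fix g assume "g \<in> bilinear_relators A B"
    then show "lin h g = 0"
      unfolding bilinear_relators_def Let_def
      by (auto simp: lin_diff lin_psc h_def ha hb p q distrib_left distrib_right cs_mult_left cs_mult_right)
  qed
  obtain \<delta> where \<delta>: "rhom (quot_alg ?M ?J) \<delta>" "\<And>x. x \<in> carrier ?M \<Longrightarrow> \<delta> (?J +>\<^bsub>?M\<^esub> x) = lin h x"
    using rhom_quot[OF M J L ker] by blast
  have Q: "calg_rec (quot_alg ?M ?J)" by (rule calg_rec_quot[OF M J])
  have inj: "x \<in> ?J" if x: "x \<in> carrier ?M" "lin h x = 0" for x
  proof (rule tensor_kernel[OF A B \<alpha> \<beta> x(1)])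
    fix F :: "'a \<Rightarrow> 'b \<Rightarrow> complex" assume F: "bilin F"
    have k: "Poly_Mapping.keys x \<subseteq> carrier A \<times> carrier B" using x(1) by (simp add: monoid_alg_simps)
    have "\<Theta> (lin h x) = lin (\<lambda>(a, b). tL (\<alpha> a) * tR (\<beta> b)) x"
      unfolding lin_def alg_homD(8)[OF \<Theta>(1)]
      by (intro sum.cong refl) (use k in \<open>auto simp: h_def alg_homD[OF \<Theta>(1)] \<Theta>(2,3)\<close>)
    then have "lin (\<lambda>(a, b). tL (\<alpha> a) * tR (\<beta> b)) x = (0 :: ('a, 'b) form_end)"
      unfolding x(2) alg_homD(5)[OF \<Theta>(1)] by (rule sym)
    then have "Rep_form_end (lin (\<lambda>(a, b). tL (\<alpha> a) * tR (\<beta> b)) x) F 1 1 = 0"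
      by (simp only: Rep_form_end_simps(1))
    then show "lin (\<lambda>(a, b). F (\<alpha> a) (\<beta> b)) x = 0" unfolding lin_tensor_eval[OF F] .
  qed
  have im: "\<delta> ` carrier (quot_alg ?M ?J) = lin h ` carrier ?M"
    unfolding quot_alg_simps(1)[OF M J] image_image by (intro image_cong refl \<delta>(2))
  have "inj_on \<delta> (carrier (quot_alg ?M ?J))"
  proof (rule inj_onI, unfold quot_alg_simps(1)[OF M J], clarify)
    fix x y assume xy: "x \<in> carrier ?M" "y \<in> carrier ?M" "\<delta> (?J +>\<^bsub>?M\<^esub> x) = \<delta> (?J +>\<^bsub>?M\<^esub> y)"
    have "lin h (x \<ominus>\<^bsub>?M\<^esub> y) = 0" using xy by (simp add: rhomD(7)[OF L M] \<delta>(2))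
    then show "?J +>\<^bsub>?M\<^esub> x = ?J +>\<^bsub>?M\<^esub> y"
      unfolding coset_eq_iff[OF M J xy(1,2)] using xy by (intro inj M.minus_closed)
  qed
  moreover have "\<gamma> ` carrier C = lin h ` carrier ?M"
  proof
    have S: "subalg (lin h ` carrier ?M)" by (rule rhom_subalg[OF M L])
    have "Poly_Mapping.single (a, b) 1 \<in> carrier ?M" if "a \<in> carrier A" "b \<in> carrier B" for a b
      using that by (simp add: monoid_alg_simps)
    then have "h (a, b) \<in> lin h ` carrier ?M" if "a \<in> carrier A" "b \<in> carrier B" for a b
      using that by (intro image_eqI[of _ _ "Poly_Mapping.single (a, b) 1"]) simp_all
    from this[OF _ B.one_closed] this[OF A.one_closed] show "\<gamma> ` carrier C \<subseteq> lin h ` carrier ?M"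
      unfolding gen[OF S] by (auto simp: h_def ha hb p q)
    have T: "subalg (\<gamma> ` carrier C)" by (rule rhom_subalg[OF C \<gamma>(1)])
    note t = subalgD[OF T]
    have "\<phi> ` \<alpha> ` carrier A \<subseteq> \<gamma> ` carrier C" "\<psi> ` \<beta> ` carrier B \<subseteq> \<gamma> ` carrier C" using gen[OF T] by blast+
    then have "h z \<in> \<gamma> ` carrier C" if "z \<in> carrier A \<times> carrier B" for z
      using that by (auto simp: h_def intro!: t(4) simp del: image_iff)
    then show "lin h ` carrier ?M \<subseteq> \<gamma> ` carrier C"
      unfolding lin_def by (auto simp: monoid_alg_simps simp del: image_iff intro!: t(8) t(5))
  qed
  ultimately show ?thesis
    unfolding tensor_alg_def Let_def by (intro alg_isoI[OF C Q \<gamma> \<delta>(1)]) (simp_all only: im)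
qed

section \<open>The subalgebras and their generating matrices\<close>

lemma calg_rec_subring:
  assumes A: "calg_rec A" and K: "subring K A" "\<And>c x. x \<in> K \<Longrightarrow> c \<odot>\<^bsub>A\<^esub> x \<in> K"
  shows "calg_rec (A\<lparr>carrier := K\<rparr>)"
proof -
  interpret ring A by (rule calg_recD(1)[OF A])
  have "K \<subseteq> carrier A" by (rule subringE(1)[OF K(1)])
  then show ?thesis
    using subring_is_ring[OF K(1)] K(2) A unfolding calg_rec_def by (simp add: subset_iff)
qed

context alg_type
begin

lemma abs_inj_on: "S \<subseteq> carrier A \<Longrightarrow> inj_on abs S"
  by (rule inj_onI) (simp add: subset_iff abs_inj)

lemma subring_vimage:
  assumes S: "subalg S"
  shows "subring {x \<in> carrier A. abs x \<in> S} A" "x \<in> carrier A \<Longrightarrow> abs x \<in> S \<Longrightarrow> abs (c \<odot>\<^bsub>A\<^esub> x) \<in> S"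
proof -
  interpret ring A by (rule calg_recD(1)[OF A])
  note s = subalgD[OF S]
  show "subring {x \<in> carrier A. abs x \<in> S} A"
    by (rule subringI) (auto simp: hom(1-7) s)
  show "x \<in> carrier A \<Longrightarrow> abs x \<in> S \<Longrightarrow> abs (c \<odot>\<^bsub>A\<^esub> x) \<in> S"
    by (simp add: hom s)
qed

lemma generated_subalg:
  assumes G: "G \<subseteq> carrier A"
  shows "calg_rec (generated_subalg A G)" "rhom (generated_subalg A G) abs"
    "inj_on abs (carrier (generated_subalg A G))" "abs ` carrier (generated_subalg A G) = gsub (abs ` G)"
proof -
  interpret ring A by (rule calg_recD(1)[OF A])
  define \<K> where "\<K> = {S. subring S A \<and> (\<forall>c. \<forall>x\<in>S. c \<odot>\<^bsub>A\<^esub> x \<in> S) \<and> G \<subseteq> S}"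
  define K where "K = \<Inter>\<K>"
  have eq: "generated_subalg A G = A\<lparr>carrier := K\<rparr>" by (simp add: generated_subalg_def K_def \<K>_def)
  have "carrier A \<in> \<K>"
    using G calg_recD(2)[OF A] carrier_is_subring by (simp add: \<K>_def)
  then have Kc: "K \<subseteq> carrier A" unfolding K_def by blast
  have "subring K A"
  proof (rule subringI[OF Kc])
    show "\<one>\<^bsub>A\<^esub> \<in> K" unfolding K_def \<K>_def using subringE(3) by blast
    fix x y assume xy: "x \<in> K" "y \<in> K"
    show "x \<otimes>\<^bsub>A\<^esub> y \<in> K" "x \<oplus>\<^bsub>A\<^esub> y \<in> K"
      using xy subringE(6,7)[of _ A x y] unfolding K_def \<K>_def by blast+
  next
    fix x assume "x \<in> K"
    then show "\<ominus>\<^bsub>A\<^esub> x \<in> K" using subringE(5)[of _ A x] unfolding K_def \<K>_def by blast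
  qed
  moreover have Ks: "c \<odot>\<^bsub>A\<^esub> x \<in> K" if "x \<in> K" for c x
    using that unfolding K_def \<K>_def by blast
  ultimately show rec: "calg_rec (generated_subalg A G)" unfolding eq by (rule calg_rec_subring[OF A])
  show r: "rhom (generated_subalg A G) abs"
    using abs_hom Kc unfolding eq rhom_def by (simp add: subset_iff)
  show "inj_on abs (carrier (generated_subalg A G))" unfolding eq by (rule abs_inj_on) (simp add: Kc)
  show "abs ` carrier (generated_subalg A G) = gsub (abs ` G)"
  proof
    have S: "subalg (gsub (abs ` G))" by (rule subalg_gsub)
    have "{x \<in> carrier A. abs x \<in> gsub (abs ` G)} \<in> \<K>"
      using subring_vimage[OF S] G gsub_incl[of "abs ` G"] calg_recD(2)[OF A] by (auto simp: \<K>_def)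
    then have "K \<subseteq> {x \<in> carrier A. abs x \<in> gsub (abs ` G)}" unfolding K_def by (rule Inter_lower)
    then show "abs ` carrier (generated_subalg A G) \<subseteq> gsub (abs ` G)" unfolding eq by auto
    have "G \<subseteq> K" unfolding K_def \<K>_def by blast
    then show "gsub (abs ` G) \<subseteq> abs ` carrier (generated_subalg A G)"
      by (intro gsub_min rhom_subalg[OF rec r]) (auto simp: eq)
  qed
qed

text \<open>The inverse in a record is a definite description, so besides exhibiting N as a
  two-sided inverse one has to show uniqueness. Matrices are compared entry by entry through
  \<open>abs\<close>, which is injective on the carrier.\<close>

lemma mat_inv_eq:
  assumes I: "finite I" and X: "X \<in> carrier (mat_ser A I)"
    and r: "\<And>i j. i \<in> I \<Longrightarrow> j \<in> I \<Longrightarrow> (\<Sum>l\<in>I. fser abs (X (i, l)) * N l j) = (if i = j then 1 else 0)"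
    and l: "\<And>i j. i \<in> I \<Longrightarrow> j \<in> I \<Longrightarrow> (\<Sum>l\<in>I. N i l * fser abs (X (l, j))) = (if i = j then 1 else 0)"
    and ij: "i \<in> I" "j \<in> I"
  shows "(inv\<^bsub>mat_ser A I\<^esub> X) (i, j) n \<in> carrier A" "fser abs ((inv\<^bsub>mat_ser A I\<^esub> X) (i, j)) = N i j"
proof -
  interpret ring A by (rule calg_recD(1)[OF A])
  let ?M = "mat_ser A I"
  define Y where "Y = (\<lambda>(i, j)\<in>I \<times> I. \<lambda>n. rep (N i j $ n))"
  have Ye: "Y (i, j) n \<in> carrier A" "fser abs (Y (i, j)) = N i j" if "i \<in> I" "j \<in> I" for i j n
    using that by (simp_all add: Y_def fps_eq_iff)
  have Yc: "Y \<in> carrier ?M" by (auto simp: mat_ser_def Y_def)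
  have entry: "F (i, j) n \<in> carrier A" if "F \<in> carrier ?M" "i \<in> I" "j \<in> I" for F i j n
  proof -
    have "F (i, j) \<in> UNIV \<rightarrow> carrier A" using that unfolding mat_ser_def by (auto dest: PiE_mem)
    then show ?thesis by blast
  qed
  have ext: "F = G" if F: "F \<in> carrier ?M" and G: "G \<in> carrier ?M"
      and e: "\<And>i j. i \<in> I \<Longrightarrow> j \<in> I \<Longrightarrow> fser abs (F (i, j)) = fser abs (G (i, j))" for F G
  proof (rule PiE_ext)
    show "F \<in> I \<times> I \<rightarrow>\<^sub>E (UNIV \<rightarrow> carrier A)" "G \<in> I \<times> I \<rightarrow>\<^sub>E (UNIV \<rightarrow> carrier A)"
      using F G by (simp_all add: mat_ser_def)
    fix p assume "p \<in> I \<times> I"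
    then obtain i j where p: "p = (i, j)" "i \<in> I" "j \<in> I" by blast
    have "F (i, j) n = G (i, j) n" for n
      using arg_cong[OF e[OF p(2,3)], of "\<lambda>s. s $ n"] abs_inj[OF entry[OF F p(2,3)] entry[OF G p(2,3)]] by simp
    then show "F p = G p" unfolding p by blast
  qed
  have prod: "F \<otimes>\<^bsub>?M\<^esub> G \<in> carrier ?M"
    "i \<in> I \<Longrightarrow> j \<in> I \<Longrightarrow> fser abs ((F \<otimes>\<^bsub>?M\<^esub> G) (i, j)) = (\<Sum>l\<in>I. fser abs (F (i, l)) * fser abs (G (l, j)))"
    if F: "F \<in> carrier ?M" and G: "G \<in> carrier ?M" for F G i j
  proof -
    have m: "(F \<otimes>\<^bsub>?M\<^esub> G) (i, j) n \<in> carrier A" if "i \<in> I" "j \<in> I" for i j n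
      by (rule mat_mult_rhom(1)[OF A abs_hom that]) (use that in \<open>simp_all add: entry F G\<close>)
    have "F \<otimes>\<^bsub>?M\<^esub> G \<in> extensional (I \<times> I)" by (simp add: mat_ser_def)
    with m have "F \<otimes>\<^bsub>?M\<^esub> G \<in> I \<times> I \<rightarrow>\<^sub>E (UNIV \<rightarrow> carrier A)" by (auto simp: PiE_iff)
    then show "F \<otimes>\<^bsub>?M\<^esub> G \<in> carrier ?M" by (simp add: mat_ser_def)
    show "fser abs ((F \<otimes>\<^bsub>?M\<^esub> G) (i, j)) = (\<Sum>l\<in>I. fser abs (F (i, l)) * fser abs (G (l, j)))" if "i \<in> I" "j \<in> I"
      by (rule mat_mult_rhom(2)[OF A abs_hom that]) (use that in \<open>simp_all add: entry F G\<close>)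
  qed
  have one: "\<one>\<^bsub>?M\<^esub> \<in> carrier ?M" "i \<in> I \<Longrightarrow> j \<in> I \<Longrightarrow> fser abs (\<one>\<^bsub>?M\<^esub> (i, j)) = (if i = j then 1 else 0)" for i j
    by (auto simp: mat_ser_def ser_one_def fps_eq_iff hom(1,2))
  have XY: "X \<otimes>\<^bsub>?M\<^esub> Y = \<one>\<^bsub>?M\<^esub>"
    by (rule ext[OF prod(1)[OF X Yc] one(1)]) (simp add: prod(2)[OF X Yc] one(2) Ye r)
  have YX: "Y \<otimes>\<^bsub>?M\<^esub> X = \<one>\<^bsub>?M\<^esub>"
    by (rule ext[OF prod(1)[OF Yc X] one(1)]) (simp add: prod(2)[OF Yc X] one(2) Ye l)
  have "inv\<^bsub>?M\<^esub> X = Y"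
    unfolding m_inv_def
  proof (rule the_equality)
    show "Y \<in> carrier ?M \<and> X \<otimes>\<^bsub>?M\<^esub> Y = \<one>\<^bsub>?M\<^esub> \<and> Y \<otimes>\<^bsub>?M\<^esub> X = \<one>\<^bsub>?M\<^esub>" using Yc XY YX by blast
    fix Z assume Z: "Z \<in> carrier ?M \<and> X \<otimes>\<^bsub>?M\<^esub> Z = \<one>\<^bsub>?M\<^esub> \<and> Z \<otimes>\<^bsub>?M\<^esub> X = \<one>\<^bsub>?M\<^esub>"
    then have Zc: "Z \<in> carrier ?M" by blast
    show "Z = Y"
    proof (rule ext[OF Zc Yc])
      fix i j assume ij: "i \<in> I" "j \<in> I"
      let ?Z = "\<lambda>i j. fser abs (Z (i, j))" and ?X = "\<lambda>i j. fser abs (X (i, j))"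
      have xz: "(\<Sum>l\<in>I. ?X i l * ?Z l j) = (if i = j then 1 else 0)" if "i \<in> I" "j \<in> I" for i j
        using prod(2)[OF X Zc that] Z one(2)[OF that] by simp
      have "?Z i j = (\<Sum>k\<in>I. (if i = k then 1 else 0) * ?Z k j)"
        using I ij by (simp add: if_distrib[where f = "\<lambda>x. x * _"] sum.delta cong: if_cong)
      also have "\<dots> = (\<Sum>k\<in>I. (\<Sum>l\<in>I. N i l * ?X l k) * ?Z k j)"
        by (intro sum.cong refl) (simp only: l[OF ij(1)])
      also have "\<dots> = (\<Sum>l\<in>I. N i l * (\<Sum>k\<in>I. ?X l k * ?Z k j))"
        unfolding sum_distrib_left sum_distrib_right by (subst sum.swap) (simp only: mult.assoc)
      also have "\<dots> = (\<Sum>l\<in>I. N i l * (if l = j then 1 else 0))"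
        by (intro sum.cong refl) (simp only: xz[OF _ ij(2)])
      also have "\<dots> = N i j"
        using I ij by (simp add: if_distrib[where f = "\<lambda>x. _ * x"] sum.delta cong: if_cong)
      finally show "fser abs (Z (i, j)) = fser abs (Y (i, j))" by (simp add: Ye ij)
    qed
  qed
  then show "(inv\<^bsub>?M\<^esub> X) (i, j) n \<in> carrier A" "fser abs ((inv\<^bsub>?M\<^esub> X) (i, j)) = N i j"
    using Ye ij by simp_all
qed

lemma twisted_generator:
  assumes I: "finite I" and T: "\<And>i j n. i \<in> I \<Longrightarrow> j \<in> I \<Longrightarrow> T (i, j) n \<in> carrier A"
    and r: "\<And>i j. i \<in> I \<Longrightarrow> j \<in> I \<Longrightarrow> (\<Sum>l\<in>I. fneg (fser abs (T (i, l))) * N l j) = (if i = j then 1 else 0)"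
    and l: "\<And>i j. i \<in> I \<Longrightarrow> j \<in> I \<Longrightarrow> (\<Sum>l\<in>I. N i l * fneg (fser abs (T (l, j)))) = (if i = j then 1 else 0)"
    and ij: "i \<in> I" "j \<in> I"
  defines "M \<equiv> T \<otimes>\<^bsub>mat_ser A I\<^esub> (inv\<^bsub>mat_ser A I\<^esub> (mat_neg A I T))"
  shows "M (i, j) n \<in> carrier A" "fser abs (M (i, j)) = (\<Sum>l\<in>I. fser abs (T (i, l)) * N l j)"
proof -
  note s = fser_simps[OF A abs_hom, where F = "T (i, j)" for i j]
  have Xe: "fser abs (mat_neg A I T (i, j)) = fneg (fser abs (T (i, j)))" if "i \<in> I" "j \<in> I" for i j
    using that by (simp add: mat_neg_def s(3)[OF T])
  have Xc: "mat_neg A I T \<in> carrier (mat_ser A I)"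
    by (auto simp: mat_ser_def mat_neg_def s(7)[OF T])
  have X: "(\<Sum>l\<in>I. fser abs (mat_neg A I T (i, l)) * N l j) = (if i = j then 1 else 0)"
    "(\<Sum>l\<in>I. N i l * fser abs (mat_neg A I T (l, j))) = (if i = j then 1 else 0)" if "i \<in> I" "j \<in> I" for i j
    using r[OF that] l[OF that] that by (simp_all add: Xe)
  note inv = mat_inv_eq[OF I Xc X]
  show "M (i, j) n \<in> carrier A" unfolding M_def
    by (rule mat_mult_rhom(1)[OF A abs_hom ij]) (simp_all add: T inv ij)
  have "fser abs (M (i, j)) = (\<Sum>l\<in>I. fser abs (T (i, l)) * fser abs ((inv\<^bsub>mat_ser A I\<^esub> (mat_neg A I T)) (l, j)))"
    unfolding M_def by (rule mat_mult_rhom(2)[OF A abs_hom ij]) (simp_all add: T inv ij)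
  then show "fser abs (M (i, j)) = (\<Sum>l\<in>I. fser abs (T (i, l)) * N l j)" by (simp add: inv ij)
qed

lemma twisted_mat_entry:
  assumes T: "\<And>i j n. i \<in> I4 \<Longrightarrow> j \<in> I4 \<Longrightarrow> T (i, j) n \<in> carrier A" and ij: "i \<in> I4" "j \<in> I4"
  shows "twisted_mat A T (i, j) n \<in> carrier A"
    "fser abs (twisted_mat A T (i, j)) = twm4 (\<lambda>i j. fser abs (T (i, j))) i j"
proof -
  let ?F = "mat_shift A I4 (- 1 / 2) T" and ?G = "mat_transp I4 (mat_neg A I4 (mat_shift A I4 (1 / 2) T))"
  note s = fser_simps[OF A abs_hom]
  have F: "?F (i, j) n \<in> carrier A" "fser abs (?F (i, j)) = fshift (- 1 / 2) (fser abs (T (i, j)))"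
    if "i \<in> I4" "j \<in> I4" for i j n
    using that s(2,6)[where F = "T (i, j)", OF T[OF that]] by (simp_all add: mat_shift_def)
  have G: "?G (i, j) n \<in> carrier A" "fser abs (?G (i, j)) = fneg (fshift (1 / 2) (fser abs (T (- j, - i))))"
    if ij: "i \<in> I4" "j \<in> I4" for i j n
  proof -
    have m: "- j \<in> I4" "- i \<in> I4" using ij by simp_all
    have e: "?G (i, j) = ser_neg A (ser_shift A (1 / 2) (T (- j, - i)))"
      using ij m by (simp add: mat_transp_def mat_neg_def mat_shift_def)
    note sh = s(2,6)[where F = "T (- j, - i)", OF T[OF m]]
    show "?G (i, j) n \<in> carrier A" unfolding e by (rule s(7)) (rule sh)
    show "fser abs (?G (i, j)) = fneg (fshift (1 / 2) (fser abs (T (- j, - i))))"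
      unfolding e sh(1)[symmetric] by (rule s(3)) (rule sh(2))
  qed
  show "twisted_mat A T (i, j) n \<in> carrier A" unfolding twisted_mat_def
    by (rule mat_mult_rhom(1)[where I = I4 and F = ?F and G = ?G, OF A abs_hom ij F(1)[OF ij(1)] G(1)[OF _ ij(2)]])
  have "fser abs (twisted_mat A T (i, j)) = (\<Sum>p\<in>I4. fser abs (?F (i, p)) * fser abs (?G (p, j)))"
    unfolding twisted_mat_def
    by (rule mat_mult_rhom(2)[where I = I4 and F = ?F and G = ?G, OF A abs_hom ij F(1)[OF ij(1)] G(1)[OF _ ij(2)]])
  also have "\<dots> = twm4 (\<lambda>i j. fser abs (T (i, j))) i j"
    unfolding twm4_def by (intro sum.cong refl) (simp only: F(2)[OF ij(1)] G(2)[OF _ ij(2)])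
  finally show "fser abs (twisted_mat A T (i, j)) = twm4 (\<lambda>i j. fser abs (T (i, j))) i j" .
qed

lemma coeffs:
  assumes "\<And>i j n. i \<in> I \<Longrightarrow> j \<in> I \<Longrightarrow> M (i, j) n \<in> carrier A"
    and "\<And>i j. i \<in> I \<Longrightarrow> j \<in> I \<Longrightarrow> fser abs (M (i, j)) = N i j"
  shows "mat_coeffs I M \<subseteq> carrier A" "abs ` mat_coeffs I M = coeffs_of I N"
proof -
  show "mat_coeffs I M \<subseteq> carrier A" using assms(1) by (auto simp: mat_coeffs_def)
  have "abs (M (i, j) n) = N i j $ n" if "i \<in> I" "j \<in> I" for i j n
    using arg_cong[OF assms(2)[OF that], of "\<lambda>s. s $ n"] by simp
  then show "abs ` mat_coeffs I M = coeffs_of I N"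
    unfolding mat_coeffs_def coeffs_of_def by (auto simp: image_iff) metis+
qed

end

lemma finite_I2: "finite I2" and finite_I4: "finite I4"
  by (simp_all add: I2_def I4_def)

lemma ST2_carrier: "i \<in> I2 \<Longrightarrow> j \<in> I2 \<Longrightarrow> ST2 (i, j) r \<in> carrier SY2"
  using T2_carrier by (auto simp: ST2_def mat_image_def SY2_eq quot_alg_simps(1)[OF calg_rec_Y2 SY2_quotient(1)])

text \<open>The inverse of T(-u) in SY(2) is T^t(1 - u), so the generating matrix is the matrix
  s.\<close>

lemma SB20:
  "calg_rec SB20" "rhom SB20 Abs_sy2" "inj_on Abs_sy2 (carrier SB20)"
  "Abs_sy2 ` carrier SB20 = gsub (coeffs_of I2 sS)"
proof -
  define M where "M = ST2 \<otimes>\<^bsub>mat_ser SY2 I2\<^esub> (inv\<^bsub>mat_ser SY2 I2\<^esub> (mat_neg SY2 I2 ST2))"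
  let ?N = "\<lambda>i j. rho (tr_mat e2 Tsy2 i j)"
  have t: "M (i, j) n \<in> carrier SY2" "fser Abs_sy2 (M (i, j)) = sS i j" if ij: "i \<in> I2" "j \<in> I2" for i j n
    unfolding M_def twm_def Tsy2_def[of i]
    by (rule sy2.twisted_generator[where I = I2 and T = ST2 and N = ?N, OF finite_I2 ST2_carrier _ _ ij];
      simp only: Tsy2_def[symmetric] twm_props(3,4)[OF Tsy2])+
  have c: "mat_coeffs I2 (M) \<subseteq> carrier SY2" "Abs_sy2 ` mat_coeffs I2 (M) = coeffs_of I2 (sS)"
    by (rule sy2.coeffs(1), rule t(1), assumption, assumption, rule t(2), assumption, assumption) (rule sy2.coeffs(2), rule t(1), assumption, assumption, rule t(2), assumption, assumption)
  note g = sy2.generated_subalg[OF c(1), folded SB20_def[folded M_def]]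
  show "calg_rec SB20" "rhom SB20 Abs_sy2" "inj_on Abs_sy2 (carrier SB20)"
    "Abs_sy2 ` carrier SB20 = gsub (coeffs_of I2 sS)"
    by (fact g(1) g(2) g(3) g(4)[unfolded c(2)])+
qed

text \<open>Writing T as d times the image of the matrix of SY(2), the inverse of T(-u) is d(-u)^-1
  times the image of T^t(1 - u). As d is central, the generating matrix is d(u)/d(-u) times the
  image of s.\<close>

lemma B20:
  "calg_rec B20" "rhom B20 Abs_y2" "inj_on Abs_y2 (carrier B20)"
  "Abs_y2 ` carrier B20 = gsub (coeffs_of I2 bB)"
proof -
  define M where "M = T2 \<otimes>\<^bsub>mat_ser Y2 I2\<^esub> (inv\<^bsub>mat_ser Y2 I2\<^esub> (mat_neg Y2 I2 T2))"
  let ?R = "\<lambda>i j. rho (tr_mat e2 Tsy2 i j)"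
  let ?D = "finv (fneg d2)"
  let ?N = "\<lambda>i j. ?D * fmap jj (?R i j)"
  note J = alg_homD[OF fmap_hom[OF jj(1)]]
  have D: "?D \<in> serin center"
    by (rule serin_finv[OF subalg_center serin_fneg[OF subalg_center d2_center]])
  note Dc = center_commute[OF D] and dc = center_commute[OF serin_fneg[OF subalg_center d2_center]]
  have d: "fneg d2 * ?D = 1" "?D * fneg d2 = 1" by (simp_all add: finv_right finv_left)
  have nT: "fneg (Ty2 i l) = fneg d2 * fmap jj (fneg (Tsy2 i l))" if "i \<in> I2" "l \<in> I2" for i l
    by (simp add: Ty2_eq[OF that] alg_homD(2)[OF fneg_hom] fmap_fneg[OF jj(1)])
  have r: "(\<Sum>l\<in>I2. fneg (Ty2 i l) * ?N l j) = (if i = j then 1 else 0)" if ij: "i \<in> I2" "j \<in> I2" for i j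
  proof -
    have "fneg (Ty2 i l) * ?N l j = fmap jj (fneg (Tsy2 i l) * ?R l j)" if l: "l \<in> I2" for l
    proof -
      have "fneg (Ty2 i l) * ?N l j = fneg d2 * (fmap jj (fneg (Tsy2 i l)) * ?D) * fmap jj (?R l j)"
        unfolding nT[OF ij(1) l] by (simp only: mult.assoc)
      also have "\<dots> = fneg d2 * ?D * (fmap jj (fneg (Tsy2 i l)) * fmap jj (?R l j))"
        unfolding Dc[of "fmap jj (fneg (Tsy2 i l))", symmetric] by (simp only: mult.assoc)
      finally show ?thesis unfolding d by (simp only: J(2) mult_1_left)
    qed
    then have "(\<Sum>l\<in>I2. fneg (Ty2 i l) * ?N l j) = fmap jj (\<Sum>l\<in>I2. fneg (Tsy2 i l) * ?R l j)"
      unfolding J(8) by (intro sum.cong refl)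
    then show ?thesis unfolding twm_props(4)[OF Tsy2 ij] by (simp add: J(3,5))
  qed
  have l: "(\<Sum>l\<in>I2. ?N i l * fneg (Ty2 l j)) = (if i = j then 1 else 0)" if ij: "i \<in> I2" "j \<in> I2" for i j
  proof -
    have "?N i l * fneg (Ty2 l j) = fmap jj (?R i l * fneg (Tsy2 l j))" if l: "l \<in> I2" for l
    proof -
      have "?N i l * fneg (Ty2 l j) = ?D * (fmap jj (?R i l) * fneg d2) * fmap jj (fneg (Tsy2 l j))"
        unfolding nT[OF l ij(2)] by (simp only: mult.assoc)
      also have "\<dots> = ?D * fneg d2 * (fmap jj (?R i l) * fmap jj (fneg (Tsy2 l j)))"
        unfolding dc[of "fmap jj (?R i l)", symmetric] by (simp only: mult.assoc)
      finally show ?thesis unfolding d by (simp only: J(2) mult_1_left)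
    qed
    then have "(\<Sum>l\<in>I2. ?N i l * fneg (Ty2 l j)) = fmap jj (\<Sum>l\<in>I2. ?R i l * fneg (Tsy2 l j))"
      unfolding J(8) by (intro sum.cong refl)
    then show ?thesis unfolding twm_props(3)[OF Tsy2 ij] by (simp add: J(3,5))
  qed
  have b: "(\<Sum>l\<in>I2. Ty2 i l * ?N l j) = bB i j" if ij: "i \<in> I2" "j \<in> I2" for i j
  proof -
    have "Ty2 i l * ?N l j = v2 * fmap jj (Tsy2 i l * ?R l j)" if l: "l \<in> I2" for l
    proof -
      have "Ty2 i l * ?N l j = d2 * (fmap jj (Tsy2 i l) * ?D) * fmap jj (?R l j)"
        unfolding Ty2_eq[OF ij(1) l] by (simp only: mult.assoc)
      also have "\<dots> = d2 * ?D * (fmap jj (Tsy2 i l) * fmap jj (?R l j))"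
        unfolding Dc[of "fmap jj (Tsy2 i l)", symmetric] by (simp only: mult.assoc)
      finally show ?thesis by (simp only: J(2) v2_def)
    qed
    then show ?thesis unfolding twm_def J(8) sum_distrib_left by (intro sum.cong refl)
  qed
  have t: "M (i, j) n \<in> carrier Y2" "fser Abs_y2 (M (i, j)) = bB i j" if ij: "i \<in> I2" "j \<in> I2" for i j n
    unfolding M_def b[OF ij, symmetric] Ty2_def[of i]
    by (rule y2.twisted_generator[where I = I2 and T = T2 and N = ?N, OF finite_I2 T2_carrier _ _ ij];
      simp only: Ty2_def[symmetric] r l)+
  have c: "mat_coeffs I2 (M) \<subseteq> carrier Y2" "Abs_y2 ` mat_coeffs I2 (M) = coeffs_of I2 (bB)"
    by (rule y2.coeffs(1), rule t(1), assumption, assumption, rule t(2), assumption, assumption) (rule y2.coeffs(2), rule t(1), assumption, assumption, rule t(2), assumption, assumption)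
  note g = y2.generated_subalg[OF c(1), folded B20_def[folded M_def]]
  show "calg_rec B20" "rhom B20 Abs_y2" "inj_on Abs_y2 (carrier B20)"
    "Abs_y2 ` carrier B20 = gsub (coeffs_of I2 bB)"
    by (fact g(1) g(2) g(3) g(4)[unfolded c(2)])+
qed

lemma twm4_cong: "(\<And>i j. i \<in> I4 \<Longrightarrow> j \<in> I4 \<Longrightarrow> A i j = B i j) \<Longrightarrow> i \<in> I4 \<Longrightarrow> j \<in> I4 \<Longrightarrow> twm4 A i j = twm4 B i j"
  unfolding twm4_def by (intro sum.cong refl) (metis I4_simps(5))

lemma X4_tw:
  "calg_rec X4_tw" "rhom X4_tw Abs_x4" "inj_on Abs_x4 (carrier X4_tw)"
  "Abs_x4 ` carrier X4_tw = gsub (coeffs_of I4 (twm4 Tx4))"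
proof -
  have t: "twisted_mat X4 T4 (i, j) n \<in> carrier X4" "fser Abs_x4 (twisted_mat X4 T4 (i, j)) = twm4 Tx4 i j"
    if ij: "i \<in> I4" "j \<in> I4" for i j n
    using x4.twisted_mat_entry[of T4, OF T4_carrier ij] twm4_cong[OF Tx4_def ij] by simp_all
  have c: "mat_coeffs I4 (twisted_mat X4 T4) \<subseteq> carrier X4" "Abs_x4 ` mat_coeffs I4 (twisted_mat X4 T4) = coeffs_of I4 (twm4 Tx4)"
    by (rule x4.coeffs(1), rule t(1), assumption, assumption, rule t(2), assumption, assumption) (rule x4.coeffs(2), rule t(1), assumption, assumption, rule t(2), assumption, assumption)
  note g = x4.generated_subalg[OF c(1), folded X4_tw_def]
  show "calg_rec X4_tw" "rhom X4_tw Abs_x4" "inj_on Abs_x4 (carrier X4_tw)"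
    "Abs_x4 ` carrier X4_tw = gsub (coeffs_of I4 (twm4 Tx4))"
    by (fact g(1) g(2) g(3) g(4)[unfolded c(2)])+
qed

lemma Y4_tw:
  "calg_rec Y4_tw" "rhom Y4_tw Abs_y4" "inj_on Abs_y4 (carrier Y4_tw)"
  "Abs_y4 ` carrier Y4_tw = gsub (coeffs_of I4 (twm4 Ty4))"
proof -
  have t: "twisted_mat Y4 ST4 (i, j) n \<in> carrier Y4" "fser Abs_y4 (twisted_mat Y4 ST4 (i, j)) = twm4 Ty4 i j"
    if ij: "i \<in> I4" "j \<in> I4" for i j n
    using y4.twisted_mat_entry[of ST4, OF ST4_carrier ij] twm4_cong[OF Ty4_fser ij] by simp_all
  have c: "mat_coeffs I4 (twisted_mat Y4 ST4) \<subseteq> carrier Y4" "Abs_y4 ` mat_coeffs I4 (twisted_mat Y4 ST4) = coeffs_of I4 (twm4 Ty4)"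
    by (rule y4.coeffs(1), rule t(1), assumption, assumption, rule t(2), assumption, assumption) (rule y4.coeffs(2), rule t(1), assumption, assumption, rule t(2), assumption, assumption)
  note g = y4.generated_subalg[OF c(1), folded Y4_tw_def]
  show "calg_rec Y4_tw" "rhom Y4_tw Abs_y4" "inj_on Abs_y4 (carrier Y4_tw)"
    "Abs_y4 ` carrier Y4_tw = gsub (coeffs_of I4 (twm4 Ty4))"
    by (fact g(1) g(2) g(3) g(4)[unfolded c(2)])+
qed

lemma kk_iL_xi_commute: "kk (iL a) * xi b = xi b * kk (iL a)"
proof -
  have e: "xi (Ty2 i j $ n) * kk (iL a) = kk (iL a) * xi (Ty2 i j $ n)" if ij: "i \<in> I2" "j \<in> I2" for i j n
  proof -
    have "kk (iL x) * kk (iR y) = kk (iR y) * kk (iL x)" for x y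
      using arg_cong[OF iL_iR_commute, of kk x y] by (simp only: alg_homD(2)[OF kk(1)])
    then have "cm (fmap (\<lambda>x. kk (iL x)) (fps_const a)) (fmap xi (Ty2 i j))"
      unfolding xi(2)[OF ij] fmap_fmap by (rule cm_arith(1)[OF center_cm(2)[OF d4(4)] cm_fmap_commute])
    then have "fmap (\<lambda>x. kk (iL x)) (fps_const a) $ 0 * fmap xi (Ty2 i j) $ n =
      fmap xi (Ty2 i j) $ n * fmap (\<lambda>x. kk (iL x)) (fps_const a) $ 0" unfolding cm_def by blast
    then show ?thesis by simp
  qed
  have "b \<in> xi -` {x. \<forall>y\<in>{kk (iL a)}. x * y = y * x}"
    by (rule y2_generated[OF subalg_vimage[OF xi(1) subalg_centralizer]]) (use e in blast)
  then show ?thesis by simp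
qed

theorem corollary4p15:
  shows "X4_tw \<cong>\<^sub>a\<^sub>l\<^sub>g SB20 \<otimes>\<^sub>a\<^sub>l\<^sub>g B20 \<and>
         X4_tw \<cong>\<^sub>a\<^sub>l\<^sub>g B20 \<otimes>\<^sub>a\<^sub>l\<^sub>g SB20 \<and>
         Y4_tw \<cong>\<^sub>a\<^sub>l\<^sub>g SB20 \<otimes>\<^sub>a\<^sub>l\<^sub>g SB20"
proof (intro conjI)
  note kL = alg_hom_comp[OF kk(1) iL(1)]
  have B: "Abs_y2 b \<in> gsub (coeffs_of I2 bB)" if "b \<in> carrier B20" for b
    using that B20(4) by blast
  obtain \<Theta> :: "x4 \<Rightarrow> (sy2, y2) form_end" where \<Theta>: "alg_hom \<Theta>" "\<And>a. \<Theta> (kk (iL a)) = tL a"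
    "\<And>b. b \<in> gsub (coeffs_of I2 bB) \<Longrightarrow> \<Theta> (xi b) = tR b"
    using x4_separation[OF tL_hom tR_hom tL_tR_commute] by blast
  show "X4_tw \<cong>\<^sub>a\<^sub>l\<^sub>g SB20 \<otimes>\<^sub>a\<^sub>l\<^sub>g B20"
  proof (rule tensor_iso[OF SB20(1) B20(1) X4_tw(1) SB20(2,3) B20(2,3) X4_tw(2,3) kL xi(1) kk_iL_xi_commute _ \<Theta>(1)])
    fix S :: "x4 set" assume "subalg S"
    then show "Abs_x4 ` carrier X4_tw \<subseteq> S \<longleftrightarrow> (\<lambda>x. kk (iL x)) ` Abs_sy2 ` carrier SB20 \<subseteq> S \<and> xi ` Abs_y2 ` carrier B20 \<subseteq> S"
      unfolding X4_tw(4) SB20(4) B20(4) by (rule x4_twisted_generated)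
  qed (simp_all add: \<Theta>(2,3) B)
  \<comment> \<open>For the reversed order of the factors the two translations exchange their roles;
    the maps into X(so_4) stay the same.\<close>
  obtain \<Theta>' :: "x4 \<Rightarrow> (y2, sy2) form_end" where \<Theta>': "alg_hom \<Theta>'" "\<And>a. \<Theta>' (kk (iL a)) = tR a"
    "\<And>b. b \<in> gsub (coeffs_of I2 bB) \<Longrightarrow> \<Theta>' (xi b) = tL b"
    using x4_separation[OF tR_hom tL_hom tL_tR_commute[symmetric]] by blast
  show "X4_tw \<cong>\<^sub>a\<^sub>l\<^sub>g B20 \<otimes>\<^sub>a\<^sub>l\<^sub>g SB20"
  proof (rule tensor_iso[OF B20(1) SB20(1) X4_tw(1) B20(2,3) SB20(2,3) X4_tw(2,3) xi(1) kL kk_iL_xi_commute[symmetric] _ \<Theta>'(1)])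
    fix S :: "x4 set" assume "subalg S"
    from x4_twisted_generated[OF this]
    show "Abs_x4 ` carrier X4_tw \<subseteq> S \<longleftrightarrow> xi ` Abs_y2 ` carrier B20 \<subseteq> S \<and> (\<lambda>x. kk (iL x)) ` Abs_sy2 ` carrier SB20 \<subseteq> S"
      unfolding X4_tw(4) SB20(4) B20(4) by (simp only: conj_commute)
  qed (simp_all add: \<Theta>'(2,3) B)
  obtain \<Phi> :: "y4 \<Rightarrow> (sy2, sy2) form_end" where \<Phi>: "alg_hom \<Phi>" "\<And>a. \<Phi> (iL a) = tL a" "\<And>b. \<Phi> (iR b) = tR b"
    using y4_separation[OF tL_hom tR_hom tL_tR_commute] by blast
  show "Y4_tw \<cong>\<^sub>a\<^sub>l\<^sub>g SB20 \<otimes>\<^sub>a\<^sub>l\<^sub>g SB20"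
  proof (rule tensor_iso[OF SB20(1) SB20(1) Y4_tw(1) SB20(2,3) SB20(2,3) Y4_tw(2,3) iL(1) iR(1) iL_iR_commute _ \<Phi>(1)])
    fix S :: "y4 set" assume "subalg S"
    then show "Abs_y4 ` carrier Y4_tw \<subseteq> S \<longleftrightarrow> iL ` Abs_sy2 ` carrier SB20 \<subseteq> S \<and> iR ` Abs_sy2 ` carrier SB20 \<subseteq> S"
      unfolding Y4_tw(4) SB20(4) by (rule y4_twisted_generated)
  qed (simp_all add: \<Phi>(2,3))
qed

end
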